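(* Let $X$ be a monoid scheme. There is a monomorphism of abelian groups $s\mathsf{Cl}(X)\to\mathsf{Pic}(X)$, which is an isomorphism if $X$ is $s$-cancellative.
   Context: All monoids are commutative, multiplicative, with unit (no zero element is required). An ideal of a monoid $M$ is a (possibly empty) subset $I$ with $IM\subset I$; it is prime if $M\setminus I$ is a submonoid (so $\emptyset$ is prime). $\mathrm{Spec}(M)$ is the set of prime ideals with basis of open sets $D(f)=\{\mathfrak p : f\notin\mathfrak p\}$, $f\in M$, and sheaf of monoids $\mathcal{O}_M$ with $\mathcal{O}_M(D(f))=M_f$ (the localization inverting $f$). A monoid scheme is a topological space $X$ with a sheaf of monoids $\mathcal{O}_X$ that is locally isomorphic to some $(\mathrm{Spec}(M),\mathcal{O}_M)$. The points of $X$ are partially ordered by $x\le y$ iff $\overline{\{y\}}\subset\overline{\{x\}}$; open sets are downward closed, and for $x\le y$ there is an induced localization map of stalks $\mathcal{O}_{X,y}\to\mathcal{O}_{X,x}$. An element $a$ of a monoid $M$ is $s$-regular if for all $u,v\in M$ and $m\in\mathbb N$ with $a^mu=a^mv$ there is $n\in\mathbb{N}=\{0,1,2,\dots\}$ with $u(uv)^n=v(uv)^n$. The set ${\sf S}(M)$ of $s$-regular elements is a submonoid of $M$, and localization maps send $s$-regular elements to $s$-regular elements. Hence $x\mapsto(\mathcal{O}_{X,x})_{{\sf S}(\mathcal{O}_{X,x})}$ is a contravariant functor on the poset $X$, and $s\mathcal{M}_X$ (the sheaf of semi-meromorphic functions) is the associated sheaf, $s\mathcal{M}_X(U)=\lim_{x\in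 U}(\mathcal{O}_{X,x})_{{\sf S}(\mathcal{O}_{X,x})}$. $\mathcal{O}_X^*$ and $s\mathcal{M}_X^*$ are the sheaves of invertible elements; the natural map $\mathcal{O}_X^*\to s\mathcal{M}_X^*$ is injective, so there is a short exact sequence $1\to\mathcal{O}_X^*\to s\mathcal{M}_X^*\to s\mathcal{M}_X^*/\mathcal{O}_X^*\to 1$ of sheaves of abelian groups, and the monomorphism of the claim comes from its long exact cohomology sequence. $s$-divisors are the global sections of $s\mathcal{M}_X^*/\mathcal{O}_X^*$; the principal ones are the images of elements of $s\mathcal{M}_X^*(X)$; $s\mathsf{Cl}(X)$ is the quotient of the group of $s$-divisors by the principal ones. $\mathsf{Pic}(X)=H^1(X,\mathcal{O}_X^* )$ is the group (under tensor product) of isomorphism classes of line bundles (sheaves of $\mathcal{O}_X$-sets locally isomorphic to $\mathcal{O}_X$). $X$ is $s$-cancellative if for any $x\le y$ in $X$ the induced map $\mathcal{O}_{X,y}^*\to\mathcal{O}_{X,x}^*$ is injective. *)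

theory Defs
  imports "HOL-Analysis.Function_Topology" "HOL-Algebra.Coset"
begin

section \<open>Presheaves on a topological space\<close>

text \<open>
  A presheaf carries its base space.  Only the values of \<open>sect\<close> and \<open>restr\<close> at open subsets of the
  base space, and of \<open>restr F U V\<close> on \<open>sect F U\<close> for \<open>V \<subseteq> U\<close>, are meaningful.
\<close>

record ('p, 's) presheaf =
  pspace :: "'p topology"
  sect :: "'p set \<Rightarrow> 's set"
  restr :: "'p set \<Rightarrow> 'p set \<Rightarrow> 's \<Rightarrow> 's"

definition is_presheaf :: "('p, 's, 'z) presheaf_scheme \<Rightarrow> bool" where
  "is_presheaf F \<longleftrightarrow>
     (\<forall>U V. openin (pspace F) U \<and> openin (pspace F) V \<and> V \<subseteq> U
        \<longrightarrow> restr F U V \<in> sect F U \<rightarrow> sect F V) \<and>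
     (\<forall>U. openin (pspace F) U \<longrightarrow> (\<forall>s\<in>sect F U. restr F U U s = s)) \<and>
     (\<forall>U V W. openin (pspace F) U \<and> openin (pspace F) V \<and> openin (pspace F) W \<and> W \<subseteq> V \<and> V \<subseteq> U
        \<longrightarrow> (\<forall>s\<in>sect F U. restr F V W (restr F U V s) = restr F U W s))"

definition is_sheaf :: "('p, 's, 'z) presheaf_scheme \<Rightarrow> bool" where
  "is_sheaf F \<longleftrightarrow> is_presheaf F \<and>
     (\<forall>\<U> \<sigma>. (\<forall>U\<in>\<U>. openin (pspace F) U \<and> \<sigma> U \<in> sect F U) \<and>
            (\<forall>U\<in>\<U>. \<forall>V\<in>\<U>. restr F U (U \<inter> V) (\<sigma> U) = restr F V (U \<inter> V) (\<sigma> V))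
        \<longrightarrow> (\<exists>!s. s \<in> sect F (\<Union>\<U>) \<and> (\<forall>U\<in>\<U>. restr F (\<Union>\<U>) U s = \<sigma> U)))"

definition restrict_to :: "('p, 's, 'z) presheaf_scheme \<Rightarrow> 'p set \<Rightarrow> ('p, 's, 'z) presheaf_scheme" where
  "restrict_to F U = F\<lparr>pspace := subtopology (pspace F) U\<rparr>"

text \<open>The elements of the stalk at \<open>x\<close> are equivalence classes of pairs of an open neighbourhood
  of \<open>x\<close> and a section over it.\<close>

type_synonym ('p, 's) germ = "('p set \<times> 's) set"

definition germ_rel ::
    "('p, 's, 'z) presheaf_scheme \<Rightarrow> 'p \<Rightarrow> (('p set \<times> 's) \<times> ('p set \<times> 's)) set" where
  "germ_rel F x = {((U, s), (V, t)) | U s V t.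
     openin (pspace F) U \<and> x \<in> U \<and> s \<in> sect F U \<and>
     openin (pspace F) V \<and> x \<in> V \<and> t \<in> sect F V \<and>
     (\<exists>W. openin (pspace F) W \<and> x \<in> W \<and> W \<subseteq> U \<inter> V \<and> restr F U W s = restr F V W t)}"

definition germ :: "('p, 's, 'z) presheaf_scheme \<Rightarrow> 'p \<Rightarrow> 'p set \<Rightarrow> 's \<Rightarrow> ('p, 's) germ" where
  "germ F x U s = germ_rel F x `` {(U, s)}"

definition stalk_set :: "('p, 's, 'z) presheaf_scheme \<Rightarrow> 'p \<Rightarrow> ('p, 's) germ set" where
  "stalk_set F x = {germ F x U s | U s. openin (pspace F) U \<and> x \<in> U \<and> s \<in> sect F U}"

text \<open>Sections of the sheaf associated with a presheaf: families of germs that are locally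
  induced by sections of the presheaf.\<close>

definition sheafify_sect :: "('p, 's, 'z) presheaf_scheme \<Rightarrow> 'p set \<Rightarrow> ('p \<Rightarrow> ('p, 's) germ) set" where
  "sheafify_sect F U = {s \<in> (\<Pi>\<^sub>E x\<in>U. stalk_set F x).
     \<forall>x\<in>U. \<exists>V t. openin (pspace F) V \<and> x \<in> V \<and> V \<subseteq> U \<and> t \<in> sect F V \<and>
       (\<forall>y\<in>V. s y = germ F y V t)}"


section \<open>Presheaves of monoids\<close>

record ('p, 's) monoid_presheaf = "('p, 's) presheaf" +
  mul :: "'p set \<Rightarrow> 's \<Rightarrow> 's \<Rightarrow> 's"
  neutral :: "'p set \<Rightarrow> 's"

definition secmon :: "('p, 's, 'z) monoid_presheaf_scheme \<Rightarrow> 'p set \<Rightarrow> 's monoid" where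
  "secmon F U = \<lparr>carrier = sect F U, monoid.mult = mul F U, one = neutral F U\<rparr>"

definition is_sheaf_of_monoids :: "('p, 's, 'z) monoid_presheaf_scheme \<Rightarrow> bool" where
  "is_sheaf_of_monoids F \<longleftrightarrow> is_sheaf F \<and>
     (\<forall>U. openin (pspace F) U \<longrightarrow> comm_monoid (secmon F U)) \<and>
     (\<forall>U V. openin (pspace F) U \<and> openin (pspace F) V \<and> V \<subseteq> U
        \<longrightarrow> restr F U V \<in> hom (secmon F U) (secmon F V) \<and> restr F U V (neutral F U) = neutral F V)"

definition stalk :: "('p, 's, 'z) monoid_presheaf_scheme \<Rightarrow> 'p \<Rightarrow> ('p, 's) germ monoid" where
  "stalk F x = \<lparr>
     carrier = stalk_set F x,
     monoid.mult = (\<lambda>A B. \<Union>(U, s)\<in>A. \<Union>(V, t)\<in>B.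
       germ F x (U \<inter> V) (mul F (U \<inter> V) (restr F U (U \<inter> V) s) (restr F V (U \<inter> V) t))),
     one = germ F x (topspace (pspace F)) (neutral F (topspace (pspace F)))\<rparr>"

definition sheafify ::
    "('p, 's, 'z) monoid_presheaf_scheme \<Rightarrow> ('p, 'p \<Rightarrow> ('p, 's) germ) monoid_presheaf" where
  "sheafify F = \<lparr>
     pspace = pspace F,
     sect = sheafify_sect F,
     restr = (\<lambda>U V s. restrict s V),
     mul = (\<lambda>U s t. \<lambda>x\<in>U. s x \<otimes>\<^bsub>stalk F x\<^esub> t x),
     neutral = (\<lambda>U. \<lambda>x\<in>U. \<one>\<^bsub>stalk F x\<^esub>)\<rparr>"

definition units_presheaf ::
    "('p, 's, 'z) monoid_presheaf_scheme \<Rightarrow> ('p, 's, 'z) monoid_presheaf_scheme" where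
  "units_presheaf F = F\<lparr>sect := (\<lambda>U. Units (secmon F U))\<rparr>"

text \<open>The presheaf quotient of a presheaf of abelian groups by the subgroups \<open>H U\<close>; its sections
  over \<open>U\<close> are the cosets of \<open>H U\<close>.\<close>

definition quotient_presheaf ::
    "('p, 's, 'z) monoid_presheaf_scheme \<Rightarrow> ('p set \<Rightarrow> 's set) \<Rightarrow> ('p, 's set) monoid_presheaf" where
  "quotient_presheaf F H = \<lparr>
     pspace = pspace F,
     sect = (\<lambda>U. carrier (secmon F U Mod H U)),
     restr = (\<lambda>U V C. \<Union>f\<in>C. H V #>\<^bsub>secmon F V\<^esub> restr F U V f),
     mul = (\<lambda>U. monoid.mult (secmon F U Mod H U)),
     neutral = (\<lambda>U. one (secmon F U Mod H U))\<rparr>"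

definition monoidal_space_iso ::
    "('p, 's, 'y) monoid_presheaf_scheme \<Rightarrow> ('q, 't, 'z) monoid_presheaf_scheme \<Rightarrow> bool" where
  "monoidal_space_iso F G \<longleftrightarrow> (\<exists>h \<phi>. homeomorphic_map (pspace F) (pspace G) h \<and>
     (let pre = (\<lambda>V. {x \<in> topspace (pspace F). h x \<in> V}) in
       (\<forall>V. openin (pspace G) V \<longrightarrow> \<phi> V \<in> iso (secmon G V) (secmon F (pre V))) \<and>
       (\<forall>V W. openin (pspace G) V \<and> openin (pspace G) W \<and> W \<subseteq> V \<longrightarrow>
          (\<forall>s\<in>sect G V. \<phi> W (restr G V W s) = restr F (pre V) (pre W) (\<phi> V s)))))"


section \<open>Localization and s-regular elements\<close>

definition loc_rel :: "'a monoid \<Rightarrow> 'a set \<Rightarrow> (('a \<times> 'a) \<times> ('a \<times> 'a)) set" where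
  "loc_rel M S = {((a, s), (b, t)) | a s b t.
     a \<in> carrier M \<and> s \<in> S \<and> b \<in> carrier M \<and> t \<in> S \<and>
     (\<exists>u\<in>S. u \<otimes>\<^bsub>M\<^esub> (t \<otimes>\<^bsub>M\<^esub> a) = u \<otimes>\<^bsub>M\<^esub> (s \<otimes>\<^bsub>M\<^esub> b))}"

definition fraction :: "'a monoid \<Rightarrow> 'a set \<Rightarrow> 'a \<Rightarrow> 'a \<Rightarrow> ('a \<times> 'a) set" where
  "fraction M S a s = loc_rel M S `` {(a, s)}"

definition localization :: "'a monoid \<Rightarrow> 'a set \<Rightarrow> ('a \<times> 'a) set monoid" where
  "localization M S = \<lparr>
     carrier = {fraction M S a s | a s. a \<in> carrier M \<and> s \<in> S},
     monoid.mult = (\<lambda>A B. \<Union>(a, s)\<in>A. \<Union>(b, t)\<in>B. fraction M S (a \<otimes>\<^bsub>M\<^esub> b) (s \<otimes>\<^bsub>M\<^esub> t)),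
     one = fraction M S \<one>\<^bsub>M\<^esub> \<one>\<^bsub>M\<^esub>\<rparr>"

definition s_regular :: "'a monoid \<Rightarrow> 'a \<Rightarrow> bool" where
  "s_regular M a \<longleftrightarrow> a \<in> carrier M \<and>
     (\<forall>u\<in>carrier M. \<forall>v\<in>carrier M. \<forall>m::nat.
        a [^]\<^bsub>M\<^esub> m \<otimes>\<^bsub>M\<^esub> u = a [^]\<^bsub>M\<^esub> m \<otimes>\<^bsub>M\<^esub> v \<longrightarrow>
        (\<exists>n::nat. u \<otimes>\<^bsub>M\<^esub> (u \<otimes>\<^bsub>M\<^esub> v) [^]\<^bsub>M\<^esub> n = v \<otimes>\<^bsub>M\<^esub> (u \<otimes>\<^bsub>M\<^esub> v) [^]\<^bsub>M\<^esub> n))"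

definition sreg :: "'a monoid \<Rightarrow> 'a set" where
  "sreg M = {a. s_regular M a}"


section \<open>Monoid schemes\<close>

definition prime_monoid_ideal :: "'a monoid \<Rightarrow> 'a set \<Rightarrow> bool" where
  "prime_monoid_ideal M I \<longleftrightarrow> I \<subseteq> carrier M \<and>
     (\<forall>i\<in>I. \<forall>m\<in>carrier M. i \<otimes>\<^bsub>M\<^esub> m \<in> I) \<and> submonoid (carrier M - I) M"

definition basic_open :: "'a monoid \<Rightarrow> 'a \<Rightarrow> 'a set set" where
  "basic_open M f = {P. prime_monoid_ideal M P \<and> f \<notin> P}"

definition spec_topology :: "'a monoid \<Rightarrow> 'a set topology" where
  "spec_topology M = topology_generated_by (basic_open M ` carrier M)"

text \<open>A section of the structure sheaf over an arbitrary open set is a family of elements of the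
  localizations at the points that is locally given by a single fraction.  Since \<open>D(f)\<close> has a
  greatest point, the sections over \<open>D(f)\<close> are \<open>M\<^sub>f\<close>.\<close>

definition Spec :: "'a monoid \<Rightarrow> ('a set, 'a set \<Rightarrow> ('a \<times> 'a) set) monoid_presheaf" where
  "Spec M = \<lparr>
     pspace = spec_topology M,
     sect = (\<lambda>U. {\<sigma> \<in> (\<Pi>\<^sub>E P\<in>U. carrier (localization M (carrier M - P))).
        \<forall>P\<in>U. \<exists>V a b. openin (spec_topology M) V \<and> P \<in> V \<and> V \<subseteq> U \<and> a \<in> carrier M \<and> b \<in> carrier M \<and>
          (\<forall>Q\<in>V. b \<notin> Q \<and> \<sigma> Q = fraction M (carrier M - Q) a b)}),
     restr = (\<lambda>U V \<sigma>. restrict \<sigma> V),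
     mul = (\<lambda>U \<sigma> \<tau>. \<lambda>P\<in>U. \<sigma> P \<otimes>\<^bsub>localization M (carrier M - P)\<^esub> \<tau> P),
     neutral = (\<lambda>U. \<lambda>P\<in>U. \<one>\<^bsub>localization M (carrier M - P)\<^esub>)\<rparr>"

text \<open>A monoid scheme \<open>X\<close> is represented by its structure sheaf, which carries the space.  Asking
  for \<open>M\<close> of the type of sections of \<open>X\<close> is no restriction: if \<open>U\<close> is isomorphic to \<open>Spec M\<close>,
  then \<open>M\<close> is isomorphic to the monoid of sections over \<open>U\<close>.\<close>

definition is_monoid_scheme :: "('p, 'a) monoid_presheaf \<Rightarrow> bool" where
  "is_monoid_scheme X \<longleftrightarrow> is_sheaf_of_monoids X \<and>
     (\<forall>x\<in>topspace (pspace X). \<exists>U. openin (pspace X) U \<and> x \<in> U \<and>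
        (\<exists>M::'a monoid. comm_monoid M \<and> monoidal_space_iso (restrict_to X U) (Spec M)))"

definition point_le :: "('p, 'a) monoid_presheaf \<Rightarrow> 'p \<Rightarrow> 'p \<Rightarrow> bool" where
  "point_le X x y \<longleftrightarrow> x \<in> topspace (pspace X) \<and> y \<in> topspace (pspace X) \<and>
     pspace X closure_of {y} \<subseteq> pspace X closure_of {x}"

text \<open>The localization map from the stalk at a point to the stalk at a smaller point \<open>x\<close>.\<close>

definition stalk_map :: "('p, 'a) monoid_presheaf \<Rightarrow> 'p \<Rightarrow> ('p, 'a) germ \<Rightarrow> ('p, 'a) germ" where
  "stalk_map X x A = (\<Union>(U, s)\<in>A. germ X x U s)"

definition s_cancellative :: "('p, 'a) monoid_presheaf \<Rightarrow> bool" where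
  "s_cancellative X \<longleftrightarrow> (\<forall>x y. point_le X x y \<longrightarrow> inj_on (stalk_map X x) (Units (stalk X y)))"


section \<open>Semi-meromorphic functions and s-divisors\<close>

type_synonym ('p, 'a) sfrac = "(('p, 'a) germ \<times> ('p, 'a) germ) set"

definition sfrac_stalk :: "('p, 'a) monoid_presheaf \<Rightarrow> 'p \<Rightarrow> ('p, 'a) sfrac monoid" where
  "sfrac_stalk X x = localization (stalk X x) (sreg (stalk X x))"

definition sfrac_map :: "('p, 'a) monoid_presheaf \<Rightarrow> 'p \<Rightarrow> ('p, 'a) sfrac \<Rightarrow> ('p, 'a) sfrac" where
  "sfrac_map X x A =
     (\<Union>(a, s)\<in>A. fraction (stalk X x) (sreg (stalk X x)) (stalk_map X x a) (stalk_map X x s))"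

definition sMero :: "('p, 'a) monoid_presheaf \<Rightarrow> ('p, 'p \<Rightarrow> ('p, 'a) sfrac) monoid_presheaf" where
  "sMero X = \<lparr>
     pspace = pspace X,
     sect = (\<lambda>U. {f \<in> (\<Pi>\<^sub>E x\<in>U. carrier (sfrac_stalk X x)).
        \<forall>x\<in>U. \<forall>y\<in>U. point_le X x y \<longrightarrow> sfrac_map X x (f y) = f x}),
     restr = (\<lambda>U V f. restrict f V),
     mul = (\<lambda>U f g. \<lambda>x\<in>U. f x \<otimes>\<^bsub>sfrac_stalk X x\<^esub> g x),
     neutral = (\<lambda>U. \<lambda>x\<in>U. \<one>\<^bsub>sfrac_stalk X x\<^esub>)\<rparr>"

definition to_sMero :: "('p, 'a) monoid_presheaf \<Rightarrow> 'p set \<Rightarrow> 'a \<Rightarrow> ('p \<Rightarrow> ('p, 'a) sfrac)" where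
  "to_sMero X U a = (\<lambda>x\<in>U. fraction (stalk X x) (sreg (stalk X x)) (germ X x U a) \<one>\<^bsub>stalk X x\<^esub>)"

abbreviation sMero_units :: "('p, 'a) monoid_presheaf \<Rightarrow> ('p, 'p \<Rightarrow> ('p, 'a) sfrac) monoid_presheaf" where
  "sMero_units X \<equiv> units_presheaf (sMero X)"

definition unit_image :: "('p, 'a) monoid_presheaf \<Rightarrow> 'p set \<Rightarrow> ('p \<Rightarrow> ('p, 'a) sfrac) set" where
  "unit_image X U = to_sMero X U ` Units (secmon X U)"

definition pre_sDiv :: "('p, 'a) monoid_presheaf \<Rightarrow> ('p, ('p \<Rightarrow> ('p, 'a) sfrac) set) monoid_presheaf" where
  "pre_sDiv X = quotient_presheaf (sMero_units X) (unit_image X)"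

type_synonym ('p, 'a) sdivisor = "'p \<Rightarrow> ('p, ('p \<Rightarrow> ('p, 'a) sfrac) set) germ"

definition sDiv :: "('p, 'a) monoid_presheaf \<Rightarrow> ('p, 'a) sdivisor monoid" where
  "sDiv X = secmon (sheafify (pre_sDiv X)) (topspace (pspace X))"

text \<open>The map from invertible semi-meromorphic functions to sections of the quotient sheaf.\<close>

definition div_of :: "('p, 'a) monoid_presheaf \<Rightarrow> 'p set \<Rightarrow> ('p \<Rightarrow> ('p, 'a) sfrac) \<Rightarrow> ('p, 'a) sdivisor" where
  "div_of X U f = (\<lambda>x\<in>U. germ (pre_sDiv X) x U (unit_image X U #>\<^bsub>secmon (sMero_units X) U\<^esub> f))"

definition principal_sDiv :: "('p, 'a) monoid_presheaf \<Rightarrow> ('p, 'a) sdivisor set" where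
  "principal_sDiv X =
     div_of X (topspace (pspace X)) ` sect (sMero_units X) (topspace (pspace X))"

definition sCl :: "('p, 'a) monoid_presheaf \<Rightarrow> ('p, 'a) sdivisor set monoid" where
  "sCl X = sDiv X Mod principal_sDiv X"


section \<open>Line bundles and the Picard group\<close>

record ('p, 'a, 'l) oset_presheaf = "('p, 'l) presheaf" +
  act :: "'p set \<Rightarrow> 'a \<Rightarrow> 'l \<Rightarrow> 'l"

definition is_oset_sheaf :: "('p, 'a) monoid_presheaf \<Rightarrow> ('p, 'a, 'l) oset_presheaf \<Rightarrow> bool" where
  "is_oset_sheaf X L \<longleftrightarrow> pspace L = pspace X \<and> is_sheaf L \<and>
     (\<forall>U. openin (pspace X) U \<longrightarrow>
        (\<forall>a\<in>sect X U. \<forall>s\<in>sect L U. act L U a s \<in> sect L U) \<and>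
        (\<forall>s\<in>sect L U. act L U (neutral X U) s = s) \<and>
        (\<forall>a\<in>sect X U. \<forall>b\<in>sect X U. \<forall>s\<in>sect L U.
           act L U (mul X U a b) s = act L U a (act L U b s))) \<and>
     (\<forall>U V. openin (pspace X) U \<and> openin (pspace X) V \<and> V \<subseteq> U \<longrightarrow>
        (\<forall>a\<in>sect X U. \<forall>s\<in>sect L U.
           restr L U V (act L U a s) = act L V (restr X U V a) (restr L U V s)))"

definition oset_iso ::
    "('p, 'a) monoid_presheaf \<Rightarrow> ('p, 'a, 'l) oset_presheaf \<Rightarrow> ('p, 'a, 'k) oset_presheaf \<Rightarrow> bool" where
  "oset_iso X L L' \<longleftrightarrow> (\<exists>\<phi>.
     (\<forall>U. openin (pspace X) U \<longrightarrow> bij_betw (\<phi> U) (sect L U) (sect L' U) \<and>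
        (\<forall>a\<in>sect X U. \<forall>s\<in>sect L U. \<phi> U (act L U a s) = act L' U a (\<phi> U s))) \<and>
     (\<forall>U V. openin (pspace X) U \<and> openin (pspace X) V \<and> V \<subseteq> U \<longrightarrow>
        (\<forall>s\<in>sect L U. \<phi> V (restr L U V s) = restr L' U V (\<phi> U s))))"

definition structure_oset :: "('p, 'a) monoid_presheaf \<Rightarrow> ('p, 'a, 'a) oset_presheaf" where
  "structure_oset X = \<lparr>pspace = pspace X, sect = sect X, restr = restr X, act = mul X\<rparr>"

definition line_bundle :: "('p, 'a) monoid_presheaf \<Rightarrow> ('p, 'a, 'l) oset_presheaf \<Rightarrow> bool" where
  "line_bundle X L \<longleftrightarrow> is_oset_sheaf X L \<and>
     (\<forall>x\<in>topspace (pspace X). \<exists>U. openin (pspace X) U \<and> x \<in> U \<and>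
        oset_iso (restrict_to X U) (restrict_to L U) (structure_oset (restrict_to X U)))"

text \<open>The presheaf tensor product: over \<open>U\<close>, pairs of sections modulo the equivalence relation
  generated by \<open>(a s, t) \<sim> (s, a t)\<close>.\<close>

definition tensor_rel ::
    "('p, 'a) monoid_presheaf \<Rightarrow> ('p, 'a, 'l) oset_presheaf \<Rightarrow> ('p, 'a, 'k) oset_presheaf
      \<Rightarrow> 'p set \<Rightarrow> (('l \<times> 'k) \<times> ('l \<times> 'k)) set" where
  "tensor_rel X L L' U =
     (let R = {((act L U a s, t), (s, act L' U a t)) | a s t.
                 a \<in> sect X U \<and> s \<in> sect L U \<and> t \<in> sect L' U}
      in (R \<union> R\<inverse>)\<^sup>*)"

definition pre_tensor ::
    "('p, 'a) monoid_presheaf \<Rightarrow> ('p, 'a, 'l) oset_presheaf \<Rightarrow> ('p, 'a, 'k) oset_presheaf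
      \<Rightarrow> ('p, 'a, ('l \<times> 'k) set) oset_presheaf" where
  "pre_tensor X L L' = \<lparr>
     pspace = pspace X,
     sect = (\<lambda>U. (sect L U \<times> sect L' U) // tensor_rel X L L' U),
     restr = (\<lambda>U V C. \<Union>(s, t)\<in>C. tensor_rel X L L' V `` {(restr L U V s, restr L' U V t)}),
     act = (\<lambda>U a C. \<Union>(s, t)\<in>C. tensor_rel X L L' U `` {(act L U a s, t)})\<rparr>"

definition sheafify_oset ::
    "('p, 'a) monoid_presheaf \<Rightarrow> ('p, 'a, 'l) oset_presheaf \<Rightarrow> ('p, 'a, 'p \<Rightarrow> ('p, 'l) germ) oset_presheaf" where
  "sheafify_oset X P = \<lparr>
     pspace = pspace X,
     sect = sheafify_sect P,
     restr = (\<lambda>U V s. restrict s V),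
     act = (\<lambda>U a s. \<lambda>x\<in>U. \<Union>(V, t)\<in>s x.
       germ P x (U \<inter> V) (act P (U \<inter> V) (restr X U (U \<inter> V) a) (restr P V (U \<inter> V) t)))\<rparr>"

definition tensor ::
    "('p, 'a) monoid_presheaf \<Rightarrow> ('p, 'a, 'l) oset_presheaf \<Rightarrow> ('p, 'a, 'k) oset_presheaf
      \<Rightarrow> ('p, 'a, 'p \<Rightarrow> ('p, ('l \<times> 'k) set) germ) oset_presheaf" where
  "tensor X L L' = sheafify_oset X (pre_tensor X L L')"

text \<open>Isomorphism classes are formed within line bundles whose sections over \<open>U\<close> are functions from
  points to germs of the structure sheaf.  Every line bundle, whatever the type of its
  sections, is isomorphic to one of these: a section is determined by its germs, and each stalk
  of a line bundle is in bijection with the stalk of the structure sheaf.\<close>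

type_synonym ('p, 'a) pic_bundle = "('p, 'a, 'p \<Rightarrow> ('p, 'a) germ) oset_presheaf"

definition bundle_class ::
    "('p, 'a) monoid_presheaf \<Rightarrow> ('p, 'a, 'l) oset_presheaf \<Rightarrow> ('p, 'a) pic_bundle set" where
  "bundle_class X L = {N. line_bundle X N \<and> oset_iso X L N}"

definition Pic :: "('p, 'a) monoid_presheaf \<Rightarrow> ('p, 'a) pic_bundle set monoid" where
  "Pic X = \<lparr>
     carrier = {bundle_class X L | L :: ('p, 'a) pic_bundle. line_bundle X L},
     monoid.mult = (\<lambda>A B. \<Union>L\<in>A. \<Union>L'\<in>B. bundle_class X (tensor X L L')),
     one = bundle_class X (structure_oset X)\<rparr>"


section \<open>The connecting homomorphism\<close>

text \<open>Sections of the sheaf of local generators of a line bundle \<open>L\<close>, the torsor under the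
  invertible functions that corresponds to \<open>L\<close>.\<close>

definition generators ::
    "('p, 'a) monoid_presheaf \<Rightarrow> ('p, 'a, 'l) oset_presheaf \<Rightarrow> 'p set \<Rightarrow> 'l set" where
  "generators X L U = {e \<in> sect L U. \<forall>V. openin (pspace X) V \<and> V \<subseteq> U \<longrightarrow>
     bij_betw (\<lambda>a. act L V a (restr L U V e)) (sect X V) (sect L V)}"

text \<open>The torsor of local lifts of an s-divisor \<open>D\<close> to invertible semi-meromorphic functions.\<close>

definition lifts ::
    "('p, 'a) monoid_presheaf \<Rightarrow> ('p, 'a) sdivisor \<Rightarrow> 'p set \<Rightarrow> ('p \<Rightarrow> ('p, 'a) sfrac) set" where
  "lifts X D U = {f \<in> sect (sMero_units X) U. div_of X U f = restrict D U}"

text \<open>\<open>L\<close> is the image of \<open>D\<close> under the connecting map if the torsor of lifts of \<open>D\<close> maps to the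
  torsor of generators of \<open>L\<close>, compatibly with restriction and multiplication by invertible
  functions.  In terms of cocycles: if \<open>D\<close> is represented by \<open>f\<^sub>i\<close> on an open cover, then \<open>L\<close>
  has generators \<open>e\<^sub>i\<close> with \<open>e\<^sub>i = (f\<^sub>i / f\<^sub>j) e\<^sub>j\<close>.\<close>

definition bundle_of_divisor ::
    "('p, 'a) monoid_presheaf \<Rightarrow> ('p, 'a) sdivisor \<Rightarrow> ('p, 'a, 'l) oset_presheaf \<Rightarrow> bool" where
  "bundle_of_divisor X D L \<longleftrightarrow> line_bundle X L \<and> (\<exists>\<epsilon>.
     (\<forall>U. openin (pspace X) U \<longrightarrow> \<epsilon> U \<in> lifts X D U \<rightarrow> generators X L U \<and>
        (\<forall>u\<in>Units (secmon X U). \<forall>f\<in>lifts X D U.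
           \<epsilon> U (mul (sMero X) U (to_sMero X U u) f) = act L U u (\<epsilon> U f))) \<and>
     (\<forall>U V. openin (pspace X) U \<and> openin (pspace X) V \<and> V \<subseteq> U \<longrightarrow>
        (\<forall>f\<in>lifts X D U. \<epsilon> V (restrict f V) = restr L U V (\<epsilon> U f))))"

definition sCl_to_Pic ::
    "('p, 'a) monoid_presheaf \<Rightarrow> ('p, 'a) sdivisor set \<Rightarrow> ('p, 'a) pic_bundle set" where
  "sCl_to_Pic X C = {L. \<exists>D\<in>C. bundle_of_divisor X D L}"

end

theory Submission
  imports Defs
begin

text \<open>
  Line bundles are handled through their torsors of generators.  A torsor under the invertible
  functions determines a line bundle, and two line bundles are isomorphic as soon as they have
  families of local generators with the same transition functions; the generators \<open>e \<otimes> f\<close> of a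
  tensor product multiply transition functions, which gives the group laws of the Picard group.
  The local lifts of an s-divisor \<open>D\<close> form a torsor, because a unit \<open>u\<close> with \<open>s u = s\<close> for an
  s-regular \<open>s\<close> equals \<open>1\<close>, and products of lifts are lifts of products, so that sending \<open>D\<close> to the
  line bundle of this torsor is a homomorphism.  If the bundle is trivial, the local lifts that
  correspond to the generator \<open>1\<close> glue to a global function with divisor \<open>D\<close>.

  The stalk maps of a monoid scheme are localizations and every point has a least generization
  \<open>\<eta>\<close>, whose stalk is a group.  Suppose that the scheme is s-cancellative.  If \<open>a^m u = a^m v\<close> in a
  stalk, then \<open>u\<close> and \<open>v\<close> agree at \<open>\<eta>\<close>, hence at the largest generization at which \<open>u v\<close> is invertible,
  hence after multiplication by a power of \<open>u v\<close>.  So every element is s-regular, semi-meromorphic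
  functions are determined by arbitrary values at the points \<open>\<eta>\<close>, and the ratio of the generators of
  a line bundle to a fixed generator at each \<open>\<eta>\<close> defines an s-divisor that induces the bundle.
\<close>

section \<open>Presheaves and sheaves of sets\<close>

text \<open>No cover is ever chosen. A torsor is used with all its sections over all open sets at
  once, so that restriction and transitivity replace refinements of covers and cocycle identities.
  The price is one of types: \<open>Pic\<close> is built from bundles whose sections are families of
  germs of \<open>X\<close>, whereas lifts of a divisor are families of fractions and sections of a
  tensor product are families of germs of classes of pairs. Choosing one base section of the torsor
  at each point, with no continuity in the point, turns torsor sections into families of invertible
  germs and brings every line bundle back to the required type. The same choice, read only at
  generic points, trivializes a line bundle there and is the source of surjectivity.

  The points \<eta> exist because the empty ideal is prime: it is the least point of every chart,
  and every element of the chart monoid is inverted there. Once all elements of a stalk are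
  s-regular, its s-fractions invert everything and so agree with those at \<eta>; a semi-meromorphic
  function can then be prescribed freely at the generic points, with no condition linking different
  ones.\<close>

locale set_presheaf =
  fixes F :: "('p, 's, 'z) presheaf_scheme"
  assumes is_presheaf: "is_presheaf F"
begin

lemma restr_closed [intro, simp]:
  "\<lbrakk>openin (pspace F) U; openin (pspace F) V; V \<subseteq> U; s \<in> sect F U\<rbrakk> \<Longrightarrow> restr F U V s \<in> sect F V"
  using is_presheaf by (auto simp: is_presheaf_def Pi_iff)

lemma restr_id [simp]:
  "\<lbrakk>openin (pspace F) U; s \<in> sect F U\<rbrakk> \<Longrightarrow> restr F U U s = s"
  using is_presheaf by (auto simp: is_presheaf_def)

lemma restr_restr [simp]:
  "\<lbrakk>openin (pspace F) U; openin (pspace F) V; openin (pspace F) W; W \<subseteq> V; V \<subseteq> U; s \<in> sect F U\<rbrakk>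
   \<Longrightarrow> restr F V W (restr F U V s) = restr F U W s"
  using is_presheaf by (auto simp: is_presheaf_def)

text \<open>Allows a neighbourhood that witnesses equality of germs to be shrunk, so that several
  witnesses can be compared on their intersection.\<close>

lemma restr_eq_mono:
  assumes "restr F U W s = restr F V W t" "openin (pspace F) U" "openin (pspace F) V"
    "openin (pspace F) W" "openin (pspace F) W'" "W' \<subseteq> W" "W \<subseteq> U" "W \<subseteq> V"
    "s \<in> sect F U" "t \<in> sect F V"
  shows "restr F U W' s = restr F V W' t"
proof -
  have "restr F U W' s = restr F W W' (restr F U W s)" using assms(2-) by simp
  also have "\<dots> = restr F V W' t" unfolding assms(1) using assms(2-) by simp
  finally show ?thesis .
qed

lemma germ_mem_iff:
  "(V, t) \<in> germ F x U s \<longleftrightarrow>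
     openin (pspace F) U \<and> x \<in> U \<and> s \<in> sect F U \<and>
     openin (pspace F) V \<and> x \<in> V \<and> t \<in> sect F V \<and>
     (\<exists>W. openin (pspace F) W \<and> x \<in> W \<and> W \<subseteq> U \<inter> V \<and> restr F U W s = restr F V W t)"
  by (auto simp: germ_def germ_rel_def)

lemma germ_rel_trans:
  assumes "(a, b) \<in> germ_rel F x" "(b, c) \<in> germ_rel F x"
  shows "(a, c) \<in> germ_rel F x"
proof -
  obtain U s V t W r where a: "a = (U, s)" and b: "b = (V, t)" and c: "c = (W, r)"
    by (metis surj_pair)
  from assms[unfolded a b c germ_rel_def] obtain A B where
    A: "openin (pspace F) A" "x \<in> A" "A \<subseteq> U \<inter> V" "restr F U A s = restr F V A t" and
    B: "openin (pspace F) B" "x \<in> B" "B \<subseteq> V \<inter> W" "restr F V B t = restr F W B r" and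
    o: "openin (pspace F) U" "s \<in> sect F U" "openin (pspace F) V" "t \<in> sect F V"
       "openin (pspace F) W" "r \<in> sect F W" "x \<in> U" "x \<in> W"
    by auto
  have AB: "openin (pspace F) (A \<inter> B)" using A(1) B(1) by blast
  have "restr F U (A \<inter> B) s = restr F V (A \<inter> B) t"
    by (rule restr_eq_mono[OF A(4)]) (use AB A o in auto)
  also have "\<dots> = restr F W (A \<inter> B) r"
    by (rule restr_eq_mono[OF B(4)]) (use AB B o in auto)
  finally have "restr F U (A \<inter> B) s = restr F W (A \<inter> B) r" .
  moreover have "x \<in> A \<inter> B" "A \<inter> B \<subseteq> U \<inter> W" using A B by auto
  ultimately have "\<exists>Z. openin (pspace F) Z \<and> x \<in> Z \<and> Z \<subseteq> U \<inter> W \<and> restr F U Z s = restr F W Z r"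
    using AB by blast
  thus ?thesis unfolding a c germ_rel_def using o by auto
qed

lemma germ_rel_sym: "(a, b) \<in> germ_rel F x \<Longrightarrow> (b, a) \<in> germ_rel F x"
  unfolding germ_rel_def by (auto simp: Int_commute) metis

lemma germ_eqI:
  assumes "openin (pspace F) U" "s \<in> sect F U" "openin (pspace F) V" "t \<in> sect F V"
    "openin (pspace F) W" "x \<in> W" "W \<subseteq> U" "W \<subseteq> V" "restr F U W s = restr F V W t"
  shows "germ F x U s = germ F x V t"
proof -
  have "((U, s), (V, t)) \<in> germ_rel F x"
    using assms by (auto simp: germ_rel_def)
  thus ?thesis
    unfolding germ_def using germ_rel_sym germ_rel_trans by blast
qed

lemma germ_self: "\<lbrakk>openin (pspace F) U; x \<in> U; s \<in> sect F U\<rbrakk> \<Longrightarrow> (U, s) \<in> germ F x U s"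
  by (auto simp: germ_mem_iff)

lemma germ_eqE:
  assumes "germ F x U s = germ F x V t" "openin (pspace F) U" "x \<in> U" "s \<in> sect F U"
  obtains W where "openin (pspace F) W" "x \<in> W" "W \<subseteq> U" "W \<subseteq> V" "restr F U W s = restr F V W t"
    "openin (pspace F) V" "x \<in> V" "t \<in> sect F V"
proof -
  have "(U, s) \<in> germ F x V t" using germ_self assms by blast
  then obtain W where "openin (pspace F) W" "x \<in> W" "W \<subseteq> V \<inter> U" "restr F V W t = restr F U W s"
    "openin (pspace F) V" "x \<in> V" "t \<in> sect F V"
    by (auto simp: germ_mem_iff)
  thus ?thesis using that[of W] by auto
qed

lemma germ_restr [simp]:
  assumes "openin (pspace F) U" "openin (pspace F) V" "V \<subseteq> U" "x \<in> V" "s \<in> sect F U"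
  shows "germ F x V (restr F U V s) = germ F x U s"
  by (rule germ_eqI[where W = V]) (use assms in auto)

lemma germ_in_stalk [intro, simp]:
  "\<lbrakk>openin (pspace F) U; x \<in> U; s \<in> sect F U\<rbrakk> \<Longrightarrow> germ F x U s \<in> stalk_set F x"
  by (auto simp: stalk_set_def)

lemma stalk_setE:
  assumes "A \<in> stalk_set F x"
  obtains U s where "openin (pspace F) U" "x \<in> U" "s \<in> sect F U" "A = germ F x U s"
  using assms by (auto simp: stalk_set_def)

text \<open>Representatives may be restricted, so a germ can be taken inside whatever neighbourhood
  the argument has already fixed.\<close>

lemma stalk_set_withinE:
  assumes "A \<in> stalk_set F x" "openin (pspace F) V" "x \<in> V"
  obtains U s where "openin (pspace F) U" "x \<in> U" "U \<subseteq> V" "s \<in> sect F U" "A = germ F x U s"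
proof -
  obtain U s where U: "openin (pspace F) U" "x \<in> U" "s \<in> sect F U" "A = germ F x U s"
    using assms(1) by (rule stalk_setE)
  show ?thesis
    by (rule that[of "U \<inter> V" "restr F U (U \<inter> V) s"])
       (use U assms in \<open>auto simp: openin_Int\<close>)
qed

end

locale set_sheaf = set_presheaf F for F :: "('p, 's, 'z) presheaf_scheme" +
  assumes is_sheaf: "is_sheaf F"
begin

lemma sheaf_glue:
  assumes "\<And>U. U \<in> \<U> \<Longrightarrow> openin (pspace F) U" "\<And>U. U \<in> \<U> \<Longrightarrow> \<sigma> U \<in> sect F U"
    "\<And>U V. \<lbrakk>U \<in> \<U>; V \<in> \<U>\<rbrakk> \<Longrightarrow> restr F U (U \<inter> V) (\<sigma> U) = restr F V (U \<inter> V) (\<sigma> V)"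
  shows "\<exists>!s. s \<in> sect F (\<Union>\<U>) \<and> (\<forall>U\<in>\<U>. restr F (\<Union>\<U>) U s = \<sigma> U)"
  using is_sheaf assms unfolding is_sheaf_def by (elim conjE allE[of _ \<U>] allE[of _ \<sigma>]) blast

text \<open>Gluing with the local data given by a predicate instead of a chosen family:
  \<open>P V s\<close> says that \<open>s\<close> is the correct section over \<open>V\<close>. It
  suffices that solutions exist near each point and agree on overlaps. Coordinates, units and germ
  families are all glued in this form.\<close>

lemma glue_rel:
  assumes U: "openin (pspace F) U"
    and ex: "\<And>x. x \<in> U \<Longrightarrow> \<exists>V s. openin (pspace F) V \<and> x \<in> V \<and> V \<subseteq> U \<and> s \<in> sect F V \<and> P V s"
    and uniq: "\<And>V V' s s'. \<lbrakk>openin (pspace F) V; openin (pspace F) V'; V \<subseteq> U; V' \<subseteq> U;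
        s \<in> sect F V; s' \<in> sect F V'; P V s; P V' s'\<rbrakk>
      \<Longrightarrow> restr F V (V \<inter> V') s = restr F V' (V \<inter> V') s'"
  shows "\<exists>!s. s \<in> sect F U \<and>
    (\<forall>V s'. openin (pspace F) V \<and> V \<subseteq> U \<and> s' \<in> sect F V \<and> P V s' \<longrightarrow> restr F U V s = s')"
proof -
  define \<U> where "\<U> = {V. openin (pspace F) V \<and> V \<subseteq> U \<and> (\<exists>s\<in>sect F V. P V s)}"
  define \<sigma> where "\<sigma> = (\<lambda>V. SOME s. s \<in> sect F V \<and> P V s)"
  have \<sigma>: "\<sigma> V \<in> sect F V \<and> P V (\<sigma> V)" if "V \<in> \<U>" for V
  proof -
    have "\<exists>s. s \<in> sect F V \<and> P V s" using that by (auto simp: \<U>_def)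
    thus ?thesis unfolding \<sigma>_def by (rule someI_ex)
  qed
  have UU: "\<Union>\<U> = U"
  proof
    show "\<Union>\<U> \<subseteq> U" by (auto simp: \<U>_def)
    show "U \<subseteq> \<Union>\<U>"
    proof
      fix x assume "x \<in> U"
      from ex[OF this] obtain V s where "openin (pspace F) V" "x \<in> V" "V \<subseteq> U" "s \<in> sect F V" "P V s"
        by (elim exE conjE)
      thus "x \<in> \<Union>\<U>" by (auto simp: \<U>_def)
    qed
  qed
  \<comment> \<open>With \<open>V' = V\<close> the hypothesis \<open>uniq\<close> says that
    \<open>P V\<close> has at most one solution, so the choice made by \<open>SOME\<close> is
    harmless.\<close>
  have \<sigma>_eq: "s = \<sigma> V" if "openin (pspace F) V" "V \<subseteq> U" "s \<in> sect F V" "P V s" for V s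
  proof -
    have "V \<in> \<U>" using that by (auto simp: \<U>_def)
    from uniq[of V V s "\<sigma> V"] that \<sigma>[OF this] show ?thesis by simp
  qed
  have "\<exists>!s. s \<in> sect F (\<Union>\<U>) \<and> (\<forall>V\<in>\<U>. restr F (\<Union>\<U>) V s = \<sigma> V)"
    by (rule sheaf_glue) (use \<sigma> uniq in \<open>auto simp: \<U>_def\<close>)
  moreover have "(\<forall>V\<in>\<U>. restr F (\<Union>\<U>) V s = \<sigma> V) \<longleftrightarrow>
      (\<forall>V s'. openin (pspace F) V \<and> V \<subseteq> U \<and> s' \<in> sect F V \<and> P V s' \<longrightarrow> restr F U V s = s')"
    (is "?L s = ?R s") for s
  proof
    assume l: "?L s"
    show "?R s"
    proof (intro allI impI, elim conjE)
      fix V s' assume V: "openin (pspace F) V" "V \<subseteq> U" "s' \<in> sect F V" "P V s'"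
      hence "V \<in> \<U>" by (auto simp: \<U>_def)
      with l UU show "restr F U V s = s'" using \<sigma>_eq[OF V] by simp
    qed
  next
    assume r: "?R s"
    show "?L s"
    proof
      fix V assume V: "V \<in> \<U>"
      hence "openin (pspace F) V" "V \<subseteq> U" by (auto simp: \<U>_def)
      with r \<sigma>[OF V] UU show "restr F (\<Union>\<U>) V s = \<sigma> V" by simp
    qed
  qed
  ultimately show ?thesis
    unfolding UU by simp
qed

lemma locally_eq:
  assumes "openin (pspace F) U" "s \<in> sect F U" "t \<in> sect F U"
    "\<And>x. x \<in> U \<Longrightarrow> \<exists>V. openin (pspace F) V \<and> x \<in> V \<and> V \<subseteq> U \<and> restr F U V s = restr F U V t"
  shows "s = t"
proof -
  let ?\<U> = "{V. openin (pspace F) V \<and> V \<subseteq> U \<and> restr F U V s = restr F U V t}"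
  have UU: "\<Union>?\<U> = U" using assms(4) by blast
  have "\<exists>!r. r \<in> sect F (\<Union>?\<U>) \<and> (\<forall>V\<in>?\<U>. restr F (\<Union>?\<U>) V r = restr F U V s)"
    by (rule sheaf_glue) (use assms in \<open>auto simp: openin_Int\<close>)
  thus ?thesis unfolding UU using assms(2,3) by auto
qed

lemma germs_eq:
  assumes "openin (pspace F) U" "s \<in> sect F U" "t \<in> sect F U"
    "\<And>x. x \<in> U \<Longrightarrow> germ F x U s = germ F x U t"
  shows "s = t"
proof (rule locally_eq[OF assms(1-3)])
  fix x assume x: "x \<in> U"
  from germ_eqE[OF assms(4)[OF x] assms(1) x assms(2)]
  show "\<exists>V. openin (pspace F) V \<and> x \<in> V \<and> V \<subseteq> U \<and> restr F U V s = restr F U V t"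
    by metis
qed

text \<open>The overlap condition is automatic: two local sections that induce the same germs are
  equal by \<open>germs_eq\<close>. This is how pointwise inverses and quotients of germs are turned
  into sections.\<close>

lemma glue_germs:
  assumes U: "openin (pspace F) U"
    and loc: "\<And>x. x \<in> U \<Longrightarrow> \<exists>V s. openin (pspace F) V \<and> x \<in> V \<and> V \<subseteq> U \<and> s \<in> sect F V \<and>
      (\<forall>y\<in>V. germ F y V s = \<sigma> y)"
  shows "\<exists>s\<in>sect F U. \<forall>y\<in>U. germ F y U s = \<sigma> y"
proof -
  let ?P = "\<lambda>V s. \<forall>y\<in>V. germ F y V s = \<sigma> y"
  have "\<exists>!s. s \<in> sect F U \<and>
    (\<forall>V s'. openin (pspace F) V \<and> V \<subseteq> U \<and> s' \<in> sect F V \<and> ?P V s' \<longrightarrow> restr F U V s = s')"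
  proof (rule glue_rel[OF U loc])
    fix V V' s s' assume *: "openin (pspace F) V" "openin (pspace F) V'" "V \<subseteq> U" "V' \<subseteq> U"
        "s \<in> sect F V" "s' \<in> sect F V'" "?P V s" "?P V' s'"
    show "restr F V (V \<inter> V') s = restr F V' (V \<inter> V') s'"
      by (rule germs_eq[of "V \<inter> V'"]) (use * in \<open>auto simp: openin_Int\<close>)
  qed
  from ex1_implies_ex[OF this] obtain s where s: "s \<in> sect F U" and s_eq:
    "\<forall>V s'. openin (pspace F) V \<and> V \<subseteq> U \<and> s' \<in> sect F V \<and> ?P V s' \<longrightarrow> restr F U V s = s'"
    by (elim exE conjE)
  have "germ F y U s = \<sigma> y" if y: "y \<in> U" for y
  proof -
    from loc[OF y] obtain V t
      where V: "openin (pspace F) V" "y \<in> V" "V \<subseteq> U" "t \<in> sect F V" "?P V t"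
      by (elim exE conjE)
    have "germ F y U s = germ F y V (restr F U V s)" using U V s by simp
    also have "\<dots> = \<sigma> y" using s_eq[rule_format, of V t] V by simp
    finally show ?thesis .
  qed
  with s show ?thesis by blast
qed

end

section \<open>Sheaves whose sections are functions on points\<close>

lemma set_sheafI: "is_sheaf F \<Longrightarrow> set_sheaf F"
  by (simp add: set_sheaf_def set_presheaf_def set_sheaf_axioms_def) (simp add: is_sheaf_def)

text \<open>For sections that are extensional functions, gluing as functions is free; the only real
  condition is that membership can be tested locally, which is \<open>loc\<close>. Semi-meromorphic
  functions, the bundle of a torsor and sheafifications are all of this kind.\<close>

lemma function_sheaf:
  assumes r: "\<And>U V s. restr F U V s = restrict s V"
    and ext: "\<And>U. openin (pspace F) U \<Longrightarrow> sect F U \<subseteq> extensional U"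
    and cl: "\<And>U V s. \<lbrakk>openin (pspace F) U; openin (pspace F) V; V \<subseteq> U; s \<in> sect F U\<rbrakk>
               \<Longrightarrow> restrict s V \<in> sect F V"
    and loc: "\<And>U s. \<lbrakk>openin (pspace F) U; s \<in> extensional U;
        \<And>x. x \<in> U \<Longrightarrow> \<exists>V. openin (pspace F) V \<and> x \<in> V \<and> V \<subseteq> U \<and> restrict s V \<in> sect F V\<rbrakk>
        \<Longrightarrow> s \<in> sect F U"
  shows "is_sheaf F"
  unfolding is_sheaf_def
proof (intro conjI allI impI)
  show "is_presheaf F"
    unfolding is_presheaf_def r using cl ext
    by (auto simp: extensional_restrict subset_iff restrict_restrict Int_absorb1)
next
  fix \<U> \<sigma>
  assume "(\<forall>U\<in>\<U>. openin (pspace F) U \<and> \<sigma> U \<in> sect F U) \<and>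
            (\<forall>U\<in>\<U>. \<forall>V\<in>\<U>. restr F U (U \<inter> V) (\<sigma> U) = restr F V (U \<inter> V) (\<sigma> V))"
  hence o: "\<And>U. U \<in> \<U> \<Longrightarrow> openin (pspace F) U" and \<sigma>: "\<And>U. U \<in> \<U> \<Longrightarrow> \<sigma> U \<in> sect F U"
    and c: "\<And>U V. \<lbrakk>U \<in> \<U>; V \<in> \<U>\<rbrakk> \<Longrightarrow> restrict (\<sigma> U) (U \<inter> V) = restrict (\<sigma> V) (U \<inter> V)"
    unfolding r by blast+
  have c': "\<sigma> U x = \<sigma> V x" if "U \<in> \<U>" "V \<in> \<U>" "x \<in> U" "x \<in> V" for U V x
    using fun_cong[OF c[OF that(1,2)], of x] that by simp
  \<comment> \<open>Any member of the cover that contains \<open>x\<close> may supply the value;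
    compatibility makes the choice irrelevant.\<close>
  define s where "s = (\<lambda>x\<in>\<Union>\<U>. \<sigma> (SOME U. U \<in> \<U> \<and> x \<in> U) x)"
  have s: "s x = \<sigma> U x" if "U \<in> \<U>" "x \<in> U" for U x
  proof -
    let ?W = "SOME U. U \<in> \<U> \<and> x \<in> U"
    have W: "?W \<in> \<U> \<and> x \<in> ?W"
      by (rule someI[of _ U]) (use that in auto)
    have "s x = \<sigma> ?W x" unfolding s_def by (rule restrict_apply') (use that in blast)
    also have "\<dots> = \<sigma> U x" using W that by (intro c') auto
    finally show ?thesis .
  qed
  have sr: "restrict s U = \<sigma> U" if "U \<in> \<U>" for U
    by (rule extensionalityI[of _ U]) (use that s ext[OF o[OF that]] \<sigma> in auto)
  show "\<exists>!s. s \<in> sect F (\<Union>\<U>) \<and> (\<forall>U\<in>\<U>. restr F (\<Union>\<U>) U s = \<sigma> U)"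
    unfolding r
  proof (rule ex1I[of _ s])
    have "openin (pspace F) (\<Union>\<U>)" using o by blast
    moreover have "s \<in> extensional (\<Union>\<U>)" by (simp add: s_def)
    ultimately have "s \<in> sect F (\<Union>\<U>)"
    proof (rule loc)
      fix x assume "x \<in> \<Union>\<U>"
      then obtain V where V: "V \<in> \<U>" "x \<in> V" by blast
      thus "\<exists>V. openin (pspace F) V \<and> x \<in> V \<and> V \<subseteq> \<Union>\<U> \<and> restrict s V \<in> sect F V"
        by (intro exI[of _ V]) (use V sr[OF V(1)] o \<sigma> in auto)
    qed
    thus "s \<in> sect F (\<Union>\<U>) \<and> (\<forall>U\<in>\<U>. restrict s U = \<sigma> U)"
      using sr by blast
  next
    fix t assume t: "t \<in> sect F (\<Union>\<U>) \<and> (\<forall>U\<in>\<U>. restrict t U = \<sigma> U)"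
    have "openin (pspace F) (\<Union>\<U>)" using o by blast
    hence "t \<in> extensional (\<Union>\<U>)" using t ext by blast
    moreover have "t x = s x" if x: "x \<in> \<Union>\<U>" for x
    proof -
      from x obtain U where U: "U \<in> \<U>" "x \<in> U" by blast
      have "t x = restrict t U x" using U by simp
      also have "\<dots> = s x" using t U s[OF U] by simp
      finally show ?thesis .
    qed
    ultimately show "t = s"
      by (intro extensionalityI[of _ "\<Union>\<U>"]) (auto simp: s_def)
  qed
qed

section \<open>Presheaves and sheaves of commutative monoids\<close>

lemma secmon_simps [simp]:
  "carrier (secmon F U) = sect F U"
  "monoid.mult (secmon F U) = mul F U"
  "one (secmon F U) = neutral F U"
  by (simp_all add: secmon_def)

lemma carrier_stalk [simp]: "carrier (stalk F x) = stalk_set F x"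
  by (simp add: stalk_def)

context set_presheaf
begin

lemma sheafify_sectI:
  assumes "s \<in> extensional U"
    "\<And>x. x \<in> U \<Longrightarrow> \<exists>V t. openin (pspace F) V \<and> x \<in> V \<and> V \<subseteq> U \<and> t \<in> sect F V \<and>
       (\<forall>y\<in>V. s y = germ F y V t)"
  shows "s \<in> sheafify_sect F U"
proof -
  have "s x \<in> stalk_set F x" if "x \<in> U" for x
    using assms(2)[OF that] by (elim exE conjE) auto
  with assms show ?thesis unfolding sheafify_sect_def by (auto simp: PiE_def)
qed

lemma sheafify_sectE:
  assumes "s \<in> sheafify_sect F U" "x \<in> U" "openin (pspace F) N" "x \<in> N"
  obtains V t where "openin (pspace F) V" "x \<in> V" "V \<subseteq> U" "V \<subseteq> N" "t \<in> sect F V"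
    "\<And>y. y \<in> V \<Longrightarrow> s y = germ F y V t"
proof -
  from assms(1,2) have "\<exists>V t. openin (pspace F) V \<and> x \<in> V \<and> V \<subseteq> U \<and> t \<in> sect F V \<and>
       (\<forall>y\<in>V. s y = germ F y V t)" by (simp add: sheafify_sect_def)
  then obtain V t where V: "openin (pspace F) V" "x \<in> V" "V \<subseteq> U" "t \<in> sect F V"
       "\<And>y. y \<in> V \<Longrightarrow> s y = germ F y V t" by (elim exE conjE) simp
  show ?thesis
    by (rule that[of "V \<inter> N" "restr F V (V \<inter> N) t"]) (use V assms in \<open>auto simp: openin_Int\<close>)
qed

end

locale cmonoid_presheaf = set_presheaf F for F :: "('p, 's, 'z) monoid_presheaf_scheme" +
  assumes secmon_comm_monoid: "openin (pspace F) U \<Longrightarrow> comm_monoid (secmon F U)"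
    and restr_mul [simp]: "\<lbrakk>openin (pspace F) U; openin (pspace F) V; V \<subseteq> U; s \<in> sect F U; t \<in> sect F U\<rbrakk>
      \<Longrightarrow> restr F U V (mul F U s t) = mul F V (restr F U V s) (restr F U V t)"
    and restr_neutral [simp]: "\<lbrakk>openin (pspace F) U; openin (pspace F) V; V \<subseteq> U\<rbrakk>
      \<Longrightarrow> restr F U V (neutral F U) = neutral F V"
begin

lemma mul_closed [intro, simp]:
  "\<lbrakk>openin (pspace F) U; s \<in> sect F U; t \<in> sect F U\<rbrakk> \<Longrightarrow> mul F U s t \<in> sect F U"
  using monoid.m_closed[of "secmon F U" s t] secmon_comm_monoid by (auto simp: comm_monoid_def)

lemma mul_assoc:
  "\<lbrakk>openin (pspace F) U; s \<in> sect F U; t \<in> sect F U; r \<in> sect F U\<rbrakk>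
   \<Longrightarrow> mul F U (mul F U s t) r = mul F U s (mul F U t r)"
  using monoid.m_assoc[of "secmon F U" s t r] secmon_comm_monoid by (auto simp: comm_monoid_def)

lemma mul_commute:
  "\<lbrakk>openin (pspace F) U; s \<in> sect F U; t \<in> sect F U\<rbrakk> \<Longrightarrow> mul F U s t = mul F U t s"
  using comm_monoid.m_comm[of "secmon F U" s t] secmon_comm_monoid by auto

lemma mul_left_commute:
  "\<lbrakk>openin (pspace F) U; s \<in> sect F U; t \<in> sect F U; r \<in> sect F U\<rbrakk>
   \<Longrightarrow> mul F U s (mul F U t r) = mul F U t (mul F U s r)"
  using comm_monoid.m_lcomm[of "secmon F U" s t r] secmon_comm_monoid by auto

lemmas mul_ac = mul_assoc mul_commute mul_left_commute

lemma neutral_closed [intro, simp]: "openin (pspace F) U \<Longrightarrow> neutral F U \<in> sect F U"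
  using monoid.one_closed[of "secmon F U"] secmon_comm_monoid by (auto simp: comm_monoid_def)

lemma mul_neutral [simp]:
  assumes "openin (pspace F) U" "s \<in> sect F U"
  shows "mul F U (neutral F U) s = s" "mul F U s (neutral F U) = s"
  using monoid.l_one[of "secmon F U" s] monoid.r_one[of "secmon F U" s] secmon_comm_monoid assms
  by (auto simp: comm_monoid_def)

lemma unit_iff: "s \<in> Units (secmon F U) \<longleftrightarrow>
    s \<in> sect F U \<and> (\<exists>t\<in>sect F U. mul F U t s = neutral F U \<and> mul F U s t = neutral F U)"
  by (simp add: Units_def)

lemma unitI:
  assumes "openin (pspace F) U" "s \<in> sect F U" "t \<in> sect F U" "mul F U t s = neutral F U"
  shows "s \<in> Units (secmon F U)"
  unfolding unit_iff using assms mul_commute[of U s t] by auto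

lemma unitE:
  assumes "s \<in> Units (secmon F U)"
  obtains t where "s \<in> sect F U" "t \<in> Units (secmon F U)" "t \<in> sect F U"
    "mul F U t s = neutral F U" "mul F U s t = neutral F U"
  using assms unfolding unit_iff by blast

lemma unit_closed [simp]: "s \<in> Units (secmon F U) \<Longrightarrow> s \<in> sect F U"
  by (simp add: unit_iff)

lemma neutral_unit [simp]: "openin (pspace F) U \<Longrightarrow> neutral F U \<in> Units (secmon F U)"
  by (rule unitI[of _ _ "neutral F U"]) auto

lemma mul_unit [simp]:
  "\<lbrakk>openin (pspace F) U; s \<in> Units (secmon F U); t \<in> Units (secmon F U)\<rbrakk>
   \<Longrightarrow> mul F U s t \<in> Units (secmon F U)"
  using monoid.Units_m_closed[of "secmon F U"] secmon_comm_monoid by (auto simp: comm_monoid_def)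

lemma restr_unit [simp]:
  assumes "openin (pspace F) U" "openin (pspace F) V" "V \<subseteq> U" "s \<in> Units (secmon F U)"
  shows "restr F U V s \<in> Units (secmon F V)"
proof -
  from assms(4) obtain t where t: "s \<in> sect F U" "t \<in> sect F U" "mul F U t s = neutral F U"
    by (rule unitE)
  have "mul F V (restr F U V t) (restr F U V s) = neutral F V"
    using restr_mul[OF assms(1-3) t(2,1)] t(3) assms by simp
  thus ?thesis using assms t by (intro unitI[of _ _ "restr F U V t"]) auto
qed

lemma unit_cancel:
  assumes "openin (pspace F) U" "u \<in> Units (secmon F U)" "s \<in> sect F U" "t \<in> sect F U"
    "mul F U u s = mul F U u t"
  shows "s = t"
proof -
  from assms(2) obtain v where v: "u \<in> sect F U" "v \<in> sect F U" "mul F U v u = neutral F U"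
    by (rule unitE)
  have "s = mul F U (mul F U v u) s" using v assms by simp
  also have "\<dots> = mul F U v (mul F U u s)" using v(1,2) assms by (intro mul_assoc) auto
  also have "\<dots> = mul F U v (mul F U u t)" using assms(5) by simp
  also have "\<dots> = mul F U (mul F U v u) t" using v(1,2) assms by (intro mul_assoc[symmetric]) auto
  also have "\<dots> = t" using v assms by simp
  finally show ?thesis .
qed

section \<open>Products of germs and the stalk monoid\<close>

lemma germ_mult:
  assumes U: "openin (pspace F) U" "x \<in> U" "s \<in> sect F U"
    and V: "openin (pspace F) V" "x \<in> V" "t \<in> sect F V"
  shows "germ F x U s \<otimes>\<^bsub>stalk F x\<^esub> germ F x V t =
    germ F x (U \<inter> V) (mul F (U \<inter> V) (restr F U (U \<inter> V) s) (restr F V (U \<inter> V) t))"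
proof -
  let ?g = "\<lambda>U s V t. germ F x (U \<inter> V) (mul F (U \<inter> V) (restr F U (U \<inter> V) s) (restr F V (U \<inter> V) t))"
  have *: "?g U' s' V' t' = ?g U s V t"
    if a: "(U', s') \<in> germ F x U s" and b: "(V', t') \<in> germ F x V t" for U' s' V' t'
  proof -
    from a obtain A where A: "openin (pspace F) A" "x \<in> A" "A \<subseteq> U" "A \<subseteq> U'"
      "restr F U A s = restr F U' A s'" and U': "openin (pspace F) U'" "x \<in> U'" "s' \<in> sect F U'"
      by (auto simp: germ_mem_iff)
    from b obtain B where B: "openin (pspace F) B" "x \<in> B" "B \<subseteq> V" "B \<subseteq> V'"
      "restr F V B t = restr F V' B t'" and V': "openin (pspace F) V'" "x \<in> V'" "t' \<in> sect F V'"
      by (auto simp: germ_mem_iff)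
    have o: "openin (pspace F) (A \<inter> B)" "openin (pspace F) (U \<inter> V)" "openin (pspace F) (U' \<inter> V')"
      using A B U V U' V' by (auto simp: openin_Int)
    have r: "A \<inter> B \<subseteq> U \<inter> V" "A \<inter> B \<subseteq> U' \<inter> V'" using A B by auto
    have 1: "restr F U (A \<inter> B) s = restr F U' (A \<inter> B) s'"
      by (rule restr_eq_mono[OF A(5)]) (use A U U' o in auto)
    have 2: "restr F V (A \<inter> B) t = restr F V' (A \<inter> B) t'"
      by (rule restr_eq_mono[OF B(5)]) (use B V V' o in auto)
    show ?thesis
      by (rule germ_eqI[where W = "A \<inter> B"])
         (use A(2) B(2) o r U V U' V' in \<open>auto simp: 1 2\<close>)
  qed
  have "germ F x U s \<otimes>\<^bsub>stalk F x\<^esub> germ F x V t =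
      (\<Union>(U', s')\<in>germ F x U s. \<Union>(V', t')\<in>germ F x V t. ?g U' s' V' t')"
    by (simp add: stalk_def)
  also have "\<dots> = (\<Union>p\<in>germ F x U s. \<Union>q\<in>germ F x V t. ?g U s V t)"
    by (intro SUP_cong refl) (auto simp: *)
  also have "\<dots> = ?g U s V t"
    using germ_self[OF U] germ_self[OF V] by blast
  finally show ?thesis .
qed

lemma germ_mult_same:
  "\<lbrakk>openin (pspace F) U; x \<in> U; s \<in> sect F U; t \<in> sect F U\<rbrakk>
   \<Longrightarrow> germ F x U s \<otimes>\<^bsub>stalk F x\<^esub> germ F x U t = germ F x U (mul F U s t)"
  by (simp add: germ_mult)

lemma germ_neutral:
  "\<lbrakk>openin (pspace F) U; x \<in> U\<rbrakk> \<Longrightarrow> germ F x U (neutral F U) = \<one>\<^bsub>stalk F x\<^esub>"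
  by (simp add: stalk_def openin_subset
      flip: germ_restr[of "topspace (pspace F)" U x "neutral F (topspace (pspace F))"])

text \<open>With common representatives, identities between germs reduce to identities between
  sections over one open set.\<close>

lemma stalk_pairE:
  assumes "A \<in> stalk_set F x" "B \<in> stalk_set F x" "openin (pspace F) N" "x \<in> N"
  obtains U s t where "openin (pspace F) U" "x \<in> U" "U \<subseteq> N" "s \<in> sect F U" "t \<in> sect F U"
    "A = germ F x U s" "B = germ F x U t"
proof -
  obtain U s where U: "openin (pspace F) U" "x \<in> U" "U \<subseteq> N" "s \<in> sect F U" "A = germ F x U s"
    using assms(1,3,4) by (rule stalk_set_withinE)
  obtain V t where V: "openin (pspace F) V" "x \<in> V" "V \<subseteq> U" "t \<in> sect F V" "B = germ F x V t"
    using assms(2) U(1,2) by (rule stalk_set_withinE)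
  show ?thesis
    by (rule that[of V "restr F U V s" t]) (use U V in auto)
qed

lemma stalk_comm_monoid:
  assumes x: "x \<in> topspace (pspace F)"
  shows "comm_monoid (stalk F x)"
proof (rule comm_monoidI, simp_all only: carrier_stalk)
  have T: "openin (pspace F) (topspace (pspace F))" by simp
  show "\<one>\<^bsub>stalk F x\<^esub> \<in> stalk_set F x"
    using germ_neutral[OF T x] germ_in_stalk[OF T x, of "neutral F (topspace (pspace F))"] by simp
  fix A B assume AB: "A \<in> stalk_set F x" "B \<in> stalk_set F x"
  obtain U s t where U: "openin (pspace F) U" "x \<in> U" "s \<in> sect F U" "t \<in> sect F U"
    "A = germ F x U s" "B = germ F x U t"
    using AB T x by (rule stalk_pairE)
  show "A \<otimes>\<^bsub>stalk F x\<^esub> B \<in> stalk_set F x" using U by (auto simp: germ_mult_same)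
  show "A \<otimes>\<^bsub>stalk F x\<^esub> B = B \<otimes>\<^bsub>stalk F x\<^esub> A"
    using U by (auto simp: germ_mult_same mul_commute)
  fix C assume "C \<in> stalk_set F x"
  then obtain V r where V: "openin (pspace F) V" "x \<in> V" "V \<subseteq> U" "r \<in> sect F V" "C = germ F x V r"
    using U(1,2) by (rule stalk_set_withinE)
  have "A = germ F x V (restr F U V s)" "B = germ F x V (restr F U V t)" using U V by auto
  thus "A \<otimes>\<^bsub>stalk F x\<^esub> B \<otimes>\<^bsub>stalk F x\<^esub> C = A \<otimes>\<^bsub>stalk F x\<^esub> (B \<otimes>\<^bsub>stalk F x\<^esub> C)"
    using U V by (simp only:) (simp add: germ_mult_same mul_assoc del: germ_restr)
next
  have T: "openin (pspace F) (topspace (pspace F))" by simp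
  fix A assume "A \<in> stalk_set F x"
  then obtain U s where U: "openin (pspace F) U" "x \<in> U" "s \<in> sect F U" "A = germ F x U s"
    by (rule stalk_setE)
  show "\<one>\<^bsub>stalk F x\<^esub> \<otimes>\<^bsub>stalk F x\<^esub> A = A"
    using U by (simp add: germ_mult_same flip: germ_neutral[of U])
qed

lemma germ_unit:
  assumes U: "openin (pspace F) U" "x \<in> U" and s: "s \<in> Units (secmon F U)"
  shows "germ F x U s \<in> Units (stalk F x)"
proof -
  from s obtain t where t: "s \<in> sect F U" "t \<in> sect F U"
    "mul F U t s = neutral F U" "mul F U s t = neutral F U"
    by (rule unitE)
  thus ?thesis
    unfolding Units_def using U t
    by (auto simp: germ_mult_same germ_neutral intro!: bexI[of _ "germ F x U t"])
qed

lemma germ_inv: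
  assumes U: "openin (pspace F) U" "x \<in> U" and s: "s \<in> sect F U" "t \<in> sect F U"
    "mul F U s t = neutral F U"
  shows "inv\<^bsub>stalk F x\<^esub> germ F x U s = germ F x U t"
proof -
  interpret S: comm_monoid "stalk F x"
    using U openin_subset by (intro stalk_comm_monoid) blast
  have "germ F x U s \<otimes>\<^bsub>stalk F x\<^esub> germ F x U t = \<one>\<^bsub>stalk F x\<^esub>"
    using assms by (simp add: germ_mult_same germ_neutral)
  moreover from this have "germ F x U t \<otimes>\<^bsub>stalk F x\<^esub> germ F x U s = \<one>\<^bsub>stalk F x\<^esub>"
    using S.m_comm assms by simp
  ultimately show ?thesis
    using S.inv_unique'[of "germ F x U s" "germ F x U t"] assms by simp
qed

text \<open>The relation \<open>t s = 1\<close> between germs already holds between sections over a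
  smaller neighbourhood, where the representative is therefore invertible.\<close>

lemma unit_germE:
  assumes A: "A \<in> Units (stalk F x)" and N: "openin (pspace F) N" "x \<in> N"
  obtains U s where "openin (pspace F) U" "x \<in> U" "U \<subseteq> N" "s \<in> Units (secmon F U)" "A = germ F x U s"
proof -
  from A obtain B where B: "A \<in> stalk_set F x" "B \<in> stalk_set F x" "B \<otimes>\<^bsub>stalk F x\<^esub> A = \<one>\<^bsub>stalk F x\<^esub>"
    by (auto simp: Units_def)
  obtain U s t where U: "openin (pspace F) U" "x \<in> U" "U \<subseteq> N" "s \<in> sect F U" "t \<in> sect F U"
    "A = germ F x U s" "B = germ F x U t"
    using B(1,2) N by (rule stalk_pairE)
  have "germ F x U (mul F U t s) = germ F x U (neutral F U)"
    using B(3) U by (simp add: germ_mult_same germ_neutral)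
  from germ_eqE[OF this U(1,2)] U obtain W where W: "openin (pspace F) W" "x \<in> W" "W \<subseteq> U"
    "restr F U W (mul F U t s) = restr F U W (neutral F U)"
    by (metis mul_closed)
  have "restr F U W s \<in> Units (secmon F W)"
    by (rule unitI[of _ _ "restr F U W t"]) (use U W in auto)
  moreover have "A = germ F x W (restr F U W s)" using U W by simp
  ultimately show ?thesis using W U by (intro that[of W "restr F U W s"]) auto
qed

lemma germ_mul_restr:
  assumes "openin (pspace F) U" "openin (pspace F) V" "V \<subseteq> U" "x \<in> V" "s \<in> sect F U" "t \<in> sect F V"
  shows "germ F x V (mul F V (restr F U V s) t) = germ F x U s \<otimes>\<^bsub>stalk F x\<^esub> germ F x V t"
  using assms germ_mult_same[of V x "restr F U V s" t] by simp

lemma stalk_comm_group: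
  assumes x: "x \<in> topspace (pspace F)"
    and grp: "\<And>U. openin (pspace F) U \<Longrightarrow> comm_group (secmon F U)"
  shows "comm_group (stalk F x)"
proof -
  interpret S: comm_monoid "stalk F x" using x by (rule stalk_comm_monoid)
  have "\<exists>B\<in>carrier (stalk F x). B \<otimes>\<^bsub>stalk F x\<^esub> A = \<one>\<^bsub>stalk F x\<^esub>" if "A \<in> carrier (stalk F x)" for A
  proof -
    from that have "A \<in> stalk_set F x" by simp
    then obtain U s where U: "openin (pspace F) U" "x \<in> U" "s \<in> sect F U" "A = germ F x U s"
      by (rule stalk_setE)
    have "s \<in> Units (secmon F U)"
      using group.Units[of "secmon F U"] grp[OF U(1)] U(3) by (auto simp: comm_group_def)
    hence "A \<in> Units (stalk F x)" using U germ_unit by simp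
    thus ?thesis by (auto simp: Units_def)
  qed
  thus ?thesis
    by (intro comm_groupI) (simp_all add: S.m_ac del: carrier_stalk)
qed

section \<open>Sheafification of a presheaf of abelian groups\<close>

lemma sheafify_simps [simp]:
  "pspace (sheafify F) = pspace F"
  "sect (sheafify F) = sheafify_sect F"
  "restr (sheafify F) U V s = restrict s V"
  "mul (sheafify F) U s t = (\<lambda>x\<in>U. s x \<otimes>\<^bsub>stalk F x\<^esub> t x)"
  "neutral (sheafify F) U = (\<lambda>x\<in>U. \<one>\<^bsub>stalk F x\<^esub>)"
  by (simp_all add: sheafify_def)

lemma sheafify_comm_group:
  assumes U: "openin (pspace F) U"
    and grp: "\<And>U. openin (pspace F) U \<Longrightarrow> comm_group (secmon F U)"
  shows "comm_group (secmon (sheafify F) U)"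
proof -
  have top: "x \<in> topspace (pspace F)" if "x \<in> U" for x using U that openin_subset by blast
  have S: "comm_group (stalk F x)" if "x \<in> U" for x
    using top[OF that] grp by (rule stalk_comm_group)
  have Sm: "comm_monoid (stalk F x)" if "x \<in> U" for x
    using top[OF that] by (rule stalk_comm_monoid)
  have st: "s x \<in> carrier (stalk F x)" if "s \<in> sheafify_sect F U" "x \<in> U" for s x
    using that by (auto simp: sheafify_sect_def)
  have ext: "s \<in> extensional U" if "s \<in> sheafify_sect F U" for s
    using that by (auto simp: sheafify_sect_def PiE_def)
  show ?thesis
  proof (rule comm_groupI, simp_all only: secmon_simps sheafify_simps)
    show "(\<lambda>x\<in>U. \<one>\<^bsub>stalk F x\<^esub>) \<in> sheafify_sect F U"
    proof (rule sheafify_sectI)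
      fix x assume "x \<in> U"
      thus "\<exists>V t. openin (pspace F) V \<and> x \<in> V \<and> V \<subseteq> U \<and> t \<in> sect F V \<and>
          (\<forall>y\<in>V. (\<lambda>x\<in>U. \<one>\<^bsub>stalk F x\<^esub>) y = germ F y V t)"
        using U by (intro exI[of _ U] exI[of _ "neutral F U"]) (auto simp: germ_neutral)
    qed simp
  next
    fix s t assume s: "s \<in> sheafify_sect F U" and t: "t \<in> sheafify_sect F U"
    show "(\<lambda>x\<in>U. s x \<otimes>\<^bsub>stalk F x\<^esub> t x) \<in> sheafify_sect F U"
    proof (rule sheafify_sectI)
      fix x assume x: "x \<in> U"
      obtain V a where V: "openin (pspace F) V" "x \<in> V" "V \<subseteq> U" "a \<in> sect F V"
          "\<And>y. y \<in> V \<Longrightarrow> s y = germ F y V a"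
        using s x U x by (rule sheafify_sectE) blast
      obtain W b where W: "openin (pspace F) W" "x \<in> W" "W \<subseteq> V" "b \<in> sect F W"
          "\<And>y. y \<in> W \<Longrightarrow> t y = germ F y W b"
        using t x V(1,2) by (rule sheafify_sectE) blast
      have "s y \<otimes>\<^bsub>stalk F y\<^esub> t y = germ F y W (mul F W (restr F V W a) b)" if "y \<in> W" for y
        using V W that by (simp add: germ_mul_restr subset_iff)
      thus "\<exists>V c. openin (pspace F) V \<and> x \<in> V \<and> V \<subseteq> U \<and> c \<in> sect F V \<and>
          (\<forall>y\<in>V. (\<lambda>x\<in>U. s x \<otimes>\<^bsub>stalk F x\<^esub> t x) y = germ F y V c)"
        using V W by (intro exI[of _ W] exI[of _ "mul F W (restr F V W a) b"]) auto
    qed simp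
    show "(\<lambda>x\<in>U. s x \<otimes>\<^bsub>stalk F x\<^esub> t x) = (\<lambda>x\<in>U. t x \<otimes>\<^bsub>stalk F x\<^esub> s x)"
      using comm_monoid.m_comm[OF Sm] st s t by (auto intro!: restrict_ext simp del: carrier_stalk)
    fix r assume r: "r \<in> sheafify_sect F U"
    show "(\<lambda>x\<in>U. (\<lambda>x\<in>U. s x \<otimes>\<^bsub>stalk F x\<^esub> t x) x \<otimes>\<^bsub>stalk F x\<^esub> r x) =
          (\<lambda>x\<in>U. s x \<otimes>\<^bsub>stalk F x\<^esub> (\<lambda>x\<in>U. t x \<otimes>\<^bsub>stalk F x\<^esub> r x) x)"
      using monoid.m_assoc[OF comm_monoid.axioms(1)[OF Sm]] st s t r
      by (auto intro!: restrict_ext simp del: carrier_stalk)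
  next
    fix s assume s: "s \<in> sheafify_sect F U"
    show "(\<lambda>x\<in>U. (\<lambda>x\<in>U. \<one>\<^bsub>stalk F x\<^esub>) x \<otimes>\<^bsub>stalk F x\<^esub> s x) = s"
      by (rule extensionalityI[OF _ ext[OF s]])
         (use monoid.l_one[OF comm_monoid.axioms(1)[OF Sm]] st s in \<open>auto simp del: carrier_stalk\<close>)
    \<comment> \<open>Near each point \<open>s\<close> is induced by a section of the presheaf; its
      inverse in the group of sections induces the pointwise inverses.\<close>
    let ?i = "\<lambda>x\<in>U. inv\<^bsub>stalk F x\<^esub> s x"
    have "?i \<in> sheafify_sect F U"
    proof (rule sheafify_sectI)
      fix x assume x: "x \<in> U"
      obtain V a where V: "openin (pspace F) V" "x \<in> V" "V \<subseteq> U" "a \<in> sect F V"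
          "\<And>y. y \<in> V \<Longrightarrow> s y = germ F y V a"
        using s x U x by (rule sheafify_sectE) blast
      have "a \<in> Units (secmon F V)"
        using group.Units[of "secmon F V"] grp[OF V(1)] V(4) by (auto simp: comm_group_def)
      then obtain b where b: "b \<in> sect F V" "mul F V a b = neutral F V" by (rule unitE)
      thus "\<exists>V c. openin (pspace F) V \<and> x \<in> V \<and> V \<subseteq> U \<and> c \<in> sect F V \<and>
          (\<forall>y\<in>V. ?i y = germ F y V c)"
        using V by (intro exI[of _ V] exI[of _ b]) (auto simp: germ_inv)
    qed simp
    moreover have "(\<lambda>x\<in>U. ?i x \<otimes>\<^bsub>stalk F x\<^esub> s x) = (\<lambda>x\<in>U. \<one>\<^bsub>stalk F x\<^esub>)"
      using group.l_inv[OF comm_group.axioms(2)[OF S]] st s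
      by (auto intro!: restrict_ext simp del: carrier_stalk)
    ultimately show "\<exists>i\<in>sheafify_sect F U.
        (\<lambda>x\<in>U. i x \<otimes>\<^bsub>stalk F x\<^esub> s x) = (\<lambda>x\<in>U. \<one>\<^bsub>stalk F x\<^esub>)"
      by - (rule bexI)
  qed
qed

end

locale cmonoid_sheaf = cmonoid_presheaf F + set_sheaf F for F :: "('p, 's, 'z) monoid_presheaf_scheme"
begin

text \<open>Inverses in a commutative monoid are unique, so the germs of local inverses are forced
  to be the inverse germs and the local inverses glue.\<close>

lemma unit_if_germs_unit:
  assumes U: "openin (pspace F) U" and s: "s \<in> sect F U"
    and un: "\<And>x. x \<in> U \<Longrightarrow> germ F x U s \<in> Units (stalk F x)"
  shows "s \<in> Units (secmon F U)"
proof -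
  have "\<exists>V t. openin (pspace F) V \<and> x \<in> V \<and> V \<subseteq> U \<and> t \<in> sect F V \<and>
      (\<forall>y\<in>V. germ F y V t = inv\<^bsub>stalk F y\<^esub> germ F y U s)" if x: "x \<in> U" for x
  proof -
    obtain W w where W: "openin (pspace F) W" "x \<in> W" "W \<subseteq> U" "w \<in> Units (secmon F W)"
      "germ F x U s = germ F x W w"
      using un[OF x] U x by (rule unit_germE)
    obtain V where V: "openin (pspace F) V" "x \<in> V" "V \<subseteq> U" "V \<subseteq> W" "restr F U V s = restr F W V w"
      using W(5) U x s by (rule germ_eqE)
    have "restr F U V s \<in> Units (secmon F V)" using V W by simp
    then obtain t where t: "t \<in> sect F V" "mul F V (restr F U V s) t = neutral F V"
      by (rule unitE)
    have "germ F y V t = inv\<^bsub>stalk F y\<^esub> germ F y U s" if "y \<in> V" for y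
    proof -
      have "inv\<^bsub>stalk F y\<^esub> germ F y V (restr F U V s) = germ F y V t"
        by (rule germ_inv) (use V(1-3) U s t that in auto)
      thus ?thesis using germ_restr[OF U V(1,3) that s] by metis
    qed
    thus ?thesis using V t by blast
  qed
  from glue_germs[OF U this] obtain t where t: "t \<in> sect F U"
    "\<forall>y\<in>U. germ F y U t = inv\<^bsub>stalk F y\<^esub> germ F y U s"
    by (rule bexE)
  have "mul F U t s = neutral F U"
  proof (rule germs_eq[OF U])
    fix x assume x: "x \<in> U"
    interpret S: comm_monoid "stalk F x"
      using x U openin_subset by (intro stalk_comm_monoid) blast
    show "germ F x U (mul F U t s) = germ F x U (neutral F U)"
      using S.Units_l_inv[OF un[OF x]] bspec[OF t(2) x] germ_mult_same[OF U x t(1) s] germ_neutral[OF U x]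
      by simp
  qed (use s t U in auto)
  thus ?thesis using U s t by (intro unitI) auto
qed

lemma unit_if_locally_unit:
  assumes U: "openin (pspace F) U" and s: "s \<in> sect F U"
    and un: "\<And>x. x \<in> U \<Longrightarrow> \<exists>V. openin (pspace F) V \<and> x \<in> V \<and> V \<subseteq> U \<and> restr F U V s \<in> Units (secmon F V)"
  shows "s \<in> Units (secmon F U)"
proof (rule unit_if_germs_unit[OF U s])
  fix x assume "x \<in> U"
  from un[OF this] obtain V where "openin (pspace F) V" "x \<in> V" "V \<subseteq> U" "restr F U V s \<in> Units (secmon F V)"
    by (elim exE conjE)
  thus "germ F x U s \<in> Units (stalk F x)"
    using germ_unit[of V x "restr F U V s"] U s by simp
qed

text \<open>The glued section is locally one of the prescribed units, and invertibility is a local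
  property. In this form transition functions and global semi-meromorphic functions are
  obtained.\<close>

lemma units_glue_rel:
  assumes U: "openin (pspace F) U"
    and ex: "\<And>x. x \<in> U \<Longrightarrow> \<exists>V s. openin (pspace F) V \<and> x \<in> V \<and> V \<subseteq> U \<and>
      s \<in> Units (secmon F V) \<and> P V s"
    and uniq: "\<And>V V' s s'. \<lbrakk>openin (pspace F) V; openin (pspace F) V'; V \<subseteq> U; V' \<subseteq> U;
        s \<in> Units (secmon F V); s' \<in> Units (secmon F V'); P V s; P V' s'\<rbrakk>
      \<Longrightarrow> restr F V (V \<inter> V') s = restr F V' (V \<inter> V') s'"
  shows "\<exists>s\<in>Units (secmon F U). \<forall>V s'. openin (pspace F) V \<and> V \<subseteq> U \<and> s' \<in> Units (secmon F V) \<and> P V s'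
    \<longrightarrow> restr F U V s = s'"
proof -
  let ?P = "\<lambda>V s. s \<in> Units (secmon F V) \<and> P V s"
  have "\<exists>!s. s \<in> sect F U \<and>
    (\<forall>V s'. openin (pspace F) V \<and> V \<subseteq> U \<and> s' \<in> sect F V \<and> ?P V s' \<longrightarrow> restr F U V s = s')"
  proof (rule glue_rel[OF U])
    fix x assume "x \<in> U"
    from ex[OF this] obtain V s where "openin (pspace F) V" "x \<in> V" "V \<subseteq> U"
      "s \<in> Units (secmon F V)" "P V s" by (elim exE conjE)
    thus "\<exists>V s. openin (pspace F) V \<and> x \<in> V \<and> V \<subseteq> U \<and> s \<in> sect F V \<and> s \<in> Units (secmon F V) \<and> P V s"
      by (intro exI[of _ V] exI[of _ s]) simp
  next
    fix V V' s s' assume *: "openin (pspace F) V" "openin (pspace F) V'" "V \<subseteq> U" "V' \<subseteq> U"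
      "s \<in> Units (secmon F V) \<and> P V s" "s' \<in> Units (secmon F V') \<and> P V' s'"
    show "restr F V (V \<inter> V') s = restr F V' (V \<inter> V') s'"
      by (rule uniq) (use * in simp_all)
  qed
  from ex1_implies_ex[OF this] obtain s where s: "s \<in> sect F U" and s_eq:
    "\<forall>V s'. openin (pspace F) V \<and> V \<subseteq> U \<and> s' \<in> sect F V \<and> ?P V s' \<longrightarrow> restr F U V s = s'"
    by (elim exE conjE)
  have "s \<in> Units (secmon F U)"
  proof (rule unit_if_locally_unit[OF U s])
    fix x assume "x \<in> U"
    from ex[OF this] obtain V t where "openin (pspace F) V" "x \<in> V" "V \<subseteq> U"
      "t \<in> Units (secmon F V)" "P V t" by (elim exE conjE)
    thus "\<exists>V. openin (pspace F) V \<and> x \<in> V \<and> V \<subseteq> U \<and> restr F U V s \<in> Units (secmon F V)"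
      using s_eq[rule_format, of V t] by (intro exI[of _ V]) simp
  qed
  thus ?thesis using s_eq by (intro bexI[of _ s]) simp_all
qed

end

lemma cmonoid_sheafI:
  assumes "is_sheaf_of_monoids F" shows "cmonoid_sheaf F"
proof -
  have s: "is_sheaf F" using assms by (simp add: is_sheaf_of_monoids_def)
  interpret set_sheaf F using s by (rule set_sheafI)
  have "cmonoid_presheaf_axioms F"
    using assms by (intro cmonoid_presheaf_axioms.intro) (simp_all add: is_sheaf_of_monoids_def hom_def)
  thus ?thesis
    using set_presheaf_axioms set_sheaf_axioms by (simp add: cmonoid_sheaf_def cmonoid_presheaf_def)
qed

section \<open>Specialization of points\<close>

text \<open>The form in which the order is used: neighbourhoods of \<open>y\<close> are
  neighbourhoods of \<open>x\<close>, hence germs at \<open>y\<close> can be read at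
  \<open>x\<close>.\<close>

lemma point_le_iff:
  "point_le X x y \<longleftrightarrow> x \<in> topspace (pspace X) \<and> y \<in> topspace (pspace X) \<and>
     (\<forall>U. openin (pspace X) U \<and> y \<in> U \<longrightarrow> x \<in> U)"
proof -
  have "(pspace X closure_of {y} \<subseteq> pspace X closure_of {x}) \<longleftrightarrow>
      (\<forall>U. openin (pspace X) U \<and> y \<in> U \<longrightarrow> x \<in> U)"
    if "x \<in> topspace (pspace X)" "y \<in> topspace (pspace X)"
  proof -
    have "y \<in> pspace X closure_of {y}" using that closure_of_subset[of "{y}" "pspace X"] by auto
    moreover have "pspace X closure_of {y} \<subseteq> pspace X closure_of {x}" if "y \<in> pspace X closure_of {x}"
      by (rule closure_of_minimal) (use that in auto)
    ultimately have "(pspace X closure_of {y} \<subseteq> pspace X closure_of {x}) \<longleftrightarrow> y \<in> pspace X closure_of {x}"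
      by auto
    also have "\<dots> \<longleftrightarrow> (\<forall>U. openin (pspace X) U \<and> y \<in> U \<longrightarrow> x \<in> U)"
      using that by (auto simp: in_closure_of)
    finally show ?thesis .
  qed
  thus ?thesis unfolding point_le_def by blast
qed

lemma point_le_open: "\<lbrakk>point_le X x y; openin (pspace X) U; y \<in> U\<rbrakk> \<Longrightarrow> x \<in> U"
  by (simp add: point_le_iff)

lemma point_le_trans: "\<lbrakk>point_le X x y; point_le X y z\<rbrakk> \<Longrightarrow> point_le X x z"
  by (auto simp: point_le_iff)

section \<open>Localization of commutative monoids\<close>

locale localizing = comm_monoid M for M :: "'a monoid" (structure) +
  fixes S :: "'a set"
  assumes submon: "submonoid S M"
begin

lemma S_closed [simp]: "s \<in> S \<Longrightarrow> s \<in> carrier M"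
  using submonoid.mem_carrier[OF submon] .

lemma S_mult [simp]: "\<lbrakk>s \<in> S; t \<in> S\<rbrakk> \<Longrightarrow> s \<otimes> t \<in> S"
  using submonoid.m_closed[OF submon] .

lemma S_one [simp]: "\<one> \<in> S"
  using submonoid.one_closed[OF submon] .

lemma loc_rel_iff: "((a, s), (b, t)) \<in> loc_rel M S \<longleftrightarrow>
    a \<in> carrier M \<and> s \<in> S \<and> b \<in> carrier M \<and> t \<in> S \<and> (\<exists>u\<in>S. u \<otimes> (t \<otimes> a) = u \<otimes> (s \<otimes> b))"
  by (simp add: loc_rel_def)

lemma loc_rel_sym: "(p, q) \<in> loc_rel M S \<Longrightarrow> (q, p) \<in> loc_rel M S"
  by (cases p; cases q; simp add: loc_rel_iff) metis

lemma loc_rel_trans: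
  assumes "(p, q) \<in> loc_rel M S" "(q, r) \<in> loc_rel M S"
  shows "(p, r) \<in> loc_rel M S"
proof -
  obtain a s b t c w where p: "p = (a, s)" "q = (b, t)" "r = (c, w)"
    by (metis surj_pair)
  from assms obtain u v where u: "u \<in> S" "u \<otimes> (t \<otimes> a) = u \<otimes> (s \<otimes> b)"
    and v: "v \<in> S" "v \<otimes> (w \<otimes> b) = v \<otimes> (t \<otimes> c)"
    and c: "a \<in> carrier M" "s \<in> S" "b \<in> carrier M" "t \<in> S" "c \<in> carrier M" "w \<in> S"
    unfolding p loc_rel_iff by blast
  have [simp]: "u \<in> carrier M" "v \<in> carrier M" "s \<in> carrier M" "t \<in> carrier M" "w \<in> carrier M"
    using u v c by auto
  note [simp] = c(1,3,5)
  \<comment> \<open>The factor \<open>t\<close> carries the middle denominator: it is consumed when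
    \<open>t a\<close> is replaced by \<open>s b\<close> and returns when \<open>w b\<close> is
    replaced by \<open>t c\<close>.\<close>
  have "(u \<otimes> v \<otimes> t) \<otimes> (w \<otimes> a) = (v \<otimes> w) \<otimes> (u \<otimes> (t \<otimes> a))" by (simp add: m_ac)
  also have "\<dots> = (u \<otimes> s) \<otimes> (v \<otimes> (w \<otimes> b))" unfolding u(2) by (simp add: m_ac)
  also have "\<dots> = (u \<otimes> v \<otimes> t) \<otimes> (s \<otimes> c)" unfolding v(2) by (simp add: m_ac)
  finally show ?thesis
    unfolding p loc_rel_iff using u v c by (intro conjI bexI[of _ "u \<otimes> v \<otimes> t"]) auto
qed

lemma fraction_eq_iff:
  assumes "a \<in> carrier M" "s \<in> S" "b \<in> carrier M" "t \<in> S"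
  shows "fraction M S a s = fraction M S b t \<longleftrightarrow> (\<exists>u\<in>S. u \<otimes> (t \<otimes> a) = u \<otimes> (s \<otimes> b))"
proof -
  have "((b, t), (b, t)) \<in> loc_rel M S" using assms by (auto simp: loc_rel_iff)
  hence "fraction M S a s = fraction M S b t \<longleftrightarrow> ((a, s), (b, t)) \<in> loc_rel M S"
    unfolding fraction_def using loc_rel_sym loc_rel_trans by blast
  thus ?thesis using assms by (simp add: loc_rel_iff)
qed

lemma fraction_mem_iff: "(b, t) \<in> fraction M S a s \<longleftrightarrow> ((a, s), (b, t)) \<in> loc_rel M S"
  by (simp add: fraction_def)

lemma fraction_self: "\<lbrakk>a \<in> carrier M; s \<in> S\<rbrakk> \<Longrightarrow> (a, s) \<in> fraction M S a s"
  by (auto simp: fraction_mem_iff loc_rel_iff)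

lemma fraction_mem_eq:
  "(b, t) \<in> fraction M S a s \<Longrightarrow> b \<in> carrier M \<and> t \<in> S \<and> fraction M S b t = fraction M S a s"
proof -
  assume "(b, t) \<in> fraction M S a s"
  hence *: "((a, s), (b, t)) \<in> loc_rel M S" by (simp add: fraction_mem_iff)
  hence "b \<in> carrier M" "t \<in> S" "a \<in> carrier M" "s \<in> S" by (simp_all add: loc_rel_iff)
  with * show ?thesis using fraction_eq_iff[of a s b t] by (simp add: loc_rel_iff)
qed

lemma fraction_eqI: "\<lbrakk>a \<in> carrier M; s \<in> S; b \<in> carrier M; t \<in> S; t \<otimes> a = s \<otimes> b\<rbrakk>
    \<Longrightarrow> fraction M S a s = fraction M S b t"
  by (subst fraction_eq_iff) auto

text \<open>Functions on fractions are encoded as unions over all representatives. Once the value is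
  the same for every representative, this is the union of a constant family over a nonempty index
  set.\<close>

lemma UN_fraction:
  assumes "a \<in> carrier M" "s \<in> S"
    and "\<And>b t. (b, t) \<in> fraction M S a s \<Longrightarrow> f b t = f a s"
  shows "(\<Union>(b, t)\<in>fraction M S a s. f b t) = f a s"
proof -
  have "(\<Union>(b, t)\<in>fraction M S a s. f b t) = (\<Union>p\<in>fraction M S a s. f a s)"
    by (intro SUP_cong refl) (use assms(3) in auto)
  also have "\<dots> = f a s" using fraction_self[OF assms(1,2)] by auto
  finally show ?thesis .
qed

lemma carrier_localization: "carrier (localization M S) = {fraction M S a s | a s. a \<in> carrier M \<and> s \<in> S}"
  by (simp add: localization_def)

lemma one_localization: "\<one>\<^bsub>localization M S\<^esub> = fraction M S \<one> \<one>"
  by (simp add: localization_def)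

lemma fraction_closed [simp]:
  "\<lbrakk>a \<in> carrier M; s \<in> S\<rbrakk> \<Longrightarrow> fraction M S a s \<in> carrier (localization M S)"
  by (auto simp: carrier_localization)

lemma localizationE:
  assumes "A \<in> carrier (localization M S)"
  obtains a s where "a \<in> carrier M" "s \<in> S" "A = fraction M S a s"
  using assms by (auto simp: carrier_localization)

lemma fraction_mult_cong:
  assumes "a \<in> carrier M" "s \<in> S" "b \<in> carrier M" "t \<in> S"
    "a' \<in> carrier M" "s' \<in> S" "b' \<in> carrier M" "t' \<in> S"
    "fraction M S a s = fraction M S a' s'" "fraction M S b t = fraction M S b' t'"
  shows "fraction M S (a \<otimes> b) (s \<otimes> t) = fraction M S (a' \<otimes> b') (s' \<otimes> t')"
proof -
  from assms obtain u v where u: "u \<in> S" "u \<otimes> (s' \<otimes> a) = u \<otimes> (s \<otimes> a')"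
    and v: "v \<in> S" "v \<otimes> (t' \<otimes> b) = v \<otimes> (t \<otimes> b')"
    by (auto simp: fraction_eq_iff)
  have [simp]: "u \<in> carrier M" "v \<in> carrier M" "s \<in> carrier M" "t \<in> carrier M"
    "s' \<in> carrier M" "t' \<in> carrier M"
    using u v assms by auto
  have "(u \<otimes> v) \<otimes> ((s' \<otimes> t') \<otimes> (a \<otimes> b)) = (u \<otimes> (s' \<otimes> a)) \<otimes> (v \<otimes> (t' \<otimes> b))"
    using assms(1,3,5,7) by (simp add: m_ac)
  also have "\<dots> = (u \<otimes> v) \<otimes> ((s \<otimes> t) \<otimes> (a' \<otimes> b'))"
    unfolding u(2) v(2) using assms(1,3,5,7) by (simp add: m_ac)
  finally show ?thesis using assms u v by (subst fraction_eq_iff) auto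
qed

lemma fraction_mult:
  assumes a: "a \<in> carrier M" "s \<in> S" and b: "b \<in> carrier M" "t \<in> S"
  shows "fraction M S a s \<otimes>\<^bsub>localization M S\<^esub> fraction M S b t = fraction M S (a \<otimes> b) (s \<otimes> t)"
proof -
  have "fraction M S a s \<otimes>\<^bsub>localization M S\<^esub> fraction M S b t =
     (\<Union>(a', s')\<in>fraction M S a s. \<Union>(b', t')\<in>fraction M S b t. fraction M S (a' \<otimes> b') (s' \<otimes> t'))"
    by (simp add: localization_def)
  also have "\<dots> = (\<Union>(a', s')\<in>fraction M S a s. fraction M S (a' \<otimes> b) (s' \<otimes> t))"
  proof (intro SUP_cong refl, clarify)
    fix a' s' assume "(a', s') \<in> fraction M S a s"
    note a' = fraction_mem_eq[OF this]
    show "(\<Union>(b', t')\<in>fraction M S b t. fraction M S (a' \<otimes> b') (s' \<otimes> t')) = fraction M S (a' \<otimes> b) (s' \<otimes> t)"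
      by (rule UN_fraction[OF b])
         (metis a' b fraction_mem_eq fraction_mult_cong)
  qed
  also have "\<dots> = fraction M S (a \<otimes> b) (s \<otimes> t)"
    by (rule UN_fraction[OF a]) (metis a b fraction_mem_eq fraction_mult_cong)
  finally show ?thesis .
qed

lemma localization_comm_monoid: "comm_monoid (localization M S)"
proof (rule comm_monoidI)
  show "\<one>\<^bsub>localization M S\<^esub> \<in> carrier (localization M S)" by (simp add: one_localization)
  fix A assume "A \<in> carrier (localization M S)"
  then obtain a s where A: "a \<in> carrier M" "s \<in> S" "A = fraction M S a s" by (rule localizationE)
  show "\<one>\<^bsub>localization M S\<^esub> \<otimes>\<^bsub>localization M S\<^esub> A = A"
    using A by (simp add: one_localization fraction_mult)
  fix B assume "B \<in> carrier (localization M S)"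
  then obtain b t where B: "b \<in> carrier M" "t \<in> S" "B = fraction M S b t" by (rule localizationE)
  show "A \<otimes>\<^bsub>localization M S\<^esub> B \<in> carrier (localization M S)" using A B by (simp add: fraction_mult)
  show "A \<otimes>\<^bsub>localization M S\<^esub> B = B \<otimes>\<^bsub>localization M S\<^esub> A"
    using A B by (simp add: fraction_mult m_comm)
  fix C assume "C \<in> carrier (localization M S)"
  then obtain c r where C: "c \<in> carrier M" "r \<in> S" "C = fraction M S c r" by (rule localizationE)
  show "A \<otimes>\<^bsub>localization M S\<^esub> B \<otimes>\<^bsub>localization M S\<^esub> C = A \<otimes>\<^bsub>localization M S\<^esub> (B \<otimes>\<^bsub>localization M S\<^esub> C)"
    using A B C by (simp add: fraction_mult m_assoc)
qed

end

section \<open>The submonoid of s-regular elements\<close>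

lemma s_regularD:
  assumes "s_regular M a" "u \<in> carrier M" "v \<in> carrier M"
    "a [^]\<^bsub>M\<^esub> (m::nat) \<otimes>\<^bsub>M\<^esub> u = a [^]\<^bsub>M\<^esub> m \<otimes>\<^bsub>M\<^esub> v"
  obtains n::nat where "u \<otimes>\<^bsub>M\<^esub> (u \<otimes>\<^bsub>M\<^esub> v) [^]\<^bsub>M\<^esub> n = v \<otimes>\<^bsub>M\<^esub> (u \<otimes>\<^bsub>M\<^esub> v) [^]\<^bsub>M\<^esub> n"
  using assms unfolding s_regular_def by blast

text \<open>From \<open>(ab)^m u = (ab)^m v\<close>, regularity of \<open>a\<close> is applied to
  \<open>b^m u\<close> and \<open>b^m v\<close>. The resulting identity contains only powers of
  \<open>b\<close> besides \<open>u (uv)^n\<close> and \<open>v (uv)^n\<close>, and regularity of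
  \<open>b\<close> removes those powers at the cost of a larger power of \<open>uv\<close>.\<close>

lemma sreg_submonoid:
  fixes M :: "'a monoid"
  assumes "comm_monoid M" shows "submonoid (sreg M) M"
proof -
  interpret comm_monoid M by fact
  show ?thesis
  proof
    show "sreg M \<subseteq> carrier M" by (auto simp: sreg_def s_regular_def)
    show "\<one>\<^bsub>M\<^esub> \<in> sreg M"
      by (auto simp: sreg_def s_regular_def intro!: exI[of _ "0::nat"])
    fix a b assume "a \<in> sreg M" "b \<in> sreg M"
    hence a: "s_regular M a" and b: "s_regular M b" by (auto simp: sreg_def)
    hence c[simp]: "a \<in> carrier M" "b \<in> carrier M" by (auto simp: s_regular_def)
    have "\<exists>n::nat. u \<otimes>\<^bsub>M\<^esub> (u \<otimes>\<^bsub>M\<^esub> v) [^]\<^bsub>M\<^esub> n = v \<otimes>\<^bsub>M\<^esub> (u \<otimes>\<^bsub>M\<^esub> v) [^]\<^bsub>M\<^esub> n"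
      if uv: "u \<in> carrier M" "v \<in> carrier M"
        and e: "(a \<otimes>\<^bsub>M\<^esub> b) [^]\<^bsub>M\<^esub> m \<otimes>\<^bsub>M\<^esub> u = (a \<otimes>\<^bsub>M\<^esub> b) [^]\<^bsub>M\<^esub> m \<otimes>\<^bsub>M\<^esub> v" for u v and m :: nat
    proof -
      note [simp] = uv
      have "a [^]\<^bsub>M\<^esub> m \<otimes>\<^bsub>M\<^esub> (b [^]\<^bsub>M\<^esub> m \<otimes>\<^bsub>M\<^esub> u) = a [^]\<^bsub>M\<^esub> m \<otimes>\<^bsub>M\<^esub> (b [^]\<^bsub>M\<^esub> m \<otimes>\<^bsub>M\<^esub> v)"
        using e by (simp add: nat_pow_distrib m_assoc)
      then obtain n :: nat where n: "(b [^]\<^bsub>M\<^esub> m \<otimes>\<^bsub>M\<^esub> u) \<otimes>\<^bsub>M\<^esub> ((b [^]\<^bsub>M\<^esub> m \<otimes>\<^bsub>M\<^esub> u) \<otimes>\<^bsub>M\<^esub> (b [^]\<^bsub>M\<^esub> m \<otimes>\<^bsub>M\<^esub> v)) [^]\<^bsub>M\<^esub> n =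
          (b [^]\<^bsub>M\<^esub> m \<otimes>\<^bsub>M\<^esub> v) \<otimes>\<^bsub>M\<^esub> ((b [^]\<^bsub>M\<^esub> m \<otimes>\<^bsub>M\<^esub> u) \<otimes>\<^bsub>M\<^esub> (b [^]\<^bsub>M\<^esub> m \<otimes>\<^bsub>M\<^esub> v)) [^]\<^bsub>M\<^esub> n"
        using s_regularD[OF a, of "b [^]\<^bsub>M\<^esub> m \<otimes>\<^bsub>M\<^esub> u" "b [^]\<^bsub>M\<^esub> m \<otimes>\<^bsub>M\<^esub> v" m] by auto
      let ?w = "(u \<otimes>\<^bsub>M\<^esub> v) [^]\<^bsub>M\<^esub> n"
      \<comment> \<open>One factor \<open>b^m\<close> stands in front and \<open>2m\<close> further
        factors \<open>b\<close> come from each of the \<open>n\<close> products, whence the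
        exponent \<open>m + 2mn\<close>.\<close>
      have bb: "(b [^]\<^bsub>M\<^esub> m \<otimes>\<^bsub>M\<^esub> x) \<otimes>\<^bsub>M\<^esub> ((b [^]\<^bsub>M\<^esub> m \<otimes>\<^bsub>M\<^esub> u) \<otimes>\<^bsub>M\<^esub> (b [^]\<^bsub>M\<^esub> m \<otimes>\<^bsub>M\<^esub> v)) [^]\<^bsub>M\<^esub> n =
          b [^]\<^bsub>M\<^esub> (m + (m + m) * n) \<otimes>\<^bsub>M\<^esub> (x \<otimes>\<^bsub>M\<^esub> ?w)" if "x \<in> carrier M" for x
      proof -
        define B where "B = b [^]\<^bsub>M\<^esub> m"
        have [simp]: "B \<in> carrier M" by (simp add: B_def)
        have BB: "B \<otimes>\<^bsub>M\<^esub> B = b [^]\<^bsub>M\<^esub> (m + m)" by (simp add: B_def nat_pow_mult)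
        have "(B \<otimes>\<^bsub>M\<^esub> u) \<otimes>\<^bsub>M\<^esub> (B \<otimes>\<^bsub>M\<^esub> v) = (B \<otimes>\<^bsub>M\<^esub> B) \<otimes>\<^bsub>M\<^esub> (u \<otimes>\<^bsub>M\<^esub> v)"
          by (simp add: m_ac)
        hence "((B \<otimes>\<^bsub>M\<^esub> u) \<otimes>\<^bsub>M\<^esub> (B \<otimes>\<^bsub>M\<^esub> v)) [^]\<^bsub>M\<^esub> n = (B \<otimes>\<^bsub>M\<^esub> B) [^]\<^bsub>M\<^esub> n \<otimes>\<^bsub>M\<^esub> ?w"
          by (simp add: nat_pow_distrib)
        hence "(B \<otimes>\<^bsub>M\<^esub> x) \<otimes>\<^bsub>M\<^esub> ((B \<otimes>\<^bsub>M\<^esub> u) \<otimes>\<^bsub>M\<^esub> (B \<otimes>\<^bsub>M\<^esub> v)) [^]\<^bsub>M\<^esub> n =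
            (B \<otimes>\<^bsub>M\<^esub> (B \<otimes>\<^bsub>M\<^esub> B) [^]\<^bsub>M\<^esub> n) \<otimes>\<^bsub>M\<^esub> (x \<otimes>\<^bsub>M\<^esub> ?w)"
          using that by (simp add: m_ac)
        moreover have "B \<otimes>\<^bsub>M\<^esub> (B \<otimes>\<^bsub>M\<^esub> B) [^]\<^bsub>M\<^esub> n = b [^]\<^bsub>M\<^esub> (m + (m + m) * n)"
          unfolding BB by (simp add: B_def nat_pow_pow nat_pow_mult)
        ultimately show ?thesis by (simp add: B_def)
      qed
      from n have "b [^]\<^bsub>M\<^esub> (m + (m + m) * n) \<otimes>\<^bsub>M\<^esub> (u \<otimes>\<^bsub>M\<^esub> ?w) = b [^]\<^bsub>M\<^esub> (m + (m + m) * n) \<otimes>\<^bsub>M\<^esub> (v \<otimes>\<^bsub>M\<^esub> ?w)"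
        by (simp only: bb uv)
      then obtain k :: nat where k: "(u \<otimes>\<^bsub>M\<^esub> ?w) \<otimes>\<^bsub>M\<^esub> ((u \<otimes>\<^bsub>M\<^esub> ?w) \<otimes>\<^bsub>M\<^esub> (v \<otimes>\<^bsub>M\<^esub> ?w)) [^]\<^bsub>M\<^esub> k =
          (v \<otimes>\<^bsub>M\<^esub> ?w) \<otimes>\<^bsub>M\<^esub> ((u \<otimes>\<^bsub>M\<^esub> ?w) \<otimes>\<^bsub>M\<^esub> (v \<otimes>\<^bsub>M\<^esub> ?w)) [^]\<^bsub>M\<^esub> k"
        using s_regularD[OF b, of "u \<otimes>\<^bsub>M\<^esub> ?w" "v \<otimes>\<^bsub>M\<^esub> ?w"] by auto
      \<comment> \<open>The product of \<open>u (uv)^n\<close> and \<open>v (uv)^n\<close> is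
        \<open>(uv)^(2n+1)\<close>; its \<open>k\<close>-th power adds to the exponent
        \<open>n\<close> already present.\<close>
      have ww: "(x \<otimes>\<^bsub>M\<^esub> ?w) \<otimes>\<^bsub>M\<^esub> ((u \<otimes>\<^bsub>M\<^esub> ?w) \<otimes>\<^bsub>M\<^esub> (v \<otimes>\<^bsub>M\<^esub> ?w)) [^]\<^bsub>M\<^esub> k =
          x \<otimes>\<^bsub>M\<^esub> (u \<otimes>\<^bsub>M\<^esub> v) [^]\<^bsub>M\<^esub> (n + Suc (n + n) * k)" if "x \<in> carrier M" for x
      proof -
        have "(u \<otimes>\<^bsub>M\<^esub> ?w) \<otimes>\<^bsub>M\<^esub> (v \<otimes>\<^bsub>M\<^esub> ?w) = (?w \<otimes>\<^bsub>M\<^esub> ?w) \<otimes>\<^bsub>M\<^esub> (u \<otimes>\<^bsub>M\<^esub> v)"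
          by (simp add: m_ac)
        also have "\<dots> = (u \<otimes>\<^bsub>M\<^esub> v) [^]\<^bsub>M\<^esub> Suc (n + n)" by (simp add: nat_pow_mult)
        finally have "((u \<otimes>\<^bsub>M\<^esub> ?w) \<otimes>\<^bsub>M\<^esub> (v \<otimes>\<^bsub>M\<^esub> ?w)) [^]\<^bsub>M\<^esub> k = (u \<otimes>\<^bsub>M\<^esub> v) [^]\<^bsub>M\<^esub> (Suc (n + n) * k)"
          by (simp only: nat_pow_pow m_closed uv)
        thus ?thesis using that by (simp add: m_assoc nat_pow_mult del: mult_Suc)
      qed
      from trans[OF trans[OF ww[OF uv(1), symmetric] k] ww[OF uv(2)]] show ?thesis by (rule exI)
    qed
    thus "a \<otimes>\<^bsub>M\<^esub> b \<in> sreg M" by (auto simp: sreg_def s_regular_def)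
  qed
qed

text \<open>This is why the invertible functions embed into the invertible semi-meromorphic ones.\<close>

lemma sreg_cancel_units:
  assumes "comm_monoid M" "s \<in> sreg M" "a \<in> Units M" "b \<in> Units M" "s \<otimes>\<^bsub>M\<^esub> a = s \<otimes>\<^bsub>M\<^esub> b"
  shows "a = b"
proof -
  interpret comm_monoid M by fact
  have s: "s_regular M s" using assms(2) by (simp add: sreg_def)
  hence [simp]: "s \<in> carrier M" by (simp add: s_regular_def)
  note [simp] = Units_closed[OF assms(3)] Units_closed[OF assms(4)]
  obtain n :: nat where n: "a \<otimes>\<^bsub>M\<^esub> (a \<otimes>\<^bsub>M\<^esub> b) [^]\<^bsub>M\<^esub> n = b \<otimes>\<^bsub>M\<^esub> (a \<otimes>\<^bsub>M\<^esub> b) [^]\<^bsub>M\<^esub> n"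
    by (rule s_regularD[OF s, of a b "1::nat"]) (use assms(5) in auto)
  \<comment> \<open>The power of \<open>ab\<close> left over by s-regularity is invertible, because
    both elements are, and can be cancelled.\<close>
  have "(a \<otimes>\<^bsub>M\<^esub> b) [^]\<^bsub>M\<^esub> n \<in> Units M"
    by (induction n) (use assms(3,4) in auto)
  from Units_l_cancel[OF this, of a b] n show ?thesis by (simp add: m_comm)
qed

text \<open>Describes a localization without naming the inverted submonoid: admissible denominators
  are the elements that become units. Together the two clauses say that every target element is a
  fraction and that elements with equal image agree after multiplication by a denominator. Stalk
  maps thereby become independent of charts.\<close>

definition localization_map :: "'a monoid \<Rightarrow> 'b monoid \<Rightarrow> ('a \<Rightarrow> 'b) \<Rightarrow> bool" where
  "localization_map M N h \<longleftrightarrow> h \<in> hom M N \<and> h \<one>\<^bsub>M\<^esub> = \<one>\<^bsub>N\<^esub> \<and>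
     (\<forall>b\<in>carrier N. \<exists>a\<in>carrier M. \<exists>s\<in>carrier M. h s \<in> Units N \<and> h s \<otimes>\<^bsub>N\<^esub> b = h a) \<and>
     (\<forall>a\<in>carrier M. \<forall>b\<in>carrier M. h a = h b \<longrightarrow>
        (\<exists>s\<in>carrier M. h s \<in> Units N \<and> s \<otimes>\<^bsub>M\<^esub> a = s \<otimes>\<^bsub>M\<^esub> b))"

lemma hom_one_pow:
  assumes "monoid M" "monoid N" "h \<in> hom M N" "h \<one>\<^bsub>M\<^esub> = \<one>\<^bsub>N\<^esub>" "a \<in> carrier M"
  shows "h (a [^]\<^bsub>M\<^esub> (n::nat)) = h a [^]\<^bsub>N\<^esub> n"
proof -
  interpret M: monoid M by fact
  interpret N: monoid N by fact
  show ?thesis by (induction n) (use assms in \<open>auto simp: hom_def\<close>)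
qed

text \<open>Clearing denominators moves an equation in the target back to the source, where
  regularity of \<open>a\<close> applies. The image of the conclusion differs from the desired one
  by unit factors only.\<close>

lemma localization_map_sreg:
  assumes cM: "comm_monoid M" and cN: "comm_monoid N" and h: "localization_map M N h" and a: "a \<in> sreg M"
  shows "h a \<in> sreg N"
proof -
  interpret M: comm_monoid M by fact
  interpret N: comm_monoid N by fact
  have hh: "h \<in> hom M N" and h1: "h \<one>\<^bsub>M\<^esub> = \<one>\<^bsub>N\<^esub>" using h by (auto simp: localization_map_def)
  have surj: "\<forall>b\<in>carrier N. \<exists>a\<in>carrier M. \<exists>s\<in>carrier M. h s \<in> Units N \<and> h s \<otimes>\<^bsub>N\<^esub> b = h a"
    and inj: "\<And>a b. \<lbrakk>a \<in> carrier M; b \<in> carrier M; h a = h b\<rbrakk> \<Longrightarrow>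
        \<exists>s\<in>carrier M. h s \<in> Units N \<and> s \<otimes>\<^bsub>M\<^esub> a = s \<otimes>\<^bsub>M\<^esub> b"
    using h by (auto simp: localization_map_def)
  have hc[simp]: "h x \<in> carrier N" if "x \<in> carrier M" for x using hh that by (auto simp: hom_def)
  have hm: "h (x \<otimes>\<^bsub>M\<^esub> y) = h x \<otimes>\<^bsub>N\<^esub> h y" if "x \<in> carrier M" "y \<in> carrier M" for x y
    using hh that by (auto simp: hom_def)
  have hp: "h (x [^]\<^bsub>M\<^esub> (n::nat)) = h x [^]\<^bsub>N\<^esub> n" if "x \<in> carrier M" for x n
    using hom_one_pow[OF M.monoid_axioms N.monoid_axioms hh h1 that] .
  have ar: "s_regular M a" and [simp]: "a \<in> carrier M" using a by (auto simp: sreg_def s_regular_def)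
  have "\<exists>n::nat. u \<otimes>\<^bsub>N\<^esub> (u \<otimes>\<^bsub>N\<^esub> v) [^]\<^bsub>N\<^esub> n = v \<otimes>\<^bsub>N\<^esub> (u \<otimes>\<^bsub>N\<^esub> v) [^]\<^bsub>N\<^esub> n"
    if uv: "u \<in> carrier N" "v \<in> carrier N" and e: "h a [^]\<^bsub>N\<^esub> m \<otimes>\<^bsub>N\<^esub> u = h a [^]\<^bsub>N\<^esub> m \<otimes>\<^bsub>N\<^esub> v"
    for u v and m :: nat
  proof -
    obtain u1 s where u1: "u1 \<in> carrier M" "s \<in> carrier M" "h s \<in> Units N" "h s \<otimes>\<^bsub>N\<^esub> u = h u1"
      using bspec[OF surj uv(1)] by (elim bexE conjE)
    obtain v1 t where v1: "v1 \<in> carrier M" "t \<in> carrier M" "h t \<in> Units N" "h t \<otimes>\<^bsub>N\<^esub> v = h v1"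
      using bspec[OF surj uv(2)] by (elim bexE conjE)
    note [simp] = u1(1,2) v1(1,2) uv
    \<comment> \<open>Numerators over a common denominator: \<open>U\<close> and \<open>V\<close>
      map to \<open>u\<close> and \<open>v\<close> multiplied by the same unit
      \<open>c\<close>.\<close>
    let ?U = "t \<otimes>\<^bsub>M\<^esub> u1" let ?V = "s \<otimes>\<^bsub>M\<^esub> v1" let ?c = "h s \<otimes>\<^bsub>N\<^esub> h t"
    have hU: "h ?U = ?c \<otimes>\<^bsub>N\<^esub> u" by (simp add: hm u1(4)[symmetric] N.m_ac)
    have hV: "h ?V = ?c \<otimes>\<^bsub>N\<^esub> v" by (simp add: hm v1(4)[symmetric] N.m_ac)
    have c: "?c \<in> Units N" using u1 v1 by simp
    have "h (a [^]\<^bsub>M\<^esub> m \<otimes>\<^bsub>M\<^esub> ?U) = ?c \<otimes>\<^bsub>N\<^esub> (h a [^]\<^bsub>N\<^esub> m \<otimes>\<^bsub>N\<^esub> u)"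
      using hm[of "a [^]\<^bsub>M\<^esub> m" ?U] N.Units_closed[OF c] hU by (simp add: hp N.m_lcomm[of _ ?c])
    also have "\<dots> = h (a [^]\<^bsub>M\<^esub> m \<otimes>\<^bsub>M\<^esub> ?V)"
      unfolding e using hm[of "a [^]\<^bsub>M\<^esub> m" ?V] N.Units_closed[OF c] hV by (simp add: hp N.m_lcomm[of _ ?c])
    finally obtain r where r: "r \<in> carrier M" "h r \<in> Units N"
      "r \<otimes>\<^bsub>M\<^esub> (a [^]\<^bsub>M\<^esub> m \<otimes>\<^bsub>M\<^esub> ?U) = r \<otimes>\<^bsub>M\<^esub> (a [^]\<^bsub>M\<^esub> m \<otimes>\<^bsub>M\<^esub> ?V)"
      by (rule inj[THEN bexE, rotated 2]) auto
    \<comment> \<open>The factor \<open>r\<close> that makes the equation true in the source is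
      absorbed into both arguments before regularity is used; it too becomes a unit.\<close>
    have "a [^]\<^bsub>M\<^esub> m \<otimes>\<^bsub>M\<^esub> (r \<otimes>\<^bsub>M\<^esub> ?U) = a [^]\<^bsub>M\<^esub> m \<otimes>\<^bsub>M\<^esub> (r \<otimes>\<^bsub>M\<^esub> ?V)"
      using r by (simp add: M.m_lcomm[of "a [^]\<^bsub>M\<^esub> m" r])
    then obtain n :: nat where n: "(r \<otimes>\<^bsub>M\<^esub> ?U) \<otimes>\<^bsub>M\<^esub> ((r \<otimes>\<^bsub>M\<^esub> ?U) \<otimes>\<^bsub>M\<^esub> (r \<otimes>\<^bsub>M\<^esub> ?V)) [^]\<^bsub>M\<^esub> n =
        (r \<otimes>\<^bsub>M\<^esub> ?V) \<otimes>\<^bsub>M\<^esub> ((r \<otimes>\<^bsub>M\<^esub> ?U) \<otimes>\<^bsub>M\<^esub> (r \<otimes>\<^bsub>M\<^esub> ?V)) [^]\<^bsub>M\<^esub> n"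
      using s_regularD[OF ar, of "r \<otimes>\<^bsub>M\<^esub> ?U" "r \<otimes>\<^bsub>M\<^esub> ?V" m] r by auto
    define d where "d = h r \<otimes>\<^bsub>N\<^esub> ?c"
    have d: "d \<in> Units N" "d \<in> carrier N" using r c by (auto simp: d_def)
    have rU: "h (r \<otimes>\<^bsub>M\<^esub> ?U) = d \<otimes>\<^bsub>N\<^esub> u" and rV: "h (r \<otimes>\<^bsub>M\<^esub> ?V) = d \<otimes>\<^bsub>N\<^esub> v"
      using r by (simp_all add: hm[of r] hU hV d_def N.m_assoc N.Units_closed)
    \<comment> \<open>All units \<open>d\<close> on either side of the mapped identity: one from the
      leading factor and two from each of the \<open>n\<close> products.\<close>
    define e where "e = d \<otimes>\<^bsub>N\<^esub> (d \<otimes>\<^bsub>N\<^esub> d) [^]\<^bsub>N\<^esub> n"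
    have "(d \<otimes>\<^bsub>N\<^esub> d) [^]\<^bsub>N\<^esub> n \<in> Units N" by (induction n) (use d in auto)
    hence e: "e \<in> Units N" using d by (simp add: e_def)
    have de: "(d \<otimes>\<^bsub>N\<^esub> x) \<otimes>\<^bsub>N\<^esub> ((d \<otimes>\<^bsub>N\<^esub> u) \<otimes>\<^bsub>N\<^esub> (d \<otimes>\<^bsub>N\<^esub> v)) [^]\<^bsub>N\<^esub> n = e \<otimes>\<^bsub>N\<^esub> (x \<otimes>\<^bsub>N\<^esub> (u \<otimes>\<^bsub>N\<^esub> v) [^]\<^bsub>N\<^esub> n)"
      if "x \<in> carrier N" for x
    proof -
      have "(d \<otimes>\<^bsub>N\<^esub> u) \<otimes>\<^bsub>N\<^esub> (d \<otimes>\<^bsub>N\<^esub> v) = (d \<otimes>\<^bsub>N\<^esub> d) \<otimes>\<^bsub>N\<^esub> (u \<otimes>\<^bsub>N\<^esub> v)" using d by (simp add: N.m_ac)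
      thus ?thesis using that d by (simp add: N.nat_pow_distrib e_def N.m_ac)
    qed
    have "h ((r \<otimes>\<^bsub>M\<^esub> ?U) \<otimes>\<^bsub>M\<^esub> ((r \<otimes>\<^bsub>M\<^esub> ?U) \<otimes>\<^bsub>M\<^esub> (r \<otimes>\<^bsub>M\<^esub> ?V)) [^]\<^bsub>M\<^esub> n) = e \<otimes>\<^bsub>N\<^esub> (u \<otimes>\<^bsub>N\<^esub> (u \<otimes>\<^bsub>N\<^esub> v) [^]\<^bsub>N\<^esub> n)"
      "h ((r \<otimes>\<^bsub>M\<^esub> ?V) \<otimes>\<^bsub>M\<^esub> ((r \<otimes>\<^bsub>M\<^esub> ?U) \<otimes>\<^bsub>M\<^esub> (r \<otimes>\<^bsub>M\<^esub> ?V)) [^]\<^bsub>M\<^esub> n) = e \<otimes>\<^bsub>N\<^esub> (v \<otimes>\<^bsub>N\<^esub> (u \<otimes>\<^bsub>N\<^esub> v) [^]\<^bsub>N\<^esub> n)"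
      using r de[OF uv(1)] de[OF uv(2)] rU rV hm[of "r \<otimes>\<^bsub>M\<^esub> ?U" "r \<otimes>\<^bsub>M\<^esub> ?V"]
        hm[of "r \<otimes>\<^bsub>M\<^esub> ?U" "((r \<otimes>\<^bsub>M\<^esub> ?U) \<otimes>\<^bsub>M\<^esub> (r \<otimes>\<^bsub>M\<^esub> ?V)) [^]\<^bsub>M\<^esub> n"]
        hm[of "r \<otimes>\<^bsub>M\<^esub> ?V" "((r \<otimes>\<^bsub>M\<^esub> ?U) \<otimes>\<^bsub>M\<^esub> (r \<otimes>\<^bsub>M\<^esub> ?V)) [^]\<^bsub>M\<^esub> n"]
        hp[of "(r \<otimes>\<^bsub>M\<^esub> ?U) \<otimes>\<^bsub>M\<^esub> (r \<otimes>\<^bsub>M\<^esub> ?V)" n]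
      by simp_all
    hence "e \<otimes>\<^bsub>N\<^esub> (u \<otimes>\<^bsub>N\<^esub> (u \<otimes>\<^bsub>N\<^esub> v) [^]\<^bsub>N\<^esub> n) = e \<otimes>\<^bsub>N\<^esub> (v \<otimes>\<^bsub>N\<^esub> (u \<otimes>\<^bsub>N\<^esub> v) [^]\<^bsub>N\<^esub> n)"
      using n by simp
    with N.Units_l_cancel[OF e] show ?thesis by auto
  qed
  thus ?thesis by (auto simp: sreg_def s_regular_def)
qed

section \<open>Affine charts of monoid schemes\<close>

lemma prime_one: "prime_monoid_ideal M P \<Longrightarrow> \<one>\<^bsub>M\<^esub> \<notin> P"
  using submonoid.one_closed[of "carrier M - P" M] by (auto simp: prime_monoid_ideal_def)

lemma prime_localizing: "\<lbrakk>comm_monoid M; prime_monoid_ideal M P\<rbrakk> \<Longrightarrow> localizing M (carrier M - P)"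
  by (simp add: localizing_def localizing_axioms_def prime_monoid_ideal_def)

lemma topspace_spec:
  assumes "comm_monoid M" shows "topspace (spec_topology M) = {P. prime_monoid_ideal M P}"
proof -
  interpret comm_monoid M by fact
  have "topspace (spec_topology M) = (\<Union>f\<in>carrier M. basic_open M f)"
    by (simp add: spec_topology_def topology_generated_by_topspace)
  also have "\<dots> = {P. prime_monoid_ideal M P}"
    using prime_one[of M] by (auto simp: basic_open_def intro!: bexI[of _ "\<one>\<^bsub>M\<^esub>"])
  finally show ?thesis .
qed

lemma openin_basic_open: "f \<in> carrier M \<Longrightarrow> openin (spec_topology M) (basic_open M f)"
  unfolding spec_topology_def by (rule topology_generated_by_Basis) simp

text \<open>A basic open set is given by an element lying outside a prime, a condition inherited by
  smaller primes; the generation of the topology preserves this.\<close>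

lemma spec_open_down_closed:
  assumes "openin (spec_topology M) V" "P \<in> V" "prime_monoid_ideal M Q" "Q \<subseteq> P"
  shows "Q \<in> V"
proof -
  from assms(1) have "generate_topology_on (basic_open M ` carrier M) V"
    by (simp add: spec_topology_def openin_topology_generated_by_iff)
  thus ?thesis using assms(2)
    by (induction rule: generate_topology_on.induct) (use assms(3,4) in \<open>auto simp: basic_open_def\<close>)
qed

lemma Spec_simps [simp]:
  "pspace (Spec M) = spec_topology M"
  "restr (Spec M) U V \<sigma> = restrict \<sigma> V"
  "mul (Spec M) U \<sigma> \<tau> = (\<lambda>P\<in>U. \<sigma> P \<otimes>\<^bsub>localization M (carrier M - P)\<^esub> \<tau> P)"
  "neutral (Spec M) U = (\<lambda>P\<in>U. \<one>\<^bsub>localization M (carrier M - P)\<^esub>)"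
  by (simp_all add: Spec_def)

lemma Spec_sectI:
  assumes M: "comm_monoid M" and V: "openin (spec_topology M) V" and ab: "a \<in> carrier M" "b \<in> carrier M"
    and nb: "\<And>Q. Q \<in> V \<Longrightarrow> b \<notin> Q"
  shows "(\<lambda>Q\<in>V. fraction M (carrier M - Q) a b) \<in> sect (Spec M) V"
proof -
  have "prime_monoid_ideal M Q" if "Q \<in> V" for Q
    using that openin_subset[OF V] topspace_spec[OF M] by auto
  hence "fraction M (carrier M - Q) a b \<in> carrier (localization M (carrier M - Q))" if "Q \<in> V" for Q
    using localizing.fraction_closed[OF prime_localizing[OF M], of Q a b] that ab nb by blast
  thus ?thesis using V ab nb
    by (auto simp: Spec_def intro!: exI[of _ V] bexI[of _ a] bexI[of _ b])
qed

lemma Spec_sectE: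
  assumes "\<sigma> \<in> sect (Spec M) U" "P \<in> U"
  obtains V a b where "openin (spec_topology M) V" "P \<in> V" "V \<subseteq> U" "a \<in> carrier M" "b \<in> carrier M"
    "\<And>Q. Q \<in> V \<Longrightarrow> b \<notin> Q" "\<And>Q. Q \<in> V \<Longrightarrow> \<sigma> Q = fraction M (carrier M - Q) a b"
proof -
  from assms have "\<exists>V a b. openin (spec_topology M) V \<and> P \<in> V \<and> V \<subseteq> U \<and> a \<in> carrier M \<and> b \<in> carrier M \<and>
          (\<forall>Q\<in>V. b \<notin> Q \<and> \<sigma> Q = fraction M (carrier M - Q) a b)"
    by (simp add: Spec_def)
  then obtain V a b where "openin (spec_topology M) V" "P \<in> V" "V \<subseteq> U" "a \<in> carrier M" "b \<in> carrier M"
    and ab: "\<forall>Q\<in>V. b \<notin> Q \<and> \<sigma> Q = fraction M (carrier M - Q) a b"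
    by (elim exE conjE)
  thus ?thesis using that[of V a b] by simp
qed

text \<open>All that is retained of an isomorphism with a spectrum: \<open>h\<close> identifies
  points with primes and the order with inclusion, \<open>g\<close> sends an element of
  \<open>M\<close> to a section over the chart, and \<open>g_surj\<close>, \<open>g_unit\<close>,
  \<open>g_inj\<close> say that the stalk at \<open>y\<close> is the localization of
  \<open>M\<close> at the complement of \<open>h y\<close>.\<close>

locale affine_chart = cmonoid_sheaf X + M: comm_monoid M
  for X :: "('p, 'a) monoid_presheaf" and M :: "'a monoid" +
  fixes U :: "'p set" and h :: "'p \<Rightarrow> 'a set" and g :: "'a \<Rightarrow> 'a"
  assumes open_chart: "openin (pspace X) U"
    and h_prime: "y \<in> U \<Longrightarrow> prime_monoid_ideal M (h y)"
    and h_surj: "prime_monoid_ideal M P \<Longrightarrow> \<exists>y\<in>U. h y = P"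
    and h_inj: "inj_on h U"
    and h_le: "\<lbrakk>y \<in> U; z \<in> U\<rbrakk> \<Longrightarrow> point_le X z y \<longleftrightarrow> h z \<subseteq> h y"
    and g_closed: "a \<in> carrier M \<Longrightarrow> g a \<in> sect X U"
    and g_mult: "\<lbrakk>a \<in> carrier M; b \<in> carrier M\<rbrakk> \<Longrightarrow> g (a \<otimes>\<^bsub>M\<^esub> b) = mul X U (g a) (g b)"
    and g_one: "g \<one>\<^bsub>M\<^esub> = neutral X U"
    and g_surj: "\<lbrakk>y \<in> U; A \<in> stalk_set X y\<rbrakk> \<Longrightarrow> \<exists>a\<in>carrier M. \<exists>b\<in>carrier M - h y.
        germ X y U (g b) \<otimes>\<^bsub>stalk X y\<^esub> A = germ X y U (g a)"
    and g_unit: "\<lbrakk>y \<in> U; b \<in> carrier M - h y\<rbrakk> \<Longrightarrow> germ X y U (g b) \<in> Units (stalk X y)"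
    and g_inj: "\<lbrakk>y \<in> U; a \<in> carrier M; b \<in> carrier M; germ X y U (g a) = germ X y U (g b)\<rbrakk>
        \<Longrightarrow> \<exists>s\<in>carrier M - h y. s \<otimes>\<^bsub>M\<^esub> a = s \<otimes>\<^bsub>M\<^esub> b"

text \<open>The notion \<open>iso\<close> records multiplicativity and bijectivity but not the unit.
  A preimage \<open>m\<close> of the unit satisfies \<open>h m = h m h(1)\<close>, which forces
  \<open>h(1)\<close> to be the unit. From \<open>M\<close> only the right unit law is used, as this
  is what is checked for sections of a spectrum.\<close>

lemma iso_one:
  assumes "h \<in> iso M N" "\<And>x. x \<in> carrier M \<Longrightarrow> x \<otimes>\<^bsub>M\<^esub> \<one>\<^bsub>M\<^esub> = x" "\<one>\<^bsub>M\<^esub> \<in> carrier M" "monoid N"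
  shows "h \<one>\<^bsub>M\<^esub> = \<one>\<^bsub>N\<^esub>"
proof -
  interpret N: monoid N by fact
  have hh: "h \<in> hom M N" "h ` carrier M = carrier N" using assms(1) by (auto simp: iso_iff)
  then obtain m where m: "m \<in> carrier M" "h m = \<one>\<^bsub>N\<^esub>" by (metis N.one_closed imageE)
  have "h m = h m \<otimes>\<^bsub>N\<^esub> h \<one>\<^bsub>M\<^esub>" using hom_mult[OF hh(1) m(1) assms(3)] assms(2)[OF m(1)] by simp
  thus ?thesis using m(2) hom_in_carrier[OF hh(1) assms(3)] by simp
qed

lemma restrict_to_simps [simp]:
  "pspace (restrict_to F U) = subtopology (pspace F) U"
  "sect (restrict_to F U) = sect F"
  "restr (restrict_to F U) = restr F"
  by (simp_all add: restrict_to_def)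

lemma restrict_to_monoid_simps [simp]:
  "mul (restrict_to F U) = mul F"
  "neutral (restrict_to F U) = neutral F"
  "secmon (restrict_to F U) = secmon F"
  by (simp_all add: restrict_to_def secmon_def fun_eq_iff)

text \<open>The map \<open>g\<close> transports the global sections \<open>a/1\<close>. The three
  stalk conditions come from the fractions \<open>1/b\<close> on the open set where \<open>b\<close>
  is invertible, from the local form \<open>a/b\<close> of sections of the spectrum, and from
  injectivity of the isomorphism on sections.\<close>

lemma affine_chart_of_iso:
  fixes X :: "('p, 'a) monoid_presheaf" and M :: "'a monoid"
  assumes X: "cmonoid_sheaf X"
    and U: "openin (pspace X) U" and M: "comm_monoid M"
    and iso: "monoidal_space_iso (restrict_to X U) (Spec M)"
  shows "\<exists>h g. affine_chart X M U h g"
proof -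
  interpret M: comm_monoid M by fact
  interpret X: cmonoid_sheaf X by fact
  let ?T = "spec_topology M"
  have top_U: "topspace (subtopology (pspace X) U) = U"
    using openin_subset[OF U] by auto
  \<comment> \<open>The preimage operation takes \<open>h\<close> as an argument because it occurs
    below the quantifier that introduces \<open>h\<close>.\<close>
  define pr0 where "pr0 = (\<lambda>h :: 'p \<Rightarrow> 'a set. \<lambda>V. {x \<in> U. h x \<in> V})"
  have "\<exists>h \<phi>. homeomorphic_map (subtopology (pspace X) U) ?T h \<and>
      (\<forall>V. openin ?T V \<longrightarrow> \<phi> V \<in> iso (secmon (Spec M) V) (secmon X (pr0 h V))) \<and>
      (\<forall>V W. openin ?T V \<and> openin ?T W \<and> W \<subseteq> V \<longrightarrow>
        (\<forall>s\<in>sect (Spec M) V. \<phi> W (restrict s W) = restr X (pr0 h V) (pr0 h W) (\<phi> V s)))"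
    using iso unfolding monoidal_space_iso_def Let_def restrict_to_simps restrict_to_monoid_simps
      top_U Spec_simps pr0_def .
  then obtain h \<phi> where hom: "homeomorphic_map (subtopology (pspace X) U) ?T h"
    and \<phi>_iso0: "\<forall>V. openin ?T V \<longrightarrow> \<phi> V \<in> iso (secmon (Spec M) V) (secmon X (pr0 h V))"
    and \<phi>_nat0: "\<forall>V W. openin ?T V \<and> openin ?T W \<and> W \<subseteq> V \<longrightarrow>
        (\<forall>s\<in>sect (Spec M) V. \<phi> W (restrict s W) = restr X (pr0 h V) (pr0 h W) (\<phi> V s))"
    by (elim exE conjE)
  define pre where "pre = (\<lambda>V. {x \<in> U. h x \<in> V})"
  have \<phi>_iso: "\<phi> V \<in> iso (secmon (Spec M) V) (secmon X (pre V))" if "openin ?T V" for V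
    using \<phi>_iso0 that by (simp add: pre_def pr0_def)
  have \<phi>_nat: "\<phi> W (restrict s W) = restr X (pre V) (pre W) (\<phi> V s)"
    if "openin ?T V" "openin ?T W" "W \<subseteq> V" "s \<in> sect (Spec M) V" for V W s
    using \<phi>_nat0 that by (simp add: pre_def pr0_def)
  have primes: "topspace ?T = {P. prime_monoid_ideal M P}" by (rule topspace_spec[OF M])
  have bij: "bij_betw h U (topspace ?T)"
    using top_U homeomorphic_imp_injective_map[OF hom]
      homeomorphic_imp_surjective_map[OF hom] by (simp add: bij_betw_def)
  have pr: "prime_monoid_ideal M (h y)" if "y \<in> U" for y
    using bij_betwE[OF bij] that primes by blast
  have open_img: "openin ?T (h ` W)" if "openin (pspace X) W" "W \<subseteq> U" for W
    using homeomorphic_imp_open_map[OF hom] that unfolding open_map_def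
    by (metis U openin_open_subtopology)
  have open_pre: "openin (pspace X) (pre V)" if "openin ?T V" for V
  proof -
    have "openin (subtopology (pspace X) U) {x \<in> topspace (subtopology (pspace X) U). h x \<in> V}"
      using openin_continuous_map_preimage[OF homeomorphic_imp_continuous_map[OF hom] that] .
    thus ?thesis unfolding top_U pre_def using U openin_open_subtopology by blast
  qed
  have pre_sub: "pre V \<subseteq> U" for V by (auto simp: pre_def)
  have pre_img: "pre (h ` W) = W" if "W \<subseteq> U" for W
    using bij that unfolding pre_def bij_betw_def inj_on_def by blast
  have pre_top: "pre (topspace ?T) = U" using bij unfolding pre_def bij_betw_def by blast
  have loc: "localizing M (carrier M - Q)" if "Q \<in> V" "openin ?T V" for Q V
    using that openin_subset[of ?T V] primes prime_localizing[OF M] by blast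
  have one_S: "\<one>\<^bsub>M\<^esub> \<in> carrier M - Q" if "Q \<in> V" "openin ?T V" for Q V
    using localizing.S_one[OF loc[OF that]] .
  have \<phi>_hom: "\<phi> V (mul (Spec M) V s t) = mul X (pre V) (\<phi> V s) (\<phi> V t)"
    if "openin ?T V" "s \<in> sect (Spec M) V" "t \<in> sect (Spec M) V" for V s t
    using hom_mult[OF iso_imp_homomorphism[OF \<phi>_iso[OF that(1)]], of s t] that by simp
  have \<phi>_closed: "\<phi> V s \<in> sect X (pre V)" if "openin ?T V" "s \<in> sect (Spec M) V" for V s
    using hom_in_carrier[OF iso_imp_homomorphism[OF \<phi>_iso[OF that(1)]], of s] that by simp
  have \<phi>_inj: "s = t" if "openin ?T V" "s \<in> sect (Spec M) V" "t \<in> sect (Spec M) V" "\<phi> V s = \<phi> V t" for V s t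
    using \<phi>_iso[OF that(1)] that by (auto simp: iso_iff inj_on_def)
  have \<phi>_surj: "\<exists>s\<in>sect (Spec M) V. \<phi> V s = t" if "openin ?T V" "t \<in> sect X (pre V)" for V t
  proof -
    have "t \<in> \<phi> V ` sect (Spec M) V" using \<phi>_iso[OF that(1)] that(2) by (simp add: iso_iff)
    thus ?thesis by blast
  qed
  \<comment> \<open>The section \<open>a/1\<close> over \<open>V\<close>.\<close>
  define \<tau> where "\<tau> = (\<lambda>a V. \<lambda>Q\<in>V. fraction M (carrier M - Q) a \<one>\<^bsub>M\<^esub>)"
  have \<tau>: "\<tau> a V \<in> sect (Spec M) V" if "a \<in> carrier M" "openin ?T V" for a V
    unfolding \<tau>_def using that one_S by (intro Spec_sectI M) auto
  have neutral: "neutral (Spec M) V = \<tau> \<one>\<^bsub>M\<^esub> V" if "openin ?T V" for V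
    unfolding \<tau>_def using localizing.one_localization[OF loc[OF _ that]] by (auto intro!: restrict_ext)
  have \<phi>_one: "\<phi> V (neutral (Spec M) V) = neutral X (pre V)" if V: "openin ?T V" for V
  proof -
    have "mul (Spec M) V s (neutral (Spec M) V) = s" if s: "s \<in> sect (Spec M) V" for s
    proof (rule extensionalityI[of _ V])
      show "s \<in> extensional V" using s by (auto simp: Spec_def PiE_def)
      fix Q assume Q: "Q \<in> V"
      have "s Q \<in> carrier (localization M (carrier M - Q))" using s Q by (auto simp: Spec_def)
      thus "mul (Spec M) V s (neutral (Spec M) V) Q = s Q"
        using Q monoid.r_one[OF comm_monoid.axioms(1)[OF localizing.localization_comm_monoid[OF loc[OF Q V]]]]
        by simp
    qed simp
    moreover have "neutral (Spec M) V \<in> sect (Spec M) V" unfolding neutral[OF V] by (rule \<tau>) (use V in auto)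
    moreover have "monoid (secmon X (pre V))"
      using X.secmon_comm_monoid[OF open_pre[OF V]] by (simp add: comm_monoid_def)
    ultimately show ?thesis using iso_one[OF \<phi>_iso[OF V]] by simp
  qed
  define g where "g = (\<lambda>a. \<phi> (topspace ?T) (\<tau> a (topspace ?T)))"
  have g_closed: "g a \<in> sect X U" if "a \<in> carrier M" for a
    using \<phi>_closed[OF _ \<tau>[OF that], of "topspace ?T"] by (simp add: g_def pre_top)
  have g_restr: "restr X U (pre V) (g a) = \<phi> V (\<tau> a V)" if a: "a \<in> carrier M" and V: "openin ?T V" for a V
  proof -
    have "restrict (\<tau> a (topspace ?T)) V = \<tau> a V"
      using openin_subset[OF V] by (auto simp: \<tau>_def Int_absorb1 intro!: restrict_ext)
    thus ?thesis using \<phi>_nat[OF openin_topspace V openin_subset[OF V] \<tau>[OF a openin_topspace]]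
      by (simp add: g_def pre_top)
  qed
  have \<tau>_mult: "\<tau> (a \<otimes>\<^bsub>M\<^esub> b) V = mul (Spec M) V (\<tau> a V) (\<tau> b V)"
    if "a \<in> carrier M" "b \<in> carrier M" "openin ?T V" for a b V
    unfolding \<tau>_def using that localizing.fraction_mult[OF loc, of _ V a "\<one>\<^bsub>M\<^esub>" b "\<one>\<^bsub>M\<^esub>"] one_S[of _ V]
    by (auto intro!: restrict_ext)
  have "affine_chart X M U h g"
  proof (unfold_locales)
    show "openin (pspace X) U" by fact
    show "prime_monoid_ideal M (h y)" if "y \<in> U" for y using pr that .
    show "\<exists>y\<in>U. h y = P" if "prime_monoid_ideal M P" for P
      using bij that unfolding primes bij_betw_def by (metis imageE mem_Collect_eq)
    show "inj_on h U" using bij by (simp add: bij_betw_def)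
    show "g a \<in> sect X U" if "a \<in> carrier M" for a using g_closed that .
    show "g (a \<otimes>\<^bsub>M\<^esub> b) = mul X U (g a) (g b)" if "a \<in> carrier M" "b \<in> carrier M" for a b
      using \<phi>_hom[OF openin_topspace \<tau>[OF that(1)] \<tau>[OF that(2)]] \<tau>_mult[OF that openin_topspace]
      by (simp add: g_def pre_top)
    show "g \<one>\<^bsub>M\<^esub> = neutral X U"
      using \<phi>_one[OF openin_topspace] neutral[OF openin_topspace] by (simp add: g_def pre_top)
    show "point_le X z y \<longleftrightarrow> h z \<subseteq> h y" if y: "y \<in> U" and z: "z \<in> U" for y z
    proof
      assume le: "point_le X z y"
      show "h z \<subseteq> h y"
      proof (rule subsetI, rule ccontr)
        \<comment> \<open>Such an \<open>f\<close> would give a neighbourhood of \<open>y\<close>,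
          the preimage of \<open>basic_open M f\<close>, that misses \<open>z\<close>.\<close>
        fix f assume f: "f \<in> h z" "f \<notin> h y"
        have fM: "f \<in> carrier M" using f(1) pr[OF z] by (auto simp: prime_monoid_ideal_def)
        have "y \<in> pre (basic_open M f)" using f(2) pr[OF y] y by (simp add: pre_def basic_open_def)
        hence "z \<in> pre (basic_open M f)"
          using point_le_open[OF le open_pre[OF openin_basic_open[OF fM]]] by simp
        thus False using f(1) by (simp add: pre_def basic_open_def)
      qed
    next
      assume le: "h z \<subseteq> h y"
      show "point_le X z y"
        unfolding point_le_iff
      proof (intro conjI allI impI)
        show "z \<in> topspace (pspace X)" "y \<in> topspace (pspace X)" using y z openin_subset[OF U] by auto
        fix W assume W: "openin (pspace X) W \<and> y \<in> W"
        \<comment> \<open>The image of a neighbourhood of \<open>y\<close> is open in the spectrum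
          and so contains the smaller prime \<open>h z\<close>; injectivity of \<open>h\<close>
          brings this back to \<open>z\<close>.\<close>
        have "h y \<in> h ` (W \<inter> U)" using W y by blast
        hence "h z \<in> h ` (W \<inter> U)"
          using spec_open_down_closed[OF open_img[of "W \<inter> U"] _ pr[OF z] le] W U by blast
        thus "z \<in> W" using bij z unfolding bij_betw_def inj_on_def by blast
      qed
    qed
    show "germ X y U (g b) \<in> Units (stalk X y)" if y: "y \<in> U" and b: "b \<in> carrier M - h y" for y b
    proof -
      \<comment> \<open>Over this set the section \<open>1/b\<close> exists and is inverse to
        \<open>b/1\<close>.\<close>
      let ?V = "basic_open M b"
      have bM: "b \<in> carrier M" using b by simp
      have V: "openin ?T ?V" and nb: "\<And>Q. Q \<in> ?V \<Longrightarrow> b \<notin> Q"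
        using b openin_basic_open by (auto simp: basic_open_def)
      let ?\<beta> = "\<lambda>Q\<in>?V. fraction M (carrier M - Q) \<one>\<^bsub>M\<^esub> b"
      have \<beta>: "?\<beta> \<in> sect (Spec M) ?V" by (rule Spec_sectI[OF M V _ _ nb]) (use b in auto)
      have key: "fraction M (carrier M - Q) \<one>\<^bsub>M\<^esub> b \<otimes>\<^bsub>localization M (carrier M - Q)\<^esub> fraction M (carrier M - Q) b \<one>\<^bsub>M\<^esub> =
           fraction M (carrier M - Q) \<one>\<^bsub>M\<^esub> \<one>\<^bsub>M\<^esub>"
        if Q: "Q \<in> ?V" for Q
      proof -
        interpret L: localizing M "carrier M - Q" by (rule loc[OF Q V])
        show ?thesis
        proof -
          have bS: "b \<in> carrier M - Q" using b nb[OF Q] by simp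
          have bM: "b \<in> carrier M" using b by simp
          have "fraction M (carrier M - Q) (\<one>\<^bsub>M\<^esub> \<otimes>\<^bsub>M\<^esub> b) (b \<otimes>\<^bsub>M\<^esub> \<one>\<^bsub>M\<^esub>) = fraction M (carrier M - Q) \<one>\<^bsub>M\<^esub> \<one>\<^bsub>M\<^esub>"
            by (rule L.fraction_eqI[OF _ L.S_mult[OF bS one_S[OF Q V]] _ one_S[OF Q V]]) (use bM in simp_all)
          thus ?thesis using L.fraction_mult[OF M.one_closed bS bM one_S[OF Q V]] by simp
        qed
      qed
      have "mul (Spec M) ?V ?\<beta> (\<tau> b ?V) = neutral (Spec M) ?V"
        unfolding neutral[OF V] \<tau>_def by (rule ext) (simp add: restrict_def key)
      from arg_cong[OF this, of "\<phi> ?V"]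
      have "mul X (pre ?V) (\<phi> ?V ?\<beta>) (\<phi> ?V (\<tau> b ?V)) = neutral X (pre ?V)"
        unfolding \<phi>_hom[OF V \<beta> \<tau>[OF bM V]] \<phi>_one[OF V] .
      hence "mul X (pre ?V) (\<phi> ?V ?\<beta>) (restr X U (pre ?V) (g b)) = neutral X (pre ?V)"
        unfolding g_restr[OF bM V] .
      hence "restr X U (pre ?V) (g b) \<in> Units (secmon X (pre ?V))"
        using open_pre[OF V] \<phi>_closed[OF V \<beta>] b g_closed U pre_sub
        by (intro X.unitI[of _ _ "\<phi> ?V ?\<beta>"]) auto
      moreover have yV: "y \<in> pre ?V" using y b pr[OF y] by (simp add: pre_def basic_open_def)
      ultimately have "germ X y (pre ?V) (restr X U (pre ?V) (g b)) \<in> Units (stalk X y)"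
        using X.germ_unit[OF open_pre[OF V]] by simp
      thus ?thesis using X.germ_restr[OF U open_pre[OF V] pre_sub yV g_closed] b by simp
    qed
    show "\<exists>a\<in>carrier M. \<exists>b\<in>carrier M - h y. germ X y U (g b) \<otimes>\<^bsub>stalk X y\<^esub> A = germ X y U (g a)"
      if y: "y \<in> U" and A: "A \<in> stalk_set X y" for y A
    proof -
      obtain W t where W: "openin (pspace X) W" "y \<in> W" "W \<subseteq> U" "t \<in> sect X W" "A = germ X y W t"
        using A U y by (rule X.stalk_set_withinE)
      have hW: "openin ?T (h ` W)" using open_img W by simp
      obtain \<sigma> where \<sigma>: "\<sigma> \<in> sect (Spec M) (h ` W)" "\<phi> (h ` W) \<sigma> = t"
        using \<phi>_surj[OF hW, of t] W pre_img by auto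
      obtain V a b where V: "openin ?T V" "h y \<in> V" "V \<subseteq> h ` W" and ab: "a \<in> carrier M" "b \<in> carrier M"
        and nb: "\<And>Q. Q \<in> V \<Longrightarrow> b \<notin> Q" and frac: "\<And>Q. Q \<in> V \<Longrightarrow> \<sigma> Q = fraction M (carrier M - Q) a b"
        by (rule Spec_sectE[OF \<sigma>(1) imageI[OF W(2)]]) blast
      have \<sigma>V: "restrict \<sigma> V = (\<lambda>Q\<in>V. fraction M (carrier M - Q) a b)"
        using frac by (auto intro!: restrict_ext)
      have s\<sigma>: "restrict \<sigma> V \<in> sect (Spec M) V"
        unfolding \<sigma>V by (rule Spec_sectI[OF M V(1) ab nb])
      have key: "fraction M (carrier M - Q) b \<one>\<^bsub>M\<^esub> \<otimes>\<^bsub>localization M (carrier M - Q)\<^esub> fraction M (carrier M - Q) a b =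
           fraction M (carrier M - Q) a \<one>\<^bsub>M\<^esub>"
        if Q: "Q \<in> V" for Q
      proof -
        interpret L: localizing M "carrier M - Q" by (rule loc[OF Q V(1)])
        show ?thesis
        proof -
          have bS: "b \<in> carrier M - Q" using ab nb[OF Q] by simp
          have "fraction M (carrier M - Q) (b \<otimes>\<^bsub>M\<^esub> a) (\<one>\<^bsub>M\<^esub> \<otimes>\<^bsub>M\<^esub> b) = fraction M (carrier M - Q) a \<one>\<^bsub>M\<^esub>"
            by (rule L.fraction_eqI[OF _ L.S_mult[OF one_S[OF Q V(1)] bS] _ one_S[OF Q V(1)]]) (use ab in simp_all)
          thus ?thesis using L.fraction_mult[OF ab(2) one_S[OF Q V(1)] ab(1) bS] by simp
        qed
      qed
      \<comment> \<open>Near \<open>h y\<close> the section is a single fraction \<open>a/b\<close>,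
        so multiplication by \<open>b/1\<close> leaves \<open>a/1\<close>.\<close>
      have "mul (Spec M) V (\<tau> b V) (restrict \<sigma> V) = \<tau> a V"
        unfolding \<sigma>V \<tau>_def by (rule ext) (simp add: restrict_def key)
      from arg_cong[OF this, of "\<phi> V"]
      have "mul X (pre V) (\<phi> V (\<tau> b V)) (\<phi> V (restrict \<sigma> V)) = \<phi> V (\<tau> a V)"
        unfolding \<phi>_hom[OF V(1) \<tau>[OF ab(2) V(1)] s\<sigma>] .
      moreover have "\<phi> V (restrict \<sigma> V) = restr X W (pre V) t"
        using \<phi>_nat[OF hW V(1,3) \<sigma>(1)] \<sigma>(2) W(3) pre_img by simp
      ultimately have eq: "mul X (pre V) (restr X U (pre V) (g b)) (restr X W (pre V) t) = restr X U (pre V) (g a)"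
        unfolding g_restr[OF ab(1) V(1)] g_restr[OF ab(2) V(1)] by simp
      have pV: "pre V \<subseteq> W" using V(3) W(3) pre_img[OF W(3)] by (auto simp: pre_def)
      have yV: "y \<in> pre V" using y V(2) by (simp add: pre_def)
      note o = open_pre[OF V(1)]
      have "germ X y U (g b) \<otimes>\<^bsub>stalk X y\<^esub> A =
          germ X y (pre V) (restr X U (pre V) (g b)) \<otimes>\<^bsub>stalk X y\<^esub> germ X y (pre V) (restr X W (pre V) t)"
        using X.germ_restr[OF U o pre_sub yV g_closed[OF ab(2)]] X.germ_restr[OF W(1) o pV yV W(4)] W(5) by simp
      also have "\<dots> = germ X y (pre V) (restr X U (pre V) (g a))"
        using X.germ_mult_same[OF o yV] eq U W o pre_sub pV g_closed ab by simp
      also have "\<dots> = germ X y U (g a)" using X.germ_restr[OF U o pre_sub yV g_closed[OF ab(1)]] .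
      finally have "germ X y U (g b) \<otimes>\<^bsub>stalk X y\<^esub> A = germ X y U (g a)" .
      moreover have "b \<in> carrier M - h y" using ab(2) nb[OF V(2)] by simp
      ultimately show ?thesis using ab(1) by (rule_tac bexI[of _ a], rule_tac bexI[of _ b])
    qed
    show "\<exists>s\<in>carrier M - h y. s \<otimes>\<^bsub>M\<^esub> a = s \<otimes>\<^bsub>M\<^esub> b"
      if y: "y \<in> U" and ab: "a \<in> carrier M" "b \<in> carrier M" and eq: "germ X y U (g a) = germ X y U (g b)" for y a b
    proof -
      obtain W where W: "openin (pspace X) W" "y \<in> W" "W \<subseteq> U" "restr X U W (g a) = restr X U W (g b)"
        using eq U y g_closed[OF ab(1)] by (rule X.germ_eqE)
      have hW: "openin ?T (h ` W)" using open_img W by simp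
      have "\<phi> (h ` W) (\<tau> a (h ` W)) = \<phi> (h ` W) (\<tau> b (h ` W))"
        using g_restr[OF ab(1) hW] g_restr[OF ab(2) hW] W pre_img[OF W(3)] by simp
      hence "\<tau> a (h ` W) = \<tau> b (h ` W)" by (rule \<phi>_inj[OF hW \<tau>[OF ab(1) hW] \<tau>[OF ab(2) hW]])
      \<comment> \<open>Evaluation at the prime \<open>h y\<close> itself reduces equality of
        sections to equality of two fractions in one localization.\<close>
      from fun_cong[OF this, of "h y"] have "fraction M (carrier M - h y) a \<one>\<^bsub>M\<^esub> = fraction M (carrier M - h y) b \<one>\<^bsub>M\<^esub>"
        using W(2) by (simp add: \<tau>_def)
      moreover have "h y \<in> h ` W" using W(2) by simp
      ultimately show ?thesis
        using localizing.fraction_eq_iff[OF loc[OF _ hW]] one_S[OF _ hW] ab by auto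
    qed
  qed
  thus ?thesis by blast
qed

locale monoid_scheme = cmonoid_sheaf X for X :: "('p, 'a) monoid_presheaf" +
  assumes is_monoid_scheme: "is_monoid_scheme X"
begin

lemma affine_chart_exists:
  assumes "x \<in> topspace (pspace X)"
  obtains U M h g where "x \<in> U" "affine_chart X M U h g"
  using assms is_monoid_scheme affine_chart_of_iso[OF cmonoid_sheaf_axioms] unfolding is_monoid_scheme_def by meson

section \<open>Maps between stalks of comparable points\<close>

lemma stalk_map_germ:
  assumes le: "point_le X x y" and U: "openin (pspace X) U" "y \<in> U" "s \<in> sect X U"
  shows "stalk_map X x (germ X y U s) = germ X x U s"
proof -
  have "germ X x V t = germ X x U s" if "(V, t) \<in> germ X y U s" for V t
  proof -
    from that obtain W where W: "openin (pspace X) W" "y \<in> W" "W \<subseteq> U" "W \<subseteq> V"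
      "restr X U W s = restr X V W t" "openin (pspace X) V" "t \<in> sect X V"
      by (auto simp: germ_mem_iff)
    show ?thesis
      by (rule germ_eqI[of V t U s W]) (use W U point_le_open[OF le W(1,2)] in auto)
  qed
  hence "stalk_map X x (germ X y U s) = (\<Union>p\<in>germ X y U s. germ X x U s)"
    unfolding stalk_map_def by (intro SUP_cong refl) auto
  also have "\<dots> = germ X x U s" using germ_self[OF U] by blast
  finally show ?thesis .
qed

lemma point_le_topspace: "point_le X x y \<Longrightarrow> x \<in> topspace (pspace X)" "point_le X x y \<Longrightarrow> y \<in> topspace (pspace X)"
  by (simp_all add: point_le_iff)

lemma stalk_map_closed:
  assumes "point_le X x y" "A \<in> stalk_set X y" shows "stalk_map X x A \<in> stalk_set X x"
proof -
  obtain U s where U: "openin (pspace X) U" "y \<in> U" "s \<in> sect X U" "A = germ X y U s"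
    using assms(2) by (rule stalk_setE)
  thus ?thesis using stalk_map_germ[OF assms(1)] point_le_open[OF assms(1)] by auto
qed

lemma stalk_map_mult:
  assumes le: "point_le X x y" and "A \<in> stalk_set X y" "B \<in> stalk_set X y"
  shows "stalk_map X x (A \<otimes>\<^bsub>stalk X y\<^esub> B) = stalk_map X x A \<otimes>\<^bsub>stalk X x\<^esub> stalk_map X x B"
proof -
  obtain U s t where U: "openin (pspace X) U" "y \<in> U" "s \<in> sect X U" "t \<in> sect X U"
    "A = germ X y U s" "B = germ X y U t"
    using assms(2,3) openin_topspace point_le_topspace(2)[OF le] by (rule stalk_pairE)
  thus ?thesis using point_le_open[OF le U(1,2)] by (simp add: germ_mult_same stalk_map_germ[OF le])
qed

lemma stalk_map_one:
  assumes le: "point_le X x y" shows "stalk_map X x \<one>\<^bsub>stalk X y\<^esub> = \<one>\<^bsub>stalk X x\<^esub>"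
  using stalk_map_germ[OF le openin_topspace point_le_topspace(2)[OF le] neutral_closed[OF openin_topspace]]
  by (simp add: germ_neutral point_le_topspace[OF le])

lemma stalk_map_comp:
  assumes "point_le X x y" "point_le X y z" "A \<in> stalk_set X z"
  shows "stalk_map X x (stalk_map X y A) = stalk_map X x A"
proof -
  obtain U s where U: "openin (pspace X) U" "z \<in> U" "s \<in> sect X U" "A = germ X z U s"
    using assms(3) by (rule stalk_setE)
  have "y \<in> U" using point_le_open[OF assms(2)] U by blast
  thus ?thesis using U assms point_le_trans[OF assms(1,2)] by (simp add: stalk_map_germ)
qed

text \<open>In a chart around \<open>y\<close>, which also contains \<open>x\<close>, both stalks
  are localizations of \<open>M\<close>, at the complements of the primes \<open>h x\<close> and
  \<open>h y\<close> with \<open>h x\<close> contained in \<open>h y\<close>. The germs at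
  \<open>y\<close> of elements outside \<open>h x\<close> are the denominators: they become units at
  \<open>x\<close>.\<close>

lemma stalk_localization_map:
  assumes le: "point_le X x y"
  shows "localization_map (stalk X y) (stalk X x) (stalk_map X x)"
proof -
  have xy: "x \<in> topspace (pspace X)" "y \<in> topspace (pspace X)" using point_le_topspace[OF le] by auto
  interpret Sx: comm_monoid "stalk X x" by (rule stalk_comm_monoid[OF xy(1)])
  interpret Sy: comm_monoid "stalk X y" by (rule stalk_comm_monoid[OF xy(2)])
  obtain U M h g where y: "y \<in> U" and ch: "affine_chart X M U h g"
    using affine_chart_exists[OF xy(2)] .
  interpret C: affine_chart X M U h g by fact
  have x: "x \<in> U" using point_le_open[OF le C.open_chart y] .
  have hxy: "h x \<subseteq> h y" using C.h_le[OF y x] le by simp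
  let ?f = "stalk_map X x"
  let ?x = "\<lambda>a. germ X x U (g a)" and ?y = "\<lambda>a. germ X y U (g a)"
  have yc: "?y a \<in> stalk_set X y" and xc: "?x a \<in> stalk_set X x" if "a \<in> carrier M" for a
    using C.g_closed[OF that] C.open_chart x y by auto
  have fy: "?f (?y a) = ?x a" if "a \<in> carrier M" for a
    using stalk_map_germ[OF le C.open_chart y C.g_closed[OF that]] .
  have xm: "?x (a \<otimes>\<^bsub>M\<^esub> b) = ?x a \<otimes>\<^bsub>stalk X x\<^esub> ?x b" and ym: "?y (a \<otimes>\<^bsub>M\<^esub> b) = ?y a \<otimes>\<^bsub>stalk X y\<^esub> ?y b"
    if "a \<in> carrier M" "b \<in> carrier M" for a b
    using that C.g_closed C.open_chart x y by (simp_all add: germ_mult_same C.g_mult)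
  show ?thesis
    unfolding localization_map_def
  proof (intro conjI ballI impI)
    show "?f \<in> hom (stalk X y) (stalk X x)"
      by (auto simp: hom_def stalk_map_closed[OF le] stalk_map_mult[OF le])
    show "?f \<one>\<^bsub>stalk X y\<^esub> = \<one>\<^bsub>stalk X x\<^esub>" by (rule stalk_map_one[OF le])
  next
    fix B assume "B \<in> carrier (stalk X x)"
    then obtain a b where ab: "a \<in> carrier M" "b \<in> carrier M - h x" "?x b \<otimes>\<^bsub>stalk X x\<^esub> B = ?x a"
      using C.g_surj[OF x, of B] by auto
    show "\<exists>a\<in>carrier (stalk X y). \<exists>s\<in>carrier (stalk X y). ?f s \<in> Units (stalk X x) \<and> ?f s \<otimes>\<^bsub>stalk X x\<^esub> B = ?f a"
      using ab C.g_unit[OF x ab(2)] fy yc by (intro bexI[of _ "?y a"] bexI[of _ "?y b"]) auto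
  next
    fix A B assume A: "A \<in> carrier (stalk X y)" and B: "B \<in> carrier (stalk X y)" and eq: "?f A = ?f B"
    obtain a s where a: "a \<in> carrier M" "s \<in> carrier M - h y" "?y s \<otimes>\<^bsub>stalk X y\<^esub> A = ?y a"
      using C.g_surj[OF y, of A] A by auto
    obtain b t where b: "b \<in> carrier M" "t \<in> carrier M - h y" "?y t \<otimes>\<^bsub>stalk X y\<^esub> B = ?y b"
      using C.g_surj[OF y, of B] B by auto
    note [simp] = a(1) b(1) Sy.Units_closed Sx.Units_closed
    have s[simp]: "s \<in> carrier M" and t[simp]: "t \<in> carrier M" using a b by auto
    have yU: "?y s \<in> Units (stalk X y)" "?y t \<in> Units (stalk X y)" using C.g_unit[OF y] a b by auto
    have AB: "A \<in> stalk_set X y" "B \<in> stalk_set X y" using A B by auto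
    have fa: "?x a = ?x s \<otimes>\<^bsub>stalk X x\<^esub> ?f A" using stalk_map_mult[OF le yc[OF s] AB(1)] a(3) fy by simp
    have fb: "?x b = ?x t \<otimes>\<^bsub>stalk X x\<^esub> ?f B" using stalk_map_mult[OF le yc[OF t] AB(2)] b(3) fy by simp
    have fc: "?f A \<in> carrier (stalk X x)" "?f B \<in> carrier (stalk X x)"
      "?x s \<in> carrier (stalk X x)" "?x t \<in> carrier (stalk X x)"
      using stalk_map_closed[OF le] AB xc by auto
    have "?x (t \<otimes>\<^bsub>M\<^esub> a) = ?x (s \<otimes>\<^bsub>M\<^esub> b)"
      using fc eq by (simp add: xm fa fb Sx.m_lcomm del: carrier_stalk)
    then obtain r where r: "r \<in> carrier M - h x" "r \<otimes>\<^bsub>M\<^esub> (t \<otimes>\<^bsub>M\<^esub> a) = r \<otimes>\<^bsub>M\<^esub> (s \<otimes>\<^bsub>M\<^esub> b)"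
      using C.g_inj[OF x, of "t \<otimes>\<^bsub>M\<^esub> a" "s \<otimes>\<^bsub>M\<^esub> b"] by auto
    have rM[simp]: "r \<in> carrier M" using r by auto
    have yc': "?y r \<in> carrier (stalk X y)" "?y s \<in> carrier (stalk X y)" "?y t \<in> carrier (stalk X y)"
      using yc by auto
    \<comment> \<open>The equation obtained at \<open>x\<close> holds in \<open>M\<close> after
      multiplication by \<open>r\<close>, hence also between germs at \<open>y\<close>.\<close>
    have "?y r \<otimes>\<^bsub>stalk X y\<^esub> (?y t \<otimes>\<^bsub>stalk X y\<^esub> (?y s \<otimes>\<^bsub>stalk X y\<^esub> A)) =
        ?y r \<otimes>\<^bsub>stalk X y\<^esub> (?y s \<otimes>\<^bsub>stalk X y\<^esub> (?y t \<otimes>\<^bsub>stalk X y\<^esub> B))"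
      using r(2) ym[of r "t \<otimes>\<^bsub>M\<^esub> a"] ym[of r "s \<otimes>\<^bsub>M\<^esub> b"] ym[of t a] ym[of s b] a(3) b(3) by simp
    hence "(?y s \<otimes>\<^bsub>stalk X y\<^esub> ?y t) \<otimes>\<^bsub>stalk X y\<^esub> (?y r \<otimes>\<^bsub>stalk X y\<^esub> A) =
        (?y s \<otimes>\<^bsub>stalk X y\<^esub> ?y t) \<otimes>\<^bsub>stalk X y\<^esub> (?y r \<otimes>\<^bsub>stalk X y\<^esub> B)"
      using A B yc' by (simp add: Sy.m_ac del: carrier_stalk)
    \<comment> \<open>The germs of \<open>s\<close> and \<open>t\<close> are units at
      \<open>y\<close> and cancel. The factor \<open>r\<close> lies outside \<open>h x\<close> only;
      it is a unit at \<open>x\<close> and stays as the required multiplier.\<close>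
    hence "?y r \<otimes>\<^bsub>stalk X y\<^esub> A = ?y r \<otimes>\<^bsub>stalk X y\<^esub> B"
      using Sy.Units_l_cancel[of "?y s \<otimes>\<^bsub>stalk X y\<^esub> ?y t"] yU A B yc'
      by (metis Sy.Units_m_closed Sy.m_closed)
    thus "\<exists>s\<in>carrier (stalk X y). ?f s \<in> Units (stalk X x) \<and> s \<otimes>\<^bsub>stalk X y\<^esub> A = s \<otimes>\<^bsub>stalk X y\<^esub> B"
      using C.g_unit[OF x r(1)] fy[OF rM] yc[OF rM] by (intro bexI[of _ "?y r"]) auto
  qed
qed

end

lemma monoid_schemeI: "is_monoid_scheme X \<Longrightarrow> monoid_scheme X"
  by (simp add: monoid_scheme_def monoid_scheme_axioms_def cmonoid_sheafI is_monoid_scheme_def)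

section \<open>Generic points and s-cancellative monoid schemes\<close>

text \<open>The complement of \<open>Q\<close> is the saturation of the submonoid generated by \<open>c\<close> and the
  complement of \<open>P\<close>, so that \<open>Q\<close> is the closed point of \<open>D(c)\<close> in the spectrum of the
  localization at \<open>P\<close>.\<close>

lemma prime_avoiding:
  fixes M :: "'a monoid" (structure)
  assumes M: "comm_monoid M" and P: "prime_monoid_ideal M P" and c: "c \<in> carrier M"
  obtains Q where "prime_monoid_ideal M Q" "Q \<subseteq> P" "c \<notin> Q"
    "\<And>s. s \<in> carrier M - Q \<Longrightarrow> \<exists>k::nat. \<exists>t\<in>carrier M - P. \<exists>r\<in>carrier M. s \<otimes> r = c [^] k \<otimes> t"
proof -
  interpret comm_monoid M by fact
  interpret P: submonoid "carrier M - P" M using P by (simp add: prime_monoid_ideal_def)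
  define R where "R = (\<lambda>s. \<exists>k::nat. \<exists>t\<in>carrier M - P. \<exists>r\<in>carrier M. s \<otimes> r = c [^] k \<otimes> t)"
  define Q where "Q = {s \<in> carrier M. \<not> R s}"
  have PM: "P \<subseteq> carrier M" using P by (simp add: prime_monoid_ideal_def)
  have RI: "R s" if "t \<in> carrier M - P" "r \<in> carrier M" "s \<otimes> r = c [^] (k::nat) \<otimes> t" for s k t r
    unfolding R_def using that by blast
  have "prime_monoid_ideal M Q"
    unfolding prime_monoid_ideal_def
  proof (intro conjI ballI)
    show "Q \<subseteq> carrier M" by (auto simp: Q_def)
    fix i m assume i: "i \<in> Q" and m: "m \<in> carrier M"
    show "i \<otimes> m \<in> Q"
    proof (rule ccontr)
      assume "i \<otimes> m \<notin> Q"
      hence "R (i \<otimes> m)" using i m by (simp add: Q_def)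
      then obtain k :: nat and t r where *: "t \<in> carrier M - P" "r \<in> carrier M" "i \<otimes> m \<otimes> r = c [^] k \<otimes> t"
        unfolding R_def by blast
      have "R i" by (rule RI[of t "m \<otimes> r" i k]) (use * i m in \<open>auto simp: Q_def m_assoc\<close>)
      thus False using i by (simp add: Q_def)
    qed
  next
    show "submonoid (carrier M - Q) M"
    proof
      show "carrier M - Q \<subseteq> carrier M" by blast
      have "R \<one>" by (rule RI[of \<one> \<one> \<one> 0]) (use P.one_closed in auto)
      thus "\<one> \<in> carrier M - Q" by (simp add: Q_def)
      fix x y assume x: "x \<in> carrier M - Q" and y: "y \<in> carrier M - Q"
      then obtain k :: nat and t r where *: "t \<in> carrier M - P" "r \<in> carrier M" "x \<otimes> r = c [^] k \<otimes> t"
        unfolding Q_def R_def by blast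
      from y obtain k' :: nat and t' r' where **: "t' \<in> carrier M - P" "r' \<in> carrier M" "y \<otimes> r' = c [^] k' \<otimes> t'"
        unfolding Q_def R_def by blast
      have [simp]: "t \<in> carrier M" "t' \<in> carrier M" "x \<in> carrier M" "y \<in> carrier M" using * ** x y by auto
      note [simp] = *(2) **(2) c
      have "(x \<otimes> y) \<otimes> (r \<otimes> r') = (x \<otimes> r) \<otimes> (y \<otimes> r')" by (simp add: m_ac)
      also have "\<dots> = (c [^] k \<otimes> c [^] k') \<otimes> (t \<otimes> t')" unfolding *(3) **(3) by (simp add: m_ac)
      also have "c [^] k \<otimes> c [^] k' = c [^] (k + k')" by (simp add: nat_pow_mult)
      finally have "R (x \<otimes> y)" by (intro RI[of "t \<otimes> t'" "r \<otimes> r'"]) (use *(1) **(1) P.m_closed in auto)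
      thus "x \<otimes> y \<in> carrier M - Q" by (simp add: Q_def)
    qed
  qed
  moreover have "Q \<subseteq> P"
  proof
    fix m assume m: "m \<in> Q"
    show "m \<in> P"
    proof (rule ccontr)
      assume "m \<notin> P"
      \<comment> \<open>Exponent 0 and cofactor 1: the complement of \<open>P\<close> consists of
        divisors of its own elements.\<close>
      hence "R m" by (intro RI[of m \<one> m 0]) (use m P.one_closed in \<open>auto simp: Q_def\<close>)
      thus False using m by (simp add: Q_def)
    qed
  qed
  moreover have "R c" by (rule RI[of \<one> \<one> c 1]) (use c P.one_closed in auto)
  hence "c \<notin> Q" by (simp add: Q_def)
  moreover have "\<exists>k::nat. \<exists>t\<in>carrier M - P. \<exists>r\<in>carrier M. s \<otimes> r = c [^] k \<otimes> t"
    if "s \<in> carrier M - Q" for s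
    using that by (simp add: Q_def R_def)
  ultimately show ?thesis by (rule that)
qed

lemma (in comm_monoid) unit_of_product:
  assumes "x \<in> carrier G" "y \<in> carrier G" "x \<otimes> y \<in> Units G"
  shows "y \<in> Units G"
proof -
  have "(inv (x \<otimes> y) \<otimes> x) \<otimes> y = \<one>" using assms by (simp add: m_assoc)
  moreover have "inv (x \<otimes> y) \<otimes> x \<in> carrier G" using assms by simp
  ultimately show ?thesis using assms(2) m_comm unfolding Units_def by fastforce
qed

section \<open>Least generizations and s-regularity of all elements\<close>

context monoid_scheme
begin

text \<open>Within a chart the order is inclusion of primes and \<open>h\<close> is injective. This
  makes the generic point below a given point unique.\<close>

lemma point_le_antisym:
  assumes "point_le X x y" "point_le X y x" shows "x = y"
proof -
  obtain U M h g where y: "y \<in> U" and ch: "affine_chart X M U h g"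
    using affine_chart_exists[OF point_le_topspace(2)[OF assms(1)]] .
  interpret C: affine_chart X M U h g by fact
  have x: "x \<in> U" using point_le_open[OF assms(1) C.open_chart y] .
  have "h x = h y" using C.h_le[OF y x] C.h_le[OF x y] assms by blast
  thus ?thesis using C.h_inj x y by (simp add: inj_on_def)
qed

text \<open>The point of a chart with empty prime ideal lies below every point of the chart. All of
  \<open>M\<close> lies in the complement of the empty ideal, so every germ there is a quotient of
  two invertible ones.\<close>

lemma generic_point_exists:
  assumes "y \<in> topspace (pspace X)"
  shows "\<exists>\<eta>. point_le X \<eta> y \<and> (\<forall>z. point_le X z y \<longrightarrow> point_le X \<eta> z) \<and>
    stalk_set X \<eta> \<subseteq> Units (stalk X \<eta>)"
proof -
  obtain U M h g where y: "y \<in> U" and ch: "affine_chart X M U h g"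
    using affine_chart_exists[OF assms] .
  interpret C: affine_chart X M U h g by fact
  have "prime_monoid_ideal M {}"
    by (auto simp: prime_monoid_ideal_def intro!: submonoid.intro)
  then obtain \<eta> where \<eta>: "\<eta> \<in> U" "h \<eta> = {}" using C.h_surj by blast
  have "point_le X \<eta> z" if "point_le X z y" for z
    using C.h_le[OF point_le_open[OF that C.open_chart y] \<eta>(1)] \<eta>(2) by simp
  moreover have "point_le X \<eta> y" using C.h_le[OF y \<eta>(1)] \<eta>(2) by simp
  moreover have "stalk_set X \<eta> \<subseteq> Units (stalk X \<eta>)"
  proof
    fix A assume A: "A \<in> stalk_set X \<eta>"
    interpret S: comm_monoid "stalk X \<eta>"
      using C.open_chart \<eta>(1) openin_subset by (intro stalk_comm_monoid) blast
    obtain a b where ab: "a \<in> carrier M" "b \<in> carrier M - h \<eta>"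
      "germ X \<eta> U (g b) \<otimes>\<^bsub>stalk X \<eta>\<^esub> A = germ X \<eta> U (g a)"
      using C.g_surj[OF \<eta>(1) A] by blast
    have "germ X \<eta> U (g a) \<in> Units (stalk X \<eta>)" "germ X \<eta> U (g b) \<in> Units (stalk X \<eta>)"
      using C.g_unit[OF \<eta>(1)] ab \<eta>(2) by auto
    thus "A \<in> Units (stalk X \<eta>)"
      using S.unit_of_product[of "germ X \<eta> U (g b)" A] ab(3) A S.Units_closed by simp
  qed
  ultimately show ?thesis by blast
qed

text \<open>Writing \<open>u\<close> and \<open>v\<close> as fractions with numerators
  \<open>a\<close> and \<open>a'\<close>, the prime \<open>Q\<close> supplied by
  \<open>prime_avoiding\<close> for \<open>a a'\<close> defines the generization \<open>z\<close> at
  which both become units. They agree at the generic point, hence at \<open>z\<close> by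
  s-cancellativity, and the description of the complement of \<open>Q\<close> turns agreement at
  \<open>z\<close> into agreement at \<open>y\<close> after multiplication by a power of
  \<open>u v\<close>.\<close>

lemma s_cancellative_sreg:
  assumes sc: "s_cancellative X" and y: "y \<in> topspace (pspace X)" and w: "w \<in> stalk_set X y"
  shows "w \<in> sreg (stalk X y)"
proof -
  obtain U M h g where yU: "y \<in> U" and ch: "affine_chart X M U h g"
    using affine_chart_exists[OF y] .
  interpret C: affine_chart X M U h g by fact
  interpret S: comm_monoid "stalk X y" by (rule stalk_comm_monoid[OF y])
  have "\<exists>n::nat. u \<otimes>\<^bsub>stalk X y\<^esub> (u \<otimes>\<^bsub>stalk X y\<^esub> v) [^]\<^bsub>stalk X y\<^esub> n = v \<otimes>\<^bsub>stalk X y\<^esub> (u \<otimes>\<^bsub>stalk X y\<^esub> v) [^]\<^bsub>stalk X y\<^esub> n"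
    if u: "u \<in> stalk_set X y" and v: "v \<in> stalk_set X y"
      and eq: "w [^]\<^bsub>stalk X y\<^esub> m \<otimes>\<^bsub>stalk X y\<^esub> u = w [^]\<^bsub>stalk X y\<^esub> m \<otimes>\<^bsub>stalk X y\<^esub> v" for u v and m :: nat
  proof -
    let ?y = "\<lambda>a. germ X y U (g a)"
    obtain a b where ab: "a \<in> carrier M" "b \<in> carrier M - h y" "?y b \<otimes>\<^bsub>stalk X y\<^esub> u = ?y a"
      using C.g_surj[OF yU u] by blast
    obtain a' b' where ab': "a' \<in> carrier M" "b' \<in> carrier M - h y" "?y b' \<otimes>\<^bsub>stalk X y\<^esub> v = ?y a'"
      using C.g_surj[OF yU v] by blast
    have bM: "b \<in> carrier M" "b' \<in> carrier M" using ab ab' by auto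
    \<comment> \<open>Up to the denominators \<open>b b'\<close>, which are units at
      \<open>y\<close>, this element of the chart represents \<open>u v\<close>.\<close>
    let ?c = "a \<otimes>\<^bsub>M\<^esub> a'"
    obtain Q where Q: "prime_monoid_ideal M Q" "Q \<subseteq> h y" "?c \<notin> Q"
      and QR: "\<And>s. s \<in> carrier M - Q \<Longrightarrow> \<exists>k::nat. \<exists>t\<in>carrier M - h y. \<exists>r\<in>carrier M. s \<otimes>\<^bsub>M\<^esub> r = ?c [^]\<^bsub>M\<^esub> k \<otimes>\<^bsub>M\<^esub> t"
      by (rule prime_avoiding[OF C.M.comm_monoid_axioms C.h_prime[OF yU], of ?c]) (use ab ab' in blast)+
    obtain z where z: "z \<in> U" "h z = Q" using C.h_surj[OF Q(1)] by blast
    have le: "point_le X z y" using C.h_le[OF yU z(1)] z(2) Q(2) by simp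
    interpret Z: comm_monoid "stalk X z" by (rule stalk_comm_monoid[OF point_le_topspace(1)[OF le]])
    let ?z = "\<lambda>a. germ X z U (g a)" and ?f = "stalk_map X z"
    have yc: "?y a \<in> stalk_set X y" and zc: "?z a \<in> stalk_set X z" if "a \<in> carrier M" for a
      using C.g_closed[OF that] C.open_chart yU z(1) by auto
    have fy: "?f (?y a) = ?z a" if "a \<in> carrier M" for a
      using stalk_map_germ[OF le C.open_chart yU C.g_closed[OF that]] .
    have zm: "?z (a \<otimes>\<^bsub>M\<^esub> b) = ?z a \<otimes>\<^bsub>stalk X z\<^esub> ?z b" and ym: "?y (a \<otimes>\<^bsub>M\<^esub> b) = ?y a \<otimes>\<^bsub>stalk X y\<^esub> ?y b"
      if "a \<in> carrier M" "b \<in> carrier M" for a b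
      using that C.g_closed C.open_chart z(1) yU by (simp_all add: germ_mult_same C.g_mult)
    have aQ: "a \<in> carrier M - Q" "a' \<in> carrier M - Q"
    proof -
      have ideal: "\<forall>i\<in>Q. \<forall>m\<in>carrier M. i \<otimes>\<^bsub>M\<^esub> m \<in> Q" using Q(1) by (simp add: prime_monoid_ideal_def)
      show "a \<in> carrier M - Q" using ideal Q(3) ab(1) ab'(1) by blast
      have "a' \<otimes>\<^bsub>M\<^esub> a \<notin> Q" using Q(3) C.M.m_comm[OF ab(1) ab'(1)] by simp
      thus "a' \<in> carrier M - Q" using ideal ab(1) ab'(1) by blast
    qed
    have fc: "?f u \<in> stalk_set X z" "?f v \<in> stalk_set X z" using stalk_map_closed[OF le] u v by auto
    have fu: "?z b \<otimes>\<^bsub>stalk X z\<^esub> ?f u = ?z a" using stalk_map_mult[OF le yc[OF bM(1)] u] ab fy bM by simp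
    have fv: "?z b' \<otimes>\<^bsub>stalk X z\<^esub> ?f v = ?z a'" using stalk_map_mult[OF le yc[OF bM(2)] v] ab' fy bM by simp
    have "?f u \<in> Units (stalk X z)" "?f v \<in> Units (stalk X z)"
      using Z.unit_of_product[of "?z b" "?f u"] Z.unit_of_product[of "?z b'" "?f v"] fu fv
        C.g_unit[OF z(1)] aQ z(2) zc bM fc by auto
    \<comment> \<open>The stalk at \<eta> is a group, so the image of \<open>w^m\<close> can be
      cancelled there.\<close>
    moreover obtain \<eta> where \<eta>: "point_le X \<eta> y" "\<And>z. point_le X z y \<Longrightarrow> point_le X \<eta> z"
      "stalk_set X \<eta> \<subseteq> Units (stalk X \<eta>)"
      using generic_point_exists[OF y] by blast
    have "stalk_map X \<eta> (?f u) = stalk_map X \<eta> (?f v)"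
    proof -
      interpret E: comm_monoid "stalk X \<eta>" by (rule stalk_comm_monoid[OF point_le_topspace(1)[OF \<eta>(1)]])
      have wm: "w [^]\<^bsub>stalk X y\<^esub> m \<in> stalk_set X y" using w S.nat_pow_closed[of w m] by simp
      have "stalk_map X \<eta> (w [^]\<^bsub>stalk X y\<^esub> m) \<otimes>\<^bsub>stalk X \<eta>\<^esub> stalk_map X \<eta> u =
          stalk_map X \<eta> (w [^]\<^bsub>stalk X y\<^esub> m) \<otimes>\<^bsub>stalk X \<eta>\<^esub> stalk_map X \<eta> v"
        using arg_cong[OF eq, of "stalk_map X \<eta>"] stalk_map_mult[OF \<eta>(1) wm] u v by simp
      hence "stalk_map X \<eta> u = stalk_map X \<eta> v"
        using E.Units_l_cancel[OF subsetD[OF \<eta>(3) stalk_map_closed[OF \<eta>(1) wm]]]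
          stalk_map_closed[OF \<eta>(1)] u v by simp
      thus ?thesis using stalk_map_comp[OF \<eta>(2)[OF le] le] u v by simp
    qed
    \<comment> \<open>The points \<eta> and \<open>z\<close> are comparable and both germs are units
      at \<open>z\<close>, so injectivity on units applies.\<close>
    ultimately have fuv: "?f u = ?f v"
      using sc \<eta>(2)[OF le] unfolding s_cancellative_def inj_on_def by blast
    have "?z (b' \<otimes>\<^bsub>M\<^esub> a) = ?z (b \<otimes>\<^bsub>M\<^esub> a')"
      using zm[OF bM(2) ab(1)] zm[OF bM(1) ab'(1)] fu fv fuv zc bM fc
        Z.m_lcomm[of "?z b'" "?z b" "?f u"] by simp
    then obtain s where s: "s \<in> carrier M - h z" "s \<otimes>\<^bsub>M\<^esub> (b' \<otimes>\<^bsub>M\<^esub> a) = s \<otimes>\<^bsub>M\<^esub> (b \<otimes>\<^bsub>M\<^esub> a')"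
      using C.g_inj[OF z(1), of "b' \<otimes>\<^bsub>M\<^esub> a" "b \<otimes>\<^bsub>M\<^esub> a'"] bM ab(1) ab'(1) by auto
    \<comment> \<open>The multiplier \<open>s\<close>, invertible only at \<open>z\<close>, divides
      \<open>c^k t\<close>; it may therefore be replaced by \<open>c^k t\<close>, in which
      \<open>t\<close> is a unit at \<open>y\<close>.\<close>
    obtain k :: nat and t r where t: "t \<in> carrier M - h y" "r \<in> carrier M" "s \<otimes>\<^bsub>M\<^esub> r = ?c [^]\<^bsub>M\<^esub> k \<otimes>\<^bsub>M\<^esub> t"
      using QR[of s] s z by blast
    have tM: "t \<in> carrier M" and sM: "s \<in> carrier M" using t s by auto
    note [simp] = bM tM sM ab(1) ab'(1) t(2)
    have "r \<otimes>\<^bsub>M\<^esub> (s \<otimes>\<^bsub>M\<^esub> (b' \<otimes>\<^bsub>M\<^esub> a)) = r \<otimes>\<^bsub>M\<^esub> (s \<otimes>\<^bsub>M\<^esub> (b \<otimes>\<^bsub>M\<^esub> a'))" using s(2) by simp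
    hence "(s \<otimes>\<^bsub>M\<^esub> r) \<otimes>\<^bsub>M\<^esub> (b' \<otimes>\<^bsub>M\<^esub> a) = (s \<otimes>\<^bsub>M\<^esub> r) \<otimes>\<^bsub>M\<^esub> (b \<otimes>\<^bsub>M\<^esub> a')" by (simp add: C.M.m_ac)
    hence e: "?c [^]\<^bsub>M\<^esub> k \<otimes>\<^bsub>M\<^esub> t \<otimes>\<^bsub>M\<^esub> (b' \<otimes>\<^bsub>M\<^esub> a) = ?c [^]\<^bsub>M\<^esub> k \<otimes>\<^bsub>M\<^esub> t \<otimes>\<^bsub>M\<^esub> (b \<otimes>\<^bsub>M\<^esub> a')" unfolding t(3) .
    define B where "B = ?y b \<otimes>\<^bsub>stalk X y\<^esub> ?y b'"
    define p where "p = u \<otimes>\<^bsub>stalk X y\<^esub> v"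
    have cS: "u \<in> carrier (stalk X y)" "v \<in> carrier (stalk X y)" "?y b \<in> carrier (stalk X y)"
      "?y b' \<in> carrier (stalk X y)" "?y t \<in> carrier (stalk X y)"
      using u v yc by auto
    have pS: "p \<in> carrier (stalk X y)" and BS: "B \<in> carrier (stalk X y)"
      unfolding p_def B_def using cS by (simp_all del: carrier_stalk)
    have Bu: "B \<in> Units (stalk X y)" "?y t \<in> Units (stalk X y)"
      using C.g_unit[OF yU] ab(2) ab'(2) t(1) by (auto simp: B_def)
    have yc_eq: "?y ?c = B \<otimes>\<^bsub>stalk X y\<^esub> p"
      using ym[OF ab(1) ab'(1)] cS by (simp add: ab(3)[symmetric] ab'(3)[symmetric] B_def p_def S.m_ac del: carrier_stalk)
    have gh: "(\<lambda>a. ?y a) \<in> hom M (stalk X y)" using ym yc by (auto simp: hom_def)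
    have g1: "?y \<one>\<^bsub>M\<^esub> = \<one>\<^bsub>stalk X y\<^esub>" using C.g_one germ_neutral[OF C.open_chart yU] by simp
    have yck: "?y (?c [^]\<^bsub>M\<^esub> k) = B [^]\<^bsub>stalk X y\<^esub> k \<otimes>\<^bsub>stalk X y\<^esub> p [^]\<^bsub>stalk X y\<^esub> k"
      using hom_one_pow[OF C.M.monoid_axioms S.monoid_axioms gh g1, of ?c k] yc_eq pS BS
      by (simp add: S.nat_pow_distrib del: carrier_stalk)
    \<comment> \<open>All unit factors at \<open>y\<close>: \<open>c^k\<close> contributes
      \<open>B^k\<close> and leaves \<open>p^k\<close>, while \<open>b' a\<close> and
      \<open>b a'\<close> contribute \<open>B\<close> and leave \<open>u\<close> and
      \<open>v\<close>. The exponent required by s-regularity is thus \<open>k\<close>.\<close>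
    define D where "D = B [^]\<^bsub>stalk X y\<^esub> k \<otimes>\<^bsub>stalk X y\<^esub> (?y t \<otimes>\<^bsub>stalk X y\<^esub> B)"
    have "B [^]\<^bsub>stalk X y\<^esub> k \<in> Units (stalk X y)" by (induction k) (use Bu in auto)
    hence D: "D \<in> Units (stalk X y)" unfolding D_def using Bu by simp
    have "?y (?c [^]\<^bsub>M\<^esub> k \<otimes>\<^bsub>M\<^esub> t \<otimes>\<^bsub>M\<^esub> (b' \<otimes>\<^bsub>M\<^esub> a)) = D \<otimes>\<^bsub>stalk X y\<^esub> (u \<otimes>\<^bsub>stalk X y\<^esub> p [^]\<^bsub>stalk X y\<^esub> k)"
      using cS pS BS ym[of "?c [^]\<^bsub>M\<^esub> k \<otimes>\<^bsub>M\<^esub> t" "b' \<otimes>\<^bsub>M\<^esub> a"] ym[of "?c [^]\<^bsub>M\<^esub> k" t] ym[of b' a] yck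
      by (simp add: ab(3)[symmetric] D_def B_def S.m_ac del: carrier_stalk)
    moreover have "?y (?c [^]\<^bsub>M\<^esub> k \<otimes>\<^bsub>M\<^esub> t \<otimes>\<^bsub>M\<^esub> (b \<otimes>\<^bsub>M\<^esub> a')) = D \<otimes>\<^bsub>stalk X y\<^esub> (v \<otimes>\<^bsub>stalk X y\<^esub> p [^]\<^bsub>stalk X y\<^esub> k)"
      using cS pS BS ym[of "?c [^]\<^bsub>M\<^esub> k \<otimes>\<^bsub>M\<^esub> t" "b \<otimes>\<^bsub>M\<^esub> a'"] ym[of "?c [^]\<^bsub>M\<^esub> k" t] ym[of b a'] yck
      by (simp add: ab'(3)[symmetric] D_def B_def S.m_ac del: carrier_stalk)
    ultimately have "D \<otimes>\<^bsub>stalk X y\<^esub> (u \<otimes>\<^bsub>stalk X y\<^esub> p [^]\<^bsub>stalk X y\<^esub> k) = D \<otimes>\<^bsub>stalk X y\<^esub> (v \<otimes>\<^bsub>stalk X y\<^esub> p [^]\<^bsub>stalk X y\<^esub> k)"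
      using e by simp
    hence "u \<otimes>\<^bsub>stalk X y\<^esub> p [^]\<^bsub>stalk X y\<^esub> k = v \<otimes>\<^bsub>stalk X y\<^esub> p [^]\<^bsub>stalk X y\<^esub> k"
      using S.Units_l_cancel[OF D] cS pS by (simp del: carrier_stalk)
    thus ?thesis unfolding p_def by blast
  qed
  thus ?thesis using w by (auto simp: sreg_def s_regular_def)
qed

end

section \<open>Quotients of presheaves of abelian groups\<close>

lemma units_presheaf_simps [simp]:
  "pspace (units_presheaf F) = pspace F"
  "sect (units_presheaf F) U = Units (secmon F U)"
  "restr (units_presheaf F) = restr F"
  "mul (units_presheaf F) = mul F"
  "neutral (units_presheaf F) = neutral F"
  by (simp_all add: units_presheaf_def)

lemma (in cmonoid_presheaf) secmon_units_presheaf: "secmon (units_presheaf F) U = units_of (secmon F U)"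
  by (simp add: secmon_def units_of_def units_presheaf_def)

lemma (in cmonoid_presheaf) units_presheaf_comm_group:
  "openin (pspace F) U \<Longrightarrow> comm_group (secmon (units_presheaf F) U)"
  unfolding secmon_units_presheaf by (rule comm_monoid.units_comm_group[OF secmon_comm_monoid])

lemma (in cmonoid_presheaf) units_presheaf: "cmonoid_presheaf (units_presheaf F)"
proof (intro cmonoid_presheaf.intro set_presheaf.intro cmonoid_presheaf_axioms.intro)
  show "is_presheaf (units_presheaf F)"
    unfolding is_presheaf_def by (auto simp del: split_paired_All)
  show "comm_monoid (secmon (units_presheaf F) U)" if "openin (pspace (units_presheaf F)) U" for U
    using units_presheaf_comm_group[of U] that by (simp add: comm_group_def)
qed auto

locale presheaf_quotient = cmonoid_presheaf F for F :: "('p, 's, 'z) monoid_presheaf_scheme" +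
  fixes H :: "'p set \<Rightarrow> 's set"
  assumes secmon_comm_group: "openin (pspace F) U \<Longrightarrow> comm_group (secmon F U)"
    and H_subgroup: "openin (pspace F) U \<Longrightarrow> subgroup (H U) (secmon F U)"
    and H_restr: "\<lbrakk>openin (pspace F) U; openin (pspace F) V; V \<subseteq> U; h \<in> H U\<rbrakk> \<Longrightarrow> restr F U V h \<in> H V"
begin

abbreviation "Q \<equiv> quotient_presheaf F H"

abbreviation "coset U f \<equiv> H U #>\<^bsub>secmon F U\<^esub> f"

lemma H_closed [simp]: "\<lbrakk>openin (pspace F) U; h \<in> H U\<rbrakk> \<Longrightarrow> h \<in> sect F U"
  using subgroup.mem_carrier[OF H_subgroup] by simp

lemma quotient_simps [simp]:
  "pspace Q = pspace F"
  "restr Q U V C = (\<Union>f\<in>C. coset V (restr F U V f))"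
  by (simp_all add: quotient_presheaf_def)

lemma secmon_quotient: "secmon Q U = secmon F U Mod H U"
  by (simp add: secmon_def quotient_presheaf_def FactGroup_def)

lemma H_normal: "openin (pspace F) U \<Longrightarrow> H U \<lhd> secmon F U"
  by (rule comm_group.normal_iff_subgroup[THEN iffD2, OF secmon_comm_group H_subgroup])

lemma coset_closed [simp]: "\<lbrakk>openin (pspace F) U; f \<in> sect F U\<rbrakk> \<Longrightarrow> coset U f \<in> sect Q U"
  using carrier_FactGroup[of "secmon F U" "H U"] secmon_quotient[of U]
  by (metis image_eqI secmon_simps(1))

lemma sect_quotientE:
  assumes "C \<in> sect Q U" obtains f where "f \<in> sect F U" "C = coset U f"
  using assms carrier_FactGroup[of "secmon F U" "H U"] secmon_quotient[of U]
  by (metis imageE secmon_simps(1))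

lemma coset_self: "\<lbrakk>openin (pspace F) U; f \<in> sect F U\<rbrakk> \<Longrightarrow> f \<in> coset U f"
  using subgroup.one_closed[OF H_subgroup[of U]] mul_neutral(1)[of U f] unfolding r_coset_def by fastforce

lemma coset_eqI:
  assumes U: "openin (pspace F) U" and g: "g \<in> sect F U" and h: "h \<in> H U" and f: "f = mul F U h g"
  shows "coset U f = coset U g"
proof -
  interpret G: comm_group "secmon F U" by (rule secmon_comm_group[OF U])
  have "coset U (h \<otimes>\<^bsub>secmon F U\<^esub> g) = coset U h #>\<^bsub>secmon F U\<^esub> g"
    using G.coset_mult_assoc[of "H U" h g] subgroup.subset[OF H_subgroup[OF U]] h g U by auto
  also have "coset U h = H U"
    by (rule G.coset_join2) (use h U H_subgroup in auto)
  finally show ?thesis using f by simp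
qed

lemma coset_eqE:
  assumes "coset U f = coset U g" "openin (pspace F) U" "f \<in> sect F U"
  obtains h where "h \<in> H U" "f = mul F U h g"
  using coset_self[OF assms(2,3)] assms(1) unfolding r_coset_def by auto

text \<open>Restriction maps the subgroup over \<open>U\<close> into the one over \<open>V\<close>,
  so all representatives of a coset restrict into the same coset and the defining union has a single
  value.\<close>

lemma restr_coset:
  assumes U: "openin (pspace F) U" and V: "openin (pspace F) V" "V \<subseteq> U" and f: "f \<in> sect F U"
  shows "restr Q U V (coset U f) = coset V (restr F U V f)"
proof -
  have "coset V (restr F U V f') = coset V (restr F U V f)" if f': "f' \<in> coset U f" for f'
  proof -
    obtain h where h: "h \<in> H U" "f' = mul F U h f" using f' unfolding r_coset_def by auto
    show ?thesis
      by (rule coset_eqI[of V _ "restr F U V h"]) (use h U V f H_restr in auto)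
  qed
  hence "restr Q U V (coset U f) = (\<Union>f'\<in>coset U f. coset V (restr F U V f))"
    unfolding quotient_simps by (intro SUP_cong refl)
  thus ?thesis using coset_self[OF U f] by auto
qed

lemma mul_coset:
  assumes "openin (pspace F) U" "f \<in> sect F U" "g \<in> sect F U"
  shows "mul Q U (coset U f) (coset U g) = coset U (mul F U f g)"
  using normal.rcos_sum[OF H_normal[OF assms(1)], of f g] assms by (simp add: quotient_presheaf_def)

lemma neutral_quotient: "neutral Q U = H U"
  by (simp add: quotient_presheaf_def)

lemma H_coset: "\<lbrakk>openin (pspace F) U; h \<in> H U\<rbrakk> \<Longrightarrow> coset U h = H U"
  by (rule group.coset_join2) (use H_subgroup comm_group.axioms(2)[OF secmon_comm_group] in auto)

lemma neutral_in_H: "openin (pspace F) U \<Longrightarrow> neutral F U \<in> H U"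
  using subgroup.one_closed[OF H_subgroup] by simp

lemma secmon_quotient_comm_group: "openin (pspace F) U \<Longrightarrow> comm_group (secmon Q U)"
  unfolding secmon_quotient by (rule comm_group.abelian_FactGroup[OF secmon_comm_group H_subgroup])

sublocale Quot: cmonoid_presheaf Q
proof (intro cmonoid_presheaf.intro set_presheaf.intro cmonoid_presheaf_axioms.intro)
  show "is_presheaf Q"
    unfolding is_presheaf_def
  proof (intro conjI allI impI ballI)
    fix U V assume *: "openin (pspace Q) U \<and> openin (pspace Q) V \<and> V \<subseteq> U"
    show "restr Q U V \<in> sect Q U \<rightarrow> sect Q V"
    proof
      fix C assume "C \<in> sect Q U"
      then obtain f where "f \<in> sect F U" "C = coset U f" by (rule sect_quotientE)
      thus "restr Q U V C \<in> sect Q V" using * restr_coset[of U V f] by (simp del: quotient_simps(2))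
    qed
  next
    fix U C assume U: "openin (pspace Q) U" and "C \<in> sect Q U"
    then obtain f where "f \<in> sect F U" "C = coset U f" by (blast elim: sect_quotientE)
    thus "restr Q U U C = C" using U restr_coset[of U U f] by (simp del: quotient_simps(2))
  next
    fix U V W C
    assume *: "openin (pspace Q) U \<and> openin (pspace Q) V \<and> openin (pspace Q) W \<and> W \<subseteq> V \<and> V \<subseteq> U"
      and "C \<in> sect Q U"
    then obtain f where "f \<in> sect F U" "C = coset U f" by (blast elim: sect_quotientE)
    thus "restr Q V W (restr Q U V C) = restr Q U W C"
      using * restr_coset[of U V f] restr_coset[of V W "restr F U V f"]
        restr_coset[of U W f] order_trans[of W V U]
      by (simp del: quotient_simps(2))
  qed
next
  fix U assume "openin (pspace Q) U"
  thus "comm_monoid (secmon Q U)" using secmon_quotient_comm_group[of U] by (simp add: comm_group_def)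
next
  fix U V C D assume *: "openin (pspace Q) U" "openin (pspace Q) V" "V \<subseteq> U" "C \<in> sect Q U" "D \<in> sect Q U"
  from *(4) obtain f where f: "f \<in> sect F U" "C = coset U f" by (rule sect_quotientE)
  from *(5) obtain g where g: "g \<in> sect F U" "D = coset U g" by (rule sect_quotientE)
  show "restr Q U V (mul Q U C D) = mul Q V (restr Q U V C) (restr Q U V D)"
    using * f g restr_coset[of U V f] restr_coset[of U V g] restr_coset[of U V "mul F U f g"]
      mul_coset[of U f g] mul_coset[of V "restr F U V f" "restr F U V g"]
    by (simp del: quotient_simps(2))
next
  fix U V assume *: "openin (pspace Q) U" "openin (pspace Q) V" "V \<subseteq> U"
  hence "restr Q U V (coset U (neutral F U)) = coset V (neutral F V)"
    using restr_coset[of U V "neutral F U"] by (simp del: quotient_simps(2))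
  thus "restr Q U V (neutral Q U) = neutral Q V"
    using * H_coset[OF _ neutral_in_H, of U] H_coset[OF _ neutral_in_H, of V]
    by (simp add: neutral_quotient del: quotient_simps(2))
qed

text \<open>The local kernel of the map to the quotient sheaf: germs of cosets agree exactly when
  representatives differ, on some neighbourhood, by an element of the subgroup.\<close>

lemma coset_germ_eqE:
  assumes "germ Q x U (coset U f) = germ Q x V (coset V g)" "openin (pspace F) U" "x \<in> U" "f \<in> sect F U"
    "openin (pspace F) V" "g \<in> sect F V"
  obtains W h where "openin (pspace F) W" "x \<in> W" "W \<subseteq> U" "W \<subseteq> V" "h \<in> H W"
    "restr F U W f = mul F W h (restr F V W g)"
proof -
  obtain W where W: "openin (pspace F) W" "x \<in> W" "W \<subseteq> U" "W \<subseteq> V"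
    "restr Q U W (coset U f) = restr Q V W (coset V g)"
    using Quot.germ_eqE[OF assms(1)] assms(2-) coset_closed by (metis quotient_simps(1))
  hence "coset W (restr F U W f) = coset W (restr F V W g)"
    using restr_coset assms by (simp del: quotient_simps(2))
  then obtain h where "h \<in> H W" "restr F U W f = mul F W h (restr F V W g)"
    by (rule coset_eqE) (use W assms in auto)
  thus ?thesis using W that by blast
qed

end

section \<open>The sheaf of semi-meromorphic functions\<close>

lemma sMero_simps [simp]:
  "pspace (sMero X) = pspace X"
  "restr (sMero X) U V f = restrict f V"
  "mul (sMero X) U f g = (\<lambda>x\<in>U. f x \<otimes>\<^bsub>sfrac_stalk X x\<^esub> g x)"
  "neutral (sMero X) U = (\<lambda>x\<in>U. \<one>\<^bsub>sfrac_stalk X x\<^esub>)"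
  by (simp_all add: sMero_def)

lemma sect_sMero: "sect (sMero X) U = {f \<in> (\<Pi>\<^sub>E x\<in>U. carrier (sfrac_stalk X x)).
    \<forall>x\<in>U. \<forall>y\<in>U. point_le X x y \<longrightarrow> sfrac_map X x (f y) = f x}"
  by (simp add: sMero_def)

context monoid_scheme
begin

lemma sfrac_localizing: "x \<in> topspace (pspace X) \<Longrightarrow> localizing (stalk X x) (sreg (stalk X x))"
  by (simp add: localizing_def localizing_axioms_def stalk_comm_monoid sreg_submonoid)

lemma sfrac_comm_monoid: "x \<in> topspace (pspace X) \<Longrightarrow> comm_monoid (sfrac_stalk X x)"
  unfolding sfrac_stalk_def by (rule localizing.localization_comm_monoid[OF sfrac_localizing])

lemma stalk_map_sreg:
  assumes le: "point_le X x y" and s: "s \<in> sreg (stalk X y)"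
  shows "stalk_map X x s \<in> sreg (stalk X x)"
  using localization_map_sreg[OF stalk_comm_monoid stalk_comm_monoid stalk_localization_map[OF le] s]
    point_le_topspace[OF le] by blast

text \<open>Stalk maps are multiplicative and preserve s-regular elements, so the witness of
  equality of two fractions is carried to a witness at \<open>x\<close>, and the union defining
  \<open>sfrac_map\<close> has a single value.\<close>

lemma sfrac_map_fraction:
  assumes le: "point_le X x y" and a: "a \<in> stalk_set X y" and s: "s \<in> sreg (stalk X y)"
  shows "sfrac_map X x (fraction (stalk X y) (sreg (stalk X y)) a s) =
    fraction (stalk X x) (sreg (stalk X x)) (stalk_map X x a) (stalk_map X x s)"
proof -
  let ?f = "stalk_map X x"
  interpret Y: localizing "stalk X y" "sreg (stalk X y)" by (rule sfrac_localizing[OF point_le_topspace(2)[OF le]])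
  interpret Z: localizing "stalk X x" "sreg (stalk X x)" by (rule sfrac_localizing[OF point_le_topspace(1)[OF le]])
  have ac: "a \<in> carrier (stalk X y)" using a by simp
  have sc: "s \<in> carrier (stalk X y)" using s by (rule Y.S_closed)
  show ?thesis
    unfolding sfrac_map_def
  proof (rule Y.UN_fraction[OF ac s])
    fix b t assume bt: "(b, t) \<in> fraction (stalk X y) (sreg (stalk X y)) a s"
    from Y.fraction_mem_eq[OF bt] have b: "b \<in> carrier (stalk X y)" "t \<in> sreg (stalk X y)"
      "fraction (stalk X y) (sreg (stalk X y)) b t = fraction (stalk X y) (sreg (stalk X y)) a s" by auto
    have tc: "t \<in> carrier (stalk X y)" using b(2) by (rule Y.S_closed)
    from b(3) obtain u where u: "u \<in> sreg (stalk X y)"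
      "u \<otimes>\<^bsub>stalk X y\<^esub> (s \<otimes>\<^bsub>stalk X y\<^esub> b) = u \<otimes>\<^bsub>stalk X y\<^esub> (t \<otimes>\<^bsub>stalk X y\<^esub> a)"
      using Y.fraction_eq_iff[OF b(1,2) ac s] by blast
    have uc: "u \<in> carrier (stalk X y)" using u(1) by (rule Y.S_closed)
    have "?f u \<otimes>\<^bsub>stalk X x\<^esub> (?f s \<otimes>\<^bsub>stalk X x\<^esub> ?f b) = ?f u \<otimes>\<^bsub>stalk X x\<^esub> (?f t \<otimes>\<^bsub>stalk X x\<^esub> ?f a)"
      using arg_cong[OF u(2), of ?f] stalk_map_mult[OF le] uc sc tc b(1) ac Y.m_closed by simp
    thus "fraction (stalk X x) (sreg (stalk X x)) (?f b) (?f t) = fraction (stalk X x) (sreg (stalk X x)) (?f a) (?f s)"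
      using Z.fraction_eq_iff[of "?f b" "?f t" "?f a" "?f s"] stalk_map_closed[OF le] b(1) ac
        stalk_map_sreg[OF le] b(2) s u(1) by auto
  qed
qed

lemma sfrac_stalkE:
  assumes "A \<in> carrier (sfrac_stalk X y)" "y \<in> topspace (pspace X)"
  obtains a s where "a \<in> stalk_set X y" "s \<in> sreg (stalk X y)" "A = fraction (stalk X y) (sreg (stalk X y)) a s"
  using localizing.localizationE[OF sfrac_localizing[OF assms(2)], of A] assms(1)
  unfolding sfrac_stalk_def by auto

lemma fraction_in_sfrac_stalk:
  "\<lbrakk>a \<in> stalk_set X y; s \<in> sreg (stalk X y); y \<in> topspace (pspace X)\<rbrakk>
   \<Longrightarrow> fraction (stalk X y) (sreg (stalk X y)) a s \<in> carrier (sfrac_stalk X y)"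
  using localizing.fraction_closed[OF sfrac_localizing, of y a s] by (simp add: sfrac_stalk_def)

lemma one_sreg: "y \<in> topspace (pspace X) \<Longrightarrow> \<one>\<^bsub>stalk X y\<^esub> \<in> sreg (stalk X y)"
  using localizing.S_one[OF sfrac_localizing] .

lemma sfrac_map_closed:
  assumes le: "point_le X x y" and A: "A \<in> carrier (sfrac_stalk X y)"
  shows "sfrac_map X x A \<in> carrier (sfrac_stalk X x)"
  by (rule sfrac_stalkE[OF A point_le_topspace(2)[OF le]])
     (simp add: sfrac_map_fraction[OF le] fraction_in_sfrac_stalk stalk_map_closed[OF le] stalk_map_sreg[OF le]
        point_le_topspace(1)[OF le])

lemma sfrac_map_mult:
  assumes le: "point_le X x y" and A: "A \<in> carrier (sfrac_stalk X y)" and B: "B \<in> carrier (sfrac_stalk X y)"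
  shows "sfrac_map X x (A \<otimes>\<^bsub>sfrac_stalk X y\<^esub> B) = sfrac_map X x A \<otimes>\<^bsub>sfrac_stalk X x\<^esub> sfrac_map X x B"
proof -
  note y = point_le_topspace(2)[OF le] and x = point_le_topspace(1)[OF le]
  interpret Y: localizing "stalk X y" "sreg (stalk X y)" by (rule sfrac_localizing[OF y])
  interpret Z: localizing "stalk X x" "sreg (stalk X x)" by (rule sfrac_localizing[OF x])
  obtain a s where A: "a \<in> stalk_set X y" "s \<in> sreg (stalk X y)" "A = fraction (stalk X y) (sreg (stalk X y)) a s"
    using A y by (rule sfrac_stalkE)
  obtain b t where B: "b \<in> stalk_set X y" "t \<in> sreg (stalk X y)" "B = fraction (stalk X y) (sreg (stalk X y)) b t"
    using B y by (rule sfrac_stalkE)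
  have c: "s \<in> stalk_set X y" "t \<in> stalk_set X y" using Y.S_closed A B by auto
  have "a \<otimes>\<^bsub>stalk X y\<^esub> b \<in> stalk_set X y" using Y.m_closed A B by simp
  thus ?thesis
    using A B c stalk_map_closed[OF le] stalk_map_sreg[OF le]
    by (simp add: sfrac_stalk_def Y.fraction_mult Z.fraction_mult sfrac_map_fraction[OF le] stalk_map_mult[OF le])
qed

lemma one_sfrac: "y \<in> topspace (pspace X) \<Longrightarrow>
    \<one>\<^bsub>sfrac_stalk X y\<^esub> = fraction (stalk X y) (sreg (stalk X y)) \<one>\<^bsub>stalk X y\<^esub> \<one>\<^bsub>stalk X y\<^esub>"
  unfolding sfrac_stalk_def by (rule localizing.one_localization[OF sfrac_localizing])

lemma stalk_one_closed: "y \<in> topspace (pspace X) \<Longrightarrow> \<one>\<^bsub>stalk X y\<^esub> \<in> stalk_set X y"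
  using monoid.one_closed[OF comm_monoid.axioms(1)[OF stalk_comm_monoid]] by simp

lemma sfrac_map_one: "point_le X x y \<Longrightarrow> sfrac_map X x \<one>\<^bsub>sfrac_stalk X y\<^esub> = \<one>\<^bsub>sfrac_stalk X x\<^esub>"
  using point_le_topspace[of x y]
  by (simp add: one_sfrac sfrac_map_fraction one_sreg stalk_one_closed stalk_map_one)

lemma sfrac_map_comp:
  assumes "point_le X x y" "point_le X y z" "A \<in> carrier (sfrac_stalk X z)"
  shows "sfrac_map X x (sfrac_map X y A) = sfrac_map X x A"
proof -
  obtain a s where A: "a \<in> stalk_set X z" "s \<in> sreg (stalk X z)" "A = fraction (stalk X z) (sreg (stalk X z)) a s"
    using assms(3) point_le_topspace(2)[OF assms(2)] by (rule sfrac_stalkE)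
  have s: "s \<in> stalk_set X z"
    using localizing.S_closed[OF sfrac_localizing[OF point_le_topspace(2)[OF assms(2)]] A(2)] by simp
  show ?thesis
    using A s assms(1,2) point_le_trans[OF assms(1,2)]
    by (simp add: sfrac_map_fraction stalk_map_closed stalk_map_sreg stalk_map_comp[OF assms(1,2)])
qed

text \<open>The limit condition concerns pairs \<open>x \<le> y\<close>, and every neighbourhood of
  \<open>y\<close> contains \<open>x\<close>; hence it can be checked inside any open set around
  \<open>y\<close>.\<close>

lemma sMero_is_sheaf: "is_sheaf (sMero X)"
proof (rule function_sheaf)
  fix U V f assume "V \<subseteq> U" "f \<in> sect (sMero X) U"
  moreover from this have "x \<in> V \<Longrightarrow> x \<in> U" for x by blast
  ultimately show "restrict f V \<in> sect (sMero X) V"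
    by (simp add: sect_sMero PiE_iff)
next
  fix U f assume U: "openin (pspace (sMero X)) U" and ext: "f \<in> extensional U"
    and loc: "\<And>x. x \<in> U \<Longrightarrow> \<exists>V. openin (pspace (sMero X)) V \<and> x \<in> V \<and> V \<subseteq> U \<and> restrict f V \<in> sect (sMero X) V"
  have "f x \<in> carrier (sfrac_stalk X x) \<and> (\<forall>z. point_le X z x \<longrightarrow> sfrac_map X z (f x) = f z)" if x: "x \<in> U" for x
  proof -
    from loc[OF x] obtain V where V: "openin (pspace X) V" "x \<in> V" "V \<subseteq> U" "restrict f V \<in> sect (sMero X) V"
      by auto
    have "sfrac_map X z (f x) = f z" if "point_le X z x" for z
    proof -
      have "z \<in> V" using point_le_open[OF that V(1,2)] .
      thus ?thesis using V that by (auto simp: sect_sMero)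
    qed
    moreover have "restrict f V x \<in> carrier (sfrac_stalk X x)" using V by (auto simp: sect_sMero PiE_iff)
    ultimately show ?thesis using V(2) by simp
  qed
  thus "f \<in> sect (sMero X) U" using ext by (auto simp: sect_sMero PiE_def)
qed (auto simp: sect_sMero PiE_def)

lemma sMero_value: "\<lbrakk>f \<in> sect (sMero X) U; x \<in> U\<rbrakk> \<Longrightarrow> f x \<in> carrier (sfrac_stalk X x)"
  by (auto simp: sect_sMero)

lemma sMero_ext: "f \<in> sect (sMero X) U \<Longrightarrow> f \<in> extensional U"
  by (auto simp: sect_sMero PiE_def)

lemma sMero_eqI:
  "\<lbrakk>f \<in> extensional U; g \<in> extensional U; \<And>x. x \<in> U \<Longrightarrow> f x = g x\<rbrakk> \<Longrightarrow> f = g"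
  by (rule extensionalityI)

lemma open_topspace: "\<lbrakk>openin (pspace X) U; x \<in> U\<rbrakk> \<Longrightarrow> x \<in> topspace (pspace X)"
  using openin_subset by blast

sublocale Mero: cmonoid_sheaf "sMero X"
proof -
  interpret sh: set_sheaf "sMero X" by (rule set_sheafI[OF sMero_is_sheaf])
  show "cmonoid_sheaf (sMero X)"
  proof (intro cmonoid_sheaf.intro cmonoid_presheaf.intro cmonoid_presheaf_axioms.intro
      sh.set_sheaf_axioms sh.set_presheaf_axioms)
    fix U assume "openin (pspace (sMero X)) U"
    hence U: "\<And>x. x \<in> U \<Longrightarrow> comm_monoid (sfrac_stalk X x)" "\<And>x. x \<in> U \<Longrightarrow> monoid (sfrac_stalk X x)"
      using open_topspace sfrac_comm_monoid by (auto simp: comm_monoid_def)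
    show "comm_monoid (secmon (sMero X) U)"
    proof (rule comm_monoidI, simp_all only: secmon_simps)
      show "neutral (sMero X) U \<in> sect (sMero X) U"
        by (auto simp: sect_sMero monoid.one_closed[OF U(2)] sfrac_map_one)
      fix f g assume f: "f \<in> sect (sMero X) U" and g: "g \<in> sect (sMero X) U"
      show "mul (sMero X) U f g \<in> sect (sMero X) U"
        using f g monoid.m_closed[OF U(2)] by (auto simp: sect_sMero sfrac_map_mult PiE_iff)
      show "mul (sMero X) U f g = mul (sMero X) U g f"
        using sMero_value[OF f] sMero_value[OF g] comm_monoid.m_comm[OF U(1)]
        by (auto intro!: restrict_ext)
      fix k assume k: "k \<in> sect (sMero X) U"
      show "mul (sMero X) U (mul (sMero X) U f g) k = mul (sMero X) U f (mul (sMero X) U g k)"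
        using sMero_value[OF f] sMero_value[OF g] sMero_value[OF k] monoid.m_assoc[OF U(2)]
        by (auto intro!: restrict_ext)
    next
      fix f assume f: "f \<in> sect (sMero X) U"
      show "mul (sMero X) U (neutral (sMero X) U) f = f"
        by (rule sMero_eqI[OF _ sMero_ext[OF f]]) (use sMero_value[OF f] monoid.l_one[OF U(2)] in auto)
    qed
  qed (auto simp: Int_absorb1 intro!: restrict_ext)
qed

lemma to_sMero_closed [simp]:
  assumes U: "openin (pspace X) U" and a: "a \<in> sect X U"
  shows "to_sMero X U a \<in> sect (sMero X) U"
proof -
  have "sfrac_map X x (to_sMero X U a y) = to_sMero X U a x" if xy: "x \<in> U" "y \<in> U" "point_le X x y" for x y
    using xy U a by (simp add: to_sMero_def sfrac_map_fraction one_sreg stalk_map_one stalk_map_germ open_topspace)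
  moreover have "to_sMero X U a x \<in> carrier (sfrac_stalk X x)" if "x \<in> U" for x
    using that U a by (simp add: to_sMero_def fraction_in_sfrac_stalk one_sreg open_topspace)
  ultimately show ?thesis by (auto simp: sect_sMero PiE_def to_sMero_def)
qed

lemma to_sMero_mult:
  assumes U: "openin (pspace X) U" and ab: "a \<in> sect X U" "b \<in> sect X U"
  shows "to_sMero X U (mul X U a b) = mul (sMero X) U (to_sMero X U a) (to_sMero X U b)"
proof -
  have "fraction (stalk X x) (sreg (stalk X x)) (germ X x U (mul X U a b)) \<one>\<^bsub>stalk X x\<^esub> =
      to_sMero X U a x \<otimes>\<^bsub>sfrac_stalk X x\<^esub> to_sMero X U b x" if x: "x \<in> U" for x
  proof -
    interpret L: localizing "stalk X x" "sreg (stalk X x)" by (rule sfrac_localizing[OF open_topspace[OF U x]])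
    show ?thesis using x U ab
      by (simp add: to_sMero_def sfrac_stalk_def L.fraction_mult germ_mult_same one_sreg
          stalk_one_closed open_topspace[OF U x])
  qed
  thus ?thesis by (auto simp: to_sMero_def[of X U "mul X U a b"] intro!: restrict_ext)
qed

lemma to_sMero_neutral: "openin (pspace X) U \<Longrightarrow> to_sMero X U (neutral X U) = neutral (sMero X) U"
  by (auto simp: to_sMero_def germ_neutral one_sfrac open_topspace intro!: restrict_ext)

lemma to_sMero_restr:
  "\<lbrakk>openin (pspace X) U; openin (pspace X) V; V \<subseteq> U; a \<in> sect X U\<rbrakk>
   \<Longrightarrow> to_sMero X V (restr X U V a) = restrict (to_sMero X U a) V"
  by (auto simp: to_sMero_def Int_absorb1 intro!: restrict_ext)

lemma to_sMero_unit:
  assumes U: "openin (pspace X) U" and u: "u \<in> Units (secmon X U)"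
  shows "to_sMero X U u \<in> Units (secmon (sMero X) U)"
proof -
  obtain v where v: "u \<in> sect X U" "v \<in> sect X U" "mul X U v u = neutral X U"
    using u by (rule unitE)
  show ?thesis
    by (rule Mero.unitI[of _ _ "to_sMero X U v"])
       (use U v to_sMero_mult[OF U v(2,1)] to_sMero_neutral[OF U] in simp_all)
qed

text \<open>Equality of \<open>u/1\<close> and \<open>v/1\<close> at a point means equality after
  multiplication by an s-regular germ, which can be cancelled between units. This injectivity is
  what makes the action on lifts free.\<close>

lemma to_sMero_inj:
  assumes U: "openin (pspace X) U" and uv: "u \<in> Units (secmon X U)" "v \<in> Units (secmon X U)"
    and eq: "to_sMero X U u = to_sMero X U v"
  shows "u = v"
proof (rule germs_eq[OF U])
  fix x assume x: "x \<in> U"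
  note xt = open_topspace[OF U x]
  interpret L: localizing "stalk X x" "sreg (stalk X x)" by (rule sfrac_localizing[OF xt])
  have gu: "germ X x U u \<in> Units (stalk X x)" "germ X x U v \<in> Units (stalk X x)"
    using germ_unit[OF U x] uv by auto
  have "fraction (stalk X x) (sreg (stalk X x)) (germ X x U u) \<one>\<^bsub>stalk X x\<^esub> =
      fraction (stalk X x) (sreg (stalk X x)) (germ X x U v) \<one>\<^bsub>stalk X x\<^esub>"
    using fun_cong[OF eq, of x] x by (simp add: to_sMero_def)
  then obtain s where "s \<in> sreg (stalk X x)" "s \<otimes>\<^bsub>stalk X x\<^esub> germ X x U u = s \<otimes>\<^bsub>stalk X x\<^esub> germ X x U v"
    using L.fraction_eq_iff[of "germ X x U u" "\<one>\<^bsub>stalk X x\<^esub>" "germ X x U v" "\<one>\<^bsub>stalk X x\<^esub>"] gu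
    by (auto simp: L.Units_closed simp del: carrier_stalk)
  thus "germ X x U u = germ X x U v"
    using sreg_cancel_units[OF stalk_comm_monoid[OF xt]] gu by blast
qed (use uv in auto)

end

section \<open>The group of s-divisors\<close>

context monoid_scheme
begin

lemma unit_image_mult:
  assumes "openin (pspace X) U" "g \<in> unit_image X U" "h \<in> unit_image X U"
  shows "mul (sMero X) U g h \<in> unit_image X U"
proof -
  from assms(2,3) obtain u v where "u \<in> Units (secmon X U)" "g = to_sMero X U u"
    "v \<in> Units (secmon X U)" "h = to_sMero X U v"
    by (auto simp: unit_image_def)
  thus ?thesis
    unfolding unit_image_def using assms(1) to_sMero_mult[of U u v]
    by (intro image_eqI[of _ _ "mul X U u v"]) auto
qed

lemma unit_image_subgroup:
  assumes U: "openin (pspace X) U"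
  shows "subgroup (unit_image X U) (secmon (sMero_units X) U)"
proof -
  interpret G: comm_group "secmon (sMero_units X) U"
    using Mero.units_presheaf_comm_group[of U] U by simp
  show ?thesis
  proof (rule G.subgroupI)
    show "unit_image X U \<subseteq> carrier (secmon (sMero_units X) U)"
      using to_sMero_unit[OF U] by (auto simp: unit_image_def)
    show "unit_image X U \<noteq> {}" using neutral_unit[OF U] by (auto simp: unit_image_def)
    show "h \<otimes>\<^bsub>secmon (sMero_units X) U\<^esub> k \<in> unit_image X U"
      if "h \<in> unit_image X U" "k \<in> unit_image X U" for h k
      using unit_image_mult[OF U that] by simp
    fix h assume "h \<in> unit_image X U"
    then obtain u where u: "u \<in> Units (secmon X U)" "h = to_sMero X U u" by (auto simp: unit_image_def)
    obtain v where v: "u \<in> sect X U" "v \<in> Units (secmon X U)" "v \<in> sect X U" "mul X U v u = neutral X U"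
      using u(1) by (rule unitE)
    have "inv\<^bsub>secmon (sMero_units X) U\<^esub> h = to_sMero X U v"
      by (rule G.inv_equality)
         (use to_sMero_mult[OF U v(3,1)] v u U to_sMero_unit[OF U] to_sMero_neutral[OF U] in auto)
    thus "inv\<^bsub>secmon (sMero_units X) U\<^esub> h \<in> unit_image X U" using v(2) by (simp add: unit_image_def)
  qed
qed

sublocale Div: presheaf_quotient "sMero_units X" "unit_image X"
  rewrites "quotient_presheaf (sMero_units X) (unit_image X) = pre_sDiv X"
proof -
  show "presheaf_quotient (sMero_units X) (unit_image X)"
  proof (intro presheaf_quotient.intro Mero.units_presheaf presheaf_quotient_axioms.intro)
    show "comm_group (secmon (sMero_units X) U)" if "openin (pspace (sMero_units X)) U" for U
      using Mero.units_presheaf_comm_group[of U] that by simp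
    show "subgroup (unit_image X U) (secmon (sMero_units X) U)" if "openin (pspace (sMero_units X)) U" for U
      using unit_image_subgroup[of U] that by simp
    fix U V h assume *: "openin (pspace (sMero_units X)) U" "openin (pspace (sMero_units X)) V" "V \<subseteq> U"
      "h \<in> unit_image X U"
    then obtain u where u: "u \<in> Units (secmon X U)" "h = to_sMero X U u" by (auto simp: unit_image_def)
    have "restrict h V = to_sMero X V (restr X U V u)" using u * to_sMero_restr[of U V u] by simp
    thus "restr (sMero_units X) U V h \<in> unit_image X V"
      using u * restr_unit[of U V u] by (simp add: unit_image_def)
  qed
qed (simp add: pre_sDiv_def)

section \<open>Divisors of invertible semi-meromorphic functions\<close>

abbreviation mero_units :: "'p set \<Rightarrow> ('p \<Rightarrow> ('p, 'a) sfrac) set" where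
  "mero_units U \<equiv> Units (secmon (sMero X) U)"

lemma mero_units_restrict:
  "\<lbrakk>openin (pspace X) U; openin (pspace X) V; V \<subseteq> U; f \<in> mero_units U\<rbrakk> \<Longrightarrow> restrict f V \<in> mero_units V"
  using Mero.restr_unit[of U V f] by simp

lemma div_of_closed:
  assumes "openin (pspace X) U" "f \<in> mero_units U"
  shows "div_of X U f \<in> sheafify_sect (pre_sDiv X) U"
proof (rule Div.Quot.sheafify_sectI)
  fix x assume "x \<in> U"
  thus "\<exists>V t. openin (pspace (pre_sDiv X)) V \<and> x \<in> V \<and> V \<subseteq> U \<and> t \<in> sect (pre_sDiv X) V \<and>
       (\<forall>y\<in>V. div_of X U f y = germ (pre_sDiv X) y V t)"
    using assms by (intro exI[of _ U] exI[of _ "Div.coset U f"]) (simp add: div_of_def)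
qed (simp add: div_of_def)

lemma div_of_restrict:
  assumes U: "openin (pspace X) U" "openin (pspace X) V" "V \<subseteq> U" and f: "f \<in> mero_units U"
  shows "div_of X V (restrict f V) = restrict (div_of X U f) V"
proof -
  have "germ (pre_sDiv X) x V (Div.coset V (restrict f V)) = germ (pre_sDiv X) x U (Div.coset U f)" if "x \<in> V" for x
    using Div.Quot.germ_restr[of U V x "Div.coset U f"] Div.restr_coset[of U V f] U f that
    by (simp del: Div.quotient_simps(2))
  thus ?thesis using U by (auto simp: div_of_def Int_absorb1 intro!: restrict_ext)
qed

lemma div_of_mult:
  assumes U: "openin (pspace X) U" and fg: "f \<in> mero_units U" "g \<in> mero_units U"
  shows "div_of X U (mul (sMero X) U f g) = (\<lambda>x\<in>U. div_of X U f x \<otimes>\<^bsub>stalk (pre_sDiv X) x\<^esub> div_of X U g x)"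
proof -
  have "germ (pre_sDiv X) x U (Div.coset U (mul (sMero X) U f g)) =
      germ (pre_sDiv X) x U (Div.coset U f) \<otimes>\<^bsub>stalk (pre_sDiv X) x\<^esub> germ (pre_sDiv X) x U (Div.coset U g)"
    if "x \<in> U" for x
    using Div.Quot.germ_mult_same[of U x "Div.coset U f" "Div.coset U g"] Div.mul_coset[of U f g] U fg that
    by (simp del: sMero_simps(3))
  thus ?thesis by (auto simp: div_of_def intro!: restrict_ext simp del: sMero_simps(3))
qed

lemma div_of_unit_mult:
  assumes U: "openin (pspace X) U" and u: "u \<in> Units (secmon X U)" and g: "g \<in> mero_units U"
  shows "div_of X U (mul (sMero X) U (to_sMero X U u) g) = div_of X U g"
proof -
  have "Div.coset U (mul (sMero X) U (to_sMero X U u) g) = Div.coset U g"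
    by (rule Div.coset_eqI[where h = "to_sMero X U u"]) (use U u g in \<open>auto simp: unit_image_def\<close>)
  thus ?thesis by (simp add: div_of_def)
qed

text \<open>Exactness in the middle of the sequence. Locally \<open>f\<close> is a unit multiple of
  \<open>g\<close>; the unit is determined because \<open>g\<close> is invertible and units embed
  into semi-meromorphic functions, so the local units glue.\<close>

lemma div_of_eqE:
  assumes U: "openin (pspace X) U" and f: "f \<in> mero_units U" and g: "g \<in> mero_units U"
    and eq: "div_of X U f = div_of X U g"
  obtains u where "u \<in> Units (secmon X U)" "f = mul (sMero X) U (to_sMero X U u) g"
proof -
  let ?m = "mul (sMero X)"
  have loc: "\<exists>V u. openin (pspace X) V \<and> x \<in> V \<and> V \<subseteq> U \<and> u \<in> Units (secmon X V) \<and>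
      restrict f V = ?m V (to_sMero X V u) (restrict g V)" if x: "x \<in> U" for x
  proof -
    have "germ (pre_sDiv X) x U (Div.coset U f) = germ (pre_sDiv X) x U (Div.coset U g)"
      using fun_cong[OF eq, of x] x by (simp add: div_of_def)
    then obtain W h where W: "openin (pspace X) W" "x \<in> W" "W \<subseteq> U" "h \<in> unit_image X W"
      "restrict f W = ?m W h (restrict g W)"
      by (rule Div.coset_germ_eqE) (use U x f g in \<open>auto simp del: sMero_simps(3)\<close>)
    from W(4) obtain u where "u \<in> Units (secmon X W)" "h = to_sMero X W u" by (auto simp: unit_image_def)
    thus ?thesis using W by (intro exI[of _ W] exI[of _ u]) (simp del: sMero_simps(3))
  qed
  have "\<exists>u\<in>Units (secmon X U). \<forall>V v. openin (pspace X) V \<and> V \<subseteq> U \<and> v \<in> Units (secmon X V) \<and>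
      restrict f V = ?m V (to_sMero X V v) (restrict g V) \<longrightarrow> restr X U V u = v"
  proof (rule units_glue_rel[OF U loc])
    fix V V' v v'
    assume *: "openin (pspace X) V" "openin (pspace X) V'" "V \<subseteq> U" "V' \<subseteq> U"
      "v \<in> Units (secmon X V)" "v' \<in> Units (secmon X V')"
      "restrict f V = ?m V (to_sMero X V v) (restrict g V)"
      "restrict f V' = ?m V' (to_sMero X V' v') (restrict g V')"
    let ?W = "V \<inter> V'"
    have W: "openin (pspace X) ?W" "?W \<subseteq> V" "?W \<subseteq> V'" "?W \<subseteq> U" using * by auto
    \<comment> \<open>The relation \<open>f = w g\<close> over either open set restricts to the
      overlap, with \<open>w\<close> replaced by its restriction.\<close>
    have res: "restrict f ?W = ?m ?W (to_sMero X ?W (restr X V1 ?W w)) (restrict g ?W)"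
      if "openin (pspace X) V1" "?W \<subseteq> V1" "V1 \<subseteq> U" "w \<in> Units (secmon X V1)"
        "restrict f V1 = ?m V1 (to_sMero X V1 w) (restrict g V1)" for V1 w
    proof -
      have g1: "restrict g V1 \<in> sect (sMero X) V1"
        using Mero.unit_closed[OF mero_units_restrict[OF U that(1,3) g]] .
      have "restrict f ?W = restr (sMero X) V1 ?W (restrict f V1)"
        using that(2) by (simp add: Int_absorb1)
      also have "\<dots> = ?m ?W (restr (sMero X) V1 ?W (to_sMero X V1 w)) (restr (sMero X) V1 ?W (restrict g V1))"
        unfolding that(5) using that W g1 to_sMero_closed by (intro Mero.restr_mul) auto
      also have "\<dots> = ?m ?W (to_sMero X ?W (restr X V1 ?W w)) (restrict g ?W)"
        using that W to_sMero_restr[of V1 ?W w] by (simp add: Int_absorb1 del: sMero_simps(3))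
      finally show ?thesis .
    qed
    have gW: "restrict g ?W \<in> mero_units ?W" using mero_units_restrict[OF U W(1,4) g] .
    have vW: "restr X V ?W v \<in> Units (secmon X ?W)" "restr X V' ?W v' \<in> Units (secmon X ?W)"
      using * W by auto
    \<comment> \<open>Factors are swapped so that the invertible \<open>g\<close> stands in front
      and can be cancelled.\<close>
    have "?m ?W (restrict g ?W) (to_sMero X ?W (restr X V ?W v)) = ?m ?W (restrict g ?W) (to_sMero X ?W (restr X V' ?W v'))"
      using res[OF *(1) W(2) *(3,5,7)] res[OF *(2) W(3) *(4,6,8)] Mero.mul_commute[of ?W "restrict g ?W"] W gW vW
      by (simp del: sMero_simps(3))
    hence "to_sMero X ?W (restr X V ?W v) = to_sMero X ?W (restr X V' ?W v')"
      by (rule Mero.unit_cancel[rotated 4]) (use W gW vW in simp_all)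
    thus "restr X V ?W v = restr X V' ?W v'" using to_sMero_inj W(1) vW by blast
  qed
  then obtain u where u: "u \<in> Units (secmon X U)"
    "\<forall>V v. openin (pspace X) V \<and> V \<subseteq> U \<and> v \<in> Units (secmon X V) \<and>
      restrict f V = ?m V (to_sMero X V v) (restrict g V) \<longrightarrow> restr X U V u = v"
    by (rule bexE)
  have "f = ?m U (to_sMero X U u) g"
  proof (rule Mero.locally_eq)
    fix x assume "x \<in> U"
    from loc[OF this] obtain V v where V: "openin (pspace X) V" "x \<in> V" "V \<subseteq> U" "v \<in> Units (secmon X V)"
      "restrict f V = ?m V (to_sMero X V v) (restrict g V)" by (elim exE conjE)
    have "restr (sMero X) U V (?m U (to_sMero X U u) g) =
        ?m V (restr (sMero X) U V (to_sMero X U u)) (restr (sMero X) U V g)"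
      using U V u g by (intro Mero.restr_mul) auto
    also have "\<dots> = ?m V (to_sMero X V v) (restrict g V)"
      using to_sMero_restr[OF U V(1,3), of u] u(2)[rule_format, of V v] V u(1) by (simp del: sMero_simps(3))
    finally have "restr (sMero X) U V f = restr (sMero X) U V (?m U (to_sMero X U u) g)"
      using V(5) by (simp del: sMero_simps(3))
    thus "\<exists>V. openin (pspace (sMero X)) V \<and> x \<in> V \<and> V \<subseteq> U \<and>
        restr (sMero X) U V f = restr (sMero X) U V (?m U (to_sMero X U u) g)"
      using V by (intro exI[of _ V]) (simp del: sMero_simps(3))
  qed (use U f g u to_sMero_unit[OF U] in \<open>auto simp del: sMero_simps(3)\<close>)
  with u(1) show ?thesis by (rule that)
qed

section \<open>The divisor group and local lifts\<close>

lemma sDiv_simps: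
  "carrier (sDiv X) = sheafify_sect (pre_sDiv X) (topspace (pspace X))"
  "D \<otimes>\<^bsub>sDiv X\<^esub> D' = (\<lambda>x\<in>topspace (pspace X). D x \<otimes>\<^bsub>stalk (pre_sDiv X) x\<^esub> D' x)"
  by (simp_all add: sDiv_def)

lemma sDiv_comm_group: "comm_group (sDiv X)"
  unfolding sDiv_def
  by (rule Div.Quot.sheafify_comm_group) (use Div.secmon_quotient_comm_group in simp_all)

lemma sDiv_ext: "D \<in> carrier (sDiv X) \<Longrightarrow> D \<in> extensional (topspace (pspace X))"
  by (auto simp: sDiv_simps sheafify_sect_def PiE_def)

lemma lifts_iff: "f \<in> lifts X D U \<longleftrightarrow> f \<in> mero_units U \<and> div_of X U f = restrict D U"
  by (simp add: lifts_def)

text \<open>A section of the sheafified quotient is locally induced by one coset, and any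
  representative of that coset is a lift.\<close>

lemma lifts_local:
  assumes D: "D \<in> carrier (sDiv X)" and N: "openin (pspace X) N" "x \<in> N"
  obtains V f where "openin (pspace X) V" "x \<in> V" "V \<subseteq> N" "f \<in> lifts X D V"
proof -
  obtain V t where V: "openin (pspace X) V" "x \<in> V" "V \<subseteq> topspace (pspace X)" "V \<subseteq> N" "t \<in> sect (pre_sDiv X) V"
    and t: "\<And>y. y \<in> V \<Longrightarrow> D y = germ (pre_sDiv X) y V t"
    using Div.Quot.sheafify_sectE[of D "topspace (pspace X)" x N] D N open_topspace[OF N]
    unfolding sDiv_simps by auto
  obtain f where f: "f \<in> mero_units V" "t = Div.coset V f"
    using Div.sect_quotientE[OF V(5)] by auto
  have "f \<in> lifts X D V"
    unfolding lifts_iff using f t by (auto simp: div_of_def intro!: restrict_ext)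
  thus ?thesis using that V by blast
qed

lemma lifts_restrict:
  assumes "openin (pspace X) U" "openin (pspace X) V" "V \<subseteq> U" "f \<in> lifts X D U"
  shows "restrict f V \<in> lifts X D V"
  using assms mero_units_restrict[OF assms(1-3)] div_of_restrict[OF assms(1-3)]
  by (simp add: lifts_iff Int_absorb1)

lemma lifts_act:
  assumes "openin (pspace X) U" "u \<in> Units (secmon X U)" "f \<in> lifts X D U"
  shows "mul (sMero X) U (to_sMero X U u) f \<in> lifts X D U"
  using assms div_of_unit_mult[of U u f] Mero.mul_unit[of U "to_sMero X U u" f] to_sMero_unit[of U u]
  by (simp add: lifts_iff del: sMero_simps(3))

lemma lifts_transitive:
  assumes "openin (pspace X) U" "f \<in> lifts X D U" "g \<in> lifts X D U"
  obtains u where "u \<in> Units (secmon X U)" "f = mul (sMero X) U (to_sMero X U u) g"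
proof -
  obtain u where "u \<in> Units (secmon X U)" "f = mul (sMero X) U (to_sMero X U u) g"
    by (rule div_of_eqE[OF assms(1), of f g]) (use assms in \<open>simp_all add: lifts_iff\<close>)
  thus ?thesis by (rule that)
qed

lemma lifts_mult:
  assumes "openin (pspace X) U" "f \<in> lifts X D U" "g \<in> lifts X D' U"
  shows "mul (sMero X) U f g \<in> lifts X (D \<otimes>\<^bsub>sDiv X\<^esub> D') U"
proof -
  have "restrict (D \<otimes>\<^bsub>sDiv X\<^esub> D') U = (\<lambda>x\<in>U. restrict D U x \<otimes>\<^bsub>stalk (pre_sDiv X) x\<^esub> restrict D' U x)"
    using open_topspace[OF assms(1)] by (auto simp: sDiv_simps restrict_def fun_eq_iff)
  thus ?thesis
    using assms div_of_mult[of U f g] Mero.mul_unit[of U f g] by (simp add: lifts_iff del: sMero_simps(3))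
qed

lemma lift_of_principal: "f \<in> mero_units (topspace (pspace X)) \<Longrightarrow> f \<in> lifts X (div_of X (topspace (pspace X)) f) (topspace (pspace X))"
  by (simp add: lifts_iff div_of_def)

lemma principal_sDiv_subgroup: "subgroup (principal_sDiv X) (sDiv X)"
proof -
  let ?T = "topspace (pspace X)"
  have T: "openin (pspace X) ?T" by simp
  interpret G: comm_group "secmon (sMero_units X) ?T"
    using Mero.units_presheaf_comm_group[of ?T] by simp
  interpret S: comm_group "sDiv X" by (rule sDiv_comm_group)
  have hom: "div_of X ?T \<in> hom (secmon (sMero_units X) ?T) (sDiv X)"
    using div_of_closed[OF T] div_of_mult[OF T] by (auto simp: hom_def sDiv_simps simp del: sMero_simps(3))
  interpret group_hom "secmon (sMero_units X) ?T" "sDiv X" "div_of X ?T"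
    by unfold_locales (rule hom)
  show ?thesis using img_is_subgroup by (simp add: principal_sDiv_def)
qed

lemma sCl_comm_group: "comm_group (sCl X)"
  unfolding sCl_def by (rule comm_group.abelian_FactGroup[OF sDiv_comm_group principal_sDiv_subgroup])

end

section \<open>Presheaves with an action of the structure sheaf and their generators\<close>

lemma generatorsI:
  assumes "e \<in> sect P U"
    and "\<And>V. \<lbrakk>openin (pspace X) V; V \<subseteq> U\<rbrakk> \<Longrightarrow> bij_betw (\<lambda>a. act P V a (restr P U V e)) (sect X V) (sect P V)"
  shows "e \<in> generators X P U"
  unfolding generators_def by (intro CollectI conjI allI impI assms) blast+

text \<open>Formulated for presheaves so that the presheaf tensor product is an instance and its
  generators can be studied before sheafification.\<close>

locale oset_presheaf = X: cmonoid_sheaf X + set_presheaf P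
  for X :: "('p, 'a) monoid_presheaf" and P :: "('p, 'a, 'l) oset_presheaf" +
  assumes pspace_eq [simp]: "pspace P = pspace X"
    and act_closed [simp]: "\<lbrakk>openin (pspace X) U; a \<in> sect X U; s \<in> sect P U\<rbrakk> \<Longrightarrow> act P U a s \<in> sect P U"
    and act_neutral [simp]: "\<lbrakk>openin (pspace X) U; s \<in> sect P U\<rbrakk> \<Longrightarrow> act P U (neutral X U) s = s"
    and act_mul: "\<lbrakk>openin (pspace X) U; a \<in> sect X U; b \<in> sect X U; s \<in> sect P U\<rbrakk>
      \<Longrightarrow> act P U (mul X U a b) s = act P U a (act P U b s)"
    and restr_act [simp]: "\<lbrakk>openin (pspace X) U; openin (pspace X) V; V \<subseteq> U; a \<in> sect X U; s \<in> sect P U\<rbrakk>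
      \<Longrightarrow> restr P U V (act P U a s) = act P V (restr X U V a) (restr P U V s)"

locale oset_sheaf = oset_presheaf X P + set_sheaf P
  for X :: "('p, 'a) monoid_presheaf" and P :: "('p, 'a, 'l) oset_presheaf"

lemma oset_sheaf_iff:
  assumes "cmonoid_sheaf X"
  shows "oset_sheaf X P \<longleftrightarrow> is_oset_sheaf X P"
proof
  assume "oset_sheaf X P"
  then interpret oset_sheaf X P .
  show "is_oset_sheaf X P" unfolding is_oset_sheaf_def using is_sheaf by (simp add: act_mul)
next
  assume L: "is_oset_sheaf X P"
  hence sh: "is_sheaf P" by (simp add: is_oset_sheaf_def)
  interpret set_sheaf P using sh by (rule set_sheafI)
  have "oset_presheaf_axioms X P"
    using L unfolding is_oset_sheaf_def by (intro oset_presheaf_axioms.intro) simp_all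
  thus "oset_sheaf X P"
    using assms set_presheaf_axioms set_sheaf_axioms by (simp add: oset_sheaf_def oset_presheaf_def)
qed

context oset_presheaf
begin

lemma act_left_commute:
  "\<lbrakk>openin (pspace X) U; a \<in> sect X U; b \<in> sect X U; s \<in> sect P U\<rbrakk>
   \<Longrightarrow> act P U a (act P U b s) = act P U b (act P U a s)"
  using X.mul_commute[of U a b] by (simp flip: act_mul)

lemma gen_closed [simp]: "e \<in> generators X P U \<Longrightarrow> e \<in> sect P U"
  by (simp add: generators_def)

lemma gen_bij:
  assumes "e \<in> generators X P U" "openin (pspace X) V" "V \<subseteq> U"
  shows "bij_betw (\<lambda>a. act P V a (restr P U V e)) (sect X V) (sect P V)"
proof -
  have "\<forall>V. openin (pspace X) V \<and> V \<subseteq> U \<longrightarrow>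
      bij_betw (\<lambda>a. act P V a (restr P U V e)) (sect X V) (sect P V)"
    using assms(1) unfolding generators_def by (rule CollectE) (erule conjunct2)
  from this[rule_format, OF conjI, OF assms(2,3)] show ?thesis .
qed

lemma gen_restr [simp]:
  assumes "openin (pspace X) U" "openin (pspace X) V" "V \<subseteq> U" "e \<in> generators X P U"
  shows "restr P U V e \<in> generators X P V"
proof -
  have "bij_betw (\<lambda>a. act P W a (restr P V W (restr P U V e))) (sect X W) (sect P W)"
    if "openin (pspace X) W" "W \<subseteq> V" for W
    using gen_bij[OF assms(4) that(1)] that assms by (simp add: order_trans[of W V U])
  thus ?thesis by (intro generatorsI restr_closed) (use assms in simp_all)
qed

lemma gen_surj:
  assumes "e \<in> generators X P U" "openin (pspace X) U" "s \<in> sect P U"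
  obtains a where "a \<in> sect X U" "s = act P U a e"
proof -
  have "s \<in> (\<lambda>a. act P U a (restr P U U e)) ` sect X U"
    using bij_betw_imp_surj_on[OF gen_bij[OF assms(1,2) order_refl]] assms(3) by simp
  thus ?thesis using assms(1,2) by (elim imageE) (rule that, simp_all)
qed

lemma gen_inj:
  assumes "e \<in> generators X P U" "openin (pspace X) U" "a \<in> sect X U" "b \<in> sect X U" "act P U a e = act P U b e"
  shows "a = b"
  by (rule inj_onD[OF bij_betw_imp_inj_on[OF gen_bij[OF assms(1,2) order_refl]]]) (use assms in simp_all)

text \<open>Each generator is a multiple of the other; since a generator is free, the two
  multipliers are inverse to each other.\<close>

lemma gen_unitE:
  assumes "e \<in> generators X P U" "openin (pspace X) U" "e' \<in> generators X P U"
  obtains u where "u \<in> Units (secmon X U)" "e' = act P U u e"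
proof -
  obtain u where u: "u \<in> sect X U" "e' = act P U u e" by (rule gen_surj[OF assms(1,2) gen_closed[OF assms(3)]])
  obtain v where v: "v \<in> sect X U" "e = act P U v e'" by (rule gen_surj[OF assms(3,2) gen_closed[OF assms(1)]])
  have "act P U (mul X U v u) e = act P U (neutral X U) e"
    using u v assms act_mul[of U v u e] by simp
  hence "mul X U v u = neutral X U"
    by (rule gen_inj[OF assms(1,2), rotated 2]) (use u v assms in auto)
  hence "u \<in> Units (secmon X U)" by (intro X.unitI[of _ _ v]) (use u v assms in auto)
  thus ?thesis using u that by blast
qed

lemma gen_act [simp]:
  assumes U: "openin (pspace X) U" and u: "u \<in> Units (secmon X U)" and e: "e \<in> generators X P U"
  shows "act P U u e \<in> generators X P U"
proof -
  obtain v where v: "u \<in> sect X U" "v \<in> sect X U" "mul X U v u = neutral X U" "mul X U u v = neutral X U"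
    using u by (rule X.unitE)
  have "bij_betw (\<lambda>a. act P V a (restr P U V (act P U u e))) (sect X V) (sect P V)"
    if V: "openin (pspace X) V" "V \<subseteq> U" for V
  proof -
    let ?u = "restr X U V u" and ?v = "restr X U V v" and ?e = "restr P U V e"
    have vu: "mul X V ?v ?u = neutral X V" "mul X V ?u ?v = neutral X V"
      using X.restr_mul[OF U V v(2,1)] X.restr_mul[OF U V v(1,2)] v U V by simp_all
    have uv: "?u \<in> sect X V" "?v \<in> sect X V" "?e \<in> sect P V" using U V v e by simp_all
    have "bij_betw (\<lambda>a. mul X V a ?u) (sect X V) (sect X V)"
    proof (rule bij_betw_byWitness[where f' = "\<lambda>a. mul X V a ?v"])
      show "\<forall>a\<in>sect X V. mul X V (mul X V a ?u) ?v = a" "\<forall>a\<in>sect X V. mul X V (mul X V a ?v) ?u = a"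
        using uv V vu by (simp_all add: X.mul_assoc del: X.restr_mul)
    qed (use uv V in auto)
    from bij_betw_trans[OF this gen_bij[OF e V]]
    have "bij_betw (\<lambda>a. act P V (mul X V a ?u) ?e) (sect X V) (sect P V)"
      by (simp add: o_def)
    moreover have "act P V a (restr P U V (act P U u e)) = act P V (mul X V a ?u) ?e" if "a \<in> sect X V" for a
      using that U V v e uv by (simp add: act_mul)
    ultimately show ?thesis by (simp cong: bij_betw_cong)
  qed
  thus ?thesis by (intro generatorsI act_closed) (use U e v(1) in simp_all)
qed

end

lemma structure_oset_simps [simp]:
  "pspace (structure_oset X) = pspace X"
  "sect (structure_oset X) = sect X"
  "restr (structure_oset X) = restr X"
  "act (structure_oset X) = mul X"
  by (simp_all add: structure_oset_def)

lemma structure_oset_sheaf: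
  fixes X :: "('p, 'a) monoid_presheaf"
  assumes "cmonoid_sheaf X" shows "oset_sheaf X (structure_oset X)"
proof -
  interpret X: cmonoid_sheaf X by fact
  have "is_sheaf (structure_oset X)"
    using X.is_sheaf unfolding is_sheaf_def is_presheaf_def by simp
  thus ?thesis
    unfolding oset_sheaf_iff[OF assms] is_oset_sheaf_def by (simp add: X.mul_assoc)
qed

text \<open>The unit section generates, and all further generators are its unit multiples.\<close>

lemma generators_structure_oset:
  fixes X :: "('p, 'a) monoid_presheaf"
  assumes X: "cmonoid_sheaf X" and U: "openin (pspace X) U"
  shows "generators X (structure_oset X) U = Units (secmon X U)"
proof -
  interpret X: cmonoid_sheaf X by fact
  interpret O: oset_sheaf X "structure_oset X" by (rule structure_oset_sheaf[OF X])
  have one: "neutral X U \<in> generators X (structure_oset X) U"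
  proof -
    have "bij_betw (\<lambda>a. mul X V a (neutral X V)) (sect X V) (sect X V)" if "openin (pspace X) V" for V
      using that bij_betw_id by (simp cong: bij_betw_cong)
    thus ?thesis using U by (intro generatorsI) simp_all
  qed
  show ?thesis
  proof
    show "generators X (structure_oset X) U \<subseteq> Units (secmon X U)"
    proof
      fix e assume "e \<in> generators X (structure_oset X) U"
      from O.gen_unitE[OF one U this] obtain u where "u \<in> Units (secmon X U)" "e = mul X U u (neutral X U)"
        by auto
      thus "e \<in> Units (secmon X U)" using U by simp
    qed
    show "Units (secmon X U) \<subseteq> generators X (structure_oset X) U"
      using O.gen_act[OF U _ one] U by auto
  qed
qed

lemma restrict_to_act [simp]: "act (restrict_to L U) = act L"
  by (simp add: restrict_to_def)

text \<open>A trivialization over \<open>U\<close> and a generator over \<open>U\<close> are the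
  same datum: the generator is the section sent to 1, and conversely taking the coefficient of a
  section with respect to a generator is the trivialization.\<close>

lemma line_bundle_iff:
  fixes X :: "('p, 'a) monoid_presheaf" and L :: "('p, 'a, 'l) oset_presheaf"
  assumes X: "cmonoid_sheaf X"
  shows "line_bundle X L \<longleftrightarrow> oset_sheaf X L \<and>
    (\<forall>x\<in>topspace (pspace X). \<exists>U. openin (pspace X) U \<and> x \<in> U \<and> generators X L U \<noteq> {})"
proof -
  interpret X: cmonoid_sheaf X by fact
  have key: "oset_iso (restrict_to X U) (restrict_to L U) (structure_oset (restrict_to X U)) \<longleftrightarrow> generators X L U \<noteq> {}"
    if L: "oset_sheaf X L" and U: "openin (pspace X) U" for U
  proof -
    interpret L: oset_sheaf X L by fact
    have op: "openin (subtopology (pspace X) U) V \<longleftrightarrow> openin (pspace X) V \<and> V \<subseteq> U" for V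
      using openin_open_subtopology[OF U] .
    show ?thesis
    proof
      assume "oset_iso (restrict_to X U) (restrict_to L U) (structure_oset (restrict_to X U))"
      then obtain \<phi> where \<phi>0: "(\<forall>V. openin (pspace X) V \<and> V \<subseteq> U \<longrightarrow> bij_betw (\<phi> V) (sect L V) (sect X V) \<and>
          (\<forall>a\<in>sect X V. \<forall>s\<in>sect L V. \<phi> V (act L V a s) = mul X V a (\<phi> V s))) \<and>
         (\<forall>V W. (openin (pspace X) V \<and> V \<subseteq> U) \<and> (openin (pspace X) W \<and> W \<subseteq> U) \<and> W \<subseteq> V \<longrightarrow>
            (\<forall>s\<in>sect L V. \<phi> W (restr L V W s) = restr X V W (\<phi> V s)))"
        unfolding oset_iso_def restrict_to_simps structure_oset_simps restrict_to_act restrict_to_monoid_simps op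
        by (rule exE)
      have bij: "bij_betw (\<phi> V) (sect L V) (sect X V)" if "openin (pspace X) V" "V \<subseteq> U" for V
        using \<phi>0 that by simp
      have equi: "\<phi> V (act L V a s) = mul X V a (\<phi> V s)"
        if "openin (pspace X) V" "V \<subseteq> U" "a \<in> sect X V" "s \<in> sect L V" for V a s
        using \<phi>0 that by simp
      have nat: "\<phi> V (restr L U V s) = restr X U V (\<phi> U s)" if "openin (pspace X) V" "V \<subseteq> U" "s \<in> sect L U" for V s
        using \<phi>0 that U by simp
      have "neutral X U \<in> \<phi> U ` sect L U" using bij[OF U order_refl] U by (simp add: bij_betw_def)
      then obtain e where e: "e \<in> sect L U" "\<phi> U e = neutral X U" by auto
      have "bij_betw (\<lambda>a. act L V a (restr L U V e)) (sect X V) (sect L V)"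
        if V: "openin (pspace X) V" "V \<subseteq> U" for V
      proof -
        let ?m = "\<lambda>a. act L V a (restr L U V e)"
        have m: "?m a \<in> sect L V" "\<phi> V (?m a) = a" if "a \<in> sect X V" for a
          using that V U e equi[OF V that, of "restr L U V e"] nat[OF V e(1)] by simp_all
        show ?thesis
        proof (rule bij_betw_byWitness[where f' = "\<phi> V"])
          show "\<forall>a\<in>sect X V. \<phi> V (?m a) = a" using m by simp
          show "\<forall>s\<in>sect L V. ?m (\<phi> V s) = s"
          proof
            fix s assume s: "s \<in> sect L V"
            have "\<phi> V s \<in> sect X V" using bij[OF V] s by (auto simp: bij_betw_def)
            thus "?m (\<phi> V s) = s" using m[of "\<phi> V s"] bij[OF V] s by (auto simp: bij_betw_def inj_on_def)
          qed
        qed (use m bij[OF V] in \<open>auto simp: bij_betw_def\<close>)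
      qed
      hence "e \<in> generators X L U" by (intro generatorsI e(1))
      thus "generators X L U \<noteq> {}" by blast
    next
      assume "generators X L U \<noteq> {}"
      then obtain e where e: "e \<in> generators X L U" by blast
      define m where "m = (\<lambda>V a. act L V a (restr L U V e))"
      have bij: "bij_betw (m V) (sect X V) (sect L V)" if "openin (pspace X) V" "V \<subseteq> U" for V
        using L.gen_bij[OF e that] by (simp add: m_def)
      define \<phi> where "\<phi> = (\<lambda>V. inv_into (sect X V) (m V))"
      have \<phi>: "bij_betw (\<phi> V) (sect L V) (sect X V)" if "openin (pspace X) V" "V \<subseteq> U" for V
        unfolding \<phi>_def by (rule bij_betw_inv_into[OF bij[OF that]])
      have \<phi>m: "\<phi> V (m V a) = a" if "openin (pspace X) V" "V \<subseteq> U" "a \<in> sect X V" for V a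
        unfolding \<phi>_def using bij[OF that(1,2)] that(3) by (simp add: bij_betw_def)
      have mE: "\<exists>a\<in>sect X V. s = m V a" if "openin (pspace X) V" "V \<subseteq> U" "s \<in> sect L V" for V s
        using bij[OF that(1,2)] that(3) by (auto simp: bij_betw_def)
      have equi: "\<phi> V (act L V a s) = mul X V a (\<phi> V s)"
        if V: "openin (pspace X) V" "V \<subseteq> U" and a: "a \<in> sect X V" and s: "s \<in> sect L V" for V a s
      proof -
        obtain b where b: "b \<in> sect X V" "s = m V b" using mE[OF V s] by blast
        have "act L V a s = m V (mul X V a b)" using a b V U e by (simp add: m_def L.act_mul)
        thus ?thesis using \<phi>m[OF V] a b V by simp
      qed
      have nat: "\<phi> W (restr L V W s) = restr X V W (\<phi> V s)"
        if V: "openin (pspace X) V" "V \<subseteq> U" and W: "openin (pspace X) W" "W \<subseteq> U" "W \<subseteq> V" and s: "s \<in> sect L V" for V W s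
      proof -
        obtain b where b: "b \<in> sect X V" "s = m V b" using mE[OF V s] by blast
        have "restr L V W s = m W (restr X V W b)" using b V W U e by (simp add: m_def)
        thus ?thesis using \<phi>m[OF V] \<phi>m[OF W(1,2)] b V W by simp
      qed
      show "oset_iso (restrict_to X U) (restrict_to L U) (structure_oset (restrict_to X U))"
        unfolding oset_iso_def restrict_to_simps structure_oset_simps restrict_to_act restrict_to_monoid_simps op
        by (intro exI[of _ \<phi>] conjI allI impI ballI \<phi> equi nat) simp_all
    qed
  qed
  show ?thesis
    unfolding line_bundle_def oset_sheaf_iff[OF X, symmetric]
    by (cases "oset_sheaf X L") (simp_all add: key cong: conj_cong)
qed

lemma (in oset_presheaf) gen_local:
  assumes "\<forall>x\<in>topspace (pspace X). \<exists>U. openin (pspace X) U \<and> x \<in> U \<and> generators X P U \<noteq> {}"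
    "openin (pspace X) N" "x \<in> N"
  obtains U e where "openin (pspace X) U" "x \<in> U" "U \<subseteq> N" "e \<in> generators X P U"
proof -
  have "x \<in> topspace (pspace X)" using assms(2,3) openin_subset by blast
  then obtain U e where U: "openin (pspace X) U" "x \<in> U" "e \<in> generators X P U" using assms(1) by blast
  show ?thesis
    by (rule that[of "U \<inter> N" "restr P U (U \<inter> N) e"]) (use U assms in \<open>auto simp: openin_Int\<close>)
qed

section \<open>Isomorphisms of line bundles\<close>

definition is_oset_iso ::
    "('p, 'a) monoid_presheaf \<Rightarrow> ('p, 'a, 'l) oset_presheaf \<Rightarrow> ('p, 'a, 'k) oset_presheaf \<Rightarrow> ('p set \<Rightarrow> 'l \<Rightarrow> 'k) \<Rightarrow> bool" where
  "is_oset_iso X L L' \<phi> \<longleftrightarrow>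
     (\<forall>U. openin (pspace X) U \<longrightarrow> bij_betw (\<phi> U) (sect L U) (sect L' U) \<and>
        (\<forall>a\<in>sect X U. \<forall>s\<in>sect L U. \<phi> U (act L U a s) = act L' U a (\<phi> U s))) \<and>
     (\<forall>U V. openin (pspace X) U \<and> openin (pspace X) V \<and> V \<subseteq> U \<longrightarrow>
        (\<forall>s\<in>sect L U. \<phi> V (restr L U V s) = restr L' U V (\<phi> U s)))"

lemma oset_iso_iff: "oset_iso X L L' \<longleftrightarrow> (\<exists>\<phi>. is_oset_iso X L L' \<phi>)"
  by (simp add: oset_iso_def is_oset_iso_def)

lemma is_oset_isoD:
  assumes "is_oset_iso X L L' \<phi>" "openin (pspace X) U"
  shows "bij_betw (\<phi> U) (sect L U) (sect L' U)"
    "s \<in> sect L U \<Longrightarrow> \<phi> U s \<in> sect L' U"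
    "\<lbrakk>a \<in> sect X U; s \<in> sect L U\<rbrakk> \<Longrightarrow> \<phi> U (act L U a s) = act L' U a (\<phi> U s)"
    "\<lbrakk>openin (pspace X) V; V \<subseteq> U; s \<in> sect L U\<rbrakk> \<Longrightarrow> \<phi> V (restr L U V s) = restr L' U V (\<phi> U s)"
  using assms unfolding is_oset_iso_def by (simp_all, metis bij_betwE)

lemma oset_iso_refl: "oset_iso X L L"
  unfolding oset_iso_def by (intro exI[of _ "\<lambda>_ s. s"]) (simp add: bij_betw_id[unfolded id_def])

lemma oset_iso_trans:
  assumes "oset_iso X L M" "oset_iso X M N" shows "oset_iso X L N"
proof -
  obtain \<phi> \<psi> where \<phi>: "is_oset_iso X L M \<phi>" and \<psi>: "is_oset_iso X M N \<psi>"
    using assms unfolding oset_iso_iff by blast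
  have "is_oset_iso X L N (\<lambda>U. \<psi> U \<circ> \<phi> U)"
    unfolding is_oset_iso_def
  proof (intro conjI allI impI ballI)
    fix U assume U: "openin (pspace X) U"
    show "bij_betw (\<psi> U \<circ> \<phi> U) (sect L U) (sect N U)"
      by (rule bij_betw_trans[OF is_oset_isoD(1)[OF \<phi> U] is_oset_isoD(1)[OF \<psi> U]])
    fix a s assume "a \<in> sect X U" "s \<in> sect L U"
    thus "(\<psi> U \<circ> \<phi> U) (act L U a s) = act N U a ((\<psi> U \<circ> \<phi> U) s)"
      using is_oset_isoD(2,3)[OF \<phi> U] is_oset_isoD(3)[OF \<psi> U] by simp
  next
    fix U V s assume *: "openin (pspace X) U \<and> openin (pspace X) V \<and> V \<subseteq> U" "s \<in> sect L U"
    thus "(\<psi> V \<circ> \<phi> V) (restr L U V s) = restr N U V ((\<psi> U \<circ> \<phi> U) s)"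
      using is_oset_isoD(2,4)[OF \<phi>] is_oset_isoD(4)[OF \<psi>] by simp
  qed
  thus ?thesis unfolding oset_iso_iff by blast
qed

lemma oset_iso_sym:
  assumes L: "oset_presheaf X L" and iso: "oset_iso X L M" shows "oset_iso X M L"
proof -
  interpret L: oset_presheaf X L by fact
  obtain \<phi> where \<phi>: "is_oset_iso X L M \<phi>" using iso unfolding oset_iso_iff by blast
  define \<psi> where "\<psi> = (\<lambda>U. inv_into (sect L U) (\<phi> U))"
  have inv: "\<psi> U (\<phi> U s) = s" if "openin (pspace X) U" "s \<in> sect L U" for U s
    using is_oset_isoD(1)[OF \<phi> that(1)] that(2) by (simp add: \<psi>_def bij_betw_def)
  have surj: "\<exists>s\<in>sect L U. t = \<phi> U s" if "openin (pspace X) U" "t \<in> sect M U" for U t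
    using is_oset_isoD(1)[OF \<phi> that(1)] that(2) by (auto simp: bij_betw_def)
  have "is_oset_iso X M L \<psi>"
    unfolding is_oset_iso_def
  proof (intro conjI allI impI ballI)
    fix U assume U: "openin (pspace X) U"
    show "bij_betw (\<psi> U) (sect M U) (sect L U)"
      unfolding \<psi>_def by (rule bij_betw_inv_into[OF is_oset_isoD(1)[OF \<phi> U]])
    fix a t assume a: "a \<in> sect X U" and t: "t \<in> sect M U"
    obtain s where "s \<in> sect L U" "t = \<phi> U s" using surj[OF U t] by blast
    thus "\<psi> U (act M U a t) = act L U a (\<psi> U t)"
      using is_oset_isoD(3)[OF \<phi> U a, symmetric] inv[OF U] U a by simp
  next
    fix U V t assume *: "openin (pspace X) U \<and> openin (pspace X) V \<and> V \<subseteq> U" and t: "t \<in> sect M U"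
    obtain s where "s \<in> sect L U" "t = \<phi> U s" using surj[OF _ t] * by blast
    thus "\<psi> V (restr M U V t) = restr L U V (\<psi> U t)"
      using is_oset_isoD(4)[OF \<phi>, symmetric, of U V s] inv * by simp
  qed
  thus ?thesis unfolding oset_iso_iff by blast
qed

lemma is_oset_iso_gen:
  assumes L: "oset_presheaf X L" and \<phi>: "is_oset_iso X L M \<phi>" and U: "openin (pspace X) U"
    and e: "e \<in> generators X L U"
  shows "\<phi> U e \<in> generators X M U"
proof -
  interpret L: oset_presheaf X L by fact
  have "bij_betw (\<lambda>a. act M V a (restr M U V (\<phi> U e))) (sect X V) (sect M V)"
    if V: "openin (pspace X) V" "V \<subseteq> U" for V
  proof -
    have "bij_betw (\<lambda>a. \<phi> V (act L V a (restr L U V e))) (sect X V) (sect M V)"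
      using bij_betw_trans[OF L.gen_bij[OF e V] is_oset_isoD(1)[OF \<phi> V(1)]] by (simp add: o_def)
    moreover have "\<phi> V (act L V a (restr L U V e)) = act M V a (restr M U V (\<phi> U e))" if "a \<in> sect X V" for a
      using is_oset_isoD(3)[OF \<phi> V(1) that, of "restr L U V e"] is_oset_isoD(4)[OF \<phi> U V, of e] e U V by simp
    ultimately show ?thesis by (simp cong: bij_betw_cong)
  qed
  moreover have "\<phi> U e \<in> sect M U" using is_oset_isoD(2)[OF \<phi> U] e by simp
  ultimately show ?thesis by (intro generatorsI)
qed

text \<open>A set of triples \<open>(W, e, f)\<close> of an open set with generators \<open>e\<close> of \<open>L\<close> and \<open>f\<close> of \<open>N\<close> over
  it plays the role of a pair of trivializations with equal cocycles.\<close>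

definition matching_generators ::
    "('p, 'a) monoid_presheaf \<Rightarrow> ('p, 'a, 'l) oset_presheaf \<Rightarrow> ('p, 'a, 'k) oset_presheaf \<Rightarrow> ('p set \<times> 'l \<times> 'k) set \<Rightarrow> bool" where
  "matching_generators X L N C \<longleftrightarrow>
     (\<forall>(W, e, f)\<in>C. openin (pspace X) W \<and> e \<in> generators X L W \<and> f \<in> generators X N W) \<and>
     (\<forall>x\<in>topspace (pspace X). \<exists>(W, e, f)\<in>C. x \<in> W) \<and>
     (\<forall>(W, e, f)\<in>C. \<forall>(W', e', f')\<in>C. \<exists>u\<in>sect X (W \<inter> W').
        restr L W (W \<inter> W') e = act L (W \<inter> W') u (restr L W' (W \<inter> W') e') \<and>
        restr N W (W \<inter> W') f = act N (W \<inter> W') u (restr N W' (W \<inter> W') f'))"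

lemma matching_generatorsD:
  assumes "matching_generators X L N C"
  shows "(W, e, f) \<in> C \<Longrightarrow> openin (pspace X) W" "(W, e, f) \<in> C \<Longrightarrow> e \<in> generators X L W"
    "(W, e, f) \<in> C \<Longrightarrow> f \<in> generators X N W"
    "x \<in> topspace (pspace X) \<Longrightarrow> \<exists>W e f. (W, e, f) \<in> C \<and> x \<in> W"
    "\<lbrakk>(W, e, f) \<in> C; (W', e', f') \<in> C\<rbrakk> \<Longrightarrow> \<exists>u\<in>sect X (W \<inter> W').
        restr L W (W \<inter> W') e = act L (W \<inter> W') u (restr L W' (W \<inter> W') e') \<and>
        restr N W (W \<inter> W') f = act N (W \<inter> W') u (restr N W' (W \<inter> W') f')"
  using assms unfolding matching_generators_def by fast+

text \<open>The graph of the isomorphism to be built: wherever \<open>s\<close> is \<open>a\<close>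
  times a generator from \<open>C\<close>, \<open>n\<close> is \<open>a\<close> times the partner of
  that generator. Quantifying over all smaller open sets and all triples keeps it independent of
  choices and compatible with restriction.\<close>

definition same_coordinates ::
    "('p, 'a) monoid_presheaf \<Rightarrow> ('p, 'a, 'l) oset_presheaf \<Rightarrow> ('p, 'a, 'k) oset_presheaf \<Rightarrow> ('p set \<times> 'l \<times> 'k) set
      \<Rightarrow> 'p set \<Rightarrow> 'l \<Rightarrow> 'k \<Rightarrow> bool" where
  "same_coordinates X L N C U s n \<longleftrightarrow> (\<forall>V W e f a. openin (pspace X) V \<and> V \<subseteq> U \<and> (W, e, f) \<in> C \<and> V \<subseteq> W \<and>
     a \<in> sect X V \<and> restr L U V s = act L V a (restr L W V e) \<longrightarrow> restr N U V n = act N V a (restr N W V f))"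

text \<open>Local candidates for \<open>n\<close> are obtained by copying coefficients. Two triples
  have the same transition function on both sides, so the coefficients of \<open>s\<close> change in
  exactly the way that makes the candidates agree.\<close>

lemma same_coordinates_ex1:
  assumes L: "oset_sheaf X L" and N: "oset_sheaf X N" and C: "matching_generators X L N C"
    and U: "openin (pspace X) U" and s: "s \<in> sect L U"
  shows "\<exists>!n. n \<in> sect N U \<and> same_coordinates X L N C U s n"
proof -
  interpret L: oset_sheaf X L by fact
  interpret N: oset_sheaf X N by fact
  note D = matching_generatorsD[OF C]
  let ?P = "\<lambda>V n. \<exists>W e f a. (W, e, f) \<in> C \<and> V \<subseteq> W \<and> a \<in> sect X V \<and>
      restr L U V s = act L V a (restr L W V e) \<and> n = act N V a (restr N W V f)"
  have "\<exists>!n. n \<in> sect N U \<and>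
    (\<forall>V n'. openin (pspace N) V \<and> V \<subseteq> U \<and> n' \<in> sect N V \<and> ?P V n' \<longrightarrow> restr N U V n = n')"
  proof (rule N.glue_rel)
    show "openin (pspace N) U" using U by simp
    fix x assume x: "x \<in> U"
    hence "x \<in> topspace (pspace X)" using openin_subset[OF U] by blast
    then obtain W e f where W: "(W, e, f) \<in> C" "x \<in> W" using D(4) by blast
    let ?V = "U \<inter> W"
    have V: "openin (pspace X) ?V" "?V \<subseteq> U" "?V \<subseteq> W" using U D(1)[OF W(1)] by auto
    have "restr L W ?V e \<in> generators X L ?V" using D(1,2)[OF W(1)] V by simp
    then obtain a where a: "a \<in> sect X ?V" "restr L U ?V s = act L ?V a (restr L W ?V e)"
      by (rule L.gen_surj) (use V U s in auto)
    have "act N ?V a (restr N W ?V f) \<in> sect N ?V" using a V D(1,3)[OF W(1)] by simp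
    thus "\<exists>V n. openin (pspace N) V \<and> x \<in> V \<and> V \<subseteq> U \<and> n \<in> sect N V \<and> ?P V n"
      by (intro exI[of _ ?V] exI[of _ "act N ?V a (restr N W ?V f)"] conjI exI[of _ W] exI[of _ e] exI[of _ f] exI[of _ a])
         (use V x W a in auto)
  next
    fix V V' n n'
    assume o: "openin (pspace N) V" "openin (pspace N) V'" "V \<subseteq> U" "V' \<subseteq> U"
      and P: "?P V n" and P': "?P V' n'"
    from P obtain W e f a where W: "(W, e, f) \<in> C" "V \<subseteq> W" "a \<in> sect X V"
      "restr L U V s = act L V a (restr L W V e)" "n = act N V a (restr N W V f)" by (elim exE conjE)
    from P' obtain W' e' f' a' where W': "(W', e', f') \<in> C" "V' \<subseteq> W'" "a' \<in> sect X V'"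
      "restr L U V' s = act L V' a' (restr L W' V' e')" "n' = act N V' a' (restr N W' V' f')" by (elim exE conjE)
    let ?Z = "V \<inter> V'"
    from D(5)[OF W(1) W'(1)] obtain u where u: "u \<in> sect X (W \<inter> W')"
      "restr L W (W \<inter> W') e = act L (W \<inter> W') u (restr L W' (W \<inter> W') e')"
      "restr N W (W \<inter> W') f = act N (W \<inter> W') u (restr N W' (W \<inter> W') f')" by blast
    have Z: "openin (pspace X) V" "openin (pspace X) V'" "openin (pspace X) ?Z" "?Z \<subseteq> V" "?Z \<subseteq> V'" "?Z \<subseteq> W \<inter> W'" "?Z \<subseteq> U" "?Z \<subseteq> W" "?Z \<subseteq> W'"
      "openin (pspace X) W" "openin (pspace X) W'" "openin (pspace X) (W \<inter> W')"
      using o W(2) W'(2) D(1)[OF W(1)] D(1)[OF W'(1)] by auto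
    note [simp] = Z D(2)[OF W(1), THEN L.gen_closed] D(2)[OF W'(1), THEN L.gen_closed]
      D(3)[OF W(1), THEN N.gen_closed] D(3)[OF W'(1), THEN N.gen_closed] u(1) W(3) W'(3) s U W(2) W'(2) o(3,4)
    let ?a = "restr X V ?Z a" and ?a' = "restr X V' ?Z a'" and ?u = "restr X (W \<inter> W') ?Z u"
    have eu: "restr L W ?Z e = act L ?Z ?u (restr L W' ?Z e')"
      using arg_cong[OF u(2), of "restr L (W \<inter> W') ?Z"] by simp
    have fu: "restr N W ?Z f = act N ?Z ?u (restr N W' ?Z f')"
      using arg_cong[OF u(3), of "restr N (W \<inter> W') ?Z"] by simp
    have "restr L U ?Z s = act L ?Z ?a (restr L W ?Z e)"
      using arg_cong[OF W(4), of "restr L V ?Z"] by simp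
    moreover have "restr L U ?Z s = act L ?Z ?a' (restr L W' ?Z e')"
      using arg_cong[OF W'(4), of "restr L V' ?Z"] by simp
    ultimately have "act L ?Z (mul X ?Z ?a ?u) (restr L W' ?Z e') = act L ?Z ?a' (restr L W' ?Z e')"
      by (simp add: eu L.act_mul)
    \<comment> \<open>Coefficients with respect to the generator \<open>e'\<close> are unique; the
      same relation then identifies the two candidates in \<open>N\<close>.\<close>
    hence au: "mul X ?Z ?a ?u = ?a'"
      by (rule L.gen_inj[OF L.gen_restr[OF _ _ _ D(2)[OF W'(1)]], rotated 6]) simp_all
    show "restr N V ?Z n = restr N V' ?Z n'"
      by (simp add: W(5) W'(5) fu au[symmetric] N.act_mul)
  qed
  moreover have "(\<forall>V n'. openin (pspace N) V \<and> V \<subseteq> U \<and> n' \<in> sect N V \<and> ?P V n' \<longrightarrow> restr N U V n = n') \<longleftrightarrow>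
      same_coordinates X L N C U s n" (is "?A n \<longleftrightarrow> ?B n") for n
  proof
    assume A: "?A n"
    show "?B n"
      unfolding same_coordinates_def
    proof (intro allI impI)
      fix V W e f a assume *: "openin (pspace X) V \<and> V \<subseteq> U \<and> (W, e, f) \<in> C \<and> V \<subseteq> W \<and>
        a \<in> sect X V \<and> restr L U V s = act L V a (restr L W V e)"
      have "act N V a (restr N W V f) \<in> sect N V" using * D(1)[of W e f] D(3)[of W e f] by simp
      thus "restr N U V n = act N V a (restr N W V f)"
        using A[rule_format, of V "act N V a (restr N W V f)"] * by (metis N.pspace_eq)
    qed
  next
    assume B: "?B n"
    show "?A n"
    proof (intro allI impI, elim conjE exE)
      fix V n' W e f a assume "openin (pspace N) V" "V \<subseteq> U" "(W, e, f) \<in> C" "V \<subseteq> W" "a \<in> sect X V"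
        "restr L U V s = act L V a (restr L W V e)" "n' = act N V a (restr N W V f)"
      thus "restr N U V n = n'"
        using B[unfolded same_coordinates_def, rule_format, of V W e f a] by simp
    qed
  qed
  ultimately show ?thesis by simp
qed

lemma matching_generators_flip:
  "matching_generators X L N C \<Longrightarrow> matching_generators X N L ((\<lambda>(W, e, f). (W, f, e)) ` C)"
  unfolding matching_generators_def by (simp add: case_prod_beta) fast

text \<open>The given coefficient of \<open>n\<close> must equal the coefficient of
  \<open>s\<close>, because the generator of \<open>N\<close> is free. Symmetry of the graph is what
  yields bijectivity later.\<close>

lemma same_coordinates_flip:
  assumes L: "oset_sheaf X L" and N: "oset_sheaf X N" and C: "matching_generators X L N C"
    and U: "openin (pspace X) U" and s: "s \<in> sect L U" and n: "n \<in> sect N U"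
    and sn: "same_coordinates X L N C U s n"
  shows "same_coordinates X N L ((\<lambda>(W, e, f). (W, f, e)) ` C) U n s"
  unfolding same_coordinates_def
proof (intro allI impI, elim conjE)
  interpret L: oset_sheaf X L by fact
  interpret N: oset_sheaf X N by fact
  note D = matching_generatorsD[OF C]
  fix V W f e a
  assume V: "openin (pspace X) V" "V \<subseteq> U" and "(W, f, e) \<in> (\<lambda>(W, e, f). (W, f, e)) ` C" and VW: "V \<subseteq> W"
    and a: "a \<in> sect X V" "restr N U V n = act N V a (restr N W V f)"
  hence W: "(W, e, f) \<in> C" by auto
  have eV: "restr L W V e \<in> generators X L V" and fV: "restr N W V f \<in> generators X N V"
    using D(1-3)[OF W] V VW by simp_all
  obtain b where b: "b \<in> sect X V" "restr L U V s = act L V b (restr L W V e)"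
    using eV by (rule L.gen_surj) (use V U s in auto)
  have "restr N U V n = act N V b (restr N W V f)"
    using sn[unfolded same_coordinates_def, rule_format, of V W e f b] V W VW b by simp
  hence "a = b" using N.gen_inj[OF fV V(1) a(1) b(1)] a(2) by simp
  thus "restr L U V s = act L V a (restr L W V e)" using b by simp
qed

text \<open>The graph is functional in both directions by \<open>same_coordinates_ex1\<close>
  applied to \<open>C\<close> and to the flipped family; equivariance and naturality follow from
  uniqueness by comparing coefficients.\<close>

theorem oset_iso_if_matching_generators:
  assumes L: "oset_sheaf X L" and N: "oset_sheaf X N" and C: "matching_generators X L N C"
  shows "oset_iso X L N"
proof -
  interpret L: oset_sheaf X L by fact
  interpret N: oset_sheaf X N by fact
  note D = matching_generatorsD[OF C]
  let ?R = "same_coordinates X L N C"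
  let ?C = "(\<lambda>(W, e, f). (W, f, e)) ` C"
  have C': "matching_generators X N L ?C" by (rule matching_generators_flip[OF C])
  have flip_flip: "(\<lambda>(W, e, f). (W, f, e)) ` ?C = C" by (force simp: image_image case_prod_beta)
  define \<phi> where "\<phi> = (\<lambda>U s. THE n. n \<in> sect N U \<and> ?R U s n)"
  have \<phi>: "\<phi> U s \<in> sect N U \<and> ?R U s (\<phi> U s)" if "openin (pspace X) U" "s \<in> sect L U" for U s
    unfolding \<phi>_def by (rule theI'[OF same_coordinates_ex1[OF L N C that]])
  have \<phi>_eq: "\<phi> U s = n" if "openin (pspace X) U" "s \<in> sect L U" "n \<in> sect N U" "?R U s n" for U s n
    using ex1E[OF same_coordinates_ex1[OF L N C that(1,2)]] \<phi>[OF that(1,2)] that(3,4) by metis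
  have "is_oset_iso X L N \<phi>"
    unfolding is_oset_iso_def
  proof (intro conjI allI impI ballI)
    fix U assume U: "openin (pspace X) U"
    show "bij_betw (\<phi> U) (sect L U) (sect N U)"
      unfolding bij_betw_def
    proof
      show "inj_on (\<phi> U) (sect L U)"
      proof (rule inj_onI)
        fix s t assume s: "s \<in> sect L U" and t: "t \<in> sect L U" and eq: "\<phi> U s = \<phi> U t"
        have n: "\<phi> U s \<in> sect N U" using \<phi>[OF U s] by simp
        \<comment> \<open>Both \<open>s\<close> and \<open>t\<close> are partners of one section of
          \<open>N\<close> for the flipped family, where the partner is unique.\<close>
        have "same_coordinates X N L ?C U (\<phi> U s) s"
          using same_coordinates_flip[OF L N C U s] \<phi>[OF U s] by simp
        moreover have "same_coordinates X N L ?C U (\<phi> U s) t"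
          using same_coordinates_flip[OF L N C U t] \<phi>[OF U t] eq by simp
        ultimately show "s = t"
          using ex1E[OF same_coordinates_ex1[OF N L C' U n]] s t by metis
      qed
      show "\<phi> U ` sect L U = sect N U"
      proof
        show "\<phi> U ` sect L U \<subseteq> sect N U" using \<phi>[OF U] by auto
        show "sect N U \<subseteq> \<phi> U ` sect L U"
        proof
          fix n assume n: "n \<in> sect N U"
          from ex1_implies_ex[OF same_coordinates_ex1[OF N L C' U n]]
          obtain s where s: "s \<in> sect L U" "same_coordinates X N L ?C U n s" by (elim exE conjE)
          have "?R U s n" using same_coordinates_flip[OF N L C' U n s] unfolding flip_flip .
          thus "n \<in> \<phi> U ` sect L U" using \<phi>_eq[OF U s(1) n] s(1) by (intro image_eqI[of _ _ s]) simp_all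
        qed
      qed
    qed
    fix b s assume b: "b \<in> sect X U" and s: "s \<in> sect L U"
    have "?R U (act L U b s) (act N U b (\<phi> U s))"
      unfolding same_coordinates_def
    proof (intro allI impI, elim conjE)
      fix V W e f a
      assume V: "openin (pspace X) V" "V \<subseteq> U" and W: "(W, e, f) \<in> C" "V \<subseteq> W"
        and a: "a \<in> sect X V" "restr L U V (act L U b s) = act L V a (restr L W V e)"
      have eV: "restr L W V e \<in> generators X L V" and fV: "restr N W V f \<in> generators X N V"
        using D(1-3)[OF W(1)] V W by simp_all
      obtain c where c: "c \<in> sect X V" "restr L U V s = act L V c (restr L W V e)"
        using eV by (rule L.gen_surj) (use V U s in auto)
      have "act L V (mul X V (restr X U V b) c) (restr L W V e) = act L V a (restr L W V e)"
        using a(2) c V U b s eV by (simp add: L.act_mul)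
      hence "mul X V (restr X U V b) c = a"
        by (rule L.gen_inj[OF eV V(1), rotated 2]) (use a c V U b in auto)
      moreover have "restr N U V (\<phi> U s) = act N V c (restr N W V f)"
        using \<phi>[OF U s] V W c unfolding same_coordinates_def by blast
      ultimately show "restr N U V (act N U b (\<phi> U s)) = act N V a (restr N W V f)"
        using \<phi>[OF U s] V U b c fV N.act_mul[of V "restr X U V b" c "restr N W V f"] by simp
    qed
    thus "\<phi> U (act L U b s) = act N U b (\<phi> U s)"
      using \<phi>_eq[OF U] \<phi>[OF U s] U b s by simp
  next
    fix U U' s assume *: "openin (pspace X) U \<and> openin (pspace X) U' \<and> U' \<subseteq> U" and s: "s \<in> sect L U"
    hence U: "openin (pspace X) U" "openin (pspace X) U'" "U' \<subseteq> U" by auto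
    have "?R U' (restr L U U' s) (restr N U U' (\<phi> U s))"
      unfolding same_coordinates_def
    proof (intro allI impI, elim conjE)
      fix V W e f a
      assume V: "openin (pspace X) V" "V \<subseteq> U'" and W: "(W, e, f) \<in> C" "V \<subseteq> W"
        and a: "a \<in> sect X V" "restr L U' V (restr L U U' s) = act L V a (restr L W V e)"
      have "restr L U V s = act L V a (restr L W V e)" using a(2) U V s by simp
      hence "restr N U V (\<phi> U s) = act N V a (restr N W V f)"
        using \<phi>[OF U(1) s] V W a(1) U(3) unfolding same_coordinates_def by blast
      thus "restr N U' V (restr N U U' (\<phi> U s)) = act N V a (restr N W V f)"
        using U V \<phi>[OF U(1) s] by simp
    qed
    thus "\<phi> U' (restr L U U' s) = restr N U U' (\<phi> U s)"
      using \<phi>_eq[OF U(2)] \<phi>[OF U(1) s] U s by simp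
  qed
  thus ?thesis unfolding oset_iso_iff by blast
qed

section \<open>The line bundle of a torsor\<close>

text \<open>The record for sheaves with an action is reused for torsors, with \<open>act\<close>
  meaningful for units only. Over each open set the sections, if any, form one free orbit, and there
  are sections near every point.\<close>

locale unit_torsor = X: cmonoid_sheaf X for X :: "('p, 'a) monoid_presheaf" +
  fixes T :: "('p, 'a, 't) oset_presheaf"
  assumes torsor_restr_closed: "\<lbrakk>openin (pspace X) U; openin (pspace X) V; V \<subseteq> U; t \<in> sect T U\<rbrakk>
      \<Longrightarrow> restr T U V t \<in> sect T V"
    and torsor_restr_restr: "\<lbrakk>openin (pspace X) U; openin (pspace X) V; openin (pspace X) W; W \<subseteq> V; V \<subseteq> U; t \<in> sect T U\<rbrakk>
      \<Longrightarrow> restr T V W (restr T U V t) = restr T U W t"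
    and torsor_act_closed: "\<lbrakk>openin (pspace X) U; u \<in> Units (secmon X U); t \<in> sect T U\<rbrakk> \<Longrightarrow> act T U u t \<in> sect T U"
    and torsor_act_mul: "\<lbrakk>openin (pspace X) U; u \<in> Units (secmon X U); v \<in> Units (secmon X U); t \<in> sect T U\<rbrakk>
      \<Longrightarrow> act T U (mul X U u v) t = act T U u (act T U v t)"
    and torsor_restr_act: "\<lbrakk>openin (pspace X) U; openin (pspace X) V; V \<subseteq> U; u \<in> Units (secmon X U); t \<in> sect T U\<rbrakk>
      \<Longrightarrow> restr T U V (act T U u t) = act T V (restr X U V u) (restr T U V t)"
    and torsor_free: "\<lbrakk>openin (pspace X) U; u \<in> Units (secmon X U); v \<in> Units (secmon X U); t \<in> sect T U;
        act T U u t = act T U v t\<rbrakk> \<Longrightarrow> u = v"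
    and torsor_transitive: "\<lbrakk>openin (pspace X) U; t \<in> sect T U; t' \<in> sect T U\<rbrakk>
      \<Longrightarrow> \<exists>u\<in>Units (secmon X U). t' = act T U u t"
    and torsor_local: "x \<in> topspace (pspace X) \<Longrightarrow> \<exists>U t. openin (pspace X) U \<and> x \<in> U \<and> t \<in> sect T U"

text \<open>Applied to the torsor of lifts of a divisor this is the condition in
  \<open>bundle_of_divisor\<close>; applied to generators of a bundle it compares bundles.\<close>

definition torsor_map ::
    "('p, 'a) monoid_presheaf \<Rightarrow> ('p, 'a, 't) oset_presheaf \<Rightarrow> ('p, 'a, 'l) oset_presheaf \<Rightarrow> ('p set \<Rightarrow> 't \<Rightarrow> 'l) \<Rightarrow> bool" where
  "torsor_map X T L \<epsilon> \<longleftrightarrow>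
     (\<forall>U. openin (pspace X) U \<longrightarrow> \<epsilon> U \<in> sect T U \<rightarrow> generators X L U \<and>
        (\<forall>u\<in>Units (secmon X U). \<forall>t\<in>sect T U. \<epsilon> U (act T U u t) = act L U u (\<epsilon> U t))) \<and>
     (\<forall>U V. openin (pspace X) U \<and> openin (pspace X) V \<and> V \<subseteq> U \<longrightarrow>
        (\<forall>t\<in>sect T U. \<epsilon> V (restr T U V t) = restr L U V (\<epsilon> U t)))"

lemma torsor_mapD:
  assumes "torsor_map X T L \<epsilon>" "openin (pspace X) U" "t \<in> sect T U"
  shows "\<epsilon> U t \<in> generators X L U"
    "u \<in> Units (secmon X U) \<Longrightarrow> \<epsilon> U (act T U u t) = act L U u (\<epsilon> U t)"
    "\<lbrakk>openin (pspace X) V; V \<subseteq> U\<rbrakk> \<Longrightarrow> \<epsilon> V (restr T U V t) = restr L U V (\<epsilon> U t)"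
  using assms unfolding torsor_map_def by (auto simp: Pi_iff)

section \<open>Coordinates of torsor sections at the points\<close>

context unit_torsor
begin

text \<open>A torsor embeds into the sheaf of not necessarily continuous families of invertible germs,
  by comparison with an arbitrary local section around each point.\<close>

definition base_section :: "'p \<Rightarrow> 'p set \<times> 't" where
  "base_section x = (SOME p. openin (pspace X) (fst p) \<and> x \<in> fst p \<and> snd p \<in> sect T (fst p))"

lemma base_section:
  assumes "x \<in> topspace (pspace X)"
  shows "openin (pspace X) (fst (base_section x))" "x \<in> fst (base_section x)"
    "snd (base_section x) \<in> sect T (fst (base_section x))"
proof -
  obtain U t where "openin (pspace X) U \<and> x \<in> U \<and> t \<in> sect T U" using torsor_local[OF assms] by blast
  hence "\<exists>p. openin (pspace X) (fst p) \<and> x \<in> fst p \<and> snd p \<in> sect T (fst p)"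
    by (intro exI[of _ "(U, t)"]) simp
  from someI_ex[OF this, folded base_section_def]
  show "openin (pspace X) (fst (base_section x))" "x \<in> fst (base_section x)"
    "snd (base_section x) \<in> sect T (fst (base_section x))" by auto
qed

text \<open>The germ at \<open>x\<close> of the unit that carries the base section at
  \<open>x\<close> to \<open>t\<close>. The base section changes with \<open>x\<close>, so the value
  is kept as a germ and the resulting family over \<open>x\<close> need not come from a section of
  \<open>X\<close>.\<close>

definition coord :: "'p set \<Rightarrow> 't \<Rightarrow> 'p \<Rightarrow> ('p, 'a) germ" where
  "coord W t x = (let (U, b) = base_section x in germ X x (W \<inter> U) (SOME u. u \<in> Units (secmon X (W \<inter> U)) \<and>
     restr T W (W \<inter> U) t = act T (W \<inter> U) u (restr T U (W \<inter> U) b)))"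

text \<open>Any comparison of \<open>t\<close> with the base section on a neighbourhood of
  \<open>x\<close> computes the coordinate: by freeness it is a restriction of the comparison chosen
  in the definition.\<close>

lemma coord_eq:
  assumes W: "openin (pspace X) W" "t \<in> sect T W" and V: "openin (pspace X) V" "x \<in> V" "V \<subseteq> W" "V \<subseteq> fst (base_section x)"
    and u: "u \<in> Units (secmon X V)" "restr T W V t = act T V u (restr T (fst (base_section x)) V (snd (base_section x)))"
  shows "coord W t x = germ X x V u"
proof -
  have x: "x \<in> topspace (pspace X)" using openin_subset[OF W(1)] V by blast
  obtain U b where Ub: "base_section x = (U, b)" by (cases "base_section x")
  note U = base_section[OF x, unfolded Ub fst_conv snd_conv] and V' = V(4)[unfolded Ub fst_conv]
    and u' = u(2)[unfolded Ub fst_conv snd_conv]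
  let ?Z = "W \<inter> U"
  have Z: "openin (pspace X) ?Z" "?Z \<subseteq> W" "?Z \<subseteq> U" "V \<subseteq> ?Z" using W U V V' by auto
  let ?P = "\<lambda>v. v \<in> Units (secmon X ?Z) \<and> restr T W ?Z t = act T ?Z v (restr T U ?Z b)"
  have "\<exists>v. ?P v"
    using torsor_transitive[OF Z(1) torsor_restr_closed[OF U(1) Z(1,3) U(3)] torsor_restr_closed[OF W(1) Z(1,2) W(2)]]
    by blast
  from someI_ex[OF this] have v: "?P (Eps ?P)" .
  define v where "v = Eps ?P"
  have v: "v \<in> Units (secmon X ?Z)" "restr T W ?Z t = act T ?Z v (restr T U ?Z b)"
    using v unfolding v_def by auto
  have "restr T W V t = restr T ?Z V (restr T W ?Z t)"
    by (rule torsor_restr_restr[symmetric]) (use W Z V in auto)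
  also have "\<dots> = act T V (restr X ?Z V v) (restr T U V b)"
    unfolding v(2) using torsor_restr_act[OF Z(1) V(1) Z(4) v(1) torsor_restr_closed[OF U(1) Z(1,3) U(3)]]
      torsor_restr_restr[OF U(1) Z(1) V(1) Z(4,3) U(3)] by simp
  finally have "act T V u (restr T U V b) = act T V (restr X ?Z V v) (restr T U V b)" using u' by simp
  hence "u = restr X ?Z V v"
    using torsor_free[OF V(1) u(1) X.restr_unit[OF Z(1) V(1) Z(4) v(1)] torsor_restr_closed[OF U(1) V(1) V' U(3)]] by simp
  hence "germ X x V u = germ X x ?Z v" using Z V v by simp
  thus ?thesis unfolding coord_def Ub v_def by simp
qed

lemma coord_local:
  assumes W: "openin (pspace X) W" "x \<in> W" "t \<in> sect T W"
  obtains V u where "openin (pspace X) V" "x \<in> V" "V \<subseteq> W" "V \<subseteq> fst (base_section x)" "u \<in> Units (secmon X V)"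
    "restr T W V t = act T V u (restr T (fst (base_section x)) V (snd (base_section x)))"
proof -
  have x: "x \<in> topspace (pspace X)" using openin_subset[OF W(1)] W by blast
  note U = base_section[OF x]
  let ?V = "W \<inter> fst (base_section x)"
  have V: "openin (pspace X) ?V" "?V \<subseteq> W" "?V \<subseteq> fst (base_section x)" "x \<in> ?V" using W U by auto
  obtain u where "u \<in> Units (secmon X ?V)"
    "restr T W ?V t = act T ?V u (restr T (fst (base_section x)) ?V (snd (base_section x)))"
    using torsor_transitive[OF V(1) torsor_restr_closed[OF U(1) V(1,3) U(3)] torsor_restr_closed[OF W(1) V(1,2) W(3)]]
    by (rule bexE)
  thus ?thesis using that V by blast
qed

lemma coord_unit:
  assumes "openin (pspace X) W" "x \<in> W" "t \<in> sect T W"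
  shows "coord W t x \<in> Units (stalk X x)"
proof -
  obtain V u where V: "openin (pspace X) V" "x \<in> V" "V \<subseteq> W" "V \<subseteq> fst (base_section x)" "u \<in> Units (secmon X V)"
    "restr T W V t = act T V u (restr T (fst (base_section x)) V (snd (base_section x)))"
    using assms by (rule coord_local)
  show ?thesis using coord_eq[OF assms(1,3) V] X.germ_unit[OF V(1,2,5)] by simp
qed

lemma coord_restr:
  assumes W: "openin (pspace X) W" "openin (pspace X) W'" "W' \<subseteq> W" "x \<in> W'" "t \<in> sect T W"
  shows "coord W' (restr T W W' t) x = coord W t x"
proof -
  have t': "restr T W W' t \<in> sect T W'" using torsor_restr_closed[OF W(1-3,5)] .
  obtain V u where V: "openin (pspace X) V" "x \<in> V" "V \<subseteq> W'" "V \<subseteq> fst (base_section x)" "u \<in> Units (secmon X V)"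
    "restr T W' V (restr T W W' t) = act T V u (restr T (fst (base_section x)) V (snd (base_section x)))"
    using W(2,4) t' by (rule coord_local)
  have "restr T W V t = act T V u (restr T (fst (base_section x)) V (snd (base_section x)))"
    using V(6) torsor_restr_restr[OF W(1,2) V(1,3) W(3,5)] by simp
  thus ?thesis
    using coord_eq[OF W(2) t' V] coord_eq[OF W(1,5) V(1,2) order_trans[OF V(3) W(3)] V(4,5)] by simp
qed

text \<open>Individual coordinates depend on arbitrary choices, but ratios of coordinates of two
  sections over the same open set are germs of a genuine unit. This is what gives the families below
  a sheaf structure.\<close>

lemma coord_act:
  assumes W: "openin (pspace X) W" "x \<in> W" "t \<in> sect T W" and w: "w \<in> Units (secmon X W)"
  shows "coord W (act T W w t) x = germ X x W w \<otimes>\<^bsub>stalk X x\<^esub> coord W t x"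
proof -
  have x: "x \<in> topspace (pspace X)" using openin_subset[OF W(1)] W by blast
  note U = base_section[OF x]
  obtain V u where V: "openin (pspace X) V" "x \<in> V" "V \<subseteq> W" "V \<subseteq> fst (base_section x)" "u \<in> Units (secmon X V)"
    "restr T W V t = act T V u (restr T (fst (base_section x)) V (snd (base_section x)))"
    using W by (rule coord_local)
  have wV: "restr X W V w \<in> Units (secmon X V)" using W V w by simp
  have "restr T W V (act T W w t) = act T V (mul X V (restr X W V w) u)
      (restr T (fst (base_section x)) V (snd (base_section x)))"
    using torsor_restr_act[OF W(1) V(1,3) w W(3)] V(6)
      torsor_act_mul[OF V(1) wV V(5) torsor_restr_closed[OF U(1) V(1,4) U(3)]] by simp
  hence "coord W (act T W w t) x = germ X x V (mul X V (restr X W V w) u)"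
    by (rule coord_eq[OF W(1) torsor_act_closed[OF W(1) w W(3)] V(1-4) X.mul_unit[OF V(1) wV V(5)]])
  also have "\<dots> = germ X x W w \<otimes>\<^bsub>stalk X x\<^esub> germ X x V u"
    by (rule X.germ_mul_restr) (use W V w in auto)
  also have "germ X x V u = coord W t x" using coord_eq[OF W(1,3) V] by simp
  finally show ?thesis .
qed

text \<open>The contracted product of the structure sheaf with the torsor: a local section is
  \<open>a\<close> times \<open>t\<close>. It is realized inside families of germs by replacing
  \<open>t\<close> with its coordinates, and so has the type demanded by \<open>Pic\<close>.\<close>

definition torsor_bundle :: "('p, 'a) pic_bundle" where
  "torsor_bundle = \<lparr>
     pspace = pspace X,
     sect = (\<lambda>V. {\<sigma> \<in> extensional V. \<forall>x\<in>V. \<exists>W t a. openin (pspace X) W \<and> x \<in> W \<and> W \<subseteq> V \<and> t \<in> sect T W \<and>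
        a \<in> sect X W \<and> (\<forall>y\<in>W. \<sigma> y = germ X y W a \<otimes>\<^bsub>stalk X y\<^esub> coord W t y)}),
     restr = (\<lambda>U V \<sigma>. restrict \<sigma> V),
     act = (\<lambda>U a \<sigma>. \<lambda>y\<in>U. germ X y U a \<otimes>\<^bsub>stalk X y\<^esub> \<sigma> y)\<rparr>"

lemma torsor_bundle_simps [simp]:
  "pspace torsor_bundle = pspace X"
  "restr torsor_bundle U V \<sigma> = restrict \<sigma> V"
  "act torsor_bundle U a \<sigma> = (\<lambda>y\<in>U. germ X y U a \<otimes>\<^bsub>stalk X y\<^esub> \<sigma> y)"
  by (simp_all add: torsor_bundle_def)

lemma torsor_bundle_sectI:
  assumes "\<sigma> \<in> extensional V"
    and "\<And>x. x \<in> V \<Longrightarrow> \<exists>W t a. openin (pspace X) W \<and> x \<in> W \<and> W \<subseteq> V \<and> t \<in> sect T W \<and>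
        a \<in> sect X W \<and> (\<forall>y\<in>W. \<sigma> y = germ X y W a \<otimes>\<^bsub>stalk X y\<^esub> coord W t y)"
  shows "\<sigma> \<in> sect torsor_bundle V"
  unfolding torsor_bundle_def presheaf.simps using assms by (intro CollectI conjI ballI)

lemma torsor_bundle_ext: "\<sigma> \<in> sect torsor_bundle V \<Longrightarrow> \<sigma> \<in> extensional V"
  by (simp add: torsor_bundle_def)

lemma torsor_bundle_sectE:
  assumes "\<sigma> \<in> sect torsor_bundle V" "x \<in> V" "openin (pspace X) N" "x \<in> N"
  obtains W t a where "openin (pspace X) W" "x \<in> W" "W \<subseteq> V" "W \<subseteq> N" "t \<in> sect T W" "a \<in> sect X W"
    "\<forall>y\<in>W. \<sigma> y = germ X y W a \<otimes>\<^bsub>stalk X y\<^esub> coord W t y"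
proof -
  have "\<forall>x\<in>V. \<exists>W t a. openin (pspace X) W \<and> x \<in> W \<and> W \<subseteq> V \<and> t \<in> sect T W \<and>
        a \<in> sect X W \<and> (\<forall>y\<in>W. \<sigma> y = germ X y W a \<otimes>\<^bsub>stalk X y\<^esub> coord W t y)"
    using assms(1) by (simp add: torsor_bundle_def)
  from bspec[OF this assms(2)] obtain W t a where W: "openin (pspace X) W" "x \<in> W" "W \<subseteq> V" "t \<in> sect T W"
    "a \<in> sect X W" "\<forall>y\<in>W. \<sigma> y = germ X y W a \<otimes>\<^bsub>stalk X y\<^esub> coord W t y" by (elim exE conjE)
  let ?W = "W \<inter> N"
  have o: "openin (pspace X) ?W" "?W \<subseteq> W" using W(1) assms(3) by auto
  have "\<sigma> y = germ X y ?W (restr X W ?W a) \<otimes>\<^bsub>stalk X y\<^esub> coord ?W (restr T W ?W t) y" if "y \<in> ?W" for y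
    using W(6) that coord_restr[OF W(1) o that W(4)] X.germ_restr[OF W(1) o that W(5)] by simp
  thus ?thesis
    using that[of ?W "restr T W ?W t" "restr X W ?W a"] o W assms(3,4)
      torsor_restr_closed[OF W(1) o W(4)] by auto
qed

lemma torsor_bundle_value:
  assumes "\<sigma> \<in> sect torsor_bundle V" "x \<in> V" "openin (pspace X) V"
  shows "\<sigma> x \<in> carrier (stalk X x)"
proof -
  have x: "x \<in> topspace (pspace X)" using openin_subset[OF assms(3)] assms(2) by blast
  interpret S: comm_monoid "stalk X x" by (rule X.stalk_comm_monoid[OF x])
  obtain W t a where W: "openin (pspace X) W" "x \<in> W" "t \<in> sect T W" "a \<in> sect X W"
    "\<forall>y\<in>W. \<sigma> y = germ X y W a \<otimes>\<^bsub>stalk X y\<^esub> coord W t y"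
    using torsor_bundle_sectE[OF assms(1,2,3,2)] by metis
  have "germ X x W a \<in> carrier (stalk X x)" using W by simp
  thus ?thesis using W(2,5) S.Units_closed[OF coord_unit[OF W(1-3)]] S.m_closed by metis
qed

lemma torsor_bundle_sheaf: "oset_sheaf X torsor_bundle"
proof -
  have top: "x \<in> topspace (pspace X)" if "openin (pspace X) U" "x \<in> U" for x U
    using openin_subset[OF that(1)] that(2) by blast
  have "is_sheaf torsor_bundle"
  proof (rule function_sheaf)
    show "sect torsor_bundle U \<subseteq> extensional U" for U using torsor_bundle_ext by blast
    fix U V \<sigma> assume *: "openin (pspace torsor_bundle) U" "openin (pspace torsor_bundle) V" "V \<subseteq> U" "\<sigma> \<in> sect torsor_bundle U"
    show "restrict \<sigma> V \<in> sect torsor_bundle V"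
    proof (rule torsor_bundle_sectI)
      fix x assume x: "x \<in> V"
      have xU: "x \<in> U" and V: "openin (pspace X) V" using x * by auto
      obtain W t a where W: "openin (pspace X) W" "x \<in> W" "W \<subseteq> U" "W \<subseteq> V" "t \<in> sect T W" "a \<in> sect X W"
        "\<forall>y\<in>W. \<sigma> y = germ X y W a \<otimes>\<^bsub>stalk X y\<^esub> coord W t y"
        using *(4) xU V x by (rule torsor_bundle_sectE)
      have "\<forall>y\<in>W. restrict \<sigma> V y = germ X y W a \<otimes>\<^bsub>stalk X y\<^esub> coord W t y"
      proof
        fix y assume y: "y \<in> W"
        hence "y \<in> V" using W(4) by blast
        thus "restrict \<sigma> V y = germ X y W a \<otimes>\<^bsub>stalk X y\<^esub> coord W t y" using bspec[OF W(7) y] by simp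
      qed
      thus "\<exists>W t a. openin (pspace X) W \<and> x \<in> W \<and> W \<subseteq> V \<and> t \<in> sect T W \<and>
        a \<in> sect X W \<and> (\<forall>y\<in>W. restrict \<sigma> V y = germ X y W a \<otimes>\<^bsub>stalk X y\<^esub> coord W t y)"
        using W by (intro exI[of _ W] exI[of _ t] exI[of _ a] conjI)
    qed simp
  next
    fix U \<sigma> assume U: "openin (pspace torsor_bundle) U" and ext: "\<sigma> \<in> extensional U"
      and loc: "\<And>x. x \<in> U \<Longrightarrow> \<exists>V. openin (pspace torsor_bundle) V \<and> x \<in> V \<and> V \<subseteq> U \<and> restrict \<sigma> V \<in> sect torsor_bundle V"
    show "\<sigma> \<in> sect torsor_bundle U"
    proof (rule torsor_bundle_sectI[OF ext])
      fix x assume "x \<in> U"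
      from loc[OF this] obtain V where V: "openin (pspace X) V" "x \<in> V" "V \<subseteq> U" "restrict \<sigma> V \<in> sect torsor_bundle V"
        by auto
      obtain W t a where W: "openin (pspace X) W" "x \<in> W" "W \<subseteq> V" "t \<in> sect T W" "a \<in> sect X W"
        "\<forall>y\<in>W. restrict \<sigma> V y = germ X y W a \<otimes>\<^bsub>stalk X y\<^esub> coord W t y"
        using torsor_bundle_sectE[OF V(4,2,1,2)] by metis
      have "\<forall>y\<in>W. \<sigma> y = germ X y W a \<otimes>\<^bsub>stalk X y\<^esub> coord W t y"
      proof
        fix y assume y: "y \<in> W"
        hence "y \<in> V" using W(3) by blast
        thus "\<sigma> y = germ X y W a \<otimes>\<^bsub>stalk X y\<^esub> coord W t y" using bspec[OF W(6) y] by simp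
      qed
      thus "\<exists>W t a. openin (pspace X) W \<and> x \<in> W \<and> W \<subseteq> U \<and> t \<in> sect T W \<and>
        a \<in> sect X W \<and> (\<forall>y\<in>W. \<sigma> y = germ X y W a \<otimes>\<^bsub>stalk X y\<^esub> coord W t y)"
        using W V(3) by (intro exI[of _ W] exI[of _ t] exI[of _ a] conjI order_trans[OF W(3) V(3)])
    qed
  qed simp
  moreover have "act torsor_bundle U a \<sigma> \<in> sect torsor_bundle U"
    if U: "openin (pspace X) U" and a: "a \<in> sect X U" and \<sigma>: "\<sigma> \<in> sect torsor_bundle U" for U a \<sigma>
  proof (rule torsor_bundle_sectI)
    fix x assume x: "x \<in> U"
    obtain W t b where W: "openin (pspace X) W" "x \<in> W" "W \<subseteq> U" "t \<in> sect T W" "b \<in> sect X W"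
      "\<forall>y\<in>W. \<sigma> y = germ X y W b \<otimes>\<^bsub>stalk X y\<^esub> coord W t y"
      using torsor_bundle_sectE[OF \<sigma> x U x] by metis
    have "act torsor_bundle U a \<sigma> y = germ X y W (mul X W (restr X U W a) b) \<otimes>\<^bsub>stalk X y\<^esub> coord W t y"
      if y: "y \<in> W" for y
    proof -
      interpret S: comm_monoid "stalk X y" by (rule X.stalk_comm_monoid[OF top[OF W(1) y]])
      have c: "germ X y U a \<in> carrier (stalk X y)" "germ X y W b \<in> carrier (stalk X y)" "coord W t y \<in> carrier (stalk X y)"
        using U W a y S.Units_closed[OF coord_unit[OF W(1) y W(4)]] by auto
      have "act torsor_bundle U a \<sigma> y = germ X y U a \<otimes>\<^bsub>stalk X y\<^esub> (germ X y W b \<otimes>\<^bsub>stalk X y\<^esub> coord W t y)"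
        using subsetD[OF W(3) y] bspec[OF W(6) y] by simp
      thus ?thesis using X.germ_mul_restr[OF U W(1,3) y a W(5)] S.m_assoc[OF c] by simp
    qed
    thus "\<exists>W t b. openin (pspace X) W \<and> x \<in> W \<and> W \<subseteq> U \<and> t \<in> sect T W \<and>
        b \<in> sect X W \<and> (\<forall>y\<in>W. act torsor_bundle U a \<sigma> y = germ X y W b \<otimes>\<^bsub>stalk X y\<^esub> coord W t y)"
      using W U a by (intro exI[of _ W] exI[of _ t] exI[of _ "mul X W (restr X U W a) b"] conjI ballI) auto
  qed simp
  moreover have "act torsor_bundle U (neutral X U) \<sigma> = \<sigma>"
    if U: "openin (pspace X) U" and \<sigma>: "\<sigma> \<in> sect torsor_bundle U" for U \<sigma>
  proof (rule extensionalityI[OF _ torsor_bundle_ext[OF \<sigma>]])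
    fix x assume x: "x \<in> U"
    show "act torsor_bundle U (neutral X U) \<sigma> x = \<sigma> x"
      using x monoid.l_one[OF comm_monoid.axioms(1)[OF X.stalk_comm_monoid[OF top[OF U x]]] torsor_bundle_value[OF \<sigma> x U]]
        X.germ_neutral[OF U x] by simp
  qed simp
  moreover have "act torsor_bundle U (mul X U a b) \<sigma> = act torsor_bundle U a (act torsor_bundle U b \<sigma>)"
    if U: "openin (pspace X) U" and ab: "a \<in> sect X U" "b \<in> sect X U" and \<sigma>: "\<sigma> \<in> sect torsor_bundle U" for U a b \<sigma>
  proof (rule extensionalityI[of _ U])
    fix x assume x: "x \<in> U"
    have c: "germ X x U a \<in> carrier (stalk X x)" "germ X x U b \<in> carrier (stalk X x)" using U x ab by auto
    show "act torsor_bundle U (mul X U a b) \<sigma> x = act torsor_bundle U a (act torsor_bundle U b \<sigma>) x"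
      using x X.germ_mult_same[OF U x ab]
        monoid.m_assoc[OF comm_monoid.axioms(1)[OF X.stalk_comm_monoid[OF top[OF U x]]] c torsor_bundle_value[OF \<sigma> x U]]
      by simp
  qed simp_all
  moreover have "restr torsor_bundle U V (act torsor_bundle U a \<sigma>) = act torsor_bundle V (restr X U V a) (restr torsor_bundle U V \<sigma>)"
    if U: "openin (pspace X) U" "openin (pspace X) V" "V \<subseteq> U" and a: "a \<in> sect X U" for U V a \<sigma>
    using X.germ_restr[OF U _ a] U by (auto simp: Int_absorb1 intro!: restrict_ext)
  ultimately have "is_oset_sheaf X torsor_bundle"
    unfolding is_oset_sheaf_def by (intro conjI allI impI ballI torsor_bundle_simps(1)) simp_all
  thus ?thesis unfolding oset_sheaf_iff[OF X.cmonoid_sheaf_axioms] .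
qed

definition bundle_gen :: "'p set \<Rightarrow> 't \<Rightarrow> 'p \<Rightarrow> ('p, 'a) germ" where
  "bundle_gen W t = (\<lambda>y\<in>W. coord W t y)"

text \<open>Coordinates are invertible, so a section of the bundle has a unique pointwise quotient
  by the coordinates of \<open>t\<close>. The quotients are germs of a section of \<open>X\<close>
  because local torsor sections differ from \<open>t\<close> by units.\<close>

lemma bundle_gen:
  assumes W: "openin (pspace X) W" and t: "t \<in> sect T W"
  shows "bundle_gen W t \<in> generators X torsor_bundle W"
proof (rule generatorsI)
  have top: "x \<in> topspace (pspace X)" if "openin (pspace X) U" "x \<in> U" for x U
    using openin_subset[OF that(1)] that(2) by blast
  interpret B: oset_sheaf X torsor_bundle by (rule torsor_bundle_sheaf)
  show gen: "bundle_gen W t \<in> sect torsor_bundle W"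
  proof (rule torsor_bundle_sectI)
    fix x assume x: "x \<in> W"
    have "bundle_gen W t y = germ X y W (neutral X W) \<otimes>\<^bsub>stalk X y\<^esub> coord W t y" if y: "y \<in> W" for y
    proof -
      interpret S: comm_monoid "stalk X y" by (rule X.stalk_comm_monoid[OF top[OF W y]])
      show ?thesis using X.germ_neutral[OF W y] S.l_one[OF S.Units_closed[OF coord_unit[OF W y t]]] y
        by (simp add: bundle_gen_def)
    qed
    thus "\<exists>V s a. openin (pspace X) V \<and> x \<in> V \<and> V \<subseteq> W \<and> s \<in> sect T V \<and>
        a \<in> sect X V \<and> (\<forall>y\<in>V. bundle_gen W t y = germ X y V a \<otimes>\<^bsub>stalk X y\<^esub> coord V s y)"
      using W t x by (intro exI[of _ W] exI[of _ t] exI[of _ "neutral X W"]) auto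
  qed (simp add: bundle_gen_def)
  fix V assume V: "openin (pspace X) V" "V \<subseteq> W"
  let ?m = "\<lambda>a. act torsor_bundle V a (restr torsor_bundle W V (bundle_gen W t))"
  have m: "?m a y = germ X y V a \<otimes>\<^bsub>stalk X y\<^esub> coord W t y" if "y \<in> V" for a y
    using that subsetD[OF V(2) that] by (simp add: bundle_gen_def)
  have unit: "coord W t y \<in> Units (stalk X y)" if "y \<in> V" for y using coord_unit[OF W _ t] that V by blast
  show "bij_betw ?m (sect X V) (sect torsor_bundle V)"
    unfolding bij_betw_def
  proof
    show "inj_on ?m (sect X V)"
    proof (rule inj_onI)
      fix a b assume ab: "a \<in> sect X V" "b \<in> sect X V" and eq: "?m a = ?m b"
      show "a = b"
      proof (rule X.germs_eq[OF V(1) ab])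
        fix y assume y: "y \<in> V"
        interpret S: comm_monoid "stalk X y" by (rule X.stalk_comm_monoid[OF top[OF V(1) y]])
        have c: "germ X y V a \<in> carrier (stalk X y)" "germ X y V b \<in> carrier (stalk X y)" using V y ab by auto
        note [simp] = S.Units_closed[OF unit[OF y]]
        have "germ X y V a \<otimes>\<^bsub>stalk X y\<^esub> coord W t y = germ X y V b \<otimes>\<^bsub>stalk X y\<^esub> coord W t y"
          using m[OF y, of a] m[OF y, of b] eq by metis
        hence "coord W t y \<otimes>\<^bsub>stalk X y\<^esub> germ X y V a = coord W t y \<otimes>\<^bsub>stalk X y\<^esub> germ X y V b"
          using S.m_comm c S.Units_closed[OF unit[OF y]] by metis
        thus "germ X y V a = germ X y V b" using S.Units_l_cancel[OF unit[OF y] c] by simp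
      qed
    qed
    show "?m ` sect X V = sect torsor_bundle V"
    proof
      show "?m ` sect X V \<subseteq> sect torsor_bundle V"
        using B.act_closed[OF V(1) _ B.restr_closed[of W V "bundle_gen W t"]] V W gen by auto
      show "sect torsor_bundle V \<subseteq> ?m ` sect X V"
      proof
        fix \<sigma> assume \<sigma>: "\<sigma> \<in> sect torsor_bundle V"
        \<comment> \<open>The coefficient is prescribed by its germs and glued. With local data
          \<open>b\<close> and \<open>s = u t\<close> it is represented by
          \<open>b u\<close>.\<close>
        have "\<exists>a\<in>sect X V. \<forall>y\<in>V. germ X y V a = \<sigma> y \<otimes>\<^bsub>stalk X y\<^esub> inv\<^bsub>stalk X y\<^esub> coord W t y"
        proof (rule X.glue_germs[OF V(1)])
          fix x assume x: "x \<in> V"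
          obtain Z s b where Z: "openin (pspace X) Z" "x \<in> Z" "Z \<subseteq> V" "s \<in> sect T Z" "b \<in> sect X Z"
            "\<forall>y\<in>Z. \<sigma> y = germ X y Z b \<otimes>\<^bsub>stalk X y\<^esub> coord Z s y"
            using torsor_bundle_sectE[OF \<sigma> x V(1) x] by metis
          have ZW: "Z \<subseteq> W" using Z(3) V(2) by blast
          have tZ: "restr T W Z t \<in> sect T Z" using torsor_restr_closed[OF W Z(1) ZW t] .
          obtain u where u: "u \<in> Units (secmon X Z)" "s = act T Z u (restr T W Z t)"
            using torsor_transitive[OF Z(1) tZ Z(4)] by blast
          have "germ X y Z (mul X Z b u) = \<sigma> y \<otimes>\<^bsub>stalk X y\<^esub> inv\<^bsub>stalk X y\<^esub> coord W t y" if y: "y \<in> Z" for y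
          proof -
            interpret S: comm_monoid "stalk X y" by (rule X.stalk_comm_monoid[OF top[OF Z(1) y]])
            have yV: "y \<in> V" using y Z(3) by blast
            have c: "germ X y Z b \<in> carrier (stalk X y)" "germ X y Z u \<in> carrier (stalk X y)"
              "coord W t y \<in> carrier (stalk X y)" "inv\<^bsub>stalk X y\<^esub> coord W t y \<in> carrier (stalk X y)"
              using Z y u S.Units_closed[OF unit[OF yV]] S.Units_inv_closed[OF unit[OF yV]] by auto
            have "coord Z s y = germ X y Z u \<otimes>\<^bsub>stalk X y\<^esub> coord W t y"
              using coord_act[OF Z(1) y tZ u(1)] coord_restr[OF W Z(1) ZW y t] u(2) by simp
            hence "\<sigma> y \<otimes>\<^bsub>stalk X y\<^esub> inv\<^bsub>stalk X y\<^esub> coord W t y =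
               (germ X y Z b \<otimes>\<^bsub>stalk X y\<^esub> germ X y Z u) \<otimes>\<^bsub>stalk X y\<^esub> (coord W t y \<otimes>\<^bsub>stalk X y\<^esub> inv\<^bsub>stalk X y\<^esub> coord W t y)"
              using Z(6) y c by (simp add: S.m_assoc del: carrier_stalk S.Units_r_inv)
            thus ?thesis using S.Units_r_inv[OF unit[OF yV]] X.germ_mult_same[OF Z(1) y Z(5) X.unit_closed[OF u(1)]] S.r_one c
              by (metis S.m_closed)
          qed
          thus "\<exists>Z a. openin (pspace X) Z \<and> x \<in> Z \<and> Z \<subseteq> V \<and> a \<in> sect X Z \<and>
              (\<forall>y\<in>Z. germ X y Z a = \<sigma> y \<otimes>\<^bsub>stalk X y\<^esub> inv\<^bsub>stalk X y\<^esub> coord W t y)"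
            using Z u by (intro exI[of _ Z] exI[of _ "mul X Z b u"]) auto
        qed
        then obtain a where a: "a \<in> sect X V"
          "\<forall>y\<in>V. germ X y V a = \<sigma> y \<otimes>\<^bsub>stalk X y\<^esub> inv\<^bsub>stalk X y\<^esub> coord W t y" by (rule bexE)
        have "\<sigma> = ?m a"
        proof (rule extensionalityI[OF torsor_bundle_ext[OF \<sigma>]])
          show "?m a \<in> extensional V" by simp
          fix y assume y: "y \<in> V"
          interpret S: comm_monoid "stalk X y" by (rule X.stalk_comm_monoid[OF top[OF V(1) y]])
          have c: "\<sigma> y \<in> carrier (stalk X y)" "coord W t y \<in> carrier (stalk X y)" "inv\<^bsub>stalk X y\<^esub> coord W t y \<in> carrier (stalk X y)"
            using torsor_bundle_value[OF \<sigma> y V(1)] S.Units_closed[OF unit[OF y]] S.Units_inv_closed[OF unit[OF y]] by auto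
          have "?m a y = \<sigma> y \<otimes>\<^bsub>stalk X y\<^esub> (inv\<^bsub>stalk X y\<^esub> coord W t y \<otimes>\<^bsub>stalk X y\<^esub> coord W t y)"
            unfolding m[OF y] bspec[OF a(2) y] by (rule S.m_assoc[OF c(1,3,2)])
          thus "\<sigma> y = ?m a y" using S.Units_l_inv[OF unit[OF y]] S.r_one[OF c(1)] by simp
        qed
        thus "\<sigma> \<in> ?m ` sect X V" using a(1) by (rule image_eqI)
      qed
    qed
  qed
qed

theorem torsor_bundle:
  "line_bundle X torsor_bundle" "torsor_map X T torsor_bundle bundle_gen"
proof -
  show "line_bundle X torsor_bundle"
    unfolding line_bundle_iff[OF X.cmonoid_sheaf_axioms]
  proof (intro conjI ballI torsor_bundle_sheaf)
    fix x assume "x \<in> topspace (pspace X)"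
    from torsor_local[OF this] obtain U t where "openin (pspace X) U" "x \<in> U" "t \<in> sect T U" by blast
    thus "\<exists>U. openin (pspace X) U \<and> x \<in> U \<and> generators X torsor_bundle U \<noteq> {}"
      using bundle_gen by blast
  qed
  show "torsor_map X T torsor_bundle bundle_gen"
    unfolding torsor_map_def
  proof (intro conjI allI impI ballI funcsetI)
    fix U t assume "openin (pspace X) U" "t \<in> sect T U"
    thus "bundle_gen U t \<in> generators X torsor_bundle U" by (rule bundle_gen)
  next
    fix U u t assume "openin (pspace X) U" "u \<in> Units (secmon X U)" "t \<in> sect T U"
    thus "bundle_gen U (act T U u t) = act torsor_bundle U u (bundle_gen U t)"
      by (auto simp: bundle_gen_def coord_act intro!: restrict_ext)
  next
    fix U V t assume "openin (pspace X) U \<and> openin (pspace X) V \<and> V \<subseteq> U" "t \<in> sect T U"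
    thus "bundle_gen V (restr T U V t) = restr torsor_bundle U V (bundle_gen U t)"
      by (auto simp: bundle_gen_def coord_restr Int_absorb1 intro!: restrict_ext)
  qed
qed

end

section \<open>Sheafification and generators\<close>

context oset_presheaf
begin

lemma sheafify_oset_simps [simp]:
  "pspace (sheafify_oset X P) = pspace X"
  "sect (sheafify_oset X P) = sheafify_sect P"
  "restr (sheafify_oset X P) U V s = restrict s V"
  by (simp_all add: sheafify_oset_def)

lemma act_sheafify_ext: "act (sheafify_oset X P) U a s \<in> extensional U"
  by (simp add: sheafify_oset_def)

lemma act_sheafify_germ:
  assumes U: "openin (pspace X) U" "a \<in> sect X U" and V: "openin (pspace X) V" "x \<in> V" "V \<subseteq> U" "t \<in> sect P V"
    and sx: "s x = germ P x V t"
  shows "act (sheafify_oset X P) U a s x = germ P x V (act P V (restr X U V a) t)"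
proof -
  let ?F = "\<lambda>V t. germ P x (U \<inter> V) (act P (U \<inter> V) (restr X U (U \<inter> V) a) (restr P V (U \<inter> V) t))"
  have *: "?F V' t' = germ P x V (act P V (restr X U V a) t)" if "(V', t') \<in> germ P x V t" for V' t'
  proof -
    from that obtain W where W: "openin (pspace X) W" "x \<in> W" "W \<subseteq> V" "W \<subseteq> V'"
      "restr P V W t = restr P V' W t'" "openin (pspace X) V'" "t' \<in> sect P V'"
      by (auto simp: germ_mem_iff)
    have o: "openin (pspace X) (U \<inter> V')" "W \<subseteq> U \<inter> V'" "W \<subseteq> U" using U W V by auto
    show ?thesis
      by (rule germ_eqI[where W = W]) (use U V W o in auto)
  qed
  have xU: "x \<in> U" using V by blast
  have "act (sheafify_oset X P) U a s x = (\<Union>(V', t')\<in>germ P x V t. ?F V' t')"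
    using xU sx by (simp add: sheafify_oset_def)
  also have "\<dots> = (\<Union>p\<in>germ P x V t. germ P x V (act P V (restr X U V a) t))"
    by (intro SUP_cong refl) (auto simp: *)
  also have "\<dots> = germ P x V (act P V (restr X U V a) t)" using germ_self[of V x t] V by auto
  finally show ?thesis .
qed

lemma sheafify_localE:
  assumes "s \<in> sheafify_sect P U" "x \<in> U" "openin (pspace X) N" "x \<in> N"
  obtains V t where "openin (pspace X) V" "x \<in> V" "V \<subseteq> U" "V \<subseteq> N" "t \<in> sect P V" "\<forall>y\<in>V. s y = germ P y V t"
proof -
  obtain V t where "openin (pspace P) V" "x \<in> V" "V \<subseteq> U" "V \<subseteq> N" "t \<in> sect P V"
    "\<And>y. y \<in> V \<Longrightarrow> s y = germ P y V t"
    using assms(1,2) _ assms(4) by (rule sheafify_sectE) (use assms(3) in simp, blast)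
  thus ?thesis using that[of V t] by simp
qed

lemma sheafify_extensional: "s \<in> sheafify_sect P U \<Longrightarrow> s \<in> extensional U"
  by (simp add: sheafify_sect_def PiE_def)

lemma sheafify_oset_is_sheaf: "is_sheaf (sheafify_oset X P)"
proof (rule function_sheaf)
  show "sect (sheafify_oset X P) U \<subseteq> extensional U" for U using sheafify_extensional by auto
  fix U V s assume *: "openin (pspace (sheafify_oset X P)) U" "openin (pspace (sheafify_oset X P)) V" "V \<subseteq> U"
    "s \<in> sect (sheafify_oset X P) U"
  have "restrict s V \<in> sheafify_sect P V"
  proof (rule sheafify_sectI)
    fix x assume x: "x \<in> V"
    have s: "s \<in> sheafify_sect P U" "x \<in> U" "openin (pspace X) V" using * x by auto
    obtain W t where W: "openin (pspace X) W" "x \<in> W" "W \<subseteq> U" "W \<subseteq> V" "t \<in> sect P W" "\<forall>y\<in>W. s y = germ P y W t"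
      using s x by (rule sheafify_localE)
    have "\<forall>y\<in>W. restrict s V y = germ P y W t"
    proof
      fix y assume "y \<in> W"
      thus "restrict s V y = germ P y W t" using bspec[OF W(6)] subsetD[OF W(4)] by simp
    qed
    thus "\<exists>W t. openin (pspace P) W \<and> x \<in> W \<and> W \<subseteq> V \<and> t \<in> sect P W \<and> (\<forall>y\<in>W. restrict s V y = germ P y W t)"
      using W by (intro exI[of _ W] exI[of _ t]) simp
  qed simp
  thus "restrict s V \<in> sect (sheafify_oset X P) V" by simp
next
  fix U s assume U: "openin (pspace (sheafify_oset X P)) U" and ext: "s \<in> extensional U"
    and loc: "\<And>x. x \<in> U \<Longrightarrow> \<exists>V. openin (pspace (sheafify_oset X P)) V \<and> x \<in> V \<and> V \<subseteq> U \<and> restrict s V \<in> sect (sheafify_oset X P) V"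
  have "s \<in> sheafify_sect P U"
  proof (rule sheafify_sectI[OF ext])
    fix x assume "x \<in> U"
    from loc[OF this] obtain V where V: "openin (pspace X) V" "x \<in> V" "V \<subseteq> U" "restrict s V \<in> sheafify_sect P V"
      by auto
    obtain W t where W: "openin (pspace X) W" "x \<in> W" "W \<subseteq> V" "W \<subseteq> V" "t \<in> sect P W" "\<forall>y\<in>W. restrict s V y = germ P y W t"
      using V(4,2,1,2) by (rule sheafify_localE)
    have "\<forall>y\<in>W. s y = germ P y W t"
    proof
      fix y assume y: "y \<in> W"
      show "s y = germ P y W t" using bspec[OF W(6) y] subsetD[OF W(3) y] by simp
    qed
    thus "\<exists>W t. openin (pspace P) W \<and> x \<in> W \<and> W \<subseteq> U \<and> t \<in> sect P W \<and> (\<forall>y\<in>W. s y = germ P y W t)"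
      using W V(3) by (intro exI[of _ W] exI[of _ t]) auto
  qed
  thus "s \<in> sect (sheafify_oset X P) U" by simp
qed simp

lemma sheafify_oset_sheaf: "oset_sheaf X (sheafify_oset X P)"
proof -
  let ?S = "sheafify_oset X P"
  have act: "act ?S U a s y = germ P y V (act P V (restr X U V a) t)"
    if "openin (pspace X) U" "a \<in> sect X U" "openin (pspace X) V" "V \<subseteq> U" "t \<in> sect P V"
      "\<forall>y\<in>V. s y = germ P y V t" "y \<in> V" for U a s V t y
    by (rule act_sheafify_germ) (use that in auto)
  have closed: "act ?S U a s \<in> sheafify_sect P U"
    if U: "openin (pspace X) U" and a: "a \<in> sect X U" and s: "s \<in> sheafify_sect P U" for U a s
  proof (rule sheafify_sectI[OF act_sheafify_ext])
    fix x assume x: "x \<in> U"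
    obtain V t where V: "openin (pspace X) V" "x \<in> V" "V \<subseteq> U" "V \<subseteq> U" "t \<in> sect P V" "\<forall>y\<in>V. s y = germ P y V t"
      using s x U x by (rule sheafify_localE)
    thus "\<exists>V t. openin (pspace P) V \<and> x \<in> V \<and> V \<subseteq> U \<and> t \<in> sect P V \<and> (\<forall>y\<in>V. act ?S U a s y = germ P y V t)"
      using U a act[OF U a V(1,3,5,6)]
      by (intro exI[of _ V] exI[of _ "act P V (restr X U V a) t"]) simp
  qed
  have "act ?S U (neutral X U) s = s" if U: "openin (pspace X) U" and s: "s \<in> sheafify_sect P U" for U s
  proof (rule extensionalityI[OF act_sheafify_ext sheafify_extensional[OF s]])
    fix x assume x: "x \<in> U"
    obtain V t where V: "openin (pspace X) V" "x \<in> V" "V \<subseteq> U" "V \<subseteq> U" "t \<in> sect P V" "\<forall>y\<in>V. s y = germ P y V t"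
      using s x U x by (rule sheafify_localE)
    show "act ?S U (neutral X U) s x = s x" using act[OF U _ V(1,3,5,6,2)] V U by simp
  qed
  moreover have "act ?S U (mul X U a b) s = act ?S U a (act ?S U b s)"
    if U: "openin (pspace X) U" and a: "a \<in> sect X U" and b: "b \<in> sect X U" and s: "s \<in> sheafify_sect P U" for U a b s
  proof (rule extensionalityI[OF act_sheafify_ext act_sheafify_ext])
    fix x assume x: "x \<in> U"
    obtain V t where V: "openin (pspace X) V" "x \<in> V" "V \<subseteq> U" "V \<subseteq> U" "t \<in> sect P V" "\<forall>y\<in>V. s y = germ P y V t"
      using s x U x by (rule sheafify_localE)
    have bt: "act P V (restr X U V b) t \<in> sect P V" using V U b by simp
    have "\<forall>y\<in>V. act ?S U b s y = germ P y V (act P V (restr X U V b) t)"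
      using act[OF U b V(1,3,5,6)] by blast
    from act[OF U a V(1,3) bt this V(2)] show "act ?S U (mul X U a b) s x = act ?S U a (act ?S U b s) x"
      using act[OF U _ V(1,3,5,6,2), of "mul X U a b"] U V a b by (simp add: act_mul)
  qed
  moreover have "restr ?S U V (act ?S U a s) = act ?S V (restr X U V a) (restr ?S U V s)"
    if U: "openin (pspace X) U" and V: "openin (pspace X) V" "V \<subseteq> U" and a: "a \<in> sect X U" and s: "s \<in> sheafify_sect P U" for U V a s
  proof (rule extensionalityI[OF _ act_sheafify_ext])
    fix x assume x: "x \<in> V"
    hence xU: "x \<in> U" using V by blast
    obtain W t where W: "openin (pspace X) W" "x \<in> W" "W \<subseteq> U" "W \<subseteq> V" "t \<in> sect P W" "\<forall>y\<in>W. s y = germ P y W t"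
      using s xU V(1) x by (rule sheafify_localE)
    have "\<forall>y\<in>W. restrict s V y = germ P y W t"
      using W(6) subsetD[OF W(4)] by simp
    from act[OF V(1) X.restr_closed[OF U V a] W(1,4,5) this W(2)]
    have "act ?S V (restr X U V a) (restrict s V) x = germ P x W (act P W (restr X V W (restr X U V a)) t)" .
    also have "restr X V W (restr X U V a) = restr X U W a" using U V W a by simp
    also have "germ P x W (act P W (restr X U W a) t) = act ?S U a s x" using act[OF U a W(1,3,5,6,2)] by simp
    finally have "act ?S V (restr X U V a) (restrict s V) x = act ?S U a s x" .
    thus "restr ?S U V (act ?S U a s) x = act ?S V (restr X U V a) (restr ?S U V s) x"
      unfolding sheafify_oset_simps using x by simp
  qed simp
  ultimately have "is_oset_sheaf X ?S"
    unfolding is_oset_sheaf_def using closed sheafify_oset_is_sheaf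
    by (intro conjI allI impI ballI sheafify_oset_simps(1)) simp_all
  thus ?thesis unfolding oset_sheaf_iff[OF X.cmonoid_sheaf_axioms] .
qed

definition sheafify_gen :: "'p set \<Rightarrow> 'l \<Rightarrow> 'p \<Rightarrow> ('p, 'l) germ" where
  "sheafify_gen W e = (\<lambda>x\<in>W. germ P x W e)"

lemma sheafify_gen_closed:
  "\<lbrakk>openin (pspace X) W; e \<in> sect P W\<rbrakk> \<Longrightarrow> sheafify_gen W e \<in> sheafify_sect P W"
  unfolding sheafify_gen_def by (rule sheafify_sectI) (auto intro!: exI[of _ W] exI[of _ e])

lemma sheafify_gen_act:
  assumes "openin (pspace X) W" "a \<in> sect X W" "e \<in> sect P W"
  shows "sheafify_gen W (act P W a e) = act (sheafify_oset X P) W a (sheafify_gen W e)"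
proof (rule extensionalityI[OF _ act_sheafify_ext])
  fix x assume "x \<in> W"
  thus "sheafify_gen W (act P W a e) x = act (sheafify_oset X P) W a (sheafify_gen W e) x"
    using act_sheafify_germ[OF assms(1,2,1) _ order_refl assms(3), of x "sheafify_gen W e"] assms
    by (simp add: sheafify_gen_def)
qed (simp add: sheafify_gen_def)

lemma sheafify_gen_restr:
  "\<lbrakk>openin (pspace X) W; openin (pspace X) V; V \<subseteq> W; e \<in> sect P W\<rbrakk>
   \<Longrightarrow> sheafify_gen V (restr P W V e) = restrict (sheafify_gen W e) V"
  by (auto simp: sheafify_gen_def Int_absorb1 intro!: restrict_ext)

text \<open>Equal germs agree on a neighbourhood, where freeness of the generator makes the
  coefficients equal; coefficients lie in the sheaf \<open>X\<close>, so local equality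
  suffices.\<close>

lemma sheafify_gen_inj:
  assumes V: "openin (pspace X) V" and e: "e \<in> generators X P V" and ab: "a \<in> sect X V" "b \<in> sect X V"
    and eq: "\<And>y. y \<in> V \<Longrightarrow> germ P y V (act P V a e) = germ P y V (act P V b e)"
  shows "a = b"
proof (rule X.locally_eq[OF V ab])
  fix x assume x: "x \<in> V"
  have c: "act P V a e \<in> sect P V" "act P V b e \<in> sect P V" using V e ab by simp_all
  obtain W where W: "openin (pspace P) W" "x \<in> W" "W \<subseteq> V" "restr P V W (act P V a e) = restr P V W (act P V b e)"
    using eq[OF x] _ x c(1) by (rule germ_eqE) (use V in simp)
  have "restr X V W a = restr X V W b"
    by (rule gen_inj[of "restr P V W e" W]) (use W V e ab in simp_all)
  thus "\<exists>W. openin (pspace X) W \<and> x \<in> W \<and> W \<subseteq> V \<and> restr X V W a = restr X V W b"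
    using W by auto
qed

text \<open>Over \<open>W\<close> the generator identifies the presheaf with the structure sheaf,
  which is already a sheaf. Concretely, the local coefficients of a section of the sheafification
  are unique and glue in \<open>X\<close>.\<close>

lemma sheafify_gen:
  assumes W: "openin (pspace X) W" and e: "e \<in> generators X P W"
  shows "sheafify_gen W e \<in> generators X (sheafify_oset X P) W"
proof (rule generatorsI)
  let ?S = "sheafify_oset X P"
  interpret S: oset_sheaf X ?S by (rule sheafify_oset_sheaf)
  show "sheafify_gen W e \<in> sect ?S W" using sheafify_gen_closed[OF W] e by simp
  fix V assume V: "openin (pspace X) V" "V \<subseteq> W"
  let ?e = "restr P W V e"
  have eV: "?e \<in> generators X P V" using gen_restr[OF W V e] .
  have m: "act ?S V a (restr ?S W V (sheafify_gen W e)) = sheafify_gen V (act P V a ?e)" if "a \<in> sect X V" for a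
    using sheafify_gen_act[OF V(1) that, of ?e] sheafify_gen_restr[OF W V, of e] e eV by simp
  have "bij_betw (\<lambda>a. sheafify_gen V (act P V a ?e)) (sect X V) (sheafify_sect P V)"
    unfolding bij_betw_def
  proof
    show "inj_on (\<lambda>a. sheafify_gen V (act P V a ?e)) (sect X V)"
    proof (rule inj_onI)
      fix a b assume ab: "a \<in> sect X V" "b \<in> sect X V" and eq: "sheafify_gen V (act P V a ?e) = sheafify_gen V (act P V b ?e)"
      show "a = b"
      proof (rule sheafify_gen_inj[OF V(1) eV ab])
        fix y assume "y \<in> V"
        thus "germ P y V (act P V a ?e) = germ P y V (act P V b ?e)"
          using fun_cong[OF eq, of y] by (simp add: sheafify_gen_def)
      qed
    qed
    show "(\<lambda>a. sheafify_gen V (act P V a ?e)) ` sect X V = sheafify_sect P V"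
    proof
      show "(\<lambda>a. sheafify_gen V (act P V a ?e)) ` sect X V \<subseteq> sheafify_sect P V"
        using sheafify_gen_closed[OF V(1)] V(1) eV by auto
      show "sheafify_sect P V \<subseteq> (\<lambda>a. sheafify_gen V (act P V a ?e)) ` sect X V"
      proof
        fix s assume s: "s \<in> sheafify_sect P V"
        \<comment> \<open>States that \<open>a\<close> is the coefficient of \<open>s\<close> over
          \<open>Z\<close>; this is the relation to be glued.\<close>
        let ?P = "\<lambda>Z a. \<forall>y\<in>Z. s y = germ P y Z (act P Z a (restr P W Z e))"
        have loc: "\<exists>Z a. openin (pspace X) Z \<and> x \<in> Z \<and> Z \<subseteq> V \<and> a \<in> sect X Z \<and> ?P Z a" if x: "x \<in> V" for x
        proof -
          obtain Z t where Z: "openin (pspace X) Z" "x \<in> Z" "Z \<subseteq> V" "Z \<subseteq> V" "t \<in> sect P Z" "\<forall>y\<in>Z. s y = germ P y Z t"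
            using s x V(1) x by (rule sheafify_localE)
          have "restr P W Z e \<in> generators X P Z" using gen_restr[OF W Z(1) order_trans[OF Z(3) V(2)] e] .
          then obtain a where "a \<in> sect X Z" "t = act P Z a (restr P W Z e)"
            using Z(1,5) by (rule gen_surj)
          thus ?thesis using Z by (intro exI[of _ Z] exI[of _ a]) simp
        qed
        have "\<exists>!a. a \<in> sect X V \<and> (\<forall>Z b. openin (pspace X) Z \<and> Z \<subseteq> V \<and> b \<in> sect X Z \<and> ?P Z b \<longrightarrow> restr X V Z a = b)"
        proof (rule X.glue_rel[OF V(1) loc])
          fix Z Z' b b' assume *: "openin (pspace X) Z" "openin (pspace X) Z'" "Z \<subseteq> V" "Z' \<subseteq> V"
            "b \<in> sect X Z" "b' \<in> sect X Z'" "?P Z b" "?P Z' b'"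
          let ?Y = "Z \<inter> Z'"
          have Y: "openin (pspace X) ?Y" "?Y \<subseteq> Z" "?Y \<subseteq> Z'" "?Y \<subseteq> W" "Z \<subseteq> W" "Z' \<subseteq> W" using * V by auto
          have res: "germ P y ?Y (act P ?Y (restr X Z1 ?Y c) (restr P W ?Y e)) = s y"
            if "openin (pspace X) Z1" "?Y \<subseteq> Z1" "Z1 \<subseteq> W" "c \<in> sect X Z1" "?P Z1 c" "y \<in> ?Y" for Z1 c y
          proof -
            have eZ: "restr P W Z1 e \<in> sect P Z1" using W e that by simp
            have "germ P y ?Y (restr P Z1 ?Y (act P Z1 c (restr P W Z1 e))) = germ P y Z1 (act P Z1 c (restr P W Z1 e))"
              by (rule germ_restr) (use that Y eZ in auto)
            also have "\<dots> = s y" using that(2,5,6) by auto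
            finally show ?thesis using that Y W e by simp
          qed
          show "restr X Z ?Y b = restr X Z' ?Y b'"
          proof (rule sheafify_gen_inj[OF Y(1) gen_restr[OF W Y(1,4) e]])
            fix y assume y: "y \<in> ?Y"
            show "germ P y ?Y (act P ?Y (restr X Z ?Y b) (restr P W ?Y e)) = germ P y ?Y (act P ?Y (restr X Z' ?Y b') (restr P W ?Y e))"
              using res[OF *(1) Y(2,5) *(5,7) y] res[OF *(2) Y(3,6) *(6,8) y] by simp
          qed (use * Y in simp_all)
        qed
        from ex1_implies_ex[OF this] obtain a where a: "a \<in> sect X V"
          "\<forall>Z b. openin (pspace X) Z \<and> Z \<subseteq> V \<and> b \<in> sect X Z \<and> ?P Z b \<longrightarrow> restr X V Z a = b"
          by (elim exE conjE)
        have "s = sheafify_gen V (act P V a ?e)"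
        proof (rule extensionalityI[OF sheafify_extensional[OF s]])
          show "sheafify_gen V (act P V a ?e) \<in> extensional V" by (simp add: sheafify_gen_def)
          fix y assume y: "y \<in> V"
          from loc[OF y] obtain Z b where Z: "openin (pspace X) Z" "y \<in> Z" "Z \<subseteq> V" "b \<in> sect X Z" "?P Z b"
            by (elim exE conjE)
          have aZ: "restr X V Z a = b" using a(2) Z by blast
          have "s y = germ P y Z (act P Z b (restr P W Z e))" using Z(2,5) by blast
          also have "act P Z b (restr P W Z e) = restr P V Z (act P V a ?e)"
            using aZ[symmetric] Z V W e eV a(1) by simp
          also have "germ P y Z \<dots> = germ P y V (act P V a ?e)"
            by (rule germ_restr) (use Z V a(1) eV in auto)
          finally show "s y = sheafify_gen V (act P V a ?e) y" using y by (simp add: sheafify_gen_def)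
        qed
        thus "s \<in> (\<lambda>a. sheafify_gen V (act P V a ?e)) ` sect X V" using a(1) by (rule image_eqI)
      qed
    qed
  qed
  thus "bij_betw (\<lambda>a. act ?S V a (restr ?S W V (sheafify_gen W e))) (sect X V) (sect ?S V)"
    using m unfolding sheafify_oset_simps by (simp cong: bij_betw_cong)
qed

end

section \<open>Tensor products of line bundles\<close>

locale oset_pair = L: oset_presheaf X L + K: oset_presheaf X K
  for X :: "('p, 'a) monoid_presheaf" and L :: "('p, 'a, 'l) oset_presheaf" and K :: "('p, 'a, 'k) oset_presheaf"
begin

definition tens :: "'p set \<Rightarrow> 'l \<Rightarrow> 'k \<Rightarrow> ('l \<times> 'k) set" where
  "tens U s t = tensor_rel X L K U `` {(s, t)}"

abbreviation "PT \<equiv> pre_tensor X L K"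

lemma tensor_rel_sym: "(p, q) \<in> tensor_rel X L K U \<Longrightarrow> (q, p) \<in> tensor_rel X L K U"
  unfolding tensor_rel_def Let_def by (rule symD[OF sym_rtrancl]) (auto intro: symI)

lemma tensor_rel_trans: "\<lbrakk>(p, q) \<in> tensor_rel X L K U; (q, r) \<in> tensor_rel X L K U\<rbrakk> \<Longrightarrow> (p, r) \<in> tensor_rel X L K U"
  unfolding tensor_rel_def Let_def by (rule rtrancl_trans)

lemma tensor_rel_refl: "(p, p) \<in> tensor_rel X L K U"
  unfolding tensor_rel_def Let_def by simp

lemma tens_eq_iff: "tens U s t = tens U s' t' \<longleftrightarrow> ((s, t), (s', t')) \<in> tensor_rel X L K U"
proof
  assume "tens U s t = tens U s' t'"
  moreover have "(s', t') \<in> tens U s' t'" by (simp add: tens_def tensor_rel_refl)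
  ultimately have "(s', t') \<in> tens U s t" by simp
  thus "((s, t), (s', t')) \<in> tensor_rel X L K U" by (simp only: tens_def Image_singleton_iff)
next
  assume *: "((s, t), (s', t')) \<in> tensor_rel X L K U"
  show "tens U s t = tens U s' t'"
    unfolding tens_def using tensor_rel_trans[OF *] tensor_rel_trans[OF tensor_rel_sym[OF *]] by blast
qed

lemma tens_act:
  assumes "a \<in> sect X U" "s \<in> sect L U" "t \<in> sect K U"
  shows "tens U (act L U a s) t = tens U s (act K U a t)"
  unfolding tens_eq_iff tensor_rel_def Let_def by (rule r_into_rtrancl) (use assms in blast)

text \<open>A balanced function is constant along the elementary steps generating the relation.
  Membership is carried through the induction because the reflexive-transitive closure lives on all
  pairs, whereas balancedness is known for sections only.\<close>

lemma tensor_rel_invariant: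
  assumes U: "openin (pspace X) U"
    and f: "\<And>a s t. \<lbrakk>a \<in> sect X U; s \<in> sect L U; t \<in> sect K U\<rbrakk> \<Longrightarrow> f (act L U a s) t = f s (act K U a t)"
    and rel: "((s, t), q) \<in> tensor_rel X L K U" and st: "s \<in> sect L U" "t \<in> sect K U"
  shows "fst q \<in> sect L U \<and> snd q \<in> sect K U \<and> f (fst q) (snd q) = f s t"
  using rel unfolding tensor_rel_def Let_def
proof (induction rule: rtrancl_induct)
  case base
  show ?case using st by simp
next
  case (step p q)
  from step.hyps(2) obtain a s' t' where a: "a \<in> sect X U" "s' \<in> sect L U" "t' \<in> sect K U"
    and "(p, q) = ((act L U a s', t'), (s', act K U a t')) \<or> (q, p) = ((act L U a s', t'), (s', act K U a t'))"
    by auto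
  thus ?case using step.IH f[OF a] U by auto
qed

lemma tens_UN:
  assumes U: "openin (pspace X) U" and st: "s \<in> sect L U" "t \<in> sect K U"
    and f: "\<And>a s t. \<lbrakk>a \<in> sect X U; s \<in> sect L U; t \<in> sect K U\<rbrakk> \<Longrightarrow> f (act L U a s) t = f s (act K U a t)"
  shows "(\<Union>(s', t')\<in>tens U s t. f s' t') = f s t"
proof -
  have "(\<Union>(s', t')\<in>tens U s t. f s' t') = (\<Union>p\<in>tens U s t. f s t)"
  proof (intro SUP_cong refl)
    fix p assume "p \<in> tens U s t"
    hence "((s, t), p) \<in> tensor_rel X L K U" by (simp add: tens_def)
    from tensor_rel_invariant[of U f, OF U f this st] show "(case p of (s', t') \<Rightarrow> f s' t') = f s t"
      by (simp add: case_prod_beta)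
  qed
  moreover have "(s, t) \<in> tens U s t" by (simp add: tens_def tensor_rel_refl)
  ultimately show ?thesis by auto
qed

lemma pre_tensor_simps:
  "pspace PT = pspace X"
  "sect PT U = {tens U s t | s t. s \<in> sect L U \<and> t \<in> sect K U}"
  by (auto simp: pre_tensor_def quotient_def tens_def)

lemma tens_closed [simp]: "\<lbrakk>s \<in> sect L U; t \<in> sect K U\<rbrakk> \<Longrightarrow> tens U s t \<in> sect PT U"
  by (auto simp: pre_tensor_simps)

lemma restr_tens:
  assumes U: "openin (pspace X) U" and V: "openin (pspace X) V" "V \<subseteq> U" and st: "s \<in> sect L U" "t \<in> sect K U"
  shows "restr PT U V (tens U s t) = tens V (restr L U V s) (restr K U V t)"
proof -
  have "restr PT U V (tens U s t) = (\<Union>(s, t)\<in>tens U s t. tens V (restr L U V s) (restr K U V t))"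
    by (simp add: pre_tensor_def tens_def)
  also have "\<dots> = tens V (restr L U V s) (restr K U V t)"
    by (rule tens_UN[OF U st]) (use U V tens_act in simp)
  finally show ?thesis .
qed

lemma act_tens:
  assumes U: "openin (pspace X) U" and a: "a \<in> sect X U" and st: "s \<in> sect L U" "t \<in> sect K U"
  shows "act PT U a (tens U s t) = tens U (act L U a s) t"
proof -
  have "act PT U a (tens U s t) = (\<Union>(s, t)\<in>tens U s t. tens U (act L U a s) t)"
    by (simp add: pre_tensor_def tens_def)
  also have "\<dots> = tens U (act L U a s) t"
  proof (rule tens_UN[OF U st])
    fix b s t assume "b \<in> sect X U" "s \<in> sect L U" "t \<in> sect K U"
    thus "tens U (act L U a (act L U b s)) t = tens U (act L U a s) (act K U b t)"
      using U a L.act_left_commute[of U a b s] tens_act[of b U "act L U a s" t] by simp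
  qed
  finally show ?thesis .
qed

lemma pre_tensor_oset_presheaf: "oset_presheaf X PT"
proof -
  have E: "\<exists>s t. s \<in> sect L U \<and> t \<in> sect K U \<and> C = tens U s t" if "C \<in> sect PT U" for C U
    using that by (auto simp: pre_tensor_simps)
  have "is_presheaf PT"
    unfolding is_presheaf_def pre_tensor_simps(1)
  proof (intro conjI allI impI ballI funcsetI)
    fix U V C assume *: "openin (pspace X) U \<and> openin (pspace X) V \<and> V \<subseteq> U" and C: "C \<in> sect PT U"
    from E[OF C] obtain s t where st: "s \<in> sect L U" "t \<in> sect K U" "C = tens U s t" by blast
    show "restr PT U V C \<in> sect PT V" using * st by (simp add: restr_tens)
  next
    fix U C assume *: "openin (pspace X) U" and C: "C \<in> sect PT U"
    from E[OF C] obtain s t where st: "s \<in> sect L U" "t \<in> sect K U" "C = tens U s t" by blast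
    show "restr PT U U C = C" using * st by (simp add: restr_tens)
  next
    fix U V W C assume *: "openin (pspace X) U \<and> openin (pspace X) V \<and> openin (pspace X) W \<and> W \<subseteq> V \<and> V \<subseteq> U"
      and C: "C \<in> sect PT U"
    from E[OF C] obtain s t where st: "s \<in> sect L U" "t \<in> sect K U" "C = tens U s t" by blast
    have "W \<subseteq> U" using * by blast
    thus "restr PT V W (restr PT U V C) = restr PT U W C" using * st by (simp add: restr_tens)
  qed
  hence pre: "set_presheaf PT" by (simp add: set_presheaf_def)
  have "oset_presheaf_axioms X PT"
  proof
    show "pspace PT = pspace X" by (rule pre_tensor_simps(1))
  next
    fix U a C assume *: "openin (pspace X) U" "a \<in> sect X U" and C: "C \<in> sect PT U"
    from E[OF C] obtain s t where st: "s \<in> sect L U" "t \<in> sect K U" "C = tens U s t" by blast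
    show "act PT U a C \<in> sect PT U" using * st by (simp add: act_tens)
  next
    fix U C assume *: "openin (pspace X) U" and C: "C \<in> sect PT U"
    from E[OF C] obtain s t where st: "s \<in> sect L U" "t \<in> sect K U" "C = tens U s t" by blast
    show "act PT U (neutral X U) C = C" using * st by (simp add: act_tens)
  next
    fix U a b C assume *: "openin (pspace X) U" "a \<in> sect X U" "b \<in> sect X U" and C: "C \<in> sect PT U"
    from E[OF C] obtain s t where st: "s \<in> sect L U" "t \<in> sect K U" "C = tens U s t" by blast
    show "act PT U (mul X U a b) C = act PT U a (act PT U b C)" using * st by (simp add: act_tens L.act_mul)
  next
    fix U V a C assume *: "openin (pspace X) U" "openin (pspace X) V" "V \<subseteq> U" "a \<in> sect X U" and C: "C \<in> sect PT U"
    from E[OF C] obtain s t where st: "s \<in> sect L U" "t \<in> sect K U" "C = tens U s t" by blast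
    show "restr PT U V (act PT U a C) = act PT V (restr X U V a) (restr PT U V C)"
      using * st by (simp add: act_tens restr_tens)
  qed
  thus ?thesis using pre L.X.cmonoid_sheaf_axioms by (simp add: oset_presheaf_def)
qed

sublocale PT: oset_presheaf X PT
  by (rule pre_tensor_oset_presheaf)

text \<open>Moving scalars between the factors writes every tensor as a multiple of \<open>e\<close>
  tensor \<open>f\<close>. For freeness an invariant of tensor classes is required: the product of
  the coefficients with respect to \<open>e\<close> and \<open>f\<close>.\<close>

lemma tens_gen:
  assumes W: "openin (pspace X) W" and e: "e \<in> generators X L W" and f: "f \<in> generators X K W"
  shows "tens W e f \<in> generators X PT W"
proof (rule generatorsI)
  show "tens W e f \<in> sect PT W" using e f by simp
  fix V assume V: "openin (pspace X) V" "V \<subseteq> W"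
  let ?e = "restr L W V e" and ?f = "restr K W V f"
  have eV: "?e \<in> generators X L V" and fV: "?f \<in> generators X K V"
    using L.gen_restr[OF W V e] K.gen_restr[OF W V f] by auto
  have ec: "?e \<in> sect L V" and fc: "?f \<in> sect K V" using eV fV by simp_all
  have m: "act PT V a (restr PT W V (tens W e f)) = tens V (act L V a ?e) ?f" if "a \<in> sect X V" for a
    using that W V e f by (simp add: restr_tens act_tens)
  \<comment> \<open>The functions \<open>i\<close> and \<open>j\<close> read off coefficients with
    respect to the restricted generators.\<close>
  define i where "i = (\<lambda>s. inv_into (sect X V) (\<lambda>a. act L V a ?e) s)"
  define j where "j = (\<lambda>t. inv_into (sect X V) (\<lambda>a. act K V a ?f) t)"
  have i: "i (act L V a ?e) = a" if "a \<in> sect X V" for a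
    unfolding i_def by (rule inv_into_f_f) (use that L.gen_inj[OF eV V(1)] in \<open>auto intro: inj_onI\<close>)
  have j: "j (act K V a ?f) = a" if "a \<in> sect X V" for a
    unfolding j_def by (rule inv_into_f_f) (use that K.gen_inj[OF fV V(1)] in \<open>auto intro: inj_onI\<close>)
  have inv: "mul X V (i (act L V a s)) (j t) = mul X V (i s) (j (act K V a t))"
    if a: "a \<in> sect X V" and s: "s \<in> sect L V" and t: "t \<in> sect K V" for a s t
  proof -
    obtain b where b: "b \<in> sect X V" "s = act L V b ?e" using eV V(1) s by (rule L.gen_surj)
    obtain c where c: "c \<in> sect X V" "t = act K V c ?f" using fV V(1) t by (rule K.gen_surj)
    have "act L V a s = act L V (mul X V a b) ?e" "act K V a t = act K V (mul X V a c) ?f"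
      using a b c V ec fc by (simp_all add: L.act_mul K.act_mul)
    thus ?thesis using a b c V i j by (simp add: L.X.mul_ac)
  qed
  have "bij_betw (\<lambda>a. tens V (act L V a ?e) ?f) (sect X V) (sect PT V)"
    unfolding bij_betw_def
  proof
    show "inj_on (\<lambda>a. tens V (act L V a ?e) ?f) (sect X V)"
    proof (rule inj_onI)
      fix a b assume ab: "a \<in> sect X V" "b \<in> sect X V"
        and "tens V (act L V a ?e) ?f = tens V (act L V b ?e) ?f"
      hence "((act L V a ?e, ?f), (act L V b ?e, ?f)) \<in> tensor_rel X L K V" by (simp add: tens_eq_iff)
      \<comment> \<open>The product of coefficients is balanced, hence equal for the two tensors;
        since \<open>f\<close> has coefficient 1, what remains is \<open>a = b\<close>.\<close>
      from tensor_rel_invariant[of V "\<lambda>s t. mul X V (i s) (j t)", OF V(1) inv this]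
      have "mul X V (i (act L V b ?e)) (j ?f) = mul X V (i (act L V a ?e)) (j ?f)"
        using ab V(1) ec fc by simp
      moreover have "j ?f = neutral X V" using j[of "neutral X V"] V(1) fc by simp
      ultimately show "a = b" using i ab V(1) by simp
    qed
    show "(\<lambda>a. tens V (act L V a ?e) ?f) ` sect X V = sect PT V"
    proof
      show "(\<lambda>a. tens V (act L V a ?e) ?f) ` sect X V \<subseteq> sect PT V" using ec fc V(1) by auto
      show "sect PT V \<subseteq> (\<lambda>a. tens V (act L V a ?e) ?f) ` sect X V"
      proof
        fix C assume "C \<in> sect PT V"
        then obtain s t where st: "s \<in> sect L V" "t \<in> sect K V" "C = tens V s t" by (auto simp: pre_tensor_simps)
        obtain b where b: "b \<in> sect X V" "s = act L V b ?e" using eV V(1) st(1) by (rule L.gen_surj)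
        obtain c where c: "c \<in> sect X V" "t = act K V c ?f" using fV V(1) st(2) by (rule K.gen_surj)
        have "C = tens V (act L V c (act L V b ?e)) ?f"
          unfolding st(3) b(2) c(2) by (rule tens_act[symmetric]) (use b c V(1) ec fc in simp_all)
        also have "\<dots> = tens V (act L V (mul X V c b) ?e) ?f" using b c V(1) ec by (simp add: L.act_mul)
        finally show "C \<in> (\<lambda>a. tens V (act L V a ?e) ?f) ` sect X V"
          by (rule image_eqI) (use b c V(1) in simp)
      qed
    qed
  qed
  thus "bij_betw (\<lambda>a. act PT V a (restr PT W V (tens W e f))) (sect X V) (sect PT V)"
    using m by (simp cong: bij_betw_cong)
qed

lemma tens_units:
  assumes "openin (pspace X) U" "a \<in> sect X U" "b \<in> sect X U" "s \<in> sect L U" "t \<in> sect K U"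
  shows "tens U (act L U a s) (act K U b t) = act PT U (mul X U a b) (tens U s t)"
proof -
  have "tens U (act L U a s) (act K U b t) = tens U (act L U b (act L U a s)) t"
    using assms by (intro tens_act[symmetric]) auto
  also have "\<dots> = tens U (act L U (mul X U a b) s) t"
    using assms by (simp add: L.act_mul L.X.mul_commute[of U a b])
  finally show ?thesis using assms by (simp add: act_tens)
qed

end

section \<open>The Picard group\<close>

context oset_presheaf
begin

lemma gen_compare:
  assumes "openin (pspace X) W" "openin (pspace X) W'" "e \<in> generators X P W" "e' \<in> generators X P W'"
  obtains u where "u \<in> Units (secmon X (W \<inter> W'))" "restr P W (W \<inter> W') e = act P (W \<inter> W') u (restr P W' (W \<inter> W') e')"
proof -
  have o: "openin (pspace X) (W \<inter> W')" using assms by blast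
  show ?thesis
    by (rule gen_unitE[OF gen_restr[OF assms(2) o Int_lower2 assms(4)] o gen_restr[OF assms(1) o Int_lower1 assms(3)]])
       (rule that)
qed

end

section \<open>Comparison of line bundles through families of generators\<close>

lemma line_bundle_oset_sheaf: "\<lbrakk>cmonoid_sheaf X; line_bundle X L\<rbrakk> \<Longrightarrow> oset_sheaf X L"
  by (simp add: line_bundle_iff)

lemma line_bundle_gen:
  assumes X: "cmonoid_sheaf X" and L: "line_bundle X L" and x: "openin (pspace X) N" "x \<in> N"
  obtains U e where "openin (pspace X) U" "x \<in> U" "U \<subseteq> N" "e \<in> generators X L U"
proof -
  interpret L: oset_sheaf X L by (rule line_bundle_oset_sheaf[OF X L])
  show ?thesis
    by (rule L.gen_local[OF _ x]) (use L line_bundle_iff[OF X, of L] that in blast)+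
qed

text \<open>Matching generators produced from a common index: pairs or triples of generators,
  sections of a torsor, or pairs of lifts. All isomorphisms between line bundles needed for the
  group laws arise by checking that both families have the same transition functions.\<close>

lemma oset_iso_of_family:
  assumes L: "oset_sheaf X L" and N: "oset_sheaf X N"
    and F: "\<And>W i. \<lbrakk>openin (pspace X) W; i \<in> I W\<rbrakk> \<Longrightarrow> F W i \<in> generators X L W"
    and G: "\<And>W i. \<lbrakk>openin (pspace X) W; i \<in> I W\<rbrakk> \<Longrightarrow> G W i \<in> generators X N W"
    and cover: "\<And>x. x \<in> topspace (pspace X) \<Longrightarrow> \<exists>W i. openin (pspace X) W \<and> x \<in> W \<and> i \<in> I W"
    and compat: "\<And>W W' i j. \<lbrakk>openin (pspace X) W; openin (pspace X) W'; i \<in> I W; j \<in> I W'\<rbrakk> \<Longrightarrow>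
      \<exists>u\<in>sect X (W \<inter> W'). restr L W (W \<inter> W') (F W i) = act L (W \<inter> W') u (restr L W' (W \<inter> W') (F W' j)) \<and>
        restr N W (W \<inter> W') (G W i) = act N (W \<inter> W') u (restr N W' (W \<inter> W') (G W' j))"
  shows "oset_iso X L N"
proof (rule oset_iso_if_matching_generators[OF L N])
  let ?C = "{(W, F W i, G W i) | W i. openin (pspace X) W \<and> i \<in> I W}"
  show "matching_generators X L N ?C"
    unfolding matching_generators_def
  proof (intro conjI ballI)
    show "case p of (W, e, f) \<Rightarrow> openin (pspace X) W \<and> e \<in> generators X L W \<and> f \<in> generators X N W" if "p \<in> ?C" for p
      using that F G by auto
    show "\<exists>(W, e, f)\<in>?C. x \<in> W" if "x \<in> topspace (pspace X)" for x
      using cover[OF that] by (elim exE conjE) (rule bexI[of _ "(W, F W i, G W i)" for W i], auto)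
    fix p assume "p \<in> ?C"
    then obtain W i where p: "p = (W, F W i, G W i)" "openin (pspace X) W" "i \<in> I W" by auto
    show "case p of (W, e, f) \<Rightarrow> \<forall>(W', e', f')\<in>?C. \<exists>u\<in>sect X (W \<inter> W').
          restr L W (W \<inter> W') e = act L (W \<inter> W') u (restr L W' (W \<inter> W') e') \<and>
          restr N W (W \<inter> W') f = act N (W \<inter> W') u (restr N W' (W \<inter> W') f')"
      unfolding p(1) prod.case
    proof (rule ballI)
      fix q assume "q \<in> ?C"
      then obtain W' j where q: "q = (W', F W' j, G W' j)" "openin (pspace X) W'" "j \<in> I W'" by auto
      show "case q of (W', e', f') \<Rightarrow> \<exists>u\<in>sect X (W \<inter> W').
          restr L W (W \<inter> W') (F W i) = act L (W \<inter> W') u (restr L W' (W \<inter> W') e') \<and>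
          restr N W (W \<inter> W') (G W i) = act N (W \<inter> W') u (restr N W' (W \<inter> W') f')"
        unfolding q(1) prod.case using compat[OF p(2) q(2) p(3) q(3)] .
    qed
  qed
qed

text \<open>What the tensor product does to generators: \<open>\<delta>\<close> plays the role of
  the map from \<open>e\<close> and \<open>f\<close> to \<open>e\<close> tensor \<open>f\<close>,
  multiplicative in the two unit actions. It determines the target up to isomorphism.\<close>

definition gen_pairing ::
    "('p, 'a) monoid_presheaf \<Rightarrow> ('p, 'a, 'l) oset_presheaf \<Rightarrow> ('p, 'a, 'k) oset_presheaf \<Rightarrow> ('p, 'a, 'n) oset_presheaf
      \<Rightarrow> ('p set \<Rightarrow> 'l \<Rightarrow> 'k \<Rightarrow> 'n) \<Rightarrow> bool" where
  "gen_pairing X L K N \<delta> \<longleftrightarrow>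
     (\<forall>U. openin (pspace X) U \<longrightarrow> (\<forall>e\<in>generators X L U. \<forall>f\<in>generators X K U. \<delta> U e f \<in> generators X N U \<and>
        (\<forall>u\<in>Units (secmon X U). \<forall>v\<in>Units (secmon X U).
           \<delta> U (act L U u e) (act K U v f) = act N U (mul X U u v) (\<delta> U e f)))) \<and>
     (\<forall>U V. openin (pspace X) U \<and> openin (pspace X) V \<and> V \<subseteq> U \<longrightarrow>
        (\<forall>e\<in>generators X L U. \<forall>f\<in>generators X K U. \<delta> V (restr L U V e) (restr K U V f) = restr N U V (\<delta> U e f)))"

text \<open>A relation in place of the concrete tensor product, so that the bundle \<open>N\<close>
  may have sections of any type; iterated tensor products would otherwise change type at each
  step.\<close>

definition tensor_related ::
    "('p, 'a) monoid_presheaf \<Rightarrow> ('p, 'a, 'l) oset_presheaf \<Rightarrow> ('p, 'a, 'k) oset_presheaf \<Rightarrow> ('p, 'a, 'n) oset_presheaf \<Rightarrow> bool" where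
  "tensor_related X L K N \<longleftrightarrow> (\<exists>\<delta>. gen_pairing X L K N \<delta>)"

lemma gen_pairingD:
  assumes "gen_pairing X L K N \<delta>" "openin (pspace X) U" "e \<in> generators X L U" "f \<in> generators X K U"
  shows "\<delta> U e f \<in> generators X N U"
    "\<lbrakk>u \<in> Units (secmon X U); v \<in> Units (secmon X U)\<rbrakk> \<Longrightarrow> \<delta> U (act L U u e) (act K U v f) = act N U (mul X U u v) (\<delta> U e f)"
    "\<lbrakk>openin (pspace X) V; V \<subseteq> U\<rbrakk> \<Longrightarrow> \<delta> V (restr L U V e) (restr K U V f) = restr N U V (\<delta> U e f)"
proof -
  have 1: "\<delta> U e f \<in> generators X N U \<and> (\<forall>u\<in>Units (secmon X U). \<forall>v\<in>Units (secmon X U).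
           \<delta> U (act L U u e) (act K U v f) = act N U (mul X U u v) (\<delta> U e f))"
    using assms(1)[unfolded gen_pairing_def, THEN conjunct1] assms(2-4) by simp
  show "\<delta> U e f \<in> generators X N U" using 1 by (rule conjunct1)
  show "\<delta> U (act L U u e) (act K U v f) = act N U (mul X U u v) (\<delta> U e f)"
    if "u \<in> Units (secmon X U)" "v \<in> Units (secmon X U)"
    using conjunct2[OF 1] that by simp
  show "\<delta> V (restr L U V e) (restr K U V f) = restr N U V (\<delta> U e f)"
    if "openin (pspace X) V" "V \<subseteq> U"
    using assms(1)[unfolded gen_pairing_def, THEN conjunct2] assms(2-4) that by simp
qed

locale structure_sheaf = cmonoid_sheaf X for X :: "('p, 'a) monoid_presheaf"
begin

lemmas sheaf_X = cmonoid_sheaf_axioms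
lemmas lb_sheaf = line_bundle_oset_sheaf[OF sheaf_X]

text \<open>Transition functions of paired generators are products of the transition functions of
  the factors.\<close>

lemma gen_pairing_compare:
  assumes L: "oset_sheaf X L" and K: "oset_sheaf X K" and \<delta>: "gen_pairing X L K N \<delta>"
    and W: "openin (pspace X) W" "openin (pspace X) W'"
    and e: "e \<in> generators X L W" "e' \<in> generators X L W'" "u \<in> Units (secmon X (W \<inter> W'))"
      "restr L W (W \<inter> W') e = act L (W \<inter> W') u (restr L W' (W \<inter> W') e')"
    and f: "f \<in> generators X K W" "f' \<in> generators X K W'" "v \<in> Units (secmon X (W \<inter> W'))"
      "restr K W (W \<inter> W') f = act K (W \<inter> W') v (restr K W' (W \<inter> W') f')"
  shows "restr N W (W \<inter> W') (\<delta> W e f) = act N (W \<inter> W') (mul X (W \<inter> W') u v) (restr N W' (W \<inter> W') (\<delta> W' e' f'))"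
proof -
  interpret L: oset_sheaf X L by fact
  interpret K: oset_sheaf X K by fact
  have Z: "openin (pspace X) (W \<inter> W')" "W \<inter> W' \<subseteq> W" "W \<inter> W' \<subseteq> W'" using W by auto
  have g: "restr L W' (W \<inter> W') e' \<in> generators X L (W \<inter> W')" "restr K W' (W \<inter> W') f' \<in> generators X K (W \<inter> W')"
    using L.gen_restr[OF W(2) Z(1,3) e(2)] K.gen_restr[OF W(2) Z(1,3) f(2)] by auto
  show ?thesis
    using gen_pairingD(3)[OF \<delta> W(1) e(1) f(1) Z(1,2)] gen_pairingD(3)[OF \<delta> W(2) e(2) f(2) Z(1,3)]
      gen_pairingD(2)[OF \<delta> Z(1) g e(3) f(3)] e(4) f(4) by simp
qed

lemma pair_cover:
  assumes L: "line_bundle X L" and K: "line_bundle X K" and x: "x \<in> topspace (pspace X)"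
  obtains W e f where "openin (pspace X) W" "x \<in> W" "e \<in> generators X L W" "f \<in> generators X K W"
proof -
  interpret L: oset_sheaf X L by (rule lb_sheaf[OF L])
  obtain U e where U: "openin (pspace X) U" "x \<in> U" "U \<subseteq> topspace (pspace X)" "e \<in> generators X L U"
    using sheaf_X L openin_topspace x by (rule line_bundle_gen)
  obtain V f where V: "openin (pspace X) V" "x \<in> V" "V \<subseteq> U" "f \<in> generators X K V"
    using sheaf_X K U(1,2) by (rule line_bundle_gen)
  show ?thesis using that[OF V(1,2) L.gen_restr[OF U(1) V(1,3) U(4)] V(4)] .
qed

text \<open>Both bundles carry generators indexed by pairs \<open>(e, f)\<close>, with the
  transition functions \<open>u v\<close> in each.\<close>

lemma tensor_related_unique:
  assumes L: "line_bundle X L" and K: "line_bundle X K" and N: "oset_sheaf X N" and N': "oset_sheaf X N'"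
    and t: "tensor_related X L K N" and t': "tensor_related X L K N'"
  shows "oset_iso X N N'"
proof -
  obtain \<delta> \<delta>' where \<delta>: "gen_pairing X L K N \<delta>" and \<delta>': "gen_pairing X L K N' \<delta>'"
    using t t' unfolding tensor_related_def by blast
  note sL = lb_sheaf[OF L] and sK = lb_sheaf[OF K]
  interpret L: oset_sheaf X L by (rule sL)
  interpret K: oset_sheaf X K by (rule sK)
  show ?thesis
  proof (rule oset_iso_of_family[OF N N', where I = "\<lambda>W. generators X L W \<times> generators X K W"
        and F = "\<lambda>W (e, f). \<delta> W e f" and G = "\<lambda>W (e, f). \<delta>' W e f"])
    show "\<exists>W i. openin (pspace X) W \<and> x \<in> W \<and> i \<in> generators X L W \<times> generators X K W" if "x \<in> topspace (pspace X)" for x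
      using pair_cover[OF L K that] by (metis SigmaI)
    fix W W' i j assume W: "openin (pspace X) W" "openin (pspace X) W'" and "i \<in> generators X L W \<times> generators X K W"
      and "j \<in> generators X L W' \<times> generators X K W'"
    then obtain e f e' f' where ij: "i = (e, f)" "j = (e', f')" and e: "e \<in> generators X L W" "e' \<in> generators X L W'"
      and f: "f \<in> generators X K W" "f' \<in> generators X K W'" by auto
    obtain u where u: "u \<in> Units (secmon X (W \<inter> W'))" "restr L W (W \<inter> W') e = act L (W \<inter> W') u (restr L W' (W \<inter> W') e')"
      using W e by (rule L.gen_compare)
    obtain v where v: "v \<in> Units (secmon X (W \<inter> W'))" "restr K W (W \<inter> W') f = act K (W \<inter> W') v (restr K W' (W \<inter> W') f')"
      using W f by (rule K.gen_compare)
    have "mul X (W \<inter> W') u v \<in> sect X (W \<inter> W')" using u v W by (simp add: openin_Int)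
    thus "\<exists>u\<in>sect X (W \<inter> W').
        restr N W (W \<inter> W') (case i of (e, f) \<Rightarrow> \<delta> W e f) = act N (W \<inter> W') u (restr N W' (W \<inter> W') (case j of (e, f) \<Rightarrow> \<delta> W' e f)) \<and>
        restr N' W (W \<inter> W') (case i of (e, f) \<Rightarrow> \<delta>' W e f) = act N' (W \<inter> W') u (restr N' W' (W \<inter> W') (case j of (e, f) \<Rightarrow> \<delta>' W' e f))"
      unfolding ij prod.case
      using gen_pairing_compare[OF sL sK \<delta> W e u f v] gen_pairing_compare[OF sL sK \<delta>' W e u f v] by blast
  qed (use gen_pairingD(1)[OF \<delta>] gen_pairingD(1)[OF \<delta>'] in auto)
qed

text \<open>Triples \<open>(e, f, g)\<close> index generators of both iterated products; the
  transition functions are \<open>(u v) w\<close> and \<open>u (v w)\<close>, so associativity of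
  sections is all that is used.\<close>

lemma tensor_related_assoc:
  assumes L: "line_bundle X L" and K: "line_bundle X K" and M: "line_bundle X M"
    and A: "line_bundle X A" "tensor_related X L K A" and B: "oset_sheaf X B" "tensor_related X A M B"
    and C: "line_bundle X C" "tensor_related X K M C" and D: "oset_sheaf X D" "tensor_related X L C D"
  shows "oset_iso X B D"
proof -
  obtain \<alpha> \<beta> \<gamma> \<delta> where \<alpha>: "gen_pairing X L K A \<alpha>" and \<beta>: "gen_pairing X A M B \<beta>"
    and \<gamma>: "gen_pairing X K M C \<gamma>" and \<delta>: "gen_pairing X L C D \<delta>"
    using A B C D unfolding tensor_related_def by blast
  note sL = lb_sheaf[OF L] and sK = lb_sheaf[OF K] and sM = lb_sheaf[OF M] and sA = lb_sheaf[OF A(1)] and sC = lb_sheaf[OF C(1)]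
  interpret L: oset_sheaf X L by (rule sL)
  interpret K: oset_sheaf X K by (rule sK)
  interpret M: oset_sheaf X M by (rule sM)
  let ?I = "\<lambda>W. generators X L W \<times> generators X K W \<times> generators X M W"
  have aA: "\<alpha> W e f \<in> generators X A W" if "openin (pspace X) W" "e \<in> generators X L W" "f \<in> generators X K W" for W e f
    using gen_pairingD(1)[OF \<alpha> that] .
  have cC: "\<gamma> W f g \<in> generators X C W" if "openin (pspace X) W" "f \<in> generators X K W" "g \<in> generators X M W" for W f g
    using gen_pairingD(1)[OF \<gamma> that] .
  show ?thesis
  proof (rule oset_iso_of_family[OF B(1) D(1), where I = ?I
        and F = "\<lambda>W (e, f, g). \<beta> W (\<alpha> W e f) g" and G = "\<lambda>W (e, f, g). \<delta> W e (\<gamma> W f g)"])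
    fix W i assume "openin (pspace X) W" "i \<in> ?I W"
    thus "(case i of (e, f, g) \<Rightarrow> \<beta> W (\<alpha> W e f) g) \<in> generators X B W"
      "(case i of (e, f, g) \<Rightarrow> \<delta> W e (\<gamma> W f g)) \<in> generators X D W"
      using gen_pairingD(1)[OF \<beta>] gen_pairingD(1)[OF \<delta>] aA cC by auto
  next
    fix x assume x: "x \<in> topspace (pspace X)"
    obtain V e f where V: "openin (pspace X) V" "x \<in> V" "e \<in> generators X L V" "f \<in> generators X K V"
      using L K x by (rule pair_cover)
    obtain W g where W: "openin (pspace X) W" "x \<in> W" "W \<subseteq> V" "g \<in> generators X M W"
      using sheaf_X M V(1,2) by (rule line_bundle_gen)
    have "(restr L V W e, restr K V W f, g) \<in> ?I W"
      using W L.gen_restr[OF V(1) W(1,3) V(3)] K.gen_restr[OF V(1) W(1,3) V(4)] by simp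
    thus "\<exists>W i. openin (pspace X) W \<and> x \<in> W \<and> i \<in> ?I W"
      using W(1,2) by blast
  next
    fix W W' i j assume W: "openin (pspace X) W" "openin (pspace X) W'" and "i \<in> ?I W" and "j \<in> ?I W'"
    then obtain e f g e' f' g' where ij: "i = (e, f, g)" "j = (e', f', g')" and e: "e \<in> generators X L W" "e' \<in> generators X L W'"
      and f: "f \<in> generators X K W" "f' \<in> generators X K W'" and g: "g \<in> generators X M W" "g' \<in> generators X M W'" by auto
    let ?Z = "W \<inter> W'"
    have Z: "openin (pspace X) ?Z" using W by blast
    obtain u where u: "u \<in> Units (secmon X ?Z)" "restr L W ?Z e = act L ?Z u (restr L W' ?Z e')"
      using W e by (rule L.gen_compare)
    obtain v where v: "v \<in> Units (secmon X ?Z)" "restr K W ?Z f = act K ?Z v (restr K W' ?Z f')"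
      using W f by (rule K.gen_compare)
    obtain w where w: "w \<in> Units (secmon X ?Z)" "restr M W ?Z g = act M ?Z w (restr M W' ?Z g')"
      using W g by (rule M.gen_compare)
    have uv: "mul X ?Z u v \<in> Units (secmon X ?Z)" "mul X ?Z v w \<in> Units (secmon X ?Z)" using u v w Z by auto
    have ass: "mul X ?Z u (mul X ?Z v w) = mul X ?Z (mul X ?Z u v) w" using mul_assoc[OF Z, of u v w] u v w by simp
    have "restr B W ?Z (\<beta> W (\<alpha> W e f) g) = act B ?Z (mul X ?Z (mul X ?Z u v) w) (restr B W' ?Z (\<beta> W' (\<alpha> W' e' f') g'))"
      by (rule gen_pairing_compare[OF sA sM \<beta> W aA[OF W(1) e(1) f(1)] aA[OF W(2) e(2) f(2)] uv(1)
            gen_pairing_compare[OF sL sK \<alpha> W e u f v] g w])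
    moreover have "restr D W ?Z (\<delta> W e (\<gamma> W f g)) = act D ?Z (mul X ?Z (mul X ?Z u v) w) (restr D W' ?Z (\<delta> W' e' (\<gamma> W' f' g')))"
      using gen_pairing_compare[OF sL sC \<delta> W e u cC[OF W(1) f(1) g(1)] cC[OF W(2) f(2) g(2)] uv(2)
            gen_pairing_compare[OF sK sM \<gamma> W f v g w]] unfolding ass .
    moreover have "mul X ?Z (mul X ?Z u v) w \<in> sect X ?Z" using uv w Z by simp
    ultimately show "\<exists>u\<in>sect X ?Z.
        restr B W ?Z (case i of (e, f, g) \<Rightarrow> \<beta> W (\<alpha> W e f) g) = act B ?Z u (restr B W' ?Z (case j of (e, f, g) \<Rightarrow> \<beta> W' (\<alpha> W' e f) g)) \<and>
        restr D W ?Z (case i of (e, f, g) \<Rightarrow> \<delta> W e (\<gamma> W f g)) = act D ?Z u (restr D W' ?Z (case j of (e, f, g) \<Rightarrow> \<delta> W' e (\<gamma> W' f g)))"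
      unfolding ij prod.case by blast
  qed
qed

lemma tensor_related_commute: "tensor_related X L K N \<Longrightarrow> tensor_related X K L N"
proof -
  assume "tensor_related X L K N"
  then obtain \<delta> where \<delta>: "gen_pairing X L K N \<delta>" unfolding tensor_related_def by blast
  have "gen_pairing X K L N (\<lambda>U f e. \<delta> U e f)"
    unfolding gen_pairing_def
  proof (intro conjI allI impI ballI)
    fix U f e assume U: "openin (pspace X) U" and f: "f \<in> generators X K U" and e: "e \<in> generators X L U"
    show "\<delta> U e f \<in> generators X N U" using gen_pairingD(1)[OF \<delta> U e f] .
    fix u v assume "u \<in> Units (secmon X U)" "v \<in> Units (secmon X U)"
    thus "\<delta> U (act L U v e) (act K U u f) = act N U (mul X U u v) (\<delta> U e f)"
      using gen_pairingD(2)[OF \<delta> U e f] mul_commute[OF U, of u v] by simp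
  next
    fix U V f e assume *: "openin (pspace X) U \<and> openin (pspace X) V \<and> V \<subseteq> U" and f: "f \<in> generators X K U" and e: "e \<in> generators X L U"
    thus "\<delta> V (restr L U V e) (restr K U V f) = restr N U V (\<delta> U e f)"
      using gen_pairingD(3)[OF \<delta> _ e f] by blast
  qed
  thus ?thesis unfolding tensor_related_def by blast
qed

lemma tensor_related_iso_left:
  assumes L: "oset_presheaf X L'" and iso: "oset_iso X L' L" and t: "tensor_related X L K N"
  shows "tensor_related X L' K N"
proof -
  interpret L': oset_presheaf X L' by fact
  obtain \<delta> where \<delta>: "gen_pairing X L K N \<delta>" using t unfolding tensor_related_def by blast
  obtain \<phi> where \<phi>: "is_oset_iso X L' L \<phi>" using iso unfolding oset_iso_iff by blast
  have g: "\<phi> U e \<in> generators X L U" if "openin (pspace X) U" "e \<in> generators X L' U" for U e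
    using is_oset_iso_gen[OF L \<phi> that] .
  have "gen_pairing X L' K N (\<lambda>U e f. \<delta> U (\<phi> U e) f)"
    unfolding gen_pairing_def
  proof (intro conjI allI impI ballI)
    fix U e f assume U: "openin (pspace X) U" and e: "e \<in> generators X L' U" and f: "f \<in> generators X K U"
    show "\<delta> U (\<phi> U e) f \<in> generators X N U" using gen_pairingD(1)[OF \<delta> U g[OF U e] f] .
    fix u v assume "u \<in> Units (secmon X U)" "v \<in> Units (secmon X U)"
    thus "\<delta> U (\<phi> U (act L' U u e)) (act K U v f) = act N U (mul X U u v) (\<delta> U (\<phi> U e) f)"
      using gen_pairingD(2)[OF \<delta> U g[OF U e] f] is_oset_isoD(3)[OF \<phi> U, of u e] e by simp
  next
    fix U V e f assume *: "openin (pspace X) U \<and> openin (pspace X) V \<and> V \<subseteq> U" and e: "e \<in> generators X L' U" and f: "f \<in> generators X K U"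
    thus "\<delta> V (\<phi> V (restr L' U V e)) (restr K U V f) = restr N U V (\<delta> U (\<phi> U e) f)"
      using gen_pairingD(3)[OF \<delta> _ g[OF _ e] f] is_oset_isoD(4)[OF \<phi>, of U V e] by simp
  qed
  thus ?thesis unfolding tensor_related_def by blast
qed

lemma tensor_related_iso_result:
  assumes N: "oset_presheaf X N" and iso: "oset_iso X N N'" and t: "tensor_related X L K N"
  shows "tensor_related X L K N'"
proof -
  interpret N: oset_presheaf X N by fact
  obtain \<delta> where \<delta>: "gen_pairing X L K N \<delta>" using t unfolding tensor_related_def by blast
  obtain \<phi> where \<phi>: "is_oset_iso X N N' \<phi>" using iso unfolding oset_iso_iff by blast
  have "gen_pairing X L K N' (\<lambda>U e f. \<phi> U (\<delta> U e f))"
    unfolding gen_pairing_def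
  proof (intro conjI allI impI ballI)
    fix U e f assume U: "openin (pspace X) U" and e: "e \<in> generators X L U" and f: "f \<in> generators X K U"
    have d: "\<delta> U e f \<in> generators X N U" using gen_pairingD(1)[OF \<delta> U e f] .
    show "\<phi> U (\<delta> U e f) \<in> generators X N' U" using is_oset_iso_gen[OF N \<phi> U d] .
    fix u v assume uv: "u \<in> Units (secmon X U)" "v \<in> Units (secmon X U)"
    thus "\<phi> U (\<delta> U (act L U u e) (act K U v f)) = act N' U (mul X U u v) (\<phi> U (\<delta> U e f))"
      using gen_pairingD(2)[OF \<delta> U e f uv] is_oset_isoD(3)[OF \<phi> U, of "mul X U u v" "\<delta> U e f"] d U by simp
  next
    fix U V e f assume *: "openin (pspace X) U \<and> openin (pspace X) V \<and> V \<subseteq> U" and e: "e \<in> generators X L U" and f: "f \<in> generators X K U"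
    thus "\<phi> V (\<delta> V (restr L U V e) (restr K U V f)) = restr N' U V (\<phi> U (\<delta> U e f))"
      using gen_pairingD(1,3)[OF \<delta> _ e f] is_oset_isoD(4)[OF \<phi>, of U V "\<delta> U e f"] by simp
  qed
  thus ?thesis unfolding tensor_related_def by blast
qed

text \<open>Near each point both factors have generators over one open set; their tensor generates
  the presheaf product there and remains a generator after sheafification.\<close>

theorem tensor_line_bundle:
  assumes L: "line_bundle X L" and K: "line_bundle X K"
  shows "line_bundle X (tensor X L K)" "tensor_related X L K (tensor X L K)"
proof -
  interpret L: oset_sheaf X L by (rule lb_sheaf[OF L])
  interpret K: oset_sheaf X K by (rule lb_sheaf[OF K])
  interpret oset_pair X L K ..
  let ?N = "tensor X L K"
  let ?\<delta> = "\<lambda>U e f. PT.sheafify_gen U (tens U e f)"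
  have N: "?N = sheafify_oset X PT" by (simp add: tensor_def)
  have gen: "?\<delta> U e f \<in> generators X ?N U"
    if "openin (pspace X) U" "e \<in> generators X L U" "f \<in> generators X K U" for U e f
    unfolding N by (rule PT.sheafify_gen[OF that(1) tens_gen[OF that]])
  show "line_bundle X ?N"
    unfolding line_bundle_iff[OF sheaf_X]
  proof (intro conjI ballI)
    show "oset_sheaf X ?N" unfolding N by (rule PT.sheafify_oset_sheaf)
    fix x assume "x \<in> topspace (pspace X)"
    with L K obtain W e f where "openin (pspace X) W" "x \<in> W" "e \<in> generators X L W" "f \<in> generators X K W"
      by (rule pair_cover)
    thus "\<exists>U. openin (pspace X) U \<and> x \<in> U \<and> generators X ?N U \<noteq> {}" using gen by blast
  qed
  have "gen_pairing X L K ?N ?\<delta>"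
    unfolding gen_pairing_def
  proof (intro conjI allI impI ballI)
    fix U e f assume U: "openin (pspace X) U" and e: "e \<in> generators X L U" and f: "f \<in> generators X K U"
    show "?\<delta> U e f \<in> generators X ?N U" by (rule gen[OF U e f])
    fix u v assume uv: "u \<in> Units (secmon X U)" "v \<in> Units (secmon X U)"
    thus "?\<delta> U (act L U u e) (act K U v f) = act ?N U (mul X U u v) (?\<delta> U e f)"
      unfolding N using tens_units[OF U, of u v e f] PT.sheafify_gen_act[OF U, of "mul X U u v" "tens U e f"] U e f by simp
  next
    fix U V e f assume *: "openin (pspace X) U \<and> openin (pspace X) V \<and> V \<subseteq> U" and e: "e \<in> generators X L U" and f: "f \<in> generators X K U"
    thus "?\<delta> V (restr L U V e) (restr K U V f) = restr ?N U V (?\<delta> U e f)"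
      unfolding N using restr_tens[of U V e f] PT.sheafify_gen_restr[of U V "tens U e f"] by simp
  qed
  thus "tensor_related X L K ?N" unfolding tensor_related_def by blast
qed

text \<open>The torsor of generators, with the action of \<open>u\<close> twisted by an involution \<open>\<theta>\<close> of the group
  of units; the identity recovers \<open>L\<close> and the inverse yields the dual of \<open>L\<close>.\<close>

definition twisted_generators ::
    "('p set \<Rightarrow> 'a \<Rightarrow> 'a) \<Rightarrow> ('p, 'a, 'l) oset_presheaf \<Rightarrow> ('p, 'a, 'l) oset_presheaf" where
  "twisted_generators \<theta> L = L\<lparr>sect := generators X L, act := (\<lambda>U u e. act L U (\<theta> U u) e)\<rparr>"

text \<open>An involution is bijective on units, so freeness and transitivity pass to the twisted
  action; multiplicativity and naturality of the involution give the action law and compatibility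
  with restriction.\<close>

lemma twisted_generators_torsor:
  assumes L: "line_bundle X L"
    and unit: "\<And>U u. \<lbrakk>openin (pspace X) U; u \<in> Units (secmon X U)\<rbrakk> \<Longrightarrow> \<theta> U u \<in> Units (secmon X U)"
    and invol: "\<And>U u. \<lbrakk>openin (pspace X) U; u \<in> Units (secmon X U)\<rbrakk> \<Longrightarrow> \<theta> U (\<theta> U u) = u"
    and mult: "\<And>U u v. \<lbrakk>openin (pspace X) U; u \<in> Units (secmon X U); v \<in> Units (secmon X U)\<rbrakk>
      \<Longrightarrow> \<theta> U (mul X U u v) = mul X U (\<theta> U u) (\<theta> U v)"
    and nat: "\<And>U V u. \<lbrakk>openin (pspace X) U; openin (pspace X) V; V \<subseteq> U; u \<in> Units (secmon X U)\<rbrakk>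
      \<Longrightarrow> restr X U V (\<theta> U u) = \<theta> V (restr X U V u)"
  shows "unit_torsor X (twisted_generators \<theta> L)"
proof -
  interpret L: oset_sheaf X L by (rule lb_sheaf[OF L])
  have S: "sect (twisted_generators \<theta> L) = generators X L" "restr (twisted_generators \<theta> L) = restr L"
    "act (twisted_generators \<theta> L) U u e = act L U (\<theta> U u) e" for U u e
    by (simp_all add: twisted_generators_def)
  have "unit_torsor_axioms X (twisted_generators \<theta> L)"
  proof (rule unit_torsor_axioms.intro, simp_all only: S)
    fix U t t' assume U: "openin (pspace X) U" and t: "t \<in> generators X L U" "t' \<in> generators X L U"
    obtain u where "u \<in> Units (secmon X U)" "t' = act L U u t" using t(1) U t(2) by (rule L.gen_unitE)
    thus "\<exists>u\<in>Units (secmon X U). t' = act L U (\<theta> U u) t"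
      using unit[OF U] invol[OF U] by (intro bexI[of _ "\<theta> U u"]) simp_all
  next
    fix U u v t assume U: "openin (pspace X) U" and uv: "u \<in> Units (secmon X U)" "v \<in> Units (secmon X U)"
      and t: "t \<in> generators X L U" and eq: "act L U (\<theta> U u) t = act L U (\<theta> U v) t"
    have "\<theta> U u = \<theta> U v" by (rule L.gen_inj[OF t U _ _ eq]) (use unit[OF U] uv in auto)
    thus "u = v" using invol[OF U uv(1)] invol[OF U uv(2)] by metis
  next
    fix x assume "x \<in> topspace (pspace X)"
    with sheaf_X L openin_topspace obtain U e where "openin (pspace X) U" "x \<in> U" "U \<subseteq> topspace (pspace X)" "e \<in> generators X L U"
      by (rule line_bundle_gen)
    thus "\<exists>U t. openin (pspace X) U \<and> x \<in> U \<and> t \<in> generators X L U" by blast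
  qed (use unit mult nat L.act_mul in simp_all)
  thus ?thesis by (simp add: unit_torsor_def sheaf_X)
qed

text \<open>The bundle rebuilt from the torsor of generators has the same transition functions as
  \<open>L\<close>, while its sections have the fixed type. This lets constructions in any type
  define elements of \<open>Pic\<close>.\<close>

lemma pic_representative:
  fixes L :: "('p, 'a, 'l) oset_presheaf"
  assumes L: "line_bundle X L"
  obtains N :: "('p, 'a) pic_bundle" where "line_bundle X N" "oset_iso X L N"
proof -
  interpret L: oset_sheaf X L by (rule lb_sheaf[OF L])
  let ?T = "twisted_generators (\<lambda>U u. u) L"
  interpret T: unit_torsor X ?T by (rule twisted_generators_torsor[OF L]) simp_all
  have S: "sect ?T = generators X L" "restr ?T = restr L" "act ?T = act L"
    by (simp_all add: twisted_generators_def)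
  note m = torsor_mapD[OF T.torsor_bundle(2), unfolded S]
  note N = lb_sheaf[OF T.torsor_bundle(1)]
  have "oset_iso X L T.torsor_bundle"
  proof (rule oset_iso_of_family[OF L.oset_sheaf_axioms N, where I = "generators X L" and F = "\<lambda>W e. e" and G = T.bundle_gen])
    show "\<exists>W e. openin (pspace X) W \<and> x \<in> W \<and> e \<in> generators X L W" if x: "x \<in> topspace (pspace X)" for x
    proof -
      obtain W e where "openin (pspace X) W" "x \<in> W" "W \<subseteq> topspace (pspace X)" "e \<in> generators X L W"
        using sheaf_X L openin_topspace x by (rule line_bundle_gen)
      thus ?thesis by blast
    qed
    fix W W' e e' assume W: "openin (pspace X) W" "openin (pspace X) W'" and e: "e \<in> generators X L W" "e' \<in> generators X L W'"
    have Z: "openin (pspace X) (W \<inter> W')" "W \<inter> W' \<subseteq> W" "W \<inter> W' \<subseteq> W'" using W by auto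
    obtain u where u: "u \<in> Units (secmon X (W \<inter> W'))" "restr L W (W \<inter> W') e = act L (W \<inter> W') u (restr L W' (W \<inter> W') e')"
      using W e by (rule L.gen_compare)
    have "restr T.torsor_bundle W (W \<inter> W') (T.bundle_gen W e) =
        act T.torsor_bundle (W \<inter> W') u (restr T.torsor_bundle W' (W \<inter> W') (T.bundle_gen W' e'))"
      using m(3)[OF W(1) e(1) Z(1,2)] m(3)[OF W(2) e(2) Z(1,3)]
        m(2)[OF Z(1) L.gen_restr[OF W(2) Z(1,3) e(2)] u(1)] u(2) by simp
    thus "\<exists>u\<in>sect X (W \<inter> W'). restr L W (W \<inter> W') e = act L (W \<inter> W') u (restr L W' (W \<inter> W') e') \<and>
      restr T.torsor_bundle W (W \<inter> W') (T.bundle_gen W e) =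
        act T.torsor_bundle (W \<inter> W') u (restr T.torsor_bundle W' (W \<inter> W') (T.bundle_gen W' e'))"
      using u by (intro bexI[of _ u]) simp_all
  qed (use m(1) in auto)
  thus ?thesis using that T.torsor_bundle(1) by blast
qed

lemma structure_line_bundle: "line_bundle X (structure_oset X)"
  unfolding line_bundle_iff[OF sheaf_X]
proof (intro conjI ballI structure_oset_sheaf[OF sheaf_X])
  fix x assume "x \<in> topspace (pspace X)"
  moreover have "neutral X (topspace (pspace X)) \<in> generators X (structure_oset X) (topspace (pspace X))"
    by (simp add: generators_structure_oset[OF sheaf_X])
  ultimately show "\<exists>U. openin (pspace X) U \<and> x \<in> U \<and> generators X (structure_oset X) U \<noteq> {}"
    using openin_topspace by blast
qed

text \<open>The pairing is the action itself: a unit times a generator.\<close>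

lemma tensor_related_unit:
  assumes L: "line_bundle X L" shows "tensor_related X (structure_oset X) L L"
proof -
  interpret L: oset_sheaf X L by (rule lb_sheaf[OF L])
  have "gen_pairing X (structure_oset X) L L (\<lambda>U. act L U)"
    unfolding gen_pairing_def
  proof (intro conjI allI impI ballI)
    fix U a e assume U: "openin (pspace X) U" and "a \<in> generators X (structure_oset X) U" and e: "e \<in> generators X L U"
    hence a: "a \<in> Units (secmon X U)" using generators_structure_oset[OF sheaf_X U] by simp
    show "act L U a e \<in> generators X L U" using L.gen_act[OF U a e] .
    fix u v assume uv: "u \<in> Units (secmon X U)" "v \<in> Units (secmon X U)"
    thus "act L U (act (structure_oset X) U u a) (act L U v e) = act L U (mul X U u v) (act L U a e)"
      using U a e L.act_left_commute[of U a v e] by (simp add: L.act_mul)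
  next
    fix U V a e assume *: "openin (pspace X) U \<and> openin (pspace X) V \<and> V \<subseteq> U"
      and "a \<in> generators X (structure_oset X) U" and e: "e \<in> generators X L U"
    hence a: "a \<in> Units (secmon X U)" using generators_structure_oset[OF sheaf_X] by simp
    thus "act L V (restr (structure_oset X) U V a) (restr L U V e) = restr L U V (act L U a e)"
      using * e by simp
  qed
  thus ?thesis unfolding tensor_related_def by blast
qed

lemma unit_inverse:
  assumes U: "openin (pspace X) U" and u: "u \<in> Units (secmon X U)"
  shows "inv\<^bsub>secmon X U\<^esub> u \<in> Units (secmon X U)" "mul X U (inv\<^bsub>secmon X U\<^esub> u) u = neutral X U"
    "mul X U u (inv\<^bsub>secmon X U\<^esub> u) = neutral X U" "inv\<^bsub>secmon X U\<^esub> (inv\<^bsub>secmon X U\<^esub> u) = u"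
proof -
  interpret S: comm_monoid "secmon X U" by (rule secmon_comm_monoid[OF U])
  show "inv\<^bsub>secmon X U\<^esub> u \<in> Units (secmon X U)" using S.Units_inv_Units[OF u] .
  show "mul X U (inv\<^bsub>secmon X U\<^esub> u) u = neutral X U" "mul X U u (inv\<^bsub>secmon X U\<^esub> u) = neutral X U"
    using S.Units_l_inv[OF u] S.Units_r_inv[OF u] by simp_all
  show "inv\<^bsub>secmon X U\<^esub> (inv\<^bsub>secmon X U\<^esub> u) = u" using S.Units_inv_inv[OF u] .
qed

lemma unit_inverse_unique:
  assumes U: "openin (pspace X) U" and u: "u \<in> Units (secmon X U)" and v: "v \<in> sect X U" "mul X U u v = neutral X U"
  shows "inv\<^bsub>secmon X U\<^esub> u = v"
  by (rule unit_cancel[OF U u]) (use unit_inverse[OF U u] v in auto)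

text \<open>In the bundle of the inversely twisted torsor the distinguished generators satisfy
  \<open>\<epsilon>(u e) = u^(-1) \<epsilon>(e)\<close>. The pairing of \<open>e\<close> with a
  generator \<open>f\<close> is the unit by which \<open>f\<close> differs from
  \<open>\<epsilon>(e)\<close>.\<close>

lemma dual_exists:
  fixes L :: "('p, 'a, 'l) oset_presheaf"
  assumes L: "line_bundle X L"
  obtains N :: "('p, 'a) pic_bundle" where "line_bundle X N" "tensor_related X L N (structure_oset X)"
proof -
  interpret L: oset_sheaf X L by (rule lb_sheaf[OF L])
  let ?\<theta> = "\<lambda>U u. inv\<^bsub>secmon X U\<^esub> u"
  let ?T = "twisted_generators ?\<theta> L"
  interpret T: unit_torsor X ?T
  proof (rule twisted_generators_torsor[OF L])
    fix U u v assume U: "openin (pspace X) U" and uv: "u \<in> Units (secmon X U)" "v \<in> Units (secmon X U)"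
    show "?\<theta> U (mul X U u v) = mul X U (?\<theta> U u) (?\<theta> U v)"
    proof (rule unit_inverse_unique[OF U])
      have c: "u \<in> sect X U" "v \<in> sect X U" "?\<theta> U u \<in> sect X U" "?\<theta> U v \<in> sect X U"
        using uv unit_inverse(1)[OF U] by simp_all
      have "mul X U (mul X U u v) (mul X U (?\<theta> U u) (?\<theta> U v)) = mul X U (mul X U u (?\<theta> U u)) (mul X U v (?\<theta> U v))"
        using c U by (simp add: mul_ac)
      thus "mul X U (mul X U u v) (mul X U (?\<theta> U u) (?\<theta> U v)) = neutral X U"
        using unit_inverse(3)[OF U] uv U by simp
    qed (use U uv unit_inverse(1)[OF U] in simp_all)
  next
    fix U V u assume U: "openin (pspace X) U" "openin (pspace X) V" "V \<subseteq> U" and u: "u \<in> Units (secmon X U)"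
    have "mul X V (restr X U V u) (restr X U V (?\<theta> U u)) = neutral X V"
      using restr_mul[OF U, of u "?\<theta> U u"] unit_inverse[OF U(1) u] u U by simp
    thus "restr X U V (?\<theta> U u) = ?\<theta> V (restr X U V u)"
      using unit_inverse_unique[OF U(2) restr_unit[OF U u], of "restr X U V (?\<theta> U u)"] unit_inverse(1)[OF U(1) u] U by simp
  qed (use unit_inverse in simp_all)
  let ?N = "T.torsor_bundle" and ?\<epsilon> = "T.bundle_gen"
  have S: "sect ?T = generators X L" "restr ?T = restr L" "act ?T U u e = act L U (?\<theta> U u) e" for U u e
    by (simp_all add: twisted_generators_def)
  note m = torsor_mapD[OF T.torsor_bundle(2), unfolded S]
  interpret N: oset_sheaf X ?N by (rule lb_sheaf[OF T.torsor_bundle(1)])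
  define \<delta> where "\<delta> = (\<lambda>U e f. SOME v. v \<in> Units (secmon X U) \<and> f = act ?N U v (?\<epsilon> U e))"
  have \<delta>: "\<delta> U e f \<in> Units (secmon X U)" "f = act ?N U (\<delta> U e f) (?\<epsilon> U e)"
    if U: "openin (pspace X) U" and e: "e \<in> generators X L U" and f: "f \<in> generators X ?N U" for U e f
  proof -
    obtain v where "v \<in> Units (secmon X U)" "f = act ?N U v (?\<epsilon> U e)"
      using m(1)[OF U e] U f by (rule N.gen_unitE)
    hence "\<exists>v. v \<in> Units (secmon X U) \<and> f = act ?N U v (?\<epsilon> U e)" by blast
    from someI_ex[OF this] show "\<delta> U e f \<in> Units (secmon X U)" "f = act ?N U (\<delta> U e f) (?\<epsilon> U e)"
      unfolding \<delta>_def by auto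
  qed
  have \<delta>_eq: "\<delta> U e f = v"
    if "openin (pspace X) U" "e \<in> generators X L U" "f \<in> generators X ?N U" "v \<in> sect X U" "f = act ?N U v (?\<epsilon> U e)" for U e f v
    by (rule N.gen_inj[OF m(1)[OF that(1,2)] that(1)]) (use \<delta>[OF that(1-3)] that(4,5) in auto)
  have "gen_pairing X L ?N (structure_oset X) \<delta>"
    unfolding gen_pairing_def
  proof (intro conjI allI impI ballI)
    fix U e f assume U: "openin (pspace X) U" and e: "e \<in> generators X L U" and f: "f \<in> generators X ?N U"
    show "\<delta> U e f \<in> generators X (structure_oset X) U"
      using \<delta>(1)[OF U e f] generators_structure_oset[OF sheaf_X U] by simp
    fix u v assume uv: "u \<in> Units (secmon X U)" "v \<in> Units (secmon X U)"
    have ue: "act L U u e \<in> generators X L U" using L.gen_act[OF U uv(1) e] .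
    have vf: "act ?N U v f \<in> generators X ?N U" using N.gen_act[OF U uv(2) f] .
    have c: "u \<in> sect X U" "v \<in> sect X U" "\<delta> U e f \<in> sect X U" "?\<epsilon> U (act L U u e) \<in> sect ?N U"
      using uv \<delta>(1)[OF U e f] m(1)[OF U ue] by simp_all
    \<comment> \<open>Expressing \<open>\<epsilon>(e)\<close> through \<open>\<epsilon>(u e)\<close>
      costs a factor \<open>u\<close>; together with \<open>v\<close> this gives the multiplier
      \<open>u v\<close> required of a pairing.\<close>
    have "?\<epsilon> U e = ?\<epsilon> U (act L U (?\<theta> U u) (act L U u e))"
      using L.act_mul[OF U, of "?\<theta> U u" u e, symmetric] unit_inverse[OF U uv(1)] uv e U by simp
    also have "\<dots> = act ?N U u (?\<epsilon> U (act L U u e))"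
      using m(2)[OF U ue uv(1)] .
    finally have "act ?N U v f = act ?N U (mul X U (mul X U u v) (\<delta> U e f)) (?\<epsilon> U (act L U u e))"
      using \<delta>(2)[OF U e f] c U N.act_mul[OF U, of v "mul X U (\<delta> U e f) u" "?\<epsilon> U (act L U u e)"]
        N.act_mul[OF U, of "\<delta> U e f" u "?\<epsilon> U (act L U u e)"]
      by (simp add: mul_ac del: T.torsor_bundle_simps)
    thus "\<delta> U (act L U u e) (act ?N U v f) = act (structure_oset X) U (mul X U u v) (\<delta> U e f)"
      using \<delta>_eq[OF U ue vf, of "mul X U (mul X U u v) (\<delta> U e f)"] c U by (simp del: T.torsor_bundle_simps)
  next
    fix U V e f assume *: "openin (pspace X) U \<and> openin (pspace X) V \<and> V \<subseteq> U"
      and e: "e \<in> generators X L U" and f: "f \<in> generators X ?N U"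
    hence U: "openin (pspace X) U" "openin (pspace X) V" "V \<subseteq> U" by auto
    have "restr ?N U V f = act ?N V (restr X U V (\<delta> U e f)) (?\<epsilon> V (restr L U V e))"
      using arg_cong[OF \<delta>(2)[OF U(1) e f], of "restr ?N U V"] N.restr_act[OF U, of "\<delta> U e f" "?\<epsilon> U e"]
        m(3)[OF U(1) e U(2,3)] m(1)[OF U(1) e] \<delta>(1)[OF U(1) e f] by (simp del: T.torsor_bundle_simps)
    thus "\<delta> V (restr L U V e) (restr ?N U V f) = restr (structure_oset X) U V (\<delta> U e f)"
      using \<delta>_eq[OF U(2) L.gen_restr[OF U e] N.gen_restr[OF U f], of "restr X U V (\<delta> U e f)"] \<delta>(1)[OF U(1) e f] U
      by (simp del: T.torsor_bundle_simps)
  qed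
  thus ?thesis using that[OF T.torsor_bundle(1)] unfolding tensor_related_def by blast
qed

section \<open>Isomorphism classes and the laws of the Picard group\<close>

lemma bundle_class_self: "line_bundle X L \<Longrightarrow> L \<in> bundle_class X L"
  by (simp add: bundle_class_def oset_iso_refl)

lemma bundle_class_eqI:
  assumes L: "line_bundle X L" and K: "line_bundle X K" and iso: "oset_iso X L K"
  shows "bundle_class X L = bundle_class X K"
proof -
  interpret L: oset_sheaf X L by (rule lb_sheaf[OF L])
  have "oset_iso X K L" by (rule oset_iso_sym[OF L.oset_presheaf_axioms iso])
  thus ?thesis using iso unfolding bundle_class_def by (auto intro: oset_iso_trans)
qed

lemma Pic_simps:
  "carrier (Pic X) = {bundle_class X L | L :: ('p, 'a) pic_bundle. line_bundle X L}"
  "\<one>\<^bsub>Pic X\<^esub> = bundle_class X (structure_oset X)"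
  by (simp_all add: Pic_def)

lemma bundle_class_closed:
  fixes L :: "('p, 'a, 'l) oset_presheaf"
  assumes L: "line_bundle X L" shows "bundle_class X L \<in> carrier (Pic X)"
proof -
  obtain N :: "('p, 'a) pic_bundle" where N: "line_bundle X N" "oset_iso X L N"
    using L by (rule pic_representative)
  thus ?thesis using bundle_class_eqI[OF L N] by (auto simp: Pic_simps)
qed

text \<open>The product is a union over all representatives of both classes. Every term is the class
  of \<open>N\<close>, since being tensor related is invariant under isomorphism and determines the
  result; products may therefore be computed with any convenient bundle.\<close>

lemma Pic_mult:
  fixes L K :: "('p, 'a) pic_bundle"
  assumes L: "line_bundle X L" and K: "line_bundle X K" and N: "line_bundle X N" and t: "tensor_related X L K N"
  shows "bundle_class X L \<otimes>\<^bsub>Pic X\<^esub> bundle_class X K = bundle_class X N"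
proof -
  have *: "bundle_class X (tensor X L' K') = bundle_class X N" if L': "L' \<in> bundle_class X L" and K': "K' \<in> bundle_class X K" for L' K'
  proof -
    have lb: "line_bundle X L'" "line_bundle X K'" and iso: "oset_iso X L L'" "oset_iso X K K'"
      using L' K' by (auto simp: bundle_class_def)
    interpret L: oset_sheaf X L by (rule lb_sheaf[OF L])
    interpret K: oset_sheaf X K by (rule lb_sheaf[OF K])
    have "tensor_related X L K' (tensor X L' K')"
      by (rule tensor_related_iso_left[OF L.oset_presheaf_axioms iso(1) tensor_line_bundle(2)[OF lb]])
    \<comment> \<open>Invariance is available in the left factor; commuting before and after
      transfers it to the right one.\<close>
    hence "tensor_related X L K (tensor X L' K')"
      by (intro tensor_related_commute[OF tensor_related_iso_left[OF K.oset_presheaf_axioms iso(2) tensor_related_commute]])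
    hence "oset_iso X (tensor X L' K') N"
      using t by (rule tensor_related_unique[OF L K lb_sheaf[OF tensor_line_bundle(1)[OF lb]] lb_sheaf[OF N]])
    thus ?thesis by (rule bundle_class_eqI[OF tensor_line_bundle(1)[OF lb] N])
  qed
  have "bundle_class X L \<otimes>\<^bsub>Pic X\<^esub> bundle_class X K =
      (\<Union>L'\<in>bundle_class X L. \<Union>K'\<in>bundle_class X K. bundle_class X (tensor X L' K'))"
    by (simp add: Pic_def)
  also have "\<dots> = (\<Union>L'\<in>bundle_class X L. \<Union>K'\<in>bundle_class X K. bundle_class X N)"
    by (intro SUP_cong refl *)
  also have "\<dots> = bundle_class X N"
    using bundle_class_self[OF L] bundle_class_self[OF K] by blast
  finally show ?thesis .
qed

lemma tensor_related_exists:
  fixes L K :: "('p, 'a) pic_bundle"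
  assumes L: "line_bundle X L" and K: "line_bundle X K"
  obtains N :: "('p, 'a) pic_bundle" where "line_bundle X N" "tensor_related X L K N"
proof -
  note t = tensor_line_bundle[OF L K]
  obtain N :: "('p, 'a) pic_bundle" where N: "line_bundle X N" "oset_iso X (tensor X L K) N"
    using t(1) by (rule pic_representative)
  interpret T: oset_sheaf X "tensor X L K" by (rule lb_sheaf[OF t(1)])
  show ?thesis using that[OF N(1) tensor_related_iso_result[OF T.oset_presheaf_axioms N(2) t(2)]] .
qed

lemma bundle_class_eqD:
  fixes L :: "('p, 'a) pic_bundle"
  assumes "line_bundle X L" "bundle_class X L = bundle_class X K"
  shows "oset_iso X K L"
  using bundle_class_self[OF assms(1)] assms(2) by (auto simp: bundle_class_def)

theorem Pic_comm_group: "comm_group (Pic X)"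
proof (rule comm_groupI)
  \<comment> \<open>Sections of the structure sheaf have another type, so the neutral class is first
    given a representative of the type used in \<open>Pic\<close>.\<close>
  obtain N1 :: "('p, 'a) pic_bundle" where N1: "line_bundle X N1" "oset_iso X (structure_oset X) N1"
    using structure_line_bundle by (rule pic_representative)
  have one: "\<one>\<^bsub>Pic X\<^esub> = bundle_class X N1"
    unfolding Pic_simps by (rule bundle_class_eqI[OF structure_line_bundle N1])
  interpret O: oset_sheaf X "structure_oset X" by (rule structure_oset_sheaf[OF sheaf_X])
  interpret N1: oset_sheaf X N1 by (rule lb_sheaf[OF N1(1)])
  show "\<one>\<^bsub>Pic X\<^esub> \<in> carrier (Pic X)" unfolding one by (rule bundle_class_closed[OF N1(1)])
  fix A assume "A \<in> carrier (Pic X)"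
  then obtain L :: "('p, 'a) pic_bundle" where L: "line_bundle X L" and A: "A = bundle_class X L"
    by (auto simp: Pic_simps)
  have "tensor_related X N1 L L"
    by (rule tensor_related_iso_left[OF N1.oset_presheaf_axioms oset_iso_sym[OF O.oset_presheaf_axioms N1(2)] tensor_related_unit[OF L]])
  thus "\<one>\<^bsub>Pic X\<^esub> \<otimes>\<^bsub>Pic X\<^esub> A = A" unfolding one A by (rule Pic_mult[OF N1(1) L L])
  obtain D :: "('p, 'a) pic_bundle" where D: "line_bundle X D" "tensor_related X L D (structure_oset X)"
    using L by (rule dual_exists)
  have "bundle_class X D \<otimes>\<^bsub>Pic X\<^esub> A = \<one>\<^bsub>Pic X\<^esub>"
    unfolding A Pic_simps by (rule Pic_mult[OF D(1) L structure_line_bundle tensor_related_commute[OF D(2)]])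
  thus "\<exists>B\<in>carrier (Pic X). B \<otimes>\<^bsub>Pic X\<^esub> A = \<one>\<^bsub>Pic X\<^esub>"
    using bundle_class_closed[OF D(1)] by blast
  fix B assume "B \<in> carrier (Pic X)"
  then obtain K :: "('p, 'a) pic_bundle" where K: "line_bundle X K" and B: "B = bundle_class X K"
    by (auto simp: Pic_simps)
  obtain LK :: "('p, 'a) pic_bundle" where LK: "line_bundle X LK" "tensor_related X L K LK"
    using L K by (rule tensor_related_exists)
  have AB: "A \<otimes>\<^bsub>Pic X\<^esub> B = bundle_class X LK" unfolding A B by (rule Pic_mult[OF L K LK])
  thus "A \<otimes>\<^bsub>Pic X\<^esub> B \<in> carrier (Pic X)" using bundle_class_closed[OF LK(1)] by simp
  show "A \<otimes>\<^bsub>Pic X\<^esub> B = B \<otimes>\<^bsub>Pic X\<^esub> A"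
    unfolding AB unfolding A B by (rule Pic_mult[OF K L LK(1) tensor_related_commute[OF LK(2)], symmetric])
  fix C assume "C \<in> carrier (Pic X)"
  then obtain M :: "('p, 'a) pic_bundle" where M: "line_bundle X M" and C: "C = bundle_class X M"
    by (auto simp: Pic_simps)
  obtain KM :: "('p, 'a) pic_bundle" where KM: "line_bundle X KM" "tensor_related X K M KM"
    using K M by (rule tensor_related_exists)
  obtain R :: "('p, 'a) pic_bundle" where R: "line_bundle X R" "tensor_related X LK M R"
    using LK(1) M by (rule tensor_related_exists)
  obtain S :: "('p, 'a) pic_bundle" where S: "line_bundle X S" "tensor_related X L KM S"
    using L KM(1) by (rule tensor_related_exists)
  have "oset_iso X R S"
    by (rule tensor_related_assoc[OF L K M LK lb_sheaf[OF R(1)] R(2) KM lb_sheaf[OF S(1)] S(2)])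
  hence "bundle_class X R = bundle_class X S" by (rule bundle_class_eqI[OF R(1) S(1)])
  moreover have "A \<otimes>\<^bsub>Pic X\<^esub> B \<otimes>\<^bsub>Pic X\<^esub> C = bundle_class X R"
    unfolding AB C by (rule Pic_mult[OF LK(1) M R])
  moreover have "A \<otimes>\<^bsub>Pic X\<^esub> (B \<otimes>\<^bsub>Pic X\<^esub> C) = bundle_class X S"
    unfolding A B C Pic_mult[OF K M KM] by (rule Pic_mult[OF L KM(1) S])
  ultimately show "A \<otimes>\<^bsub>Pic X\<^esub> B \<otimes>\<^bsub>Pic X\<^esub> C = A \<otimes>\<^bsub>Pic X\<^esub> (B \<otimes>\<^bsub>Pic X\<^esub> C)" by simp
qed

end

section \<open>The connecting homomorphism\<close>

text \<open>Sections of the torsor index generators of both bundles, and in each the transition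
  functions are those of the torsor.\<close>

lemma (in structure_sheaf) torsor_maps_iso:
  assumes T: "unit_torsor X T" and L: "line_bundle X L" "torsor_map X T L \<epsilon>" and N: "line_bundle X N" "torsor_map X T N \<nu>"
  shows "oset_iso X L N"
proof -
  interpret T: unit_torsor X T by fact
  show ?thesis
  proof (rule oset_iso_of_family[OF lb_sheaf[OF L(1)] lb_sheaf[OF N(1)], where I = "sect T" and F = \<epsilon> and G = \<nu>])
    show "\<exists>W i. openin (pspace X) W \<and> x \<in> W \<and> i \<in> sect T W" if "x \<in> topspace (pspace X)" for x
      using T.torsor_local[OF that] .
    fix W W' i j assume W: "openin (pspace X) W" "openin (pspace X) W'" and i: "i \<in> sect T W" and j: "j \<in> sect T W'"
    have Z: "openin (pspace X) (W \<inter> W')" "W \<inter> W' \<subseteq> W" "W \<inter> W' \<subseteq> W'" using W by auto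
    have r: "restr T W' (W \<inter> W') j \<in> sect T (W \<inter> W')" "restr T W (W \<inter> W') i \<in> sect T (W \<inter> W')"
      using T.torsor_restr_closed W Z i j by auto
    obtain u where u: "u \<in> Units (secmon X (W \<inter> W'))" "restr T W (W \<inter> W') i = act T (W \<inter> W') u (restr T W' (W \<inter> W') j)"
      using T.torsor_transitive[OF Z(1) r] by (rule bexE)
    have "restr L W (W \<inter> W') (\<epsilon> W i) = act L (W \<inter> W') u (restr L W' (W \<inter> W') (\<epsilon> W' j))"
      using torsor_mapD(3)[OF L(2) W(1) i Z(1,2)] torsor_mapD(3)[OF L(2) W(2) j Z(1,3)] torsor_mapD(2)[OF L(2) Z(1) r(1) u(1)] u(2)
      by simp
    moreover have "restr N W (W \<inter> W') (\<nu> W i) = act N (W \<inter> W') u (restr N W' (W \<inter> W') (\<nu> W' j))"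
      using torsor_mapD(3)[OF N(2) W(1) i Z(1,2)] torsor_mapD(3)[OF N(2) W(2) j Z(1,3)] torsor_mapD(2)[OF N(2) Z(1) r(1) u(1)] u(2)
      by simp
    ultimately show "\<exists>u\<in>sect X (W \<inter> W'). restr L W (W \<inter> W') (\<epsilon> W i) = act L (W \<inter> W') u (restr L W' (W \<inter> W') (\<epsilon> W' j)) \<and>
        restr N W (W \<inter> W') (\<nu> W i) = act N (W \<inter> W') u (restr N W' (W \<inter> W') (\<nu> W' j))"
      using unit_closed[OF u(1)] by blast
  qed (use torsor_mapD(1)[OF L(2)] torsor_mapD(1)[OF N(2)] in auto)
qed

lemma torsor_map_iso:
  assumes L: "oset_presheaf X L" and \<epsilon>: "torsor_map X T L \<epsilon>" and \<phi>: "is_oset_iso X L N \<phi>"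
  shows "torsor_map X T N (\<lambda>U t. \<phi> U (\<epsilon> U t))"
proof -
  interpret L: oset_presheaf X L by fact
  note m = torsor_mapD[OF \<epsilon>]
  show ?thesis
    unfolding torsor_map_def
  proof (intro conjI allI impI ballI funcsetI)
    fix U t assume U: "openin (pspace X) U" and t: "t \<in> sect T U"
    show "\<phi> U (\<epsilon> U t) \<in> generators X N U" by (rule is_oset_iso_gen[OF L \<phi> U m(1)[OF U t]])
  next
    fix U u t assume U: "openin (pspace X) U" and u: "u \<in> Units (secmon X U)" and t: "t \<in> sect T U"
    show "\<phi> U (\<epsilon> U (act T U u t)) = act N U u (\<phi> U (\<epsilon> U t))"
      using m(2)[OF U t u] is_oset_isoD(3)[OF \<phi> U, of u "\<epsilon> U t"] m(1)[OF U t] u by simp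
  next
    fix U V t assume *: "openin (pspace X) U \<and> openin (pspace X) V \<and> V \<subseteq> U" and t: "t \<in> sect T U"
    thus "\<phi> V (\<epsilon> V (restr T U V t)) = restr N U V (\<phi> U (\<epsilon> U t))"
      using m(3)[of U t V] is_oset_isoD(4)[OF \<phi>, of U V "\<epsilon> U t"] m(1)[of U t] by simp
  qed
qed

sublocale monoid_scheme \<subseteq> structure_sheaf X ..

context monoid_scheme
begin

definition lift_torsor :: "('p, 'a) sdivisor \<Rightarrow> ('p, 'a, 'p \<Rightarrow> ('p, 'a) sfrac) oset_presheaf" where
  "lift_torsor D = \<lparr>pspace = pspace X, sect = lifts X D, restr = (\<lambda>U V f. restrict f V),
     act = (\<lambda>U u f. mul (sMero X) U (to_sMero X U u) f)\<rparr>"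

lemma lift_torsor_simps:
  "sect (lift_torsor D) = lifts X D"
  "restr (lift_torsor D) U V f = restrict f V"
  "act (lift_torsor D) U u f = mul (sMero X) U (to_sMero X U u) f"
  by (simp_all add: lift_torsor_def)

lemma lifts_unit: "f \<in> lifts X D U \<Longrightarrow> f \<in> mero_units U"
  by (simp add: lifts_iff)

text \<open>Freeness of the torsor of lifts: the invertible \<open>f\<close> cancels, and units
  embed into semi-meromorphic functions.\<close>

lemma mero_act_cancel:
  assumes U: "openin (pspace X) U" and uv: "u \<in> Units (secmon X U)" "v \<in> Units (secmon X U)" and f: "f \<in> mero_units U"
    and eq: "mul (sMero X) U (to_sMero X U u) f = mul (sMero X) U (to_sMero X U v) f"
  shows "u = v"
proof -
  have c: "to_sMero X U u \<in> sect (sMero X) U" "to_sMero X U v \<in> sect (sMero X) U" using U uv by simp_all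
  have oU: "openin (pspace (sMero X)) U" using U by simp
  have "mul (sMero X) U f (to_sMero X U u) = mul (sMero X) U f (to_sMero X U v)"
    using eq Mero.mul_commute[OF oU _ c(1), of f] Mero.mul_commute[OF oU _ c(2), of f] Mero.unit_closed[OF f]
    by (simp del: sMero_simps(3))
  hence "to_sMero X U u = to_sMero X U v" using Mero.unit_cancel[OF oU f c] by blast
  thus ?thesis using to_sMero_inj[OF U uv] by blast
qed

lemma mero_act_restrict:
  assumes U: "openin (pspace X) U" "openin (pspace X) V" "V \<subseteq> U" and u: "u \<in> Units (secmon X U)" and f: "f \<in> mero_units U"
  shows "restrict (mul (sMero X) U (to_sMero X U u) f) V = mul (sMero X) V (to_sMero X V (restr X U V u)) (restrict f V)"
  using Mero.restr_mul[of U V "to_sMero X U u" f] to_sMero_restr[OF U, of u] U u f by (simp del: sMero_simps(3))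

lemma lift_torsor:
  assumes D: "D \<in> carrier (sDiv X)" shows "unit_torsor X (lift_torsor D)"
proof -
  have "unit_torsor_axioms X (lift_torsor D)"
  proof (rule unit_torsor_axioms.intro, simp_all only: lift_torsor_simps)
    fix U V f assume "openin (pspace X) U" "openin (pspace X) V" "V \<subseteq> U" "f \<in> lifts X D U"
    thus "restrict f V \<in> lifts X D V" by (rule lifts_restrict)
  next
    fix U V W :: "'p set" and f :: "'p \<Rightarrow> ('p, 'a) sfrac" assume "W \<subseteq> V"
    thus "restrict (restrict f V) W = restrict f W" by (simp add: Int_absorb1)
  next
    fix U u f assume "openin (pspace X) U" "u \<in> Units (secmon X U)" "f \<in> lifts X D U"
    thus "mul (sMero X) U (to_sMero X U u) f \<in> lifts X D U" by (rule lifts_act)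
  next
    fix U u v f assume U: "openin (pspace X) U" and uv: "u \<in> Units (secmon X U)" "v \<in> Units (secmon X U)" and f: "f \<in> lifts X D U"
    show "mul (sMero X) U (to_sMero X U (mul X U u v)) f = mul (sMero X) U (to_sMero X U u) (mul (sMero X) U (to_sMero X U v) f)"
      using Mero.mul_assoc[of U "to_sMero X U u" "to_sMero X U v" f] to_sMero_mult[OF U, of u v] U uv lifts_unit[OF f]
      by (simp del: sMero_simps(3))
  next
    fix U V u f assume "openin (pspace X) U" "openin (pspace X) V" "V \<subseteq> U" "u \<in> Units (secmon X U)" "f \<in> lifts X D U"
    thus "restrict (mul (sMero X) U (to_sMero X U u) f) V = mul (sMero X) V (to_sMero X V (restr X U V u)) (restrict f V)"
      by (intro mero_act_restrict lifts_unit)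
  next
    fix U u v f assume "openin (pspace X) U" "u \<in> Units (secmon X U)" "v \<in> Units (secmon X U)" "f \<in> lifts X D U"
      "mul (sMero X) U (to_sMero X U u) f = mul (sMero X) U (to_sMero X U v) f"
    thus "u = v" using mero_act_cancel lifts_unit by blast
  next
    fix U f g assume U: "openin (pspace X) U" and f: "f \<in> lifts X D U" and g: "g \<in> lifts X D U"
    obtain u where "u \<in> Units (secmon X U)" "g = mul (sMero X) U (to_sMero X U u) f"
      using U g f by (rule lifts_transitive)
    thus "\<exists>u\<in>Units (secmon X U). g = mul (sMero X) U (to_sMero X U u) f" by blast
  next
    fix x assume x: "x \<in> topspace (pspace X)"
    obtain V f where "openin (pspace X) V" "x \<in> V" "V \<subseteq> topspace (pspace X)" "f \<in> lifts X D V"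
      using D openin_topspace x by (rule lifts_local)
    thus "\<exists>U t. openin (pspace X) U \<and> x \<in> U \<and> t \<in> lifts X D U" by blast
  qed
  thus ?thesis by (simp add: unit_torsor_def sheaf_X)
qed

section \<open>From divisor classes to classes of line bundles\<close>

lemma bundle_of_divisor_iff:
  "bundle_of_divisor X D L \<longleftrightarrow> line_bundle X L \<and> (\<exists>\<epsilon>. torsor_map X (lift_torsor D) L \<epsilon>)"
  unfolding bundle_of_divisor_def torsor_map_def lift_torsor_simps ..

lemma bundle_of_divisor_exists:
  assumes D: "D \<in> carrier (sDiv X)"
  obtains L :: "('p, 'a) pic_bundle" where "bundle_of_divisor X D L"
proof -
  interpret T: unit_torsor X "lift_torsor D" by (rule lift_torsor[OF D])
  show ?thesis using that T.torsor_bundle unfolding bundle_of_divisor_iff by blast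
qed

lemma bundle_of_divisor_unique:
  assumes D: "D \<in> carrier (sDiv X)" and L: "bundle_of_divisor X D L" and N: "bundle_of_divisor X D N"
  shows "oset_iso X L N"
  using L N torsor_maps_iso[OF lift_torsor[OF D]] unfolding bundle_of_divisor_iff by blast

lemma bundle_of_divisor_iso:
  assumes L: "bundle_of_divisor X D L" and N: "line_bundle X N" and iso: "oset_iso X L N"
  shows "bundle_of_divisor X D N"
proof -
  obtain \<epsilon> where \<epsilon>: "line_bundle X L" "torsor_map X (lift_torsor D) L \<epsilon>"
    using L unfolding bundle_of_divisor_iff by blast
  interpret L: oset_sheaf X L by (rule lb_sheaf[OF \<epsilon>(1)])
  obtain \<phi> where \<phi>: "is_oset_iso X L N \<phi>" using iso unfolding oset_iso_iff by blast
  show ?thesis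
    unfolding bundle_of_divisor_iff using N torsor_map_iso[OF L.oset_presheaf_axioms \<epsilon>(2) \<phi>] by blast
qed

text \<open>Multiplication by a global function with divisor \<open>P\<close> carries lifts of
  \<open>D\<close> to lifts of the product divisor and commutes with the unit action, so a torsor
  map for the product can be composed with it.\<close>

lemma bundle_of_divisor_principal:
  assumes D: "D \<in> carrier (sDiv X)" and P: "P \<in> principal_sDiv X" and L: "bundle_of_divisor X (P \<otimes>\<^bsub>sDiv X\<^esub> D) L"
  shows "bundle_of_divisor X D L"
proof -
  let ?T = "topspace (pspace X)"
  obtain f where f: "f \<in> mero_units ?T" "P = div_of X ?T f" using P by (auto simp: principal_sDiv_def)
  obtain \<epsilon> where \<epsilon>: "line_bundle X L" "torsor_map X (lift_torsor (P \<otimes>\<^bsub>sDiv X\<^esub> D)) L \<epsilon>"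
    using L unfolding bundle_of_divisor_iff by blast
  note m = torsor_mapD[OF \<epsilon>(2), unfolded lift_torsor_simps]
  have fT: "f \<in> lifts X P ?T" using lift_of_principal[OF f(1)] f(2) by simp
  have fU: "restrict f U \<in> lifts X P U" if "openin (pspace X) U" for U
    by (rule lifts_restrict[OF openin_topspace that openin_subset[OF that] fT])
  let ?m = "\<lambda>U g. mul (sMero X) U (restrict f U) g"
  have mU: "?m U g \<in> lifts X (P \<otimes>\<^bsub>sDiv X\<^esub> D) U" if "openin (pspace X) U" "g \<in> lifts X D U" for U g
    by (rule lifts_mult[OF that(1) fU[OF that(1)] that(2)])
  have "torsor_map X (lift_torsor D) L (\<lambda>U g. \<epsilon> U (?m U g))"
    unfolding torsor_map_def lift_torsor_simps
  proof (intro conjI allI impI ballI funcsetI)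
    fix U g assume U: "openin (pspace X) U" and g: "g \<in> lifts X D U"
    show "\<epsilon> U (?m U g) \<in> generators X L U" by (rule m(1)[OF U mU[OF U g]])
  next
    fix U u g assume U: "openin (pspace X) U" and u: "u \<in> Units (secmon X U)" and g: "g \<in> lifts X D U"
    have "?m U (mul (sMero X) U (to_sMero X U u) g) = mul (sMero X) U (to_sMero X U u) (?m U g)"
      using Mero.mul_left_commute[of U "restrict f U" "to_sMero X U u" g] U u lifts_unit[OF fU[OF U]] lifts_unit[OF g]
      by (simp del: sMero_simps(3))
    thus "\<epsilon> U (?m U (mul (sMero X) U (to_sMero X U u) g)) = act L U u (\<epsilon> U (?m U g))"
      using m(2)[OF U mU[OF U g] u] by (simp del: sMero_simps(3))
  next
    fix U V g assume "openin (pspace X) U \<and> openin (pspace X) V \<and> V \<subseteq> U" and g: "g \<in> lifts X D U"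
    hence U: "openin (pspace X) U" "openin (pspace X) V" "V \<subseteq> U" by auto
    have "restrict (?m U g) V = ?m V (restrict g V)"
      using Mero.restr_mul[of U V "restrict f U" g] U lifts_unit[OF fU[OF U(1)]] lifts_unit[OF g]
      by (simp add: Int_absorb1 del: sMero_simps(3))
    thus "\<epsilon> V (?m V (restrict g V)) = restr L U V (\<epsilon> U (?m U g))"
      using m(3)[OF U(1) mU[OF U(1) g] U(2,3)] by (simp del: sMero_simps(3))
  qed
  thus ?thesis unfolding bundle_of_divisor_iff using \<epsilon>(1) by blast
qed

text \<open>Shows that the set defining \<open>sCl_to_Pic\<close> is a single isomorphism class:
  principal divisors do not change the associated bundles, and any two bundles of one divisor are
  isomorphic.\<close>

lemma sCl_to_Pic_coset:
  fixes L :: "('p, 'a) pic_bundle"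
  assumes D: "D \<in> carrier (sDiv X)" and L: "bundle_of_divisor X D L"
  shows "sCl_to_Pic X (principal_sDiv X #>\<^bsub>sDiv X\<^esub> D) = bundle_class X L"
proof -
  interpret S: comm_group "sDiv X" by (rule sDiv_comm_group)
  interpret P: subgroup "principal_sDiv X" "sDiv X" by (rule principal_sDiv_subgroup)
  have lbL: "line_bundle X L" using L by (simp add: bundle_of_divisor_iff)
  have mem: "bundle_of_divisor X D N" if "D' \<in> principal_sDiv X #>\<^bsub>sDiv X\<^esub> D" "bundle_of_divisor X D' N"
    for D' and N :: "('p, 'a) pic_bundle"
    using that bundle_of_divisor_principal[OF D] by (auto simp: r_coset_def)
  show ?thesis
  proof
    show "sCl_to_Pic X (principal_sDiv X #>\<^bsub>sDiv X\<^esub> D) \<subseteq> bundle_class X L"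
    proof
      fix N assume "N \<in> sCl_to_Pic X (principal_sDiv X #>\<^bsub>sDiv X\<^esub> D)"
      then obtain D' where "D' \<in> principal_sDiv X #>\<^bsub>sDiv X\<^esub> D" "bundle_of_divisor X D' N"
        by (auto simp: sCl_to_Pic_def)
      hence N: "bundle_of_divisor X D N" by (rule mem)
      hence "oset_iso X L N" by (rule bundle_of_divisor_unique[OF D L])
      thus "N \<in> bundle_class X L" using N by (simp add: bundle_class_def bundle_of_divisor_iff)
    qed
    show "bundle_class X L \<subseteq> sCl_to_Pic X (principal_sDiv X #>\<^bsub>sDiv X\<^esub> D)"
    proof
      fix N assume "N \<in> bundle_class X L"
      hence N: "line_bundle X N" "oset_iso X L N" by (auto simp: bundle_class_def)
      have "D \<in> principal_sDiv X #>\<^bsub>sDiv X\<^esub> D" by (rule S.rcos_self[OF D principal_sDiv_subgroup])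
      thus "N \<in> sCl_to_Pic X (principal_sDiv X #>\<^bsub>sDiv X\<^esub> D)"
        using bundle_of_divisor_iso[OF L N] by (auto simp: sCl_to_Pic_def)
    qed
  qed
qed

text \<open>Pairs of lifts \<open>(f, g)\<close> index generators of the tensor product and, through
  \<open>f g\<close>, of \<open>N\<close>. If the lifts change by \<open>u\<close> and
  \<open>v\<close>, both generators change by \<open>u v\<close>.\<close>

lemma bundle_of_divisor_mult:
  fixes L L' N :: "('p, 'a) pic_bundle"
  assumes D: "D \<in> carrier (sDiv X)" and D': "D' \<in> carrier (sDiv X)"
    and L: "bundle_of_divisor X D L" and L': "bundle_of_divisor X D' L'"
    and N: "bundle_of_divisor X (D \<otimes>\<^bsub>sDiv X\<^esub> D') N"
  shows "bundle_class X L \<otimes>\<^bsub>Pic X\<^esub> bundle_class X L' = bundle_class X N"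
proof -
  obtain \<epsilon> where \<epsilon>: "line_bundle X L" "torsor_map X (lift_torsor D) L \<epsilon>" using L unfolding bundle_of_divisor_iff by blast
  obtain \<epsilon>' where \<epsilon>': "line_bundle X L'" "torsor_map X (lift_torsor D') L' \<epsilon>'" using L' unfolding bundle_of_divisor_iff by blast
  obtain \<nu> where \<nu>: "line_bundle X N" "torsor_map X (lift_torsor (D \<otimes>\<^bsub>sDiv X\<^esub> D')) N \<nu>" using N unfolding bundle_of_divisor_iff by blast
  note m = torsor_mapD[OF \<epsilon>(2), unfolded lift_torsor_simps] and m' = torsor_mapD[OF \<epsilon>'(2), unfolded lift_torsor_simps]
    and n = torsor_mapD[OF \<nu>(2), unfolded lift_torsor_simps]
  let ?K = "tensor X L L'"
  note t = tensor_line_bundle[OF \<epsilon>(1) \<epsilon>'(1)]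
  obtain \<delta> where \<delta>: "gen_pairing X L L' ?K \<delta>" using t(2) unfolding tensor_related_def by blast
  note d = gen_pairingD[OF \<delta>]
  have "oset_iso X ?K N"
  proof (rule oset_iso_of_family[OF lb_sheaf[OF t(1)] lb_sheaf[OF \<nu>(1)], where I = "\<lambda>W. lifts X D W \<times> lifts X D' W"
        and F = "\<lambda>W (f, g). \<delta> W (\<epsilon> W f) (\<epsilon>' W g)" and G = "\<lambda>W (f, g). \<nu> W (mul (sMero X) W f g)"])
    fix W i assume "openin (pspace X) W" "i \<in> lifts X D W \<times> lifts X D' W"
    thus "(case i of (f, g) \<Rightarrow> \<delta> W (\<epsilon> W f) (\<epsilon>' W g)) \<in> generators X ?K W"
      "(case i of (f, g) \<Rightarrow> \<nu> W (mul (sMero X) W f g)) \<in> generators X N W"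
      using d(1) m(1) m'(1) n(1) lifts_mult by (auto simp del: sMero_simps(3))
  next
    fix x assume x: "x \<in> topspace (pspace X)"
    obtain V f where V: "openin (pspace X) V" "x \<in> V" "V \<subseteq> topspace (pspace X)" "f \<in> lifts X D V"
      using D openin_topspace x by (rule lifts_local)
    obtain W g where W: "openin (pspace X) W" "x \<in> W" "W \<subseteq> V" "g \<in> lifts X D' W"
      using D' V(1,2) by (rule lifts_local)
    thus "\<exists>W i. openin (pspace X) W \<and> x \<in> W \<and> i \<in> lifts X D W \<times> lifts X D' W"
      using lifts_restrict[OF V(1) W(1,3) V(4)] by blast
  next
    fix W W' i j assume W: "openin (pspace X) W" "openin (pspace X) W'"
      and "i \<in> lifts X D W \<times> lifts X D' W" and "j \<in> lifts X D W' \<times> lifts X D' W'"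
    then obtain f g f' g' where ij: "i = (f, g)" "j = (f', g')" and f: "f \<in> lifts X D W" "f' \<in> lifts X D W'"
      and g: "g \<in> lifts X D' W" "g' \<in> lifts X D' W'" by auto
    let ?Z = "W \<inter> W'"
    have Z: "openin (pspace X) ?Z" "?Z \<subseteq> W" "?Z \<subseteq> W'" using W by auto
    have r: "restrict f ?Z \<in> lifts X D ?Z" "restrict f' ?Z \<in> lifts X D ?Z" "restrict g ?Z \<in> lifts X D' ?Z" "restrict g' ?Z \<in> lifts X D' ?Z"
      using lifts_restrict[OF W(1) Z(1,2)] lifts_restrict[OF W(2) Z(1,3)] f g by auto
    obtain u where u: "u \<in> Units (secmon X ?Z)" "restrict f ?Z = mul (sMero X) ?Z (to_sMero X ?Z u) (restrict f' ?Z)"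
      using Z(1) r(1,2) by (rule lifts_transitive)
    obtain v where v: "v \<in> Units (secmon X ?Z)" "restrict g ?Z = mul (sMero X) ?Z (to_sMero X ?Z v) (restrict g' ?Z)"
      using Z(1) r(3,4) by (rule lifts_transitive)
    have e: "restr L W ?Z (\<epsilon> W f) = act L ?Z u (restr L W' ?Z (\<epsilon> W' f'))"
      using m(3)[OF W(1) f(1) Z(1,2)] m(3)[OF W(2) f(2) Z(1,3)] m(2)[OF Z(1) r(2) u(1)] u(2) by metis
    have e': "restr L' W ?Z (\<epsilon>' W g) = act L' ?Z v (restr L' W' ?Z (\<epsilon>' W' g'))"
      using m'(3)[OF W(1) g(1) Z(1,2)] m'(3)[OF W(2) g(2) Z(1,3)] m'(2)[OF Z(1) r(4) v(1)] v(2) by metis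
    have uv: "mul X ?Z u v \<in> Units (secmon X ?Z)" using u v Z by simp
    have "restr ?K W ?Z (\<delta> W (\<epsilon> W f) (\<epsilon>' W g)) = act ?K ?Z (mul X ?Z u v) (restr ?K W' ?Z (\<delta> W' (\<epsilon> W' f') (\<epsilon>' W' g')))"
      by (rule gen_pairing_compare[OF lb_sheaf[OF \<epsilon>(1)] lb_sheaf[OF \<epsilon>'(1)] \<delta> W m(1)[OF W(1) f(1)] m(1)[OF W(2) f(2)] u(1) e
            m'(1)[OF W(1) g(1)] m'(1)[OF W(2) g(2)] v(1) e'])
    moreover have "restr N W ?Z (\<nu> W (mul (sMero X) W f g)) = act N ?Z (mul X ?Z u v) (restr N W' ?Z (\<nu> W' (mul (sMero X) W' f' g')))"
    proof -
      have c: "restrict f' ?Z \<in> sect (sMero X) ?Z" "restrict g' ?Z \<in> sect (sMero X) ?Z"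
        "to_sMero X ?Z u \<in> sect (sMero X) ?Z" "to_sMero X ?Z v \<in> sect (sMero X) ?Z"
        using r lifts_unit Mero.unit_closed Z u v by simp_all
      have rm: "restrict (mul (sMero X) W1 a b) ?Z = mul (sMero X) ?Z (restrict a ?Z) (restrict b ?Z)"
        if "openin (pspace X) W1" "?Z \<subseteq> W1" "a \<in> lifts X D W1" "b \<in> lifts X D' W1" for W1 a b
        using Mero.restr_mul[of W1 ?Z a b] that Z(1) lifts_unit[OF that(3)] lifts_unit[OF that(4)] by (simp del: sMero_simps(3))
      have fg': "mul (sMero X) ?Z (restrict f' ?Z) (restrict g' ?Z) \<in> lifts X (D \<otimes>\<^bsub>sDiv X\<^esub> D') ?Z"
        by (rule lifts_mult[OF Z(1) r(2,4)])
      have "restrict (mul (sMero X) W f g) ?Z = mul (sMero X) ?Z (to_sMero X ?Z (mul X ?Z u v)) (mul (sMero X) ?Z (restrict f' ?Z) (restrict g' ?Z))"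
        unfolding rm[OF W(1) Z(2) f(1) g(1)] u(2) v(2) to_sMero_mult[OF Z(1) unit_closed[OF u(1)] unit_closed[OF v(1)]]
        using c Z(1) by (simp add: Mero.mul_ac del: sMero_simps(3))
      hence "\<nu> ?Z (restrict (mul (sMero X) W f g) ?Z) = act N ?Z (mul X ?Z u v) (\<nu> ?Z (restrict (mul (sMero X) W' f' g') ?Z))"
        using n(2)[OF Z(1) fg' uv] unfolding rm[OF W(2) Z(3) f(2) g(2)] by metis
      thus ?thesis
        using n(3)[OF W(1) lifts_mult[OF W(1) f(1) g(1)] Z(1,2)] n(3)[OF W(2) lifts_mult[OF W(2) f(2) g(2)] Z(1,3)] by metis
    qed
    ultimately show "\<exists>u\<in>sect X ?Z.
        restr ?K W ?Z (case i of (f, g) \<Rightarrow> \<delta> W (\<epsilon> W f) (\<epsilon>' W g)) = act ?K ?Z u (restr ?K W' ?Z (case j of (f, g) \<Rightarrow> \<delta> W' (\<epsilon> W' f) (\<epsilon>' W' g))) \<and>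
        restr N W ?Z (case i of (f, g) \<Rightarrow> \<nu> W (mul (sMero X) W f g)) = act N ?Z u (restr N W' ?Z (case j of (f, g) \<Rightarrow> \<nu> W' (mul (sMero X) W' f g)))"
      unfolding ij prod.case using unit_closed[OF uv] by blast
  qed
  moreover have "bundle_class X L \<otimes>\<^bsub>Pic X\<^esub> bundle_class X L' = bundle_class X ?K" by (rule Pic_mult[OF \<epsilon>(1) \<epsilon>'(1) t])
  ultimately show ?thesis using bundle_class_eqI[OF t(1) \<nu>(1)] by simp
qed

lemma principal_if_trivial_bundle:
  assumes D: "D \<in> carrier (sDiv X)" and triv: "bundle_of_divisor X D (structure_oset X)"
  shows "D \<in> principal_sDiv X"
proof -
  let ?T = "topspace (pspace X)"
  obtain \<kappa> where \<kappa>: "torsor_map X (lift_torsor D) (structure_oset X) \<kappa>" using triv unfolding bundle_of_divisor_iff by blast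
  note k = torsor_mapD[OF \<kappa>, unfolded lift_torsor_simps structure_oset_simps]
  have ku: "\<kappa> U f \<in> Units (secmon X U)" if "openin (pspace X) U" "f \<in> lifts X D U" for U f
    using k(1)[OF that] generators_structure_oset[OF sheaf_X that(1)] by simp
  let ?P = "\<lambda>V f. f \<in> lifts X D V \<and> \<kappa> V f = neutral X V"
  have ex: "\<exists>V f. openin (pspace X) V \<and> x \<in> V \<and> V \<subseteq> ?T \<and> f \<in> mero_units V \<and> ?P V f" if x: "x \<in> ?T" for x
  proof -
    obtain V f where V: "openin (pspace X) V" "x \<in> V" "V \<subseteq> ?T" "f \<in> lifts X D V"
      using D openin_topspace x by (rule lifts_local)
    note u = unit_inverse[OF V(1) ku[OF V(1,4)]]
    \<comment> \<open>Rescaled by the inverse of its image so that the corresponding generator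
      becomes 1.\<close>
    let ?f = "mul (sMero X) V (to_sMero X V (inv\<^bsub>secmon X V\<^esub> \<kappa> V f)) f"
    have f: "?f \<in> lifts X D V" by (rule lifts_act[OF V(1) u(1) V(4)])
    have "\<kappa> V ?f = neutral X V" using k(2)[OF V(1,4) u(1)] u(2) by (simp del: sMero_simps(3))
    thus ?thesis using V f lifts_unit[OF f] by blast
  qed
  have "\<exists>s\<in>mero_units ?T. \<forall>V s'. openin (pspace (sMero X)) V \<and> V \<subseteq> ?T \<and> s' \<in> mero_units V \<and> ?P V s'
      \<longrightarrow> restr (sMero X) ?T V s = s'"
  proof (rule Mero.units_glue_rel)
    fix x assume "x \<in> ?T"
    from ex[OF this] show "\<exists>V s. openin (pspace (sMero X)) V \<and> x \<in> V \<and> V \<subseteq> ?T \<and> s \<in> mero_units V \<and> ?P V s"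
      by simp
  next
    fix V V' f f' assume o: "openin (pspace (sMero X)) V" "openin (pspace (sMero X)) V'"
      and P: "?P V f" and P': "?P V' f'"
    hence V: "openin (pspace X) V" "openin (pspace X) V'" by simp_all
    let ?Z = "V \<inter> V'"
    have Z: "openin (pspace X) ?Z" "?Z \<subseteq> V" "?Z \<subseteq> V'" using V by auto
    have r: "restrict f ?Z \<in> lifts X D ?Z" "restrict f' ?Z \<in> lifts X D ?Z"
      using lifts_restrict[OF V(1) Z(1,2)] lifts_restrict[OF V(2) Z(1,3)] P P' by auto
    obtain u where u: "u \<in> Units (secmon X ?Z)" "restrict f ?Z = mul (sMero X) ?Z (to_sMero X ?Z u) (restrict f' ?Z)"
      using Z(1) r by (rule lifts_transitive)
    have one: "\<kappa> ?Z (restrict f ?Z) = neutral X ?Z" "\<kappa> ?Z (restrict f' ?Z) = neutral X ?Z"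
      using k(3)[OF V(1) _ Z(1,2), of f] k(3)[OF V(2) _ Z(1,3), of f'] P P' V Z by simp_all
    \<comment> \<open>On the overlap two such lifts differ by a unit \<open>u\<close>; both
      correspond to 1, so \<open>u = 1\<close> and they agree.\<close>
    have "neutral X ?Z = mul X ?Z u (neutral X ?Z)"
      using k(2)[OF Z(1) r(2) u(1)] one u(2) by metis
    hence "u = neutral X ?Z" using mul_neutral(2)[OF Z(1) unit_closed[OF u(1)]] by simp
    thus "restr (sMero X) V ?Z f = restr (sMero X) V' ?Z f'"
      using u(2) to_sMero_neutral[OF Z(1)] Mero.mul_neutral(1)[of ?Z "restrict f' ?Z"] Z(1) lifts_unit[OF r(2)]
      by (simp del: sMero_simps(3,4))
  qed simp
  then obtain s where s: "s \<in> mero_units ?T"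
    "\<forall>V s'. openin (pspace (sMero X)) V \<and> V \<subseteq> ?T \<and> s' \<in> mero_units V \<and> ?P V s' \<longrightarrow> restr (sMero X) ?T V s = s'"
    by (rule bexE)
  have "div_of X ?T s = D"
  proof (rule extensionalityI[OF _ sDiv_ext[OF D]])
    fix x assume x: "x \<in> ?T"
    from ex[OF x] obtain V f where V: "openin (pspace X) V" "x \<in> V" "V \<subseteq> ?T" "f \<in> mero_units V" "?P V f"
      by (elim exE conjE) blast
    have "restrict s V = f" using s(2)[rule_format, of V f] V by simp
    hence "restrict (div_of X ?T s) V = div_of X V f"
      using div_of_restrict[OF openin_topspace V(1,3) s(1)] by simp
    also have "\<dots> = restrict D V" using V(5) by (simp add: lifts_iff)
    finally show "div_of X ?T s x = D x" using V(2) by (metis restrict_apply')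
  qed (simp add: div_of_def)
  thus ?thesis unfolding principal_sDiv_def using s(1) by auto
qed

lemma sCl_carrierE:
  assumes "C \<in> carrier (sCl X)"
  obtains D where "D \<in> carrier (sDiv X)" "C = principal_sDiv X #>\<^bsub>sDiv X\<^esub> D"
  using assms unfolding sCl_def carrier_FactGroup by auto

lemma sCl_to_Pic_hom: "sCl_to_Pic X \<in> hom (sCl X) (Pic X)"
proof -
  interpret S: comm_group "sDiv X" by (rule sDiv_comm_group)
  have lb: "line_bundle X L" if "bundle_of_divisor X D L" for D and L :: "('p, 'a) pic_bundle"
    using that by (simp add: bundle_of_divisor_iff)
  show ?thesis
    unfolding hom_def
  proof (intro CollectI conjI ballI funcsetI)
    fix C assume "C \<in> carrier (sCl X)"
    then obtain D where D: "D \<in> carrier (sDiv X)" "C = principal_sDiv X #>\<^bsub>sDiv X\<^esub> D" by (rule sCl_carrierE)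
    obtain L :: "('p, 'a) pic_bundle" where L: "bundle_of_divisor X D L" using D(1) by (rule bundle_of_divisor_exists)
    show "sCl_to_Pic X C \<in> carrier (Pic X)"
      unfolding D(2) sCl_to_Pic_coset[OF D(1) L] by (rule bundle_class_closed[OF lb[OF L]])
    fix C' assume "C' \<in> carrier (sCl X)"
    then obtain D' where D': "D' \<in> carrier (sDiv X)" "C' = principal_sDiv X #>\<^bsub>sDiv X\<^esub> D'" by (rule sCl_carrierE)
    obtain L' :: "('p, 'a) pic_bundle" where L': "bundle_of_divisor X D' L'" using D'(1) by (rule bundle_of_divisor_exists)
    have DD: "D \<otimes>\<^bsub>sDiv X\<^esub> D' \<in> carrier (sDiv X)" using D D' by simp
    obtain N :: "('p, 'a) pic_bundle" where N: "bundle_of_divisor X (D \<otimes>\<^bsub>sDiv X\<^esub> D') N" using DD by (rule bundle_of_divisor_exists)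
    have "C \<otimes>\<^bsub>sCl X\<^esub> C' = principal_sDiv X #>\<^bsub>sDiv X\<^esub> (D \<otimes>\<^bsub>sDiv X\<^esub> D')"
      unfolding sCl_def mult_FactGroup D(2) D'(2)
      by (rule normal.rcos_sum[OF _ D(1) D'(1)]) (simp add: S.normal_iff_subgroup principal_sDiv_subgroup)
    thus "sCl_to_Pic X (C \<otimes>\<^bsub>sCl X\<^esub> C') = sCl_to_Pic X C \<otimes>\<^bsub>Pic X\<^esub> sCl_to_Pic X C'"
      using sCl_to_Pic_coset[OF DD N] sCl_to_Pic_coset[OF D(1) L] sCl_to_Pic_coset[OF D'(1) L']
        bundle_of_divisor_mult[OF D(1) D'(1) L L' N] D(2) D'(2) by simp
  qed
qed

theorem sCl_to_Pic_mon: "sCl_to_Pic X \<in> mon (sCl X) (Pic X)"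
proof -
  interpret S: comm_group "sDiv X" by (rule sDiv_comm_group)
  interpret C: comm_group "sCl X" by (rule sCl_comm_group)
  interpret P: comm_group "Pic X" by (rule Pic_comm_group)
  interpret h: group_hom "sCl X" "Pic X" "sCl_to_Pic X"
    by unfold_locales (rule sCl_to_Pic_hom)
  have "C = \<one>\<^bsub>sCl X\<^esub>" if C: "C \<in> carrier (sCl X)" and eq: "sCl_to_Pic X C = \<one>\<^bsub>Pic X\<^esub>" for C
  proof -
    obtain D where D: "D \<in> carrier (sDiv X)" "C = principal_sDiv X #>\<^bsub>sDiv X\<^esub> D" using C by (rule sCl_carrierE)
    obtain L :: "('p, 'a) pic_bundle" where L: "bundle_of_divisor X D L" using D(1) by (rule bundle_of_divisor_exists)
    have lb: "line_bundle X L" using L by (simp add: bundle_of_divisor_iff)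
    have "bundle_class X L = bundle_class X (structure_oset X)"
      using eq sCl_to_Pic_coset[OF D(1) L] D(2) by (simp add: Pic_simps)
    hence "oset_iso X (structure_oset X) L" by (rule bundle_class_eqD[OF lb])
    hence "oset_iso X L (structure_oset X)"
      using oset_iso_sym[of X "structure_oset X" L] structure_oset_sheaf[OF sheaf_X]
      by (simp add: oset_sheaf_def)
    hence "bundle_of_divisor X D (structure_oset X)" by (rule bundle_of_divisor_iso[OF L structure_line_bundle])
    hence "D \<in> principal_sDiv X" by (rule principal_if_trivial_bundle[OF D(1)])
    hence "principal_sDiv X #>\<^bsub>sDiv X\<^esub> D = principal_sDiv X"
      by (intro S.coset_join2) (use D(1) principal_sDiv_subgroup in auto)
    thus ?thesis using D(2) by (simp add: sCl_def)
  qed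
  thus ?thesis unfolding mon_def using sCl_to_Pic_hom h.inj_on_one_iff by blast
qed

section \<open>The s-cancellative case\<close>

definition generic_point :: "'p \<Rightarrow> 'p" where
  "generic_point y = (SOME \<eta>. point_le X \<eta> y \<and> (\<forall>z. point_le X z y \<longrightarrow> point_le X \<eta> z) \<and>
     stalk_set X \<eta> \<subseteq> Units (stalk X \<eta>))"

lemma generic_point:
  assumes "y \<in> topspace (pspace X)"
  shows "point_le X (generic_point y) y" "point_le X z y \<Longrightarrow> point_le X (generic_point y) z"
    "stalk_set X (generic_point y) \<subseteq> Units (stalk X (generic_point y))"
  using someI_ex[OF generic_point_exists[OF assms], folded generic_point_def] by auto

text \<open>Each of the two generic points is least among the generizations of its point, and each
  turns out to be a generization of the other point too.\<close>

lemma generic_point_eq: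
  assumes "point_le X x y" shows "generic_point x = generic_point y"
proof -
  note x = generic_point[OF point_le_topspace(1)[OF assms]] and y = generic_point[OF point_le_topspace(2)[OF assms]]
  have "point_le X (generic_point x) (generic_point y)" by (rule x(2)[OF y(2)[OF assms]])
  moreover have "point_le X (generic_point y) (generic_point x)" by (rule y(2)[OF point_le_trans[OF x(1) assms]])
  ultimately show ?thesis by (rule point_le_antisym)
qed

text \<open>All elements of the stalk at \<open>y\<close> are admissible denominators, so forming
  fractions at \<open>y\<close> already inverts everything that the localization map to \<eta>
  inverts, and the stalk at \<eta> is a group.\<close>

lemma sfrac_map_bij:
  assumes sc: "s_cancellative X" and le: "point_le X \<eta> y" and grp: "stalk_set X \<eta> \<subseteq> Units (stalk X \<eta>)"
  shows "bij_betw (sfrac_map X \<eta>) (carrier (sfrac_stalk X y)) (carrier (sfrac_stalk X \<eta>))"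
proof -
  let ?f = "stalk_map X \<eta>"
  note y = point_le_topspace(2)[OF le] and e = point_le_topspace(1)[OF le]
  interpret Y: localizing "stalk X y" "sreg (stalk X y)" by (rule sfrac_localizing[OF y])
  interpret E: localizing "stalk X \<eta>" "sreg (stalk X \<eta>)" by (rule sfrac_localizing[OF e])
  note lm = stalk_localization_map[OF le]
  show ?thesis
    unfolding bij_betw_def
  proof
    show "inj_on (sfrac_map X \<eta>) (carrier (sfrac_stalk X y))"
    proof (rule inj_onI)
      fix A B assume A: "A \<in> carrier (sfrac_stalk X y)" and B: "B \<in> carrier (sfrac_stalk X y)"
        and eq: "sfrac_map X \<eta> A = sfrac_map X \<eta> B"
      obtain a s where a: "a \<in> stalk_set X y" "s \<in> sreg (stalk X y)" "A = fraction (stalk X y) (sreg (stalk X y)) a s"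
        using A y by (rule sfrac_stalkE)
      obtain b t where b: "b \<in> stalk_set X y" "t \<in> sreg (stalk X y)" "B = fraction (stalk X y) (sreg (stalk X y)) b t"
        using B y by (rule sfrac_stalkE)
      have st: "s \<in> stalk_set X y" "t \<in> stalk_set X y" using Y.S_closed a b by auto
      have fc: "?f a \<in> stalk_set X \<eta>" "?f b \<in> stalk_set X \<eta>" "?f s \<in> stalk_set X \<eta>" "?f t \<in> stalk_set X \<eta>"
        using stalk_map_closed[OF le] a b st by auto
      have fr: "?f s \<in> sreg (stalk X \<eta>)" "?f t \<in> sreg (stalk X \<eta>)" using stalk_map_sreg[OF le] a b by auto
      have "fraction (stalk X \<eta>) (sreg (stalk X \<eta>)) (?f a) (?f s) = fraction (stalk X \<eta>) (sreg (stalk X \<eta>)) (?f b) (?f t)"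
        using eq a b by (simp add: sfrac_map_fraction[OF le])
      then obtain w where w: "w \<in> sreg (stalk X \<eta>)"
        "w \<otimes>\<^bsub>stalk X \<eta>\<^esub> (?f t \<otimes>\<^bsub>stalk X \<eta>\<^esub> ?f a) = w \<otimes>\<^bsub>stalk X \<eta>\<^esub> (?f s \<otimes>\<^bsub>stalk X \<eta>\<^esub> ?f b)"
        using E.fraction_eq_iff[of "?f a" "?f s" "?f b" "?f t"] fc fr by auto
      have "w \<in> stalk_set X \<eta>" using E.S_closed[OF w(1)] by simp
      hence wu: "w \<in> Units (stalk X \<eta>)" using grp by blast
      have "?f t \<otimes>\<^bsub>stalk X \<eta>\<^esub> ?f a \<in> carrier (stalk X \<eta>)" "?f s \<otimes>\<^bsub>stalk X \<eta>\<^esub> ?f b \<in> carrier (stalk X \<eta>)"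
        using fc by (auto intro!: E.m_closed simp del: carrier_stalk simp flip: carrier_stalk)
      hence "?f t \<otimes>\<^bsub>stalk X \<eta>\<^esub> ?f a = ?f s \<otimes>\<^bsub>stalk X \<eta>\<^esub> ?f b" using E.Units_l_cancel[OF wu] w(2) by blast
      hence "?f (t \<otimes>\<^bsub>stalk X y\<^esub> a) = ?f (s \<otimes>\<^bsub>stalk X y\<^esub> b)"
        using stalk_map_mult[OF le] a b st by simp
      moreover have c: "t \<otimes>\<^bsub>stalk X y\<^esub> a \<in> carrier (stalk X y)" "s \<otimes>\<^bsub>stalk X y\<^esub> b \<in> carrier (stalk X y)"
        using a b st by (auto intro!: Y.m_closed simp del: carrier_stalk simp flip: carrier_stalk)
      ultimately obtain r where r: "r \<in> carrier (stalk X y)"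
        "r \<otimes>\<^bsub>stalk X y\<^esub> (t \<otimes>\<^bsub>stalk X y\<^esub> a) = r \<otimes>\<^bsub>stalk X y\<^esub> (s \<otimes>\<^bsub>stalk X y\<^esub> b)"
        using lm unfolding localization_map_def by blast
      \<comment> \<open>The multiplier given by the localization map becomes a unit at \<eta>; it
        also witnesses equality of the fractions at \<open>y\<close> because s-cancellativity makes
        it s-regular.\<close>
      have "r \<in> sreg (stalk X y)" using s_cancellative_sreg[OF sc y] r(1) by simp
      thus "A = B" unfolding a(3) b(3) using Y.fraction_eq_iff[of a s b t] a b r(2) by auto
    qed
    show "sfrac_map X \<eta> ` carrier (sfrac_stalk X y) = carrier (sfrac_stalk X \<eta>)"
    proof
      show "sfrac_map X \<eta> ` carrier (sfrac_stalk X y) \<subseteq> carrier (sfrac_stalk X \<eta>)" using sfrac_map_closed[OF le] by blast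
      show "carrier (sfrac_stalk X \<eta>) \<subseteq> sfrac_map X \<eta> ` carrier (sfrac_stalk X y)"
      proof
        fix B assume "B \<in> carrier (sfrac_stalk X \<eta>)"
        then obtain b t where b: "b \<in> stalk_set X \<eta>" "t \<in> sreg (stalk X \<eta>)" "B = fraction (stalk X \<eta>) (sreg (stalk X \<eta>)) b t"
          using e by (rule sfrac_stalkE)
        have tu: "t \<in> Units (stalk X \<eta>)" using E.S_closed[OF b(2)] grp by auto
        \<comment> \<open>The fraction \<open>b/t\<close> as an honest element of the group at
          \<eta>, to which surjectivity of the localization map applies.\<close>
        let ?c = "inv\<^bsub>stalk X \<eta>\<^esub> t \<otimes>\<^bsub>stalk X \<eta>\<^esub> b"
        have bc: "b \<in> carrier (stalk X \<eta>)" "t \<in> carrier (stalk X \<eta>)" "inv\<^bsub>stalk X \<eta>\<^esub> t \<in> carrier (stalk X \<eta>)"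
          using b E.Units_closed[OF tu] E.Units_inv_closed[OF tu] by auto
        have cc: "?c \<in> carrier (stalk X \<eta>)" using bc by (rule_tac E.m_closed)
        have tc: "t \<otimes>\<^bsub>stalk X \<eta>\<^esub> ?c = b"
          using bc E.m_assoc[OF bc(2,3,1)] E.Units_r_inv[OF tu] E.l_one[OF bc(1)] by simp
        obtain a s where a: "a \<in> carrier (stalk X y)" "s \<in> carrier (stalk X y)" "?f s \<otimes>\<^bsub>stalk X \<eta>\<^esub> ?c = ?f a"
          using lm cc unfolding localization_map_def by blast
        have s: "s \<in> sreg (stalk X y)" using s_cancellative_sreg[OF sc y] a(2) by simp
        have fc: "?f a \<in> carrier (stalk X \<eta>)" "?f s \<in> carrier (stalk X \<eta>)" using stalk_map_closed[OF le] a by auto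
        have "t \<otimes>\<^bsub>stalk X \<eta>\<^esub> ?f a = ?f s \<otimes>\<^bsub>stalk X \<eta>\<^esub> (t \<otimes>\<^bsub>stalk X \<eta>\<^esub> ?c)"
          unfolding a(3)[symmetric] by (rule E.m_lcomm[OF bc(2) fc(2) cc])
        hence "t \<otimes>\<^bsub>stalk X \<eta>\<^esub> ?f a = ?f s \<otimes>\<^bsub>stalk X \<eta>\<^esub> b" unfolding tc .
        hence "fraction (stalk X \<eta>) (sreg (stalk X \<eta>)) (?f a) (?f s) = B"
          unfolding b(3) by (rule E.fraction_eqI[OF fc(1) stalk_map_sreg[OF le s] bc(1) b(2)])
        hence "B = sfrac_map X \<eta> (fraction (stalk X y) (sreg (stalk X y)) a s)"
          using sfrac_map_fraction[OF le _ s, of a] a(1) by simp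
        thus "B \<in> sfrac_map X \<eta> ` carrier (sfrac_stalk X y)"
          using fraction_in_sfrac_stalk[of a y s] a(1) s y by (intro image_eqI) simp_all
      qed
    qed
  qed
qed

text \<open>In the s-cancellative case a semi-meromorphic function is the same as a family of elements of
  the stalks at the generic points, one for each irreducible component.\<close>

definition generic_section :: "'p set \<Rightarrow> ('p \<Rightarrow> ('p, 'a) germ) \<Rightarrow> 'p \<Rightarrow> ('p, 'a) sfrac" where
  "generic_section U q = (\<lambda>y\<in>U. inv_into (carrier (sfrac_stalk X y)) (sfrac_map X (generic_point y))
     (fraction (stalk X (generic_point y)) (sreg (stalk X (generic_point y))) (q (generic_point y)) \<one>\<^bsub>stalk X (generic_point y)\<^esub>))"

lemma generic_section_value:
  assumes sc: "s_cancellative X" and y: "y \<in> U" "y \<in> topspace (pspace X)" and q: "q (generic_point y) \<in> stalk_set X (generic_point y)"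
  shows "generic_section U q y \<in> carrier (sfrac_stalk X y)"
    "sfrac_map X (generic_point y) (generic_section U q y) =
      fraction (stalk X (generic_point y)) (sreg (stalk X (generic_point y))) (q (generic_point y)) \<one>\<^bsub>stalk X (generic_point y)\<^esub>"
proof -
  let ?F = "fraction (stalk X (generic_point y)) (sreg (stalk X (generic_point y))) (q (generic_point y)) \<one>\<^bsub>stalk X (generic_point y)\<^esub>"
  note g = generic_point[OF y(2)]
  note gt = point_le_topspace(1)[OF g(1)]
  have "?F \<in> carrier (sfrac_stalk X (generic_point y))" by (rule fraction_in_sfrac_stalk[OF q one_sreg[OF gt] gt])
  hence "?F \<in> sfrac_map X (generic_point y) ` carrier (sfrac_stalk X y)"
    using sfrac_map_bij[OF sc g(1,3)] by (simp add: bij_betw_def)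
  thus "generic_section U q y \<in> carrier (sfrac_stalk X y)" "sfrac_map X (generic_point y) (generic_section U q y) = ?F"
    using y(1) by (simp_all add: generic_section_def inv_into_into f_inv_into_f)
qed

lemma sfrac_generic_eqI:
  assumes "s_cancellative X" "y \<in> topspace (pspace X)" "A \<in> carrier (sfrac_stalk X y)" "B \<in> carrier (sfrac_stalk X y)"
    "sfrac_map X (generic_point y) A = sfrac_map X (generic_point y) B"
  shows "A = B"
  using inj_onD[OF bij_betw_imp_inj_on[OF sfrac_map_bij[OF assms(1) generic_point(1,3)[OF assms(2)]]] assms(5,3,4)] .

text \<open>Comparable points share their generic point, so the values at \<open>x\<close> and
  \<open>y\<close> have the same image there, and this image determines the value at
  \<open>x\<close>.\<close>

lemma generic_section_closed:
  assumes sc: "s_cancellative X" and U: "openin (pspace X) U"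
    and q: "\<And>y. y \<in> U \<Longrightarrow> q (generic_point y) \<in> stalk_set X (generic_point y)"
  shows "generic_section U q \<in> sect (sMero X) U"
proof -
  note v = generic_section_value[where U = U and q = q, OF sc _ open_topspace[OF U] q]
  have "sfrac_map X x (generic_section U q y) = generic_section U q x" if x: "x \<in> U" and y: "y \<in> U" and le: "point_le X x y" for x y
  proof (rule sfrac_generic_eqI[OF sc open_topspace[OF U x] sfrac_map_closed[OF le v(1)[OF y y y]] v(1)[OF x x x]])
    have "sfrac_map X (generic_point x) (sfrac_map X x (generic_section U q y)) = sfrac_map X (generic_point x) (generic_section U q y)"
      by (rule sfrac_map_comp[OF generic_point(1)[OF open_topspace[OF U x]] le v(1)[OF y y y]])
    also have "\<dots> = sfrac_map X (generic_point x) (generic_section U q x)"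
      using v(2)[OF y y y] v(2)[OF x x x] generic_point_eq[OF le] by simp
    finally show "sfrac_map X (generic_point x) (sfrac_map X x (generic_section U q y)) = sfrac_map X (generic_point x) (generic_section U q x)" .
  qed
  thus ?thesis using v(1) by (auto simp: sect_sMero PiE_def generic_section_def)
qed

lemma generic_section_mult:
  assumes sc: "s_cancellative X" and U: "openin (pspace X) U"
    and q: "\<And>y. y \<in> U \<Longrightarrow> q (generic_point y) \<in> stalk_set X (generic_point y)"
    and r: "\<And>y. y \<in> U \<Longrightarrow> r (generic_point y) \<in> stalk_set X (generic_point y)"
  shows "mul (sMero X) U (generic_section U q) (generic_section U r) =
    generic_section U (\<lambda>z. q z \<otimes>\<^bsub>stalk X z\<^esub> r z)"
proof (rule sMero_eqI)
  fix y assume y: "y \<in> U"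
  note yt = open_topspace[OF U y]
  note g = generic_point(1)[OF yt]
  let ?g = "generic_point y"
  interpret G: localizing "stalk X ?g" "sreg (stalk X ?g)" by (rule sfrac_localizing[OF point_le_topspace(1)[OF g]])
  have c: "q ?g \<in> carrier (stalk X ?g)" "r ?g \<in> carrier (stalk X ?g)" using q[OF y] r[OF y] by auto
  have qr: "q ?g \<otimes>\<^bsub>stalk X ?g\<^esub> r ?g \<in> stalk_set X ?g" using G.m_closed[OF c] by simp
  note vq = generic_section_value[where U = U and q = q, OF sc y yt q[OF y]]
    and vr = generic_section_value[where U = U and q = r, OF sc y yt r[OF y]]
    and vqr = generic_section_value[where U = U and q = "\<lambda>z. q z \<otimes>\<^bsub>stalk X z\<^esub> r z", OF sc y yt qr]
  interpret Y: comm_monoid "sfrac_stalk X y" by (rule sfrac_comm_monoid[OF yt])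
  have "sfrac_map X ?g (generic_section U q y \<otimes>\<^bsub>sfrac_stalk X y\<^esub> generic_section U r y) =
      sfrac_map X ?g (generic_section U (\<lambda>z. q z \<otimes>\<^bsub>stalk X z\<^esub> r z) y)"
    unfolding sfrac_map_mult[OF g vq(1) vr(1)] vq(2) vr(2) vqr(2)
    unfolding sfrac_stalk_def G.fraction_mult[OF c(1) G.S_one c(2) G.S_one] using G.l_one[OF G.one_closed] by simp
  hence "generic_section U q y \<otimes>\<^bsub>sfrac_stalk X y\<^esub> generic_section U r y = generic_section U (\<lambda>z. q z \<otimes>\<^bsub>stalk X z\<^esub> r z) y"
    by (rule sfrac_generic_eqI[OF sc yt Y.m_closed[OF vq(1) vr(1)] vqr(1)])
  thus "mul (sMero X) U (generic_section U q) (generic_section U r) y = generic_section U (\<lambda>z. q z \<otimes>\<^bsub>stalk X z\<^esub> r z) y"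
    using y by simp
qed (simp_all add: generic_section_def)

lemma to_sMero_generic:
  assumes sc: "s_cancellative X" and U: "openin (pspace X) U" and a: "a \<in> sect X U"
  shows "to_sMero X U a = generic_section U (\<lambda>z. germ X z U a)"
proof (rule sMero_eqI)
  fix y assume y: "y \<in> U"
  note yt = open_topspace[OF U y]
  note g = generic_point(1)[OF yt]
  have gU: "generic_point y \<in> U" by (rule point_le_open[OF g U y])
  note v = generic_section_value[where U = U and q = "\<lambda>z. germ X z U a", OF sc y yt germ_in_stalk[OF U gU a]]
  have m: "to_sMero X U a \<in> sect (sMero X) U" using U a by simp
  have "sfrac_map X (generic_point y) (to_sMero X U a y) = to_sMero X U a (generic_point y)"
    using m gU y g by (simp add: sect_sMero)
  hence "sfrac_map X (generic_point y) (to_sMero X U a y) = sfrac_map X (generic_point y) (generic_section U (\<lambda>z. germ X z U a) y)"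
    unfolding v(2) using gU by (simp add: to_sMero_def)
  thus "to_sMero X U a y = generic_section U (\<lambda>z. germ X z U a) y"
    by (rule sfrac_generic_eqI[OF sc yt sMero_value[OF m y] v(1)])
qed (simp_all add: generic_section_def to_sMero_def)

lemma generic_section_cong:
  assumes "openin (pspace X) U" "\<And>z. z \<in> U \<Longrightarrow> q z = r z"
  shows "generic_section U q = generic_section U r"
proof -
  have "generic_point y \<in> U" if "y \<in> U" for y
    by (rule point_le_open[OF generic_point(1)[OF open_topspace[OF assms(1) that]] assms(1) that])
  thus ?thesis unfolding generic_section_def using assms(2) by (auto intro!: restrict_ext)
qed

text \<open>The coordinates of a generator \<open>e\<close> at the generic points compare it with
  the base sections chosen there. They prescribe an invertible semi-meromorphic function, which
  changes by \<open>u\<close> when \<open>e\<close> changes by \<open>u\<close>; its divisor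
  therefore depends on \<open>L\<close> and the base sections only.\<close>

theorem divisor_of_bundle_exists:
  fixes L :: "('p, 'a) pic_bundle"
  assumes sc: "s_cancellative X" and L: "line_bundle X L"
  obtains D where "D \<in> carrier (sDiv X)" "bundle_of_divisor X D L"
proof -
  interpret L: oset_sheaf X L by (rule lb_sheaf[OF L])
  let ?T = "topspace (pspace X)"
  let ?Tor = "twisted_generators (\<lambda>U u. u) L"
  interpret T: unit_torsor X ?Tor by (rule twisted_generators_torsor[OF L]) simp_all
  have S: "sect ?Tor = generators X L" "restr ?Tor = restr L" "act ?Tor = act L"
    by (simp_all add: twisted_generators_def)
  note c_unit = T.coord_unit[unfolded S] and c_restr = T.coord_restr[unfolded S] and c_act = T.coord_act[unfolded S]
  have gU: "generic_point y \<in> U" if "openin (pspace X) U" "y \<in> U" for U y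
    by (rule point_le_open[OF generic_point(1)[OF open_topspace[OF that]] that])
  have c_stalk: "T.coord U e z \<in> stalk_set X z" if "openin (pspace X) U" "e \<in> generators X L U" "z \<in> U" for U e z
    using monoid.Units_closed[OF comm_monoid.axioms(1)[OF stalk_comm_monoid[OF open_topspace[OF that(1,3)]]] c_unit[OF that(1,3,2)]]
    by simp
  \<comment> \<open>Only the coordinates at generic points enter, so the missing continuity of the
    base sections does no harm.\<close>
  define \<kappa> where "\<kappa> = (\<lambda>U e. generic_section U (T.coord U e))"
  have \<kappa>_sect: "\<kappa> U e \<in> mero_units U" if U: "openin (pspace X) U" and e: "e \<in> generators X L U" for U e
  proof -
    \<comment> \<open>The inverse function is the generic section with the inverse
      coordinates.\<close>
    let ?q = "T.coord U e" let ?r = "\<lambda>z. inv\<^bsub>stalk X z\<^esub> T.coord U e z"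
    have m: "monoid (stalk X z)" if "z \<in> U" for z
      using stalk_comm_monoid[OF open_topspace[OF U that]] by (simp add: comm_monoid_def)
    have q: "?q (generic_point y) \<in> stalk_set X (generic_point y)" if "y \<in> U" for y using c_stalk[OF U e gU[OF U that]] .
    have r: "?r (generic_point y) \<in> stalk_set X (generic_point y)" if "y \<in> U" for y
      using monoid.Units_inv_closed[OF m c_unit[OF U _ e]] gU[OF U that] by simp
    have "mul (sMero X) U (generic_section U ?r) (generic_section U ?q) = generic_section U (\<lambda>z. ?r z \<otimes>\<^bsub>stalk X z\<^esub> ?q z)"
      by (rule generic_section_mult[OF sc U]) (use r q in auto)
    also have "\<dots> = generic_section U (\<lambda>z. germ X z U (neutral X U))"
      by (rule generic_section_cong[OF U]) (use monoid.Units_l_inv[OF m c_unit[OF U _ e]] germ_neutral[OF U] in simp)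
    also have "\<dots> = neutral (sMero X) U"
      using to_sMero_generic[OF sc U, of "neutral X U"] to_sMero_neutral[OF U] U by simp
    finally show ?thesis
      unfolding \<kappa>_def using U generic_section_closed[where q = ?q, OF sc U q] generic_section_closed[where q = ?r, OF sc U r]
      by (intro Mero.unitI[of _ _ "generic_section U ?r"]) simp_all
  qed
  have \<kappa>_act: "\<kappa> U (act L U u e) = mul (sMero X) U (to_sMero X U u) (\<kappa> U e)"
    if U: "openin (pspace X) U" and u: "u \<in> Units (secmon X U)" and e: "e \<in> generators X L U" for U u e
  proof -
    have "\<kappa> U (act L U u e) = generic_section U (\<lambda>z. germ X z U u \<otimes>\<^bsub>stalk X z\<^esub> T.coord U e z)"
      unfolding \<kappa>_def by (rule generic_section_cong[OF U]) (use c_act[OF U _ e u] in simp)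
    also have "\<dots> = mul (sMero X) U (generic_section U (\<lambda>z. germ X z U u)) (generic_section U (T.coord U e))"
      by (rule generic_section_mult[OF sc U, symmetric]) (use gU[OF U] U u c_stalk[OF U e] in auto)
    finally show ?thesis unfolding \<kappa>_def to_sMero_generic[OF sc U unit_closed[OF u]] .
  qed
  have \<kappa>_restr: "restrict (\<kappa> U e) V = \<kappa> V (restr L U V e)"
    if U: "openin (pspace X) U" "openin (pspace X) V" "V \<subseteq> U" and e: "e \<in> generators X L U" for U V e
  proof -
    have "\<kappa> V (restr L U V e) = generic_section V (T.coord U e)"
      unfolding \<kappa>_def by (rule generic_section_cong[OF U(2)]) (use c_restr[OF U _ e] in simp)
    thus ?thesis unfolding \<kappa>_def generic_section_def using U(3) by (simp add: Int_absorb1)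
  qed
  have loc: "\<exists>U e. openin (pspace X) U \<and> x \<in> U \<and> e \<in> generators X L U" if x: "x \<in> ?T" for x
    using T.torsor_local[OF x] unfolding S .
  \<comment> \<open>Two generators differ by a unit on the overlap, so the associated functions
    differ by that unit and have equal divisors there.\<close>
  have indep: "div_of X U (\<kappa> U e) x = div_of X U' (\<kappa> U' e') x"
    if U: "openin (pspace X) U" "openin (pspace X) U'" "x \<in> U" "x \<in> U'" and e: "e \<in> generators X L U" "e' \<in> generators X L U'" for U U' e e' x
  proof -
    let ?Z = "U \<inter> U'"
    have Z: "openin (pspace X) ?Z" "?Z \<subseteq> U" "?Z \<subseteq> U'" "x \<in> ?Z" using U by auto
    obtain u where u: "u \<in> Units (secmon X ?Z)" "restr L U ?Z e = act L ?Z u (restr L U' ?Z e')"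
      using U(1,2) e by (rule L.gen_compare)
    have e'Z: "restr L U' ?Z e' \<in> generators X L ?Z" by (rule L.gen_restr[OF U(2) Z(1,3) e(2)])
    have "restrict (div_of X U (\<kappa> U e)) ?Z = div_of X ?Z (\<kappa> ?Z (restr L U ?Z e))"
      using div_of_restrict[OF U(1) Z(1,2) \<kappa>_sect[OF U(1) e(1)]] \<kappa>_restr[OF U(1) Z(1,2) e(1)] by simp
    also have "\<dots> = div_of X ?Z (\<kappa> ?Z (restr L U' ?Z e'))"
      unfolding u(2) \<kappa>_act[OF Z(1) u(1) e'Z] by (rule div_of_unit_mult[OF Z(1) u(1) \<kappa>_sect[OF Z(1) e'Z]])
    also have "\<dots> = restrict (div_of X U' (\<kappa> U' e')) ?Z"
      using div_of_restrict[OF U(2) Z(1,3) \<kappa>_sect[OF U(2) e(2)]] \<kappa>_restr[OF U(2) Z(1,3) e(2)] by simp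
    finally show ?thesis using Z(4) by (metis restrict_apply')
  qed
  \<comment> \<open>The base section at \<open>x\<close> serves merely as some generator near
    \<open>x\<close>; by \<open>indep\<close> any other gives the same value.\<close>
  define D where "D = (\<lambda>x\<in>?T. div_of X (fst (T.base_section x)) (\<kappa> (fst (T.base_section x)) (snd (T.base_section x))) x)"
  have D_eq: "D x = div_of X U (\<kappa> U e) x" if "openin (pspace X) U" "x \<in> U" "e \<in> generators X L U" for U e x
    using indep[OF _ that(1) _ that(2) _ that(3)] T.base_section[OF open_topspace[OF that(1,2)], unfolded S] open_topspace[OF that(1,2)]
    by (simp add: D_def)
  have D: "D \<in> carrier (sDiv X)"
    unfolding sDiv_simps
  proof (rule Div.Quot.sheafify_sectI)
    show "D \<in> extensional ?T" by (simp add: D_def)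
    fix x assume x: "x \<in> ?T"
    from loc[OF x] obtain U e where U: "openin (pspace X) U" "x \<in> U" "e \<in> generators X L U" by blast
    have "\<forall>y\<in>U. D y = germ (pre_sDiv X) y U (Div.coset U (\<kappa> U e))"
      using D_eq[OF U(1) _ U(3)] by (simp add: div_of_def)
    thus "\<exists>V t. openin (pspace (pre_sDiv X)) V \<and> x \<in> V \<and> V \<subseteq> ?T \<and> t \<in> sect (pre_sDiv X) V \<and>
       (\<forall>y\<in>V. D y = germ (pre_sDiv X) y V t)"
      using U \<kappa>_sect[OF U(1,3)] openin_subset[OF U(1)]
      by (intro exI[of _ U] exI[of _ "Div.coset U (\<kappa> U e)"]) simp
  qed
  have lift: "\<kappa> U e \<in> lifts X D U" if "openin (pspace X) U" "e \<in> generators X L U" for U e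
  proof -
    have "div_of X U (\<kappa> U e) = restrict D U"
      by (rule extensionalityI[of _ U]) (use D_eq[OF that(1) _ that(2)] in \<open>simp_all add: div_of_def\<close>)
    thus ?thesis using \<kappa>_sect[OF that] by (simp add: lifts_iff)
  qed
  obtain N :: "('p, 'a) pic_bundle" where N: "bundle_of_divisor X D N" using D by (rule bundle_of_divisor_exists)
  then obtain \<epsilon> where \<epsilon>: "line_bundle X N" "torsor_map X (lift_torsor D) N \<epsilon>" unfolding bundle_of_divisor_iff by blast
  note m = torsor_mapD[OF \<epsilon>(2), unfolded lift_torsor_simps]
  \<comment> \<open>Generators of \<open>L\<close> map to lifts of \<open>D\<close> by
    \<open>\<kappa>\<close> and on to generators of the bundle of \<open>D\<close>. Since they also
    map identically to generators of \<open>L\<close>, both bundles come from one torsor and are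
    isomorphic.\<close>
  have "torsor_map X ?Tor N (\<lambda>U e. \<epsilon> U (\<kappa> U e))"
    unfolding torsor_map_def S
  proof (intro conjI allI impI ballI funcsetI)
    fix U e assume U: "openin (pspace X) U" and e: "e \<in> generators X L U"
    show "\<epsilon> U (\<kappa> U e) \<in> generators X N U" by (rule m(1)[OF U lift[OF U e]])
  next
    fix U u e assume U: "openin (pspace X) U" and u: "u \<in> Units (secmon X U)" and e: "e \<in> generators X L U"
    show "\<epsilon> U (\<kappa> U (act L U u e)) = act N U u (\<epsilon> U (\<kappa> U e))"
      unfolding \<kappa>_act[OF U u e] by (rule m(2)[OF U lift[OF U e] u])
  next
    fix U V e assume "openin (pspace X) U \<and> openin (pspace X) V \<and> V \<subseteq> U" and e: "e \<in> generators X L U"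
    hence U: "openin (pspace X) U" "openin (pspace X) V" "V \<subseteq> U" by auto
    show "\<epsilon> V (\<kappa> V (restr L U V e)) = restr N U V (\<epsilon> U (\<kappa> U e))"
      unfolding \<kappa>_restr[OF U e, symmetric] by (rule m(3)[OF U(1) lift[OF U(1) e] U(2,3)])
  qed
  moreover have "torsor_map X ?Tor L (\<lambda>U e. e)" unfolding torsor_map_def S by simp
  ultimately have "oset_iso X N L"
    using torsor_maps_iso[OF T.unit_torsor_axioms \<epsilon>(1) _ L] by blast
  hence "bundle_of_divisor X D L" by (rule bundle_of_divisor_iso[OF N L])
  with D show ?thesis by (rule that)
qed

theorem sCl_to_Pic_iso:
  assumes sc: "s_cancellative X" shows "sCl_to_Pic X \<in> iso (sCl X) (Pic X)"
proof -
  have "carrier (Pic X) \<subseteq> sCl_to_Pic X ` carrier (sCl X)"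
  proof
    fix A assume "A \<in> carrier (Pic X)"
    then obtain L :: "('p, 'a) pic_bundle" where L: "line_bundle X L" "A = bundle_class X L" by (auto simp: Pic_simps)
    obtain D where D: "D \<in> carrier (sDiv X)" "bundle_of_divisor X D L" using sc L(1) by (rule divisor_of_bundle_exists)
    have "principal_sDiv X #>\<^bsub>sDiv X\<^esub> D \<in> carrier (sCl X)" using D(1) by (simp add: sCl_def carrier_FactGroup)
    thus "A \<in> sCl_to_Pic X ` carrier (sCl X)" using sCl_to_Pic_coset[OF D] L(2) by (intro image_eqI) simp_all
  qed
  thus ?thesis
    using sCl_to_Pic_mon unfolding iso_iff mon_def by (auto simp: hom_def)
qed

end

theorem proposition6p6:
  fixes X :: "('p, 'a) monoid_presheaf"
  assumes "is_monoid_scheme X"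
  shows "comm_group (sCl X) \<and> comm_group (Pic X) \<and>
    sCl_to_Pic X \<in> mon (sCl X) (Pic X) \<and>
    (s_cancellative X \<longrightarrow> sCl_to_Pic X \<in> iso (sCl X) (Pic X))"
proof -
  interpret monoid_scheme X by (rule monoid_schemeI[OF assms])
  show ?thesis using sCl_comm_group Pic_comm_group sCl_to_Pic_mon sCl_to_Pic_iso by blast
qed

end
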